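(* Let $B^g_\Gamma(\infty)$ be the subset of $B^g_Q(\infty)$ (the set of irreducible components of Lusztig's quiver varieties $\Lambda(\mathbf{v})$, $\mathbf{v}\in(\mathbb{Z}_{\ge0})^I$) generated from the highest weight component $X_\infty$ by the action of the operators $\tilde f_{\mathbf{i}}$, $\mathbf{i}\in\mathbf{I}$. Then the underlying set of $B^g_\Gamma(\infty)$ is precisely the subset of $B^g_Q(\infty)$ consisting of those irreducible components that are invariant under the automorphism $\mathbf{a}$.
   Context: **Quiver with automorphism.** $Q=(I,H)$ is a (double) quiver: $I$ is the finite vertex set and $E$ the set of unoriented edges of a graph without vertex loops (multiple edges allowed), and $H$ is the set of pairs consisting of an edge together with an orientation of it. For $h\in H$, $\mathrm{in}(h)$ and $\mathrm{out}(h)$ are the vertices that $h$ points to and starts from, and $\bar h$ is the same edge with opposite orientation. $\mathbf{a}$ is an admissible automorphism of $Q$: an automorphism of the underlying graph such that no edge connects two vertices in the same $\mathbf{a}$-orbit. $\mathbf{I}$ is the set of $\mathbf{a}$-orbits in $I$. $\alpha_i$ ($i\in I$) are the simple roots of the Kac-Moody algebra attached to the underlying graph, identified with the standard basis of $\mathbb{Z}^I$. **Lusztig's quiver variety.** Fix an orientation $\Omega\subset H$ ($\Omega\sqcup\bar\Omega=H$) with $\mathbf{a}(\Omega)=\Omega$ (always possible) and let $\varepsilon(h)=1$ for $h\in\Omega$, $\varepsilon(h)=-1$ for $h\in\bar\Omega$. For $\mathbf{v}\in(\mathbb{Z}_{\geq0})^I$ let $\mathbf{V}_i=\mathbb{C}^{\mathbf{v}_i}$.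 $\Lambda(\mathbf{v})$ is the set of $x=(x_h)\in\bigoplus_{h\in H}\mathrm{Hom}(\mathbf{V}_{\mathrm{out}(h)},\mathbf{V}_{\mathrm{in}(h)})$ with $\sum_{h:\,\mathrm{in}(h)=i}\varepsilon(h)x_hx_{\bar h}=0$ for all $i\in I$ that are nilpotent: there is $N\ge1$ such that $x_{h_1}\cdots x_{h_N}=0$ for every composable sequence ($\mathrm{out}(h_k)=\mathrm{in}(h_{k+1})$). $B^g_Q(\mathbf{v},\infty)$ is the set of irreducible components of $\Lambda(\mathbf{v})$ and $B^g_Q(\infty)=\bigsqcup_{\mathbf{v}}B^g_Q(\mathbf{v},\infty)$. $X_\infty$ is the unique component (a point) for $\mathbf{v}=0$. **Operators.** For $i\in I$ let $\varepsilon_i(x)=\dim\mathrm{Coker}\big(\bigoplus_{h:\,\mathrm{in}(h)=i}\mathbf{V}_{\mathrm{out}(h)}\xrightarrow{(x_h)}\mathbf{V}_i\big)$, let $\varepsilon_i(X)$ be its value at a generic point of the component $X$, and let $B^g_Q(\mathbf{v},\infty)_{i,p}=\{X\in B^g_Q(\mathbf{v},\infty):\varepsilon_i(X)=p\}$. Let $\mathbf{v}=\bar{\mathbf{v}}+c\alpha_i$. Let $\Lambda'$ be the variety of triples $(x,\bar\phi,\phi')$ with $x\in\Lambda(\mathbf{v})$ and $0\to\bar{\mathbf{V}}\xrightarrow{\bar\phi}\mathbf{V}\xrightarrow{\phi'}\mathbf{V}'\to0$ an exact sequence of $I$-graded spaces of graded dimensions $\bar{\mathbf{v}},\mathbf{v},c\alpha_i$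 with $\mathrm{Im}\,\bar\phi$ stable under $x$; let $\varpi_1:\Lambda'\to\Lambda(\bar{\mathbf{v}})$ send it to the induced $\bar x$ on $\bar{\mathbf{V}}$, and let $\varpi_2:\Lambda'\to\Lambda(\mathbf{v})$ send it to $x$. It is known (Kashiwara–Saito) that $\bar X\mapsto X$, where $X$ is the closure of $\varpi_2\varpi_1^{-1}(\bar X\cap\{\varepsilon_i=0\})$, is a bijection $\tilde f_i^c:B^g_Q(\bar{\mathbf{v}},\infty)_{i,0}\to B^g_Q(\mathbf{v},\infty)_{i,c}$; its inverse is denoted $\tilde e_i^c$. For $X$ with $\varepsilon_i(X)=c$ set $\tilde f_i(X)=\tilde f_i^{c+1}\tilde e_i^c(X)$. For $i,j$ in the same orbit, $\tilde f_i$ and $\tilde f_j$ commute, and $\tilde f_{\mathbf{i}}=\prod_{i\in\mathbf{i}}\tilde f_i$. **Action of $\mathbf{a}$.** $\mathbf{a}$ acts on $I$ and on $H$. Let $F(\mathbf{a}):\Lambda(\mathbf{v})\to\Lambda(\mathbf{a}(\mathbf{v}))$ be given by $({}^{\mathbf{a}}\mathbf{V})_i=\mathbf{V}_{\mathbf{a}^{-1}(i)}$, $({}^{\mathbf{a}}x)_h=x_{\mathbf{a}^{-1}(h)}$, where $\mathbf{a}(\mathbf{v})_i=\mathbf{v}_{\mathbf{a}^{-1}(i)}$. The induced map on irreducible components is again denoted $\mathbf{a}$; $X$ is invariant if $\mathbf{a}(X)=X$ (so in particular its dimension vector is $\mathbf{a}$-invariant). *)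

theory Defs
  imports
    "HOL-Analysis.Abstract_Topology"
    "Jordan_Normal_Form.Matrix_Kernel"
begin

section \<open>Quivers with an admissible automorphism\<close>

record ('i, 'e) graph =
  verts :: "'i set"
  edges :: "'e set"
  ends :: "'e \<Rightarrow> 'i set"

definition graph :: "('i, 'e) graph \<Rightarrow> bool" where
  "graph Q \<longleftrightarrow> finite (verts Q) \<and> finite (edges Q) \<and>
     (\<forall>e\<in>edges Q. ends Q e \<subseteq> verts Q \<and> card (ends Q e) = 2)"

text \<open>The oriented edge \<open>(e, i, j)\<close> is the edge \<open>e\<close>, with end points \<open>i\<close> and \<open>j\<close>,
  oriented from \<open>i\<close> to \<open>j\<close>.\<close>

type_synonym ('i, 'e) arrow = "'e \<times> 'i \<times> 'i"

definition arrows :: "('i, 'e) graph \<Rightarrow> ('i, 'e) arrow set" where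
  "arrows Q = {(e, i, j) | e i j. e \<in> edges Q \<and> ends Q e = {i, j}}"

fun out_vertex :: "('i, 'e) arrow \<Rightarrow> 'i" where
  "out_vertex (e, i, j) = i"

fun in_vertex :: "('i, 'e) arrow \<Rightarrow> 'i" where
  "in_vertex (e, i, j) = j"

fun rev_arrow :: "('i, 'e) arrow \<Rightarrow> ('i, 'e) arrow" where
  "rev_arrow (e, i, j) = (e, j, i)"

text \<open>A graph automorphism is a pair \<open>(a, b)\<close> of compatible bijections of the vertices and of the
  edges. Since there are no loops, it determines an action on oriented edges.\<close>

definition graph_automorphism ::
  "('i, 'e) graph \<Rightarrow> ('i \<Rightarrow> 'i) \<Rightarrow> ('e \<Rightarrow> 'e) \<Rightarrow> bool" where
  "graph_automorphism Q a b \<longleftrightarrow>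
     bij_betw a (verts Q) (verts Q) \<and> bij_betw b (edges Q) (edges Q) \<and>
     (\<forall>e\<in>edges Q. ends Q (b e) = a ` ends Q e)"

text \<open>As the vertex set is finite, the nonnegative powers of \<open>a\<close> already give the whole orbit.\<close>

definition vertex_orbits :: "('i, 'e) graph \<Rightarrow> ('i \<Rightarrow> 'i) \<Rightarrow> 'i set set" where
  "vertex_orbits Q a = (\<lambda>i. range (\<lambda>n. (a ^^ n) i)) ` verts Q"

definition admissible_automorphism ::
  "('i, 'e) graph \<Rightarrow> ('i \<Rightarrow> 'i) \<Rightarrow> ('e \<Rightarrow> 'e) \<Rightarrow> bool" where
  "admissible_automorphism Q a b \<longleftrightarrow> graph_automorphism Q a b \<and>
     \<not> (\<exists>e\<in>edges Q. \<exists>orb\<in>vertex_orbits Q a. ends Q e \<subseteq> orb)"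

fun act_arrow :: "('i \<Rightarrow> 'i) \<Rightarrow> ('e \<Rightarrow> 'e) \<Rightarrow> ('i, 'e) arrow \<Rightarrow> ('i, 'e) arrow" where
  "act_arrow a b (e, i, j) = (b e, a i, a j)"

definition orientation :: "('i, 'e) graph \<Rightarrow> ('i, 'e) arrow set \<Rightarrow> bool" where
  "orientation Q \<Omega> \<longleftrightarrow>
     \<Omega> \<inter> rev_arrow ` \<Omega> = {} \<and> \<Omega> \<union> rev_arrow ` \<Omega> = arrows Q"

definition arrow_sign :: "('i, 'e) arrow set \<Rightarrow> ('i, 'e) arrow \<Rightarrow> complex" where
  "arrow_sign \<Omega> h = (if h \<in> \<Omega> then 1 else - 1)"


section \<open>Lusztig's quiver varieties\<close>

text \<open>Dimension vectors are elements of \<^term>\<open>verts Q \<rightarrow>\<^sub>E (UNIV :: nat set)\<close>. A representation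
  assigns to an arrow the matrix of the corresponding linear map in the standard bases. Both are
  extensional functions, so that equality is the mathematical one.\<close>

type_synonym ('i, 'e) rep = "('i, 'e) arrow \<Rightarrow> complex mat"

definition dim_vectors :: "('i, 'e) graph \<Rightarrow> ('i \<Rightarrow> nat) set" where
  "dim_vectors Q = verts Q \<rightarrow>\<^sub>E UNIV"

definition zero_dim :: "('i, 'e) graph \<Rightarrow> 'i \<Rightarrow> nat" where
  "zero_dim Q = (\<lambda>j\<in>verts Q. 0)"

definition mult_root :: "('i, 'e) graph \<Rightarrow> nat \<Rightarrow> 'i \<Rightarrow> 'i \<Rightarrow> nat" where
  "mult_root Q c i = (\<lambda>j\<in>verts Q. if j = i then c else 0)"

definition add_dim :: "('i, 'e) graph \<Rightarrow> ('i \<Rightarrow> nat) \<Rightarrow> ('i \<Rightarrow> nat) \<Rightarrow> 'i \<Rightarrow> nat" where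
  "add_dim Q v w = (\<lambda>j\<in>verts Q. v j + w j)"

definition reps :: "('i, 'e) graph \<Rightarrow> ('i \<Rightarrow> nat) \<Rightarrow> ('i, 'e) rep set" where
  "reps Q v = (\<Pi>\<^sub>E h\<in>arrows Q. carrier_mat (v (in_vertex h)) (v (out_vertex h)))"

definition arrows_into :: "('i, 'e) graph \<Rightarrow> 'i \<Rightarrow> ('i, 'e) arrow set" where
  "arrows_into Q i = {h \<in> arrows Q. in_vertex h = i}"

text \<open>Matrices of a fixed size do not form a type, so the equation between matrices is
  stated entrywise.\<close>

definition preprojective ::
  "('i, 'e) graph \<Rightarrow> ('i, 'e) arrow set \<Rightarrow> ('i \<Rightarrow> nat) \<Rightarrow> ('i, 'e) rep \<Rightarrow> bool" where
  "preprojective Q \<Omega> v x \<longleftrightarrow>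
     (\<forall>i\<in>verts Q. \<forall>r<v i. \<forall>s<v i.
        (\<Sum>h\<in>arrows_into Q i. arrow_sign \<Omega> h * (x h * x (rev_arrow h)) $$ (r, s)) = 0)"

text \<open>The product \<open>x\<^bsub>h\<^sub>1\<^esub> \<cdots> x\<^bsub>h\<^sub>N\<^esub>\<close> along a nonempty list of arrows.\<close>

fun path_mat :: "('i, 'e) rep \<Rightarrow> ('i, 'e) arrow list \<Rightarrow> complex mat" where
  "path_mat x [h] = x h"
| "path_mat x (h # h' # hs) = x h * path_mat x (h' # hs)"

definition nilpotent_rep ::
  "('i, 'e) graph \<Rightarrow> ('i \<Rightarrow> nat) \<Rightarrow> ('i, 'e) rep \<Rightarrow> bool" where
  "nilpotent_rep Q v x \<longleftrightarrow>
     (\<exists>N\<ge>1. \<forall>hs. length hs = N \<and> set hs \<subseteq> arrows Q \<and>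
        successively (\<lambda>h h'. out_vertex h = in_vertex h') hs \<longrightarrow>
        path_mat x hs = 0\<^sub>m (v (in_vertex (hd hs))) (v (out_vertex (last hs))))"

definition Lam ::
  "('i, 'e) graph \<Rightarrow> ('i, 'e) arrow set \<Rightarrow> ('i \<Rightarrow> nat) \<Rightarrow> ('i, 'e) rep set" where
  "Lam Q \<Omega> v = {x \<in> reps Q v. preprojective Q \<Omega> v x \<and> nilpotent_rep Q v x}"


section \<open>Zariski topology and irreducible components\<close>

inductive_set polynomial_functions ::
  "('i, 'e) graph \<Rightarrow> ('i \<Rightarrow> nat) \<Rightarrow> (('i, 'e) rep \<Rightarrow> complex) set"
  for Q :: "('i, 'e) graph" and v :: "'i \<Rightarrow> nat" where
  const: "(\<lambda>x. c) \<in> polynomial_functions Q v"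
| coord: "\<lbrakk>h \<in> arrows Q; r < v (in_vertex h); s < v (out_vertex h)\<rbrakk>
    \<Longrightarrow> (\<lambda>x. x h $$ (r, s)) \<in> polynomial_functions Q v"
| add: "\<lbrakk>p \<in> polynomial_functions Q v; q \<in> polynomial_functions Q v\<rbrakk>
    \<Longrightarrow> (\<lambda>x. p x + q x) \<in> polynomial_functions Q v"
| mult: "\<lbrakk>p \<in> polynomial_functions Q v; q \<in> polynomial_functions Q v\<rbrakk>
    \<Longrightarrow> (\<lambda>x. p x * q x) \<in> polynomial_functions Q v"

definition zariski_open ::
  "('i, 'e) graph \<Rightarrow> ('i \<Rightarrow> nat) \<Rightarrow> ('i, 'e) rep set \<Rightarrow> bool" where
  "zariski_open Q v U \<longleftrightarrow>
     (\<exists>P \<subseteq> polynomial_functions Q v. U = {x \<in> reps Q v. \<exists>p\<in>P. p x \<noteq> 0})"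

lemma istopology_zariski_open: "istopology (zariski_open Q v)"
  unfolding istopology_def
proof (intro conjI allI impI)
  fix U V assume "zariski_open Q v U" "zariski_open Q v V"
  then obtain P P' where P: "P \<subseteq> polynomial_functions Q v" "U = {x \<in> reps Q v. \<exists>p\<in>P. p x \<noteq> 0}"
    and P': "P' \<subseteq> polynomial_functions Q v" "V = {x \<in> reps Q v. \<exists>p\<in>P'. p x \<noteq> 0}"
    unfolding zariski_open_def by (elim exE conjE)
  define R where "R = {\<lambda>x. p x * q x | p q. p \<in> P \<and> q \<in> P'}"
  have "R \<subseteq> polynomial_functions Q v"
    using P(1) P'(1) unfolding R_def by (auto intro!: polynomial_functions.mult)
  moreover have "(\<exists>r\<in>R. r x \<noteq> 0) \<longleftrightarrow> (\<exists>p\<in>P. p x \<noteq> 0) \<and> (\<exists>q\<in>P'. q x \<noteq> 0)" for x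
  proof
    assume "\<exists>r\<in>R. r x \<noteq> 0"
    then obtain p q where "p \<in> P" "q \<in> P'" "p x * q x \<noteq> 0"
      unfolding R_def by fast
    then show "(\<exists>p\<in>P. p x \<noteq> 0) \<and> (\<exists>q\<in>P'. q x \<noteq> 0)" by auto
  next
    assume "(\<exists>p\<in>P. p x \<noteq> 0) \<and> (\<exists>q\<in>P'. q x \<noteq> 0)"
    then obtain p q where pq: "p \<in> P" "q \<in> P'" "p x \<noteq> 0" "q x \<noteq> 0" by (elim conjE bexE)
    then have "(\<lambda>x. p x * q x) \<in> R" unfolding R_def by (intro CollectI exI conjI) (rule refl)
    then show "\<exists>r\<in>R. r x \<noteq> 0"
      by (rule bexI[rotated]) (use pq in simp)
  qed
  then have "U \<inter> V = {x \<in> reps Q v. \<exists>r\<in>R. r x \<noteq> 0}"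
    by (simp only: P(2) P'(2) set_eq_iff Int_iff mem_Collect_eq) iprover
  ultimately show "zariski_open Q v (U \<inter> V)"
    unfolding zariski_open_def by (intro exI[of _ R] conjI)
next
  fix K assume K: "\<forall>U\<in>K. zariski_open Q v U"
  define R where
    "R = {p \<in> polynomial_functions Q v. \<exists>U\<in>K. \<forall>x\<in>reps Q v. p x \<noteq> 0 \<longrightarrow> x \<in> U}"
  have "\<Union>K = {x \<in> reps Q v. \<exists>p\<in>R. p x \<noteq> 0}"
  proof (intro equalityI subsetI)
    fix x assume "x \<in> \<Union>K"
    then obtain U where U: "U \<in> K" "x \<in> U" by (elim UnionE)
    obtain P where P: "P \<subseteq> polynomial_functions Q v" "U = {x \<in> reps Q v. \<exists>p\<in>P. p x \<noteq> 0}"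
      using bspec[OF K U(1)] unfolding zariski_open_def by (elim exE conjE)
    obtain p where p: "p \<in> P" "p x \<noteq> 0" "x \<in> reps Q v"
      using U(2) P(2) by auto
    have "\<forall>y\<in>reps Q v. p y \<noteq> 0 \<longrightarrow> y \<in> U" using P(2) p(1) by auto
    then have "p \<in> R" unfolding R_def using P(1) p(1) U(1) by auto
    then show "x \<in> {x \<in> reps Q v. \<exists>p\<in>R. p x \<noteq> 0}" using p by auto
  next
    fix x assume "x \<in> {x \<in> reps Q v. \<exists>p\<in>R. p x \<noteq> 0}"
    then show "x \<in> \<Union>K" unfolding R_def by auto
  qed
  moreover have "R \<subseteq> polynomial_functions Q v" unfolding R_def by (intro subsetI) simp
  ultimately show "zariski_open Q v (\<Union>K)"
    unfolding zariski_open_def by (intro exI[of _ R] conjI)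
qed

definition zariski :: "('i, 'e) graph \<Rightarrow> ('i \<Rightarrow> nat) \<Rightarrow> ('i, 'e) rep topology" where
  "zariski Q v = topology (zariski_open Q v)"

lemma openin_zariski: "openin (zariski Q v) = zariski_open Q v"
  unfolding zariski_def using istopology_zariski_open topology_inverse' by blast

definition irreducible_in :: "'a topology \<Rightarrow> 'a set \<Rightarrow> bool" where
  "irreducible_in T S \<longleftrightarrow> S \<subseteq> topspace T \<and> S \<noteq> {} \<and>
     (\<forall>A B. closedin T A \<and> closedin T B \<and> S \<subseteq> A \<union> B \<longrightarrow> S \<subseteq> A \<or> S \<subseteq> B)"

definition irreducible_components :: "'a topology \<Rightarrow> 'a set \<Rightarrow> 'a set set" where
  "irreducible_components T Y =
     {X. X \<subseteq> Y \<and> irreducible_in T X \<and>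
         (\<forall>Z. Z \<subseteq> Y \<and> irreducible_in T Z \<and> X \<subseteq> Z \<longrightarrow> Z = X)}"

text \<open>The union over all dimension vectors is disjoint: a component carries its dimension vector.\<close>

type_synonym ('i, 'e) component = "('i \<Rightarrow> nat) \<times> ('i, 'e) rep set"

definition B_infinity ::
  "('i, 'e) graph \<Rightarrow> ('i, 'e) arrow set \<Rightarrow> ('i, 'e) component set" where
  "B_infinity Q \<Omega> =
     (SIGMA v : dim_vectors Q. irreducible_components (zariski Q v) (Lam Q \<Omega> v))"

definition X_infinity ::
  "('i, 'e) graph \<Rightarrow> ('i, 'e) arrow set \<Rightarrow> ('i, 'e) component" where
  "X_infinity Q \<Omega> =
     (zero_dim Q, the_elem (irreducible_components (zariski Q (zero_dim Q)) (Lam Q \<Omega> (zero_dim Q))))"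


section \<open>Crystal operators\<close>

text \<open>The image of \<open>\<Oplus>\<^bsub>in(h) = i\<^esub> V\<^bsub>out(h)\<^esub> \<rightarrow> V\<^bsub>i\<^esub>\<close>.\<close>

definition incoming_image ::
  "('i, 'e) graph \<Rightarrow> ('i \<Rightarrow> nat) \<Rightarrow> 'i \<Rightarrow> ('i, 'e) rep \<Rightarrow> complex vec set" where
  "incoming_image Q v i x =
     (\<lambda>w. vec (v i) (\<lambda>r. \<Sum>h\<in>arrows_into Q i. (x h *\<^sub>v w h) $ r)) `
       (\<Pi>\<^sub>E h\<in>arrows_into Q i. carrier_vec (v (out_vertex h)))"

definition eps_rep ::
  "('i, 'e) graph \<Rightarrow> ('i \<Rightarrow> nat) \<Rightarrow> 'i \<Rightarrow> ('i, 'e) rep \<Rightarrow> nat" where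
  "eps_rep Q v i x = v i -
     vectorspace.dim class_ring (module_vec TYPE(complex) (v i) \<lparr>carrier := incoming_image Q v i x\<rparr>)"

text \<open>The generic value is the one taken on some nonempty open subset of the component; it is
  unique because the component is irreducible.\<close>

definition eps :: "('i, 'e) graph \<Rightarrow> 'i \<Rightarrow> ('i, 'e) component \<Rightarrow> nat" where
  "eps Q i = (\<lambda>(v, X). THE p. \<exists>U. openin (zariski Q v) U \<and> U \<inter> X \<noteq> {} \<and>
     (\<forall>x \<in> U \<inter> X. eps_rep Q v i x = p))"

definition B_infinity_eps ::
  "('i, 'e) graph \<Rightarrow> ('i, 'e) arrow set \<Rightarrow> 'i \<Rightarrow> nat \<Rightarrow> ('i, 'e) component set" where
  "B_infinity_eps Q \<Omega> i p = {C \<in> B_infinity Q \<Omega>. eps Q i C = p}"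

definition mat_image :: "complex mat \<Rightarrow> complex vec set" where
  "mat_image A = (\<lambda>u. A *\<^sub>v u) ` carrier_vec (dim_col A)"

definition short_exact ::
  "('i, 'e) graph \<Rightarrow> ('i \<Rightarrow> nat) \<Rightarrow> ('i \<Rightarrow> nat) \<Rightarrow> ('i \<Rightarrow> nat) \<Rightarrow>
   ('i \<Rightarrow> complex mat) \<Rightarrow> ('i \<Rightarrow> complex mat) \<Rightarrow> bool" where
  "short_exact Q v1 v v2 \<phi> \<psi> \<longleftrightarrow>
     \<phi> \<in> (\<Pi>\<^sub>E j\<in>verts Q. carrier_mat (v j) (v1 j)) \<and>
     \<psi> \<in> (\<Pi>\<^sub>E j\<in>verts Q. carrier_mat (v2 j) (v j)) \<and>
     (\<forall>j\<in>verts Q. inj_on (\<lambda>u. \<phi> j *\<^sub>v u) (carrier_vec (v1 j)) \<and>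
        mat_image (\<phi> j) = mat_kernel (\<psi> j) \<and>
        mat_image (\<psi> j) = carrier_vec (v2 j))"

definition stable_image ::
  "('i, 'e) graph \<Rightarrow> ('i, 'e) rep \<Rightarrow> ('i \<Rightarrow> complex mat) \<Rightarrow> bool" where
  "stable_image Q x \<phi> \<longleftrightarrow>
     (\<forall>h\<in>arrows Q. \<forall>u\<in>mat_image (\<phi> (out_vertex h)). x h *\<^sub>v u \<in> mat_image (\<phi> (in_vertex h)))"

text \<open>The variety \<open>\<Lambda>'\<close> for \<open>v = v1 + c \<alpha>\<^sub>i\<close>, and its projections to \<open>\<Lambda>(v1)\<close> and \<open>\<Lambda>(v)\<close>.\<close>

definition Lam' ::
  "('i, 'e) graph \<Rightarrow> ('i, 'e) arrow set \<Rightarrow> 'i \<Rightarrow> nat \<Rightarrow> ('i \<Rightarrow> nat) \<Rightarrow>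
   (('i, 'e) rep \<times> ('i \<Rightarrow> complex mat) \<times> ('i \<Rightarrow> complex mat)) set" where
  "Lam' Q \<Omega> i c v1 = (let v2 = mult_root Q c i; v = add_dim Q v1 v2 in
     {(x, \<phi>, \<psi>). x \<in> Lam Q \<Omega> v \<and> short_exact Q v1 v v2 \<phi> \<psi> \<and> stable_image Q x \<phi>})"

definition varpi1 ::
  "('i, 'e) graph \<Rightarrow> ('i \<Rightarrow> nat) \<Rightarrow>
   ('i, 'e) rep \<times> ('i \<Rightarrow> complex mat) \<times> ('i \<Rightarrow> complex mat) \<Rightarrow> ('i, 'e) rep" where
  "varpi1 Q v1 = (\<lambda>(x, \<phi>, \<psi>). THE y. y \<in> reps Q v1 \<and>
     (\<forall>h\<in>arrows Q. \<phi> (in_vertex h) * y h = x h * \<phi> (out_vertex h)))"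

definition varpi2 ::
  "('i, 'e) rep \<times> ('i \<Rightarrow> complex mat) \<times> ('i \<Rightarrow> complex mat) \<Rightarrow> ('i, 'e) rep" where
  "varpi2 = fst"

text \<open>\<open>f_pow Q \<Omega> i c\<close> and \<open>e_pow Q \<Omega> i c\<close> are \<open>f\<^sub>i\<^sup>c\<close> on the components with \<open>\<epsilon>\<^sub>i = 0\<close> and its inverse
  on the components with \<open>\<epsilon>\<^sub>i = c\<close>.\<close>

definition f_pow ::
  "('i, 'e) graph \<Rightarrow> ('i, 'e) arrow set \<Rightarrow> 'i \<Rightarrow> nat \<Rightarrow> ('i, 'e) component \<Rightarrow> ('i, 'e) component" where
  "f_pow Q \<Omega> i c = (\<lambda>(v1, X1). let v = add_dim Q v1 (mult_root Q c i) in
     (v, zariski Q v closure_of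
           (varpi2 ` {t \<in> Lam' Q \<Omega> i c v1. varpi1 Q v1 t \<in> X1 \<inter> {y. eps_rep Q v1 i y = 0}})))"

definition e_pow ::
  "('i, 'e) graph \<Rightarrow> ('i, 'e) arrow set \<Rightarrow> 'i \<Rightarrow> nat \<Rightarrow> ('i, 'e) component \<Rightarrow> ('i, 'e) component" where
  "e_pow Q \<Omega> i c = inv_into (B_infinity_eps Q \<Omega> i 0) (f_pow Q \<Omega> i c)"

definition f_tilde ::
  "('i, 'e) graph \<Rightarrow> ('i, 'e) arrow set \<Rightarrow> 'i \<Rightarrow> ('i, 'e) component \<Rightarrow> ('i, 'e) component" where
  "f_tilde Q \<Omega> i C = f_pow Q \<Omega> i (eps Q i C + 1) (e_pow Q \<Omega> i (eps Q i C) C)"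

text \<open>The composition of the commuting operators \<open>f\<^sub>i\<close>, \<open>i \<in> orb\<close>, in any order.\<close>

definition f_tilde_orbit ::
  "('i, 'e) graph \<Rightarrow> ('i, 'e) arrow set \<Rightarrow> 'i set \<Rightarrow> ('i, 'e) component \<Rightarrow> ('i, 'e) component" where
  "f_tilde_orbit Q \<Omega> orb C = Finite_Set.fold (f_tilde Q \<Omega>) C orb"

inductive_set B_Gamma ::
  "('i, 'e) graph \<Rightarrow> ('i, 'e) arrow set \<Rightarrow> ('i \<Rightarrow> 'i) \<Rightarrow> ('i, 'e) component set"
  for Q :: "('i, 'e) graph" and \<Omega> :: "('i, 'e) arrow set" and a :: "'i \<Rightarrow> 'i" where
  highest: "X_infinity Q \<Omega> \<in> B_Gamma Q \<Omega> a"
| step: "\<lbrakk>C \<in> B_Gamma Q \<Omega> a; orb \<in> vertex_orbits Q a\<rbrakk> \<Longrightarrow> f_tilde_orbit Q \<Omega> orb C \<in> B_Gamma Q \<Omega> a"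


section \<open>The action of the automorphism on components\<close>

definition act_dim :: "('i, 'e) graph \<Rightarrow> ('i \<Rightarrow> 'i) \<Rightarrow> ('i \<Rightarrow> nat) \<Rightarrow> 'i \<Rightarrow> nat" where
  "act_dim Q a v = (\<lambda>i\<in>verts Q. v (inv_into (verts Q) a i))"

definition act_rep ::
  "('i, 'e) graph \<Rightarrow> ('i \<Rightarrow> 'i) \<Rightarrow> ('e \<Rightarrow> 'e) \<Rightarrow> ('i, 'e) rep \<Rightarrow> ('i, 'e) rep" where
  "act_rep Q a b x = (\<lambda>h\<in>arrows Q. x (inv_into (arrows Q) (act_arrow a b) h))"

definition act_component ::
  "('i, 'e) graph \<Rightarrow> ('i \<Rightarrow> 'i) \<Rightarrow> ('e \<Rightarrow> 'e) \<Rightarrow> ('i, 'e) component \<Rightarrow> ('i, 'e) component" where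
  "act_component Q a b = (\<lambda>(v, X). (act_dim Q a v, act_rep Q a b ` X))"

end

theory Submission
  imports Defs "Jordan_Normal_Form.DL_Rank"
begin

text \<open>The operators \<^const>\<open>f_tilde\<close> commute with the automorphism, up to moving the vertex, so a product of
them over an orbit preserves invariance. Conversely, let \<open>C\<close> be an invariant component for a nonzero
dimension vector. By nilpotency some \<open>\<epsilon>\<^sub>i(C)\<close> is positive, and by invariance so is \<open>\<epsilon>\<^sub>j(C)\<close> for
every \<open>j\<close> in the orbit of \<open>i\<close>. No two vertices of an orbit are joined by an edge; hence the
operators of the orbit commute and \<open>f\<^sub>j\<close> leaves the other \<open>\<epsilon>\<^sub>k\<close> unchanged, so that they can be
removed from \<open>C\<close> one after the other. The result \<open>D\<close> is determined by \<open>C\<close>, because the operators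
are injective. Therefore \<open>D\<close> is invariant as well, and induction on the total dimension applies to it
(\<open>B_Gamma_invariant\<close>, \<open>invariant_B_Gamma\<close>).

This argument rests on the theorem of Kashiwara and Saito that \<open>f\<^sub>i\<^sup>c\<close> is a bijection from the
components with \<open>\<epsilon>\<^sub>i = 0\<close> to those with \<open>\<epsilon>\<^sub>i = c\<close>, and on the commutation of \<open>f\<^sub>i\<close> and \<open>f\<^sub>j\<close> when \<open>i\<close>
and \<open>j\<close> are not joined. Most of the text proves these two facts, by elementary means.

Fix a vertex \<open>i\<close>. The arrows into \<open>i\<close> form one matrix \<open>M\<close>, those out of \<open>i\<close>, with signs, another one
\<open>N\<close>, and the relation at \<open>i\<close> is \<open>M N = 0\<close>. A representation \<open>x\<close> with cokernel of dimension \<open>c\<close> at \<open>i\<close>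
restricts to a representation \<open>z\<close> on the image of \<open>M\<close>, and \<open>x\<close> is recovered from \<open>z\<close>, the position
of the image, and the values of \<open>N\<close> on a complement, which may be chosen freely in the kernel of the
incoming matrix of \<open>z\<close>. This is the set \<open>lifts\<close>; it replaces the correspondence in the definition of
\<^const>\<open>f_pow\<close> (\<open>f_pow_eq_lift_closure\<close>).

As the incoming matrix of \<open>z\<close> is surjective, its kernel is the image of a matrix that depends
polynomially on \<open>z\<close> (\<open>ker_op\<close>). So every lift belongs to a polynomial family of lifts over all \<open>z\<close>, and any
two lifts of the same \<open>z\<close> are joined by a rational curve of lifts. It follows that the lifts of an irreducible set
form an irreducible set (\<open>irreducible_lifts\<close>), and that lifts of a dense subset are dense
(\<open>lifts_dense\<close>). In the other direction, restriction is a polynomial map up to a scalar factor,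
which does not matter because components are cones. This gives surjectivity
(\<open>component_is_lift_closure\<close>) and injectivity (\<open>lift_closure_inj\<close>) of the correspondence between
components.

That the closure of the lifts is a component, and not just an irreducible subset, is a matter of
dimension. All components for \<open>v\<close> have dimension \<open>\<Sum>\<^bsub>h\<in>\<Omega>\<^esub> v\<^bsub>in(h)\<^esub> v\<^bsub>out(h)\<^esub>\<close>, because a lift has \<open>c\<close> times
the number of columns of \<open>M\<close> free parameters. Dimensions are measured by the growth of the number of
linearly independent polynomial functions of bounded degree.\<close>

section \<open>Polynomial functions and the growth of function spaces\<close>

inductive poly_deg :: "('x \<Rightarrow> complex) set \<Rightarrow> nat \<Rightarrow> ('x \<Rightarrow> complex) \<Rightarrow> bool"
  for G :: "('x \<Rightarrow> complex) set" where
  const: "poly_deg G n (\<lambda>x. c)"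
| gen: "g \<in> G \<Longrightarrow> poly_deg G (Suc n) g"
| add: "\<lbrakk>poly_deg G n f; poly_deg G n g\<rbrakk> \<Longrightarrow> poly_deg G n (\<lambda>x. f x + g x)"
| mult: "\<lbrakk>poly_deg G n f; poly_deg G m g\<rbrakk> \<Longrightarrow> poly_deg G (n + m) (\<lambda>x. f x * g x)"

definition polys :: "('x \<Rightarrow> complex) set \<Rightarrow> nat \<Rightarrow> ('x \<Rightarrow> complex) set" where
  "polys G n = {f. poly_deg G n f}"

lemma polys_intros:
  shows polys_const: "(\<lambda>x. c) \<in> polys G n"
    and polys_gen: "g \<in> G \<Longrightarrow> g \<in> polys G (Suc n)"
    and polys_add: "\<lbrakk>f \<in> polys G n; g \<in> polys G n\<rbrakk> \<Longrightarrow> (\<lambda>x. f x + g x) \<in> polys G n"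
    and polys_mult: "\<lbrakk>f \<in> polys G n; g \<in> polys G m\<rbrakk> \<Longrightarrow> (\<lambda>x. f x * g x) \<in> polys G (n + m)"
  unfolding polys_def by (auto intro: poly_deg.intros)

lemma polys_induct [consumes 1, case_names const gen add mult, induct set: polys]:
  assumes "f \<in> polys G n"
    and "\<And>c n. P n (\<lambda>x. c)"
    and "\<And>g n. g \<in> G \<Longrightarrow> P (Suc n) g"
    and "\<And>f n g. \<lbrakk>f \<in> polys G n; P n f; g \<in> polys G n; P n g\<rbrakk> \<Longrightarrow> P n (\<lambda>x. f x + g x)"
    and "\<And>f n g m. \<lbrakk>f \<in> polys G n; P n f; g \<in> polys G m; P m g\<rbrakk>
      \<Longrightarrow> P (n + m) (\<lambda>x. f x * g x)"
  shows "P n f"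
  using assms(1) unfolding polys_def mem_Collect_eq
  by (induction n f rule: poly_deg.induct) (auto intro: assms(2-) simp: polys_def)

definition all_polys :: "('x \<Rightarrow> complex) set \<Rightarrow> ('x \<Rightarrow> complex) set" where
  "all_polys G = (\<Union>n. polys G n)"

definition function_ring :: "('x \<Rightarrow> complex) set \<Rightarrow> bool" where
  "function_ring F \<longleftrightarrow> (\<forall>c. (\<lambda>x. c) \<in> F) \<and>
     (\<forall>f\<in>F. \<forall>g\<in>F. (\<lambda>x. f x + g x) \<in> F \<and> (\<lambda>x. f x * g x) \<in> F)"

lemma function_ringD:
  assumes "function_ring F"
  shows "(\<lambda>x. c) \<in> F"
    and "f \<in> F \<Longrightarrow> g \<in> F \<Longrightarrow> (\<lambda>x. f x + g x) \<in> F"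
    and "f \<in> F \<Longrightarrow> g \<in> F \<Longrightarrow> (\<lambda>x. f x * g x) \<in> F"
  using assms unfolding function_ring_def by auto

lemma function_ring_sum:
  assumes "function_ring F" "\<And>i. i \<in> A \<Longrightarrow> f i \<in> F"
  shows "(\<lambda>x. \<Sum>i\<in>A. f i x) \<in> F"
  using assms(2)
  by (induction A rule: infinite_finite_induct) (auto intro: function_ringD[OF assms(1)])

lemma function_ring_prod:
  assumes "function_ring F" "\<And>i. i \<in> A \<Longrightarrow> f i \<in> F"
  shows "(\<lambda>x. \<Prod>i\<in>A. f i x) \<in> F"
  using assms(2)
  by (induction A rule: infinite_finite_induct) (auto intro: function_ringD[OF assms(1)])

lemma polys_mono:
  assumes "f \<in> polys G n" "n \<le> m"
  shows "f \<in> polys G m"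
  using polys_mult[OF assms(1) polys_const[of 1 G "m - n"]] assms(2) by simp

lemma polys_sum:
  assumes "\<And>i. i \<in> A \<Longrightarrow> f i \<in> polys G n"
  shows "(\<lambda>x. \<Sum>i\<in>A. f i x) \<in> polys G n"
  using assms by (induction A rule: infinite_finite_induct) (auto intro: polys_const polys_add)

lemma polys_power:
  assumes "f \<in> polys G n"
  shows "(\<lambda>x. f x ^ k) \<in> polys G (k * n)"
  using assms by (induction k) (auto intro: polys_const polys_mult)

lemma function_ring_all_polys: "function_ring (all_polys G)"
  unfolding function_ring_def
proof (intro conjI allI ballI)
  fix f g assume "f \<in> all_polys G" "g \<in> all_polys G"
  then obtain n m where nm: "f \<in> polys G n" "g \<in> polys G m" unfolding all_polys_def by auto
  have "f \<in> polys G (n + m)" "g \<in> polys G (n + m)"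
    using nm by (auto intro: polys_mono)
  then show "(\<lambda>x. f x + g x) \<in> all_polys G" unfolding all_polys_def by (auto intro: polys_add)
  show "(\<lambda>x. f x * g x) \<in> all_polys G"
    unfolding all_polys_def using polys_mult[OF nm] by blast
qed (auto simp: all_polys_def intro: polys_const)

lemma all_polys_gen: "g \<in> G \<Longrightarrow> g \<in> all_polys G"
  unfolding all_polys_def using polys_gen[of g G 0] by blast

text \<open>Substitution multiplies degrees by a constant, so growth exponents are compared along polynomial
maps without regard to the degree of the map.\<close>

lemma polys_comp:
  assumes "\<And>g. g \<in> G \<Longrightarrow> (\<lambda>y. g (\<Phi> y)) \<in> polys G' e" and "f \<in> polys G n"
  shows "(\<lambda>y. f (\<Phi> y)) \<in> polys G' (e * n)"
  using assms(2)
proof induction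
  case (gen g n)
  then show ?case using polys_mono[OF assms(1), of g "e * Suc n"] by simp
next
  case (mult f n g m)
  then show ?case using polys_mult[OF mult.IH] by (simp add: algebra_simps)
qed (auto intro: polys_intros)

lemma polys_eq_on_gens:
  assumes "f \<in> polys G n" "\<And>g. g \<in> G \<Longrightarrow> g x = g y"
  shows "f x = f y"
  using assms(1) by induction (auto simp: assms(2))

lemma bounded_degree_comp:
  assumes "finite G" "\<And>g. g \<in> G \<Longrightarrow> (\<lambda>y. g (\<Phi> y)) \<in> all_polys G'"
  obtains e where "\<And>g. g \<in> G \<Longrightarrow> (\<lambda>y. g (\<Phi> y)) \<in> polys G' e"
proof -
  have "\<forall>g\<in>G. \<exists>e. (\<lambda>y. g (\<Phi> y)) \<in> polys G' e" using assms(2) unfolding all_polys_def by auto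
  then obtain e where e: "\<And>g. g \<in> G \<Longrightarrow> (\<lambda>y. g (\<Phi> y)) \<in> polys G' (e g)" by metis
  have "(\<lambda>y. g (\<Phi> y)) \<in> polys G' (\<Sum>g\<in>G. e g)" if "g \<in> G" for g
    using polys_mono[OF e[OF that]] member_le_sum[of g G e] that assms(1) by simp
  then show ?thesis by (rule that)
qed

definition lin_indep :: "'x set \<Rightarrow> ('k \<Rightarrow> 'x \<Rightarrow> complex) \<Rightarrow> 'k set \<Rightarrow> bool" where
  "lin_indep X f K \<longleftrightarrow> (\<forall>c. (\<forall>x\<in>X. (\<Sum>k\<in>K. c k * f k x) = 0) \<longrightarrow> (\<forall>k\<in>K. c k = 0))"

definition many_indep :: "'x set \<Rightarrow> ('x \<Rightarrow> complex) set \<Rightarrow> nat \<Rightarrow> bool" where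
  "many_indep X F r \<longleftrightarrow> (\<exists>f :: nat \<Rightarrow> 'x \<Rightarrow> complex. (\<forall>k<r. f k \<in> F) \<and> lin_indep X f {..<r})"

lemma many_indepI:
  assumes fin: "finite K" and F: "\<And>k. k \<in> K \<Longrightarrow> f k \<in> F" and ind: "lin_indep X f K"
  shows "many_indep X F (card K)"
proof -
  obtain h where h: "bij_betw h {..<card K} K"
    using ex_bij_betw_nat_finite[OF fin] by (auto simp: atLeast0LessThan)
  have "lin_indep X (f \<circ> h) {..<card K}"
    unfolding lin_indep_def
  proof (intro allI impI ballI)
    fix c i assume c: "\<forall>x\<in>X. (\<Sum>k<card K. c k * (f \<circ> h) k x) = 0" and i: "i \<in> {..<card K}"
    define c' where "c' k = c (inv_into {..<card K} h k)" for k
    have c'h: "c' (h k) = c k" if "k < card K" for k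
      unfolding c'_def using h that by (simp add: bij_betw_def)
    have "(\<Sum>k\<in>K. c' k * f k x) = (\<Sum>k<card K. c k * (f \<circ> h) k x)" for x
      unfolding sum.reindex_bij_betw[OF h, symmetric] by (intro sum.cong) (auto simp: c'h)
    with c ind have "\<forall>k\<in>K. c' k = 0" unfolding lin_indep_def by auto
    then show "c i = 0" using c'h i h by (metis bij_betwE lessThan_iff)
  qed
  moreover have "\<forall>k<card K. (f \<circ> h) k \<in> F" using F h by (auto simp: bij_betw_def)
  ultimately show ?thesis unfolding many_indep_def by blast
qed

text \<open>The map \<open>\<Phi>\<close> need not map \<open>Y\<close> into \<open>E\<close>; it suffices that every point of \<open>E\<close> is hit as far as the functions
in \<open>F\<close> can see.\<close>

lemma many_indep_pullback:
  assumes "\<And>f. f \<in> F \<Longrightarrow> (\<lambda>y. f (\<Phi> y)) \<in> F'"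
    and "\<And>x. x \<in> E \<Longrightarrow> \<exists>y\<in>Y. \<forall>f\<in>F. f (\<Phi> y) = f x" and "many_indep E F r"
  shows "many_indep Y F' r"
proof -
  obtain f :: "nat \<Rightarrow> 'a \<Rightarrow> complex" where f: "\<forall>k<r. f k \<in> F" "lin_indep E f {..<r}"
    using assms(3) unfolding many_indep_def by auto
  have "lin_indep Y (\<lambda>k y. f k (\<Phi> y)) {..<r}"
    unfolding lin_indep_def
  proof (intro allI impI)
    fix c assume c: "\<forall>y\<in>Y. (\<Sum>k<r. c k * f k (\<Phi> y)) = 0"
    have "\<forall>x\<in>E. (\<Sum>k<r. c k * f k x) = 0"
    proof
      fix x assume "x \<in> E"
      then obtain y where y: "y \<in> Y" "\<forall>f\<in>F. f (\<Phi> y) = f x" using assms(2) by blast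
      have "f k (\<Phi> y) = f k x" if "k < r" for k using f(1) y(2) that by blast
      then have "(\<Sum>k<r. c k * f k x) = (\<Sum>k<r. c k * f k (\<Phi> y))" by (intro sum.cong refl) simp
      then show "(\<Sum>k<r. c k * f k x) = 0" using c y(1) by simp
    qed
    then show "\<forall>k\<in>{..<r}. c k = 0" using f(2) unfolding lin_indep_def by simp
  qed
  then show ?thesis unfolding many_indep_def using f(1) assms(1)
    by (intro exI[of _ "\<lambda>k y. f k (\<Phi> y)"]) auto
qed

text \<open>The dimension of a variety is the exponent with which the dimension of the space of functions
  of degree at most \<open>n\<close> grows; \<open>growth_ge\<close> and \<open>growth_le\<close> bound it from below and above.\<close>

definition growth_ge :: "'x set \<Rightarrow> ('x \<Rightarrow> complex) set \<Rightarrow> nat \<Rightarrow> bool" where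
  "growth_ge X G d \<longleftrightarrow> (\<exists>a. \<forall>n. many_indep X (polys G (a * n)) (n ^ d))"

definition growth_le :: "'x set \<Rightarrow> ('x \<Rightarrow> complex) set \<Rightarrow> nat \<Rightarrow> bool" where
  "growth_le X G d \<longleftrightarrow> (\<exists>a. \<forall>n r. many_indep X (polys G n) r \<longrightarrow> r \<le> a * (n + 1) ^ d)"

lemma growth_contradiction:
  assumes "growth_ge X G (Suc d)" "growth_le X G d"
  shows False
proof -
  obtain a where a: "\<And>n. many_indep X (polys G (a * n)) (n ^ Suc d)"
    using assms(1) unfolding growth_ge_def by auto
  obtain b where b: "\<And>n r. many_indep X (polys G n) r \<Longrightarrow> r \<le> b * (n + 1) ^ d"
    using assms(2) unfolding growth_le_def by auto
  define n where "n = b * (a + 1) ^ d + 1"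
  have "n ^ Suc d \<le> b * (a * n + 1) ^ d" using b[OF a[of n]] .
  also have "\<dots> \<le> b * ((a + 1) * n) ^ d"
    by (intro mult_left_mono power_mono) (auto simp: n_def algebra_simps)
  also have "\<dots> = (n - 1) * n ^ d" unfolding power_mult_distrib by (simp add: n_def)
  finally have "n * n ^ d \<le> (n - 1) * n ^ d" by simp
  moreover have "n ^ d > 0" by (simp add: n_def)
  ultimately show False by (simp add: n_def)
qed

text \<open>If the image of \<open>Y\<close> covers \<open>E\<close>, then \<open>Y\<close> is at least as large as \<open>E\<close>. Equality of points is only
required on the generators, since these do not see all coordinates of a point of a product.\<close>

lemma growth_ge_pullback:
  assumes "\<And>g. g \<in> G \<Longrightarrow> (\<lambda>y. g (\<Phi> y)) \<in> all_polys G'" "finite G"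
    and eq: "\<And>x. x \<in> E \<Longrightarrow> \<exists>y\<in>Y. \<forall>g\<in>G. g (\<Phi> y) = g x" and "growth_ge E G d"
  shows "growth_ge Y G' d"
proof -
  obtain e where e: "\<And>g. g \<in> G \<Longrightarrow> (\<lambda>y. g (\<Phi> y)) \<in> polys G' e"
    using bounded_degree_comp[of G \<Phi> G'] assms(1,2) by metis
  obtain a where a: "\<And>n. many_indep E (polys G (a * n)) (n ^ d)"
    using \<open>growth_ge E G d\<close> unfolding growth_ge_def by auto
  have "many_indep Y (polys G' (e * (a * n))) (n ^ d)" for n
  proof (rule many_indep_pullback[where \<Phi> = \<Phi>, OF _ _ a])
    show "\<exists>y\<in>Y. \<forall>f\<in>polys G (a * n). f (\<Phi> y) = f x" if x: "x \<in> E" for x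
    proof -
      obtain y where y: "y \<in> Y" "\<And>g. g \<in> G \<Longrightarrow> g (\<Phi> y) = g x" using eq[OF x] by blast
      have "f (\<Phi> y) = f x" if "f \<in> polys G (a * n)" for f
        using that y(2) by (rule polys_eq_on_gens)
      with y(1) show ?thesis by blast
    qed
  qed (rule polys_comp[OF e])
  then show ?thesis unfolding growth_ge_def by (metis mult.assoc)
qed

lemma growth_le_pullback:
  assumes "\<And>g. g \<in> G \<Longrightarrow> (\<lambda>y. g (\<Phi> y)) \<in> all_polys G'" "finite G"
    and "E \<subseteq> \<Phi> ` Y" "growth_le Y G' d"
  shows "growth_le E G d"
proof -
  obtain e where e: "\<And>g. g \<in> G \<Longrightarrow> (\<lambda>y. g (\<Phi> y)) \<in> polys G' e"
    using bounded_degree_comp[of G \<Phi> G'] assms(1,2) by metis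
  obtain b where b: "\<And>n r. many_indep Y (polys G' n) r \<Longrightarrow> r \<le> b * (n + 1) ^ d"
    using assms(4) unfolding growth_le_def by auto
  have "r \<le> (b * (e + 1) ^ d) * (n + 1) ^ d" if "many_indep E (polys G n) r" for n r
  proof -
    have "many_indep Y (polys G' (e * n)) r"
    proof (rule many_indep_pullback[where \<Phi> = \<Phi>, OF _ _ that])
      show "\<exists>y\<in>Y. \<forall>f\<in>polys G n. f (\<Phi> y) = f x" if "x \<in> E" for x
        using assms(3) that by blast
    qed (rule polys_comp[OF e])
    then have "r \<le> b * (e * n + 1) ^ d" by (rule b)
    also have "\<dots> \<le> b * ((e + 1) * (n + 1)) ^ d"
      by (intro mult_left_mono power_mono) (auto simp: algebra_simps)
    finally show ?thesis unfolding power_mult_distrib by (simp only: mult.assoc)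
  qed
  then show ?thesis unfolding growth_le_def by blast
qed

lemma many_indep_mono: "\<lbrakk>many_indep X F r; X \<subseteq> Y\<rbrakk> \<Longrightarrow> many_indep Y F r"
  by (rule many_indep_pullback[where \<Phi> = "\<lambda>x. x" and E = X and F = F]) auto

lemma many_indep_dense:
  assumes "\<And>f. \<lbrakk>f \<in> polys G n; \<forall>x\<in>Y. f x = 0\<rbrakk> \<Longrightarrow> \<forall>x\<in>X. f x = 0"
    and "many_indep X (polys G n) r"
  shows "many_indep Y (polys G n) r"
proof -
  obtain f :: "nat \<Rightarrow> 'a \<Rightarrow> complex" where f: "\<forall>k<r. f k \<in> polys G n" "lin_indep X f {..<r}"
    using assms(2) unfolding many_indep_def by auto
  have "lin_indep Y f {..<r}"
    unfolding lin_indep_def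
  proof (intro allI impI)
    fix c assume c: "\<forall>x\<in>Y. (\<Sum>k<r. c k * f k x) = 0"
    have "(\<lambda>x. c k * f k x) \<in> polys G n" if "k < r" for k
      using polys_mult[OF polys_const[of "c k" G 0], of "f k" n] f(1) that by simp
    then have "(\<lambda>x. \<Sum>k<r. c k * f k x) \<in> polys G n" by (intro polys_sum) auto
    then have "\<forall>x\<in>X. (\<Sum>k<r. c k * f k x) = 0" by (rule assms(1)[OF _ c])
    then show "\<forall>k\<in>{..<r}. c k = 0" using f(2) unfolding lin_indep_def by blast
  qed
  then show ?thesis using f(1) unfolding many_indep_def by blast
qed

lemma growth_ge_mono: "\<lbrakk>growth_ge X G d; X \<subseteq> Y\<rbrakk> \<Longrightarrow> growth_ge Y G d"
  unfolding growth_ge_def using many_indep_mono by metis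

lemma growth_le_mono: "\<lbrakk>growth_le Y G d; X \<subseteq> Y\<rbrakk> \<Longrightarrow> growth_le X G d"
  unfolding growth_le_def using many_indep_mono by metis

lemma growth_dense:
  assumes "\<And>f. \<lbrakk>f \<in> all_polys G; \<forall>x\<in>Y. f x = 0\<rbrakk> \<Longrightarrow> \<forall>x\<in>X. f x = 0"
  shows growth_ge_dense: "growth_ge X G d \<Longrightarrow> growth_ge Y G d"
    and growth_le_dense: "growth_le Y G d \<Longrightarrow> growth_le X G d"
proof -
  have *: "many_indep Y (polys G n) r" if "many_indep X (polys G n) r" for n r
    by (rule many_indep_dense[OF _ that], rule assms) (auto simp: all_polys_def)
  show "growth_ge X G d \<Longrightarrow> growth_ge Y G d" "growth_le Y G d \<Longrightarrow> growth_le X G d"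
    unfolding growth_ge_def growth_le_def using * by blast+
qed

text \<open>A subset of an irreducible set that lies in a hypersurface has smaller dimension: if \<open>f\<close> vanishes on
\<open>Z\<close> but not on \<open>X\<close>, and the functions \<open>q\<^sub>k\<close> are independent on \<open>Z\<close>, then the products \<open>f\<^sup>l q\<^sub>k\<close> are
independent on \<open>X\<close>.\<close>

lemma growth_ge_hypersurface:
  assumes Z: "growth_ge Z G d" "Z \<subseteq> X"
    and f: "f \<in> all_polys G" "\<And>z. z \<in> Z \<Longrightarrow> f z = 0" "x0 \<in> X" "f x0 \<noteq> 0"
    and irr: "\<And>p q. \<lbrakk>p \<in> all_polys G; q \<in> all_polys G; \<forall>x\<in>X. p x * q x = 0\<rbrakk>
      \<Longrightarrow> (\<forall>x\<in>X. p x = 0) \<or> (\<forall>x\<in>X. q x = 0)"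
  shows "growth_ge X G (Suc d)"
proof -
  obtain a where a: "\<And>n. many_indep Z (polys G (a * n)) (n ^ d)"
    using Z(1) unfolding growth_ge_def by auto
  obtain e where e: "f \<in> polys G e" using f(1) unfolding all_polys_def by auto
  have "many_indep X (polys G ((e + a) * n)) (n ^ Suc d)" for n
  proof -
    obtain q :: "nat \<Rightarrow> 'a \<Rightarrow> complex"
      where q: "\<forall>k<n^d. q k \<in> polys G (a * n)" "lin_indep Z q {..<n^d}"
      using a[of n] unfolding many_indep_def by auto
    let ?R = "\<lambda>m c x. \<Sum>l<m. f x ^ l * (\<Sum>k<n^d. c l k * q k x)"
    have inner: "(\<lambda>x. \<Sum>k<n^d. b k * q k x) \<in> all_polys G" for b
      using q(1) by (intro function_ring_sum[OF function_ring_all_polys]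
          function_ringD[OF function_ring_all_polys]) (auto simp: all_polys_def)
    have pow: "(\<lambda>x. f x ^ l) \<in> all_polys G" for l
      using polys_power[OF e] unfolding all_polys_def by blast
    have R: "?R m c \<in> all_polys G" for m c
      by (intro function_ring_sum[OF function_ring_all_polys]
          function_ringD(3)[OF function_ring_all_polys] inner pow)
    \<comment> \<open>Restricting to \<open>Z\<close> kills all terms but the lowest, whose coefficients vanish by
      independence on \<open>Z\<close>; then a factor \<open>f\<close> can be cancelled.\<close>
    have key: "\<forall>x\<in>X. ?R m c x = 0 \<Longrightarrow> \<forall>l<m. \<forall>k<n^d. c l k = 0" for m c
    proof (induction m arbitrary: c)
      case (Suc m)
      have split: "?R (Suc m) c x = (\<Sum>k<n^d. c 0 k * q k x) + f x * ?R m (\<lambda>l. c (Suc l)) x" for x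
        by (subst sum.lessThan_Suc_shift) (simp add: sum_distrib_left mult.assoc)
      have "\<forall>x\<in>Z. (\<Sum>k<n^d. c 0 k * q k x) = 0"
      proof
        fix x assume x: "x \<in> Z"
        then have "?R (Suc m) c x = 0" using Suc.prems Z(2) by blast
        then show "(\<Sum>k<n^d. c 0 k * q k x) = 0" unfolding split using f(2)[OF x] by simp
      qed
      then have c0: "\<forall>k<n^d. c 0 k = 0"
        using q(2) unfolding lin_indep_def by (auto dest: spec[of _ "c 0"])
      then have "\<forall>x\<in>X. f x * ?R m (\<lambda>l. c (Suc l)) x = 0"
        using Suc.prems unfolding split by simp
      then have "\<forall>x\<in>X. ?R m (\<lambda>l. c (Suc l)) x = 0"
        using irr[OF f(1) R[where m = m and c = "\<lambda>l. c (Suc l)"]] f(3,4) by blast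
      from Suc.IH[OF this] c0 show ?case by (auto simp: less_Suc_eq_0_disj)
    qed simp
    let ?K = "{..<n} \<times> {..<n^d}"
    have "many_indep X (polys G ((e + a) * n)) (card ?K)"
    proof (rule many_indepI)
      fix lk assume lk: "lk \<in> ?K"
      have "(\<lambda>x. f x ^ fst lk * q (snd lk) x) \<in> polys G (fst lk * e + a * n)"
        using lk q(1) by (intro polys_mult polys_power e) auto
      moreover have "fst lk * e + a * n \<le> (e + a) * n"
        using lk by (auto simp: algebra_simps)
      ultimately show "(\<lambda>x. f x ^ fst lk * q (snd lk) x) \<in> polys G ((e + a) * n)"
        by (rule polys_mono)
    next
      show "lin_indep X (\<lambda>lk x. f x ^ fst lk * q (snd lk) x) ?K"
        unfolding lin_indep_def
      proof (intro allI impI)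
        fix c assume c: "\<forall>x\<in>X. (\<Sum>lk\<in>?K. c lk * (f x ^ fst lk * q (snd lk) x)) = 0"
        have "(\<Sum>lk\<in>?K. c lk * (f x ^ fst lk * q (snd lk) x)) = ?R n (\<lambda>l k. c (l, k)) x" for x
          unfolding sum_distrib_left sum.cartesian_product
          by (intro sum.cong refl) (auto simp: mult.left_commute)
        with c have "\<forall>x\<in>X. ?R n (\<lambda>l k. c (l, k)) x = 0" by simp
        from key[OF this] show "\<forall>lk\<in>?K. c lk = 0" by auto
      qed
    qed simp
    then show ?thesis by simp
  qed
  then show ?thesis unfolding growth_ge_def by blast
qed

text \<open>Gaussian elimination: fewer equations than unknowns leave a nonzero solution.\<close>

lemma homogeneous_system_solution:
  fixes a :: "'k \<Rightarrow> 'l \<Rightarrow> complex"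
  assumes "finite S" "finite R" "card S < card R"
  shows "\<exists>c. (\<exists>k\<in>R. c k \<noteq> 0) \<and> (\<forall>l\<in>S. (\<Sum>k\<in>R. c k * a k l) = 0)"
  using assms
proof (induction S arbitrary: R a rule: finite_induct)
  case empty
  then have "R \<noteq> {}" by auto
  then show ?case by (intro exI[of _ "\<lambda>_. 1"]) auto
next
  case (insert l0 S)
  show ?case
  proof (cases "\<forall>k\<in>R. a k l0 = 0")
    case True
    with insert.IH[of R a] insert.prems insert.hyps show ?thesis by auto
  next
    case False
    then obtain p where p: "p \<in> R" "a p l0 \<noteq> 0" by auto
    define a' where "a' k l = a k l - a k l0 / a p l0 * a p l" for k l
    have "card S < card (R - {p})" using insert.prems insert.hyps p by simp
    with insert.IH[of "R - {p}" a'] insert.prems(1) obtain c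
      where c: "\<exists>k\<in>R - {p}. c k \<noteq> 0" "\<And>l. l \<in> S \<Longrightarrow> (\<Sum>k\<in>R - {p}. c k * a' k l) = 0" by auto
    define s where "s = (\<Sum>k\<in>R - {p}. c k * a k l0) / a p l0"
    define c' where "c' = c(p := - s)"
    have sum_c': "(\<Sum>k\<in>R. c' k * a k l) = - s * a p l + (\<Sum>k\<in>R - {p}. c k * a k l)" for l
    proof -
      have "(\<Sum>k\<in>R - {p}. c' k * a k l) = (\<Sum>k\<in>R - {p}. c k * a k l)"
        by (intro sum.cong) (auto simp: c'_def)
      then show ?thesis using insert.prems(1) p(1) by (simp add: sum.remove[of R p] c'_def)
    qed
    have "(\<Sum>k\<in>R. c' k * a k l) = 0" if "l \<in> insert l0 S" for l
    proof (cases "l = l0")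
      case True
      then show ?thesis unfolding sum_c' using p(2) by (simp add: s_def)
    next
      case False
      with that have "(\<Sum>k\<in>R - {p}. c k * a' k l) = 0" by (intro c(2)) auto
      moreover have "(\<Sum>k\<in>R - {p}. c k * a' k l) = (\<Sum>k\<in>R - {p}. c k * a k l) - s * a p l"
        by (simp add: a'_def s_def right_diff_distrib sum_subtractf sum_divide_distrib
            sum_distrib_right mult.assoc)
      ultimately show ?thesis unfolding sum_c' by simp
    qed
    moreover have "\<exists>k\<in>R. c' k \<noteq> 0" using c(1) by (auto simp: c'_def)
    ultimately show ?thesis by blast
  qed
qed

lemma spanned_imp_bound:
  assumes S: "finite S" and ind: "lin_indep X f {..<r}"
    and span: "\<And>k. k < r \<Longrightarrow> \<exists>a. \<forall>x\<in>X. f k x = (\<Sum>l\<in>S. a l * g l x)"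
  shows "r \<le> card S"
proof (rule ccontr)
  assume "\<not> r \<le> card S"
  obtain a where a: "\<And>k x. k < r \<Longrightarrow> x \<in> X \<Longrightarrow> f k x = (\<Sum>l\<in>S. a k l * g l x)"
    using span by metis
  obtain c where c: "\<exists>k\<in>{..<r}. c k \<noteq> 0" "\<forall>l\<in>S. (\<Sum>k<r. c k * a k l) = 0"
    using homogeneous_system_solution[of S "{..<r}" a] S \<open>\<not> r \<le> card S\<close> by auto
  have "(\<Sum>k<r. c k * f k x) = 0" if "x \<in> X" for x
  proof -
    have "(\<Sum>k<r. c k * f k x) = (\<Sum>k<r. \<Sum>l\<in>S. c k * a k l * g l x)"
      by (intro sum.cong refl) (simp add: a that sum_distrib_left mult.assoc)
    also have "\<dots> = (\<Sum>l\<in>S. (\<Sum>k<r. c k * a k l) * g l x)"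
      by (subst sum.swap) (simp add: sum_distrib_right)
    also have "\<dots> = 0" using c(2) by simp
    finally show ?thesis .
  qed
  with ind c(1) show False unfolding lin_indep_def by blast
qed

text \<open>A maximal independent family spans. This turns an upper bound for independent families into
generators of the space, which can then be multiplied by powers of a new coordinate.\<close>

lemma bound_imp_spanned:
  fixes X :: "'x set"
  assumes "\<And>r. many_indep X F r \<Longrightarrow> r \<le> B"
  shows "\<exists>r\<le>B. \<exists>g :: nat \<Rightarrow> 'x \<Rightarrow> complex. \<forall>f\<in>F. \<exists>a. \<forall>x\<in>X. f x = (\<Sum>l<r. a l * g l x)"
proof -
  have "many_indep X F 0" unfolding many_indep_def lin_indep_def by simp
  then obtain r where r: "many_indep X F r" and max: "\<And>r'. many_indep X F r' \<Longrightarrow> r' \<le> r"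
    using GreatestI_nat[of "many_indep X F" 0 B] Greatest_le_nat[of "many_indep X F" _ B] assms
    by blast
  obtain g :: "nat \<Rightarrow> 'x \<Rightarrow> complex" where g: "\<forall>k<r. g k \<in> F" "lin_indep X g {..<r}"
    using r unfolding many_indep_def by auto
  have "\<exists>a. \<forall>x\<in>X. f x = (\<Sum>l<r. a l * g l x)" if "f \<in> F" for f
  proof -
    have "\<not> lin_indep X (g(r := f)) {..<Suc r}"
    proof
      assume "lin_indep X (g(r := f)) {..<Suc r}"
      moreover have "\<forall>k<Suc r. (g(r := f)) k \<in> F" using g(1) that by (auto simp: less_Suc_eq)
      ultimately have "many_indep X F (Suc r)" unfolding many_indep_def by blast
      from max[OF this] show False by simp
    qed
    then obtain c k where c: "\<forall>x\<in>X. (\<Sum>k<Suc r. c k * (g(r := f)) k x) = 0" "k < Suc r" "c k \<noteq> 0"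
      unfolding lin_indep_def by auto
    have c': "c r * f x = - (\<Sum>k<r. c k * g k x)" if "x \<in> X" for x
    proof -
      have "(\<Sum>k<r. c k * (g(r := f)) k x) = (\<Sum>k<r. c k * g k x)" by (intro sum.cong) auto
      then show ?thesis using bspec[OF c(1) that] by (simp add: eq_neg_iff_add_eq_0 add.commute)
    qed
    have "c r \<noteq> 0"
    proof
      assume "c r = 0"
      then have "\<forall>x\<in>X. (\<Sum>k<r. c k * g k x) = 0" using c' by simp
      then have "\<forall>k<r. c k = 0" using g(2) unfolding lin_indep_def by blast
      with c(2,3) \<open>c r = 0\<close> show False by (auto simp: less_Suc_eq)
    qed
    then have "f x = (\<Sum>l<r. (- c l / c r) * g l x)" if "x \<in> X" for x
    proof -
      have "(\<Sum>l<r. (- c l / c r) * g l x) = - (\<Sum>l<r. c l * g l x) / c r"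
        by (simp add: sum_negf sum_divide_distrib)
      also have "\<dots> = f x" unfolding c'[OF that, symmetric] using \<open>c r \<noteq> 0\<close> by simp
      finally show ?thesis by simp
    qed
    then show ?thesis by (intro exI[of _ "\<lambda>l. - c l / c r"]) blast
  qed
  with assms[OF r] show ?thesis by blast
qed

subsection \<open>Products with an affine space\<close>

definition product_gens ::
  "('x \<Rightarrow> complex) set \<Rightarrow> 'j set \<Rightarrow> ('x \<times> ('j \<Rightarrow> complex) \<Rightarrow> complex) set" where
  "product_gens G J = (\<lambda>g p. g (fst p)) ` G \<union> (\<lambda>j p. snd p j) ` J"

lemma product_gens_update:
  assumes "f \<in> polys (product_gens G J) n" "j \<notin> J"
  shows "f (x, w(j := t)) = f (x, w)"
  using assms(1)
proof induction
  case (gen g n)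
  then show ?case using assms(2) unfolding product_gens_def by auto
qed auto

lemma sum_delta_power:
  fixes t :: complex
  shows "(\<Sum>l\<le>n. (if l = i then c else 0) * t ^ l) = (if i \<le> n then c * t ^ i else 0)"
proof -
  have "(if l = i then c else 0) * t ^ l = (if l = i then c * t ^ i else 0)" for l by simp
  then show ?thesis by simp
qed

text \<open>Expansion in powers of the new coordinate. The number of terms and the degree of the coefficients
are both bounded by the degree, which makes the two growth estimates below possible.\<close>

lemma polys_product_insert:
  fixes G :: "('x \<Rightarrow> complex) set" and j :: 'j
  assumes "f \<in> polys (product_gens G (insert j J)) n"
  shows "\<exists>Q. (\<forall>l. Q l \<in> polys (product_gens G J) n) \<and> (\<forall>l>n. \<forall>p. Q l p = 0) \<and>
    (\<forall>p. f p = (\<Sum>l\<le>n. Q l p * snd p j ^ l))"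
  using assms
proof induction
  case (const c n)
  let ?Q = "\<lambda>l (p :: 'x \<times> ('j \<Rightarrow> complex)). if l = 0 then c else (0 :: complex)"
  have "(\<Sum>l\<le>n. (if l = 0 then c else 0) * t ^ l) = c" for t :: complex
      using sum_delta_power by simp
  moreover have "?Q l \<in> polys (product_gens G J) n" for l by (cases "l = 0") (auto intro: polys_const)
  ultimately show ?case by (intro exI[of _ ?Q] conjI allI impI) (auto intro: polys_const)
next
  case (gen g n)
  show ?case
  proof (cases "g = (\<lambda>p. snd p j)")
    case True
    let ?Q = "\<lambda>l (p :: 'x \<times> ('j \<Rightarrow> complex)). if l = 1 then 1 else (0 :: complex)"
    have "(\<Sum>l\<le>Suc n. (if l = 1 then 1 else 0) * t ^ l) = t" for t :: complex
      using sum_delta_power by simp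
    moreover have "?Q l \<in> polys (product_gens G J) (Suc n)" for l
      by (cases "l = 1") (auto intro: polys_const)
    ultimately show ?thesis by (intro exI[of _ ?Q] conjI allI impI) (auto simp: True simp del: sum.atMost_Suc intro: polys_const)
  next
    case False
    with gen have g: "g \<in> product_gens G J" unfolding product_gens_def by auto
    let ?Q = "\<lambda>l (p :: 'x \<times> ('j \<Rightarrow> complex)). if l = 0 then g p else (0 :: complex)"
    have "(\<Sum>l\<le>Suc n. (if l = 0 then g p else 0) * t ^ l) = g p" for t :: complex and p
      using sum_delta_power by simp
    moreover have "?Q l \<in> polys (product_gens G J) (Suc n)" for l
      using g by (cases "l = 0") (auto intro: polys_const polys_gen)
    ultimately show ?thesis by (intro exI[of _ ?Q] conjI allI impI) auto
  qed
next
  case (add f n g)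
  from add.IH(1) obtain Q where
    "\<forall>l. Q l \<in> polys (product_gens G J) n" "\<forall>l>n. \<forall>p. Q l p = 0"
    "\<forall>p. f p = (\<Sum>l\<le>n. Q l p * snd p j ^ l)" by blast
  moreover from add.IH(2) obtain Q' where
    "\<forall>l. Q' l \<in> polys (product_gens G J) n" "\<forall>l>n. \<forall>p. Q' l p = 0"
    "\<forall>p. g p = (\<Sum>l\<le>n. Q' l p * snd p j ^ l)" by blast
  ultimately show ?case
    by (intro exI[of _ "\<lambda>l p. Q l p + Q' l p"])
      (auto intro: polys_add simp: sum.distrib distrib_right)
next
  case (mult f n g m)
  from mult.IH(1) obtain Q where Q: "\<forall>l. Q l \<in> polys (product_gens G J) n" "\<forall>l>n. \<forall>p. Q l p = 0"
    "\<forall>p. f p = (\<Sum>l\<le>n. Q l p * snd p j ^ l)" by blast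
  from mult.IH(2) obtain Q' where Q': "\<forall>l. Q' l \<in> polys (product_gens G J) m" "\<forall>l>m. \<forall>p. Q' l p = 0"
    "\<forall>p. g p = (\<Sum>l\<le>m. Q' l p * snd p j ^ l)" by blast
  let ?P = "\<lambda>l p. \<Sum>k\<le>l. Q k p * Q' (l - k) p"
  have "?P l \<in> polys (product_gens G J) (n + m)" for l
    using Q(1) Q'(1) by (intro polys_sum polys_mult) auto
  moreover have "?P l p = 0" if "l > n + m" for l p
  proof (rule sum.neutral, rule ballI)
    fix k assume "k \<in> {..l}"
    show "Q k p * Q' (l - k) p = 0"
    proof (cases "k > n")
      case True
      then show ?thesis using Q(2)[rule_format, of k p] by simp
    next
      case False
      then have "l - k > m" using that by simp
      then show ?thesis using Q'(2)[rule_format, of "l - k" p] by simp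
    qed
  qed
  moreover have "f p * g p = (\<Sum>l\<le>n + m. ?P l p * snd p j ^ l)" for p
    unfolding Q(3)[rule_format] Q'(3)[rule_format]
    using Q(2) Q'(2) by (intro polynomial_product) (auto simp del: split_paired_All)
  ultimately show ?case by (intro exI[of _ ?P]) auto
qed

lemma growth_ge_product_insert:
  fixes Z :: "'x set"
  assumes "j \<notin> J" "growth_ge (Z \<times> UNIV) (product_gens G J) d"
  shows "growth_ge (Z \<times> UNIV) (product_gens G (insert j J)) (Suc d)"
proof -
  obtain a where a: "\<And>n. many_indep (Z \<times> UNIV) (polys (product_gens G J) (a * n)) (n ^ d)"
    using assms(2) unfolding growth_ge_def by auto
  have up: "f \<in> polys (product_gens G (insert j J)) n" if "f \<in> polys (product_gens G J) n" for f n
    using that by induction (auto simp: product_gens_def intro: polys_intros)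
  have "many_indep (Z \<times> UNIV) (polys (product_gens G (insert j J)) ((1 + a) * n)) (n ^ Suc d)" for n
  proof -
    obtain q :: "nat \<Rightarrow> 'x \<times> ('a \<Rightarrow> complex) \<Rightarrow> complex"
      where q: "\<forall>k<n^d. q k \<in> polys (product_gens G J) (a * n)" "lin_indep (Z \<times> UNIV) q {..<n^d}"
      using a[of n] unfolding many_indep_def by auto
    let ?K = "{..<n} \<times> {..<n^d}"
    let ?f = "\<lambda>lk p. snd p j ^ fst lk * q (snd lk) p"
    have "many_indep (Z \<times> UNIV) (polys (product_gens G (insert j J)) ((1 + a) * n)) (card ?K)"
    proof (rule many_indepI)
      fix lk assume lk: "lk \<in> ?K"
      have "(\<lambda>p. snd p j) \<in> polys (product_gens G (insert j J)) 1"
        using polys_gen[of "\<lambda>p. snd p j" "product_gens G (insert j J)" 0]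
        by (simp add: product_gens_def)
      then have "?f lk \<in> polys (product_gens G (insert j J)) (fst lk * 1 + a * n)"
        using lk q(1) by (intro polys_mult polys_power[OF \<open>_ \<in> polys _ 1\<close>] up) auto
      then show "?f lk \<in> polys (product_gens G (insert j J)) ((1 + a) * n)"
        by (rule polys_mono) (use lk in \<open>auto simp: algebra_simps\<close>)
    next
      show "lin_indep (Z \<times> UNIV) ?f ?K"
        unfolding lin_indep_def
      proof (intro allI impI)
        fix c assume c: "\<forall>p\<in>Z \<times> UNIV. (\<Sum>lk\<in>?K. c lk * ?f lk p) = 0"
        have "(\<Sum>k<n^d. c (l, k) * q k p) = 0" if l: "l < n" and p: "p \<in> Z \<times> UNIV" for l p
        proof -
          obtain x w where xw: "p = (x, w)" by (cases p)
          have "(\<Sum>l<n. (\<Sum>k<n^d. c (l, k) * q k p) * t ^ l) = 0" for t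
          proof -
            have "(x, w(j := t)) \<in> Z \<times> UNIV" using p xw by simp
            then have "(\<Sum>lk\<in>?K. c lk * ?f lk (x, w(j := t))) = 0" using c by blast
            moreover have "(\<Sum>lk\<in>?K. c lk * ?f lk (x, w(j := t)))
              = (\<Sum>l<n. (\<Sum>k<n^d. c (l, k) * q k p) * t ^ l)"
              unfolding sum_distrib_right sum.cartesian_product
              using q(1) by (intro sum.cong refl)
                (auto simp: xw product_gens_update[OF _ assms(1)])
            ultimately show ?thesis by simp
          qed
          then have "\<forall>t. (\<Sum>l\<le>n - 1. (\<Sum>k<n^d. c (l, k) * q k p) * t ^ l) = 0"
            using l by (auto simp: lessThan_Suc_atMost[symmetric])
          then show ?thesis using l polyfun_eq_0[of "\<lambda>l. \<Sum>k<n^d. c (l, k) * q k p" "n - 1"] by auto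
        qed
        then have "\<forall>k<n^d. c (l, k) = 0" if "l < n" for l
          using q(2) that unfolding lin_indep_def by (auto dest: spec[of _ "\<lambda>k. c (l, k)"])
        then show "\<forall>lk\<in>?K. c lk = 0" by auto
      qed
    qed simp
    then show ?thesis by simp
  qed
  then show ?thesis unfolding growth_ge_def by blast
qed

lemma growth_le_product_insert:
  fixes Z :: "'x set"
  assumes "growth_le (Z \<times> UNIV) (product_gens G J) d"
  shows "growth_le (Z \<times> UNIV) (product_gens G (insert j J)) (Suc d)"
proof -
  obtain b where b: "\<And>n r. many_indep (Z \<times> UNIV) (polys (product_gens G J) n) r
      \<Longrightarrow> r \<le> b * (n + 1) ^ d"
    using assms unfolding growth_le_def by auto
  have "r \<le> b * (n + 1) ^ Suc d"
    if ind: "many_indep (Z \<times> UNIV) (polys (product_gens G (insert j J)) n) r" for n r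
  proof -
    obtain s and g :: "nat \<Rightarrow> 'x \<times> ('a \<Rightarrow> complex) \<Rightarrow> complex" where s: "s \<le> b * (n + 1) ^ d"
      and g: "\<And>f. f \<in> polys (product_gens G J) n
        \<Longrightarrow> \<exists>a. \<forall>p\<in>Z \<times> UNIV. f p = (\<Sum>l<s. a l * g l p)"
      using bound_imp_spanned[of "Z \<times> (UNIV :: ('a \<Rightarrow> complex) set)"
          "polys (product_gens G J) n", OF b] by blast
    obtain f :: "nat \<Rightarrow> 'x \<times> ('a \<Rightarrow> complex) \<Rightarrow> complex"
      where f: "\<forall>k<r. f k \<in> polys (product_gens G (insert j J)) n" "lin_indep (Z \<times> UNIV) f {..<r}"
      using ind unfolding many_indep_def by auto
    let ?S = "{..n} \<times> {..<s}"
    have "r \<le> card ?S"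
    proof (rule spanned_imp_bound[OF _ f(2), where g = "\<lambda>il p. snd p j ^ fst il * g (snd il) p"])
      fix k assume "k < r"
      then obtain Q where Q: "\<forall>l. Q l \<in> polys (product_gens G J) n"
        "\<forall>p. f k p = (\<Sum>l\<le>n. Q l p * snd p j ^ l)"
        using polys_product_insert[OF f(1)[rule_format]] by blast
      then have "\<forall>l. \<exists>a. \<forall>p\<in>Z \<times> UNIV. Q l p = (\<Sum>i<s. a i * g i p)" using g by blast
      from choice[OF this] obtain A
        where A: "\<And>l p. p \<in> Z \<times> UNIV \<Longrightarrow> Q l p = (\<Sum>i<s. A l i * g i p)" by blast
      have "f k p = (\<Sum>il\<in>?S. A (fst il) (snd il) * (snd p j ^ fst il * g (snd il) p))"
        if "p \<in> Z \<times> UNIV" for p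
      proof -
        have "f k p = (\<Sum>l\<le>n. (\<Sum>i<s. A l i * g i p) * snd p j ^ l)"
          unfolding Q(2)[rule_format] by (intro sum.cong refl) (simp add: A[OF that])
        also have "\<dots> = (\<Sum>il\<in>?S. A (fst il) (snd il) * (snd p j ^ fst il * g (snd il) p))"
          unfolding sum_distrib_right sum.cartesian_product by (intro sum.cong refl) auto
        finally show ?thesis .
      qed
      then show "\<exists>a. \<forall>p\<in>Z \<times> UNIV. f k p =
          (\<Sum>il\<in>?S. a il * (snd p j ^ fst il * g (snd il) p))"
        by (intro exI[of _ "\<lambda>il. A (fst il) (snd il)"]) auto
    qed simp
    also have "card ?S = s * (n + 1)" by simp
    also have "\<dots> \<le> b * (n + 1) ^ d * (n + 1)" using s by (rule mult_right_mono) simp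
    finally show ?thesis by (simp add: algebra_simps)
  qed
  then show ?thesis unfolding growth_le_def by blast
qed

text \<open>Every further coordinate multiplies the number of independent functions of degree \<open>n\<close> by about \<open>n\<close>,
hence raises the exponent by one.\<close>

lemma growth_product:
  fixes Z :: "'x set" and J :: "'j set"
  assumes "finite J" "finite G"
  shows growth_ge_product: "growth_ge Z G d \<Longrightarrow> growth_ge (Z \<times> UNIV) (product_gens G J) (d + card J)"
    and growth_le_product: "growth_le Z G d \<Longrightarrow> growth_le (Z \<times> UNIV) (product_gens G J) (d + card J)"
proof -
  show "growth_ge (Z \<times> UNIV) (product_gens G J) (d + card J)" if ge: "growth_ge Z G d"
    using assms(1)
  proof induction
    case empty
    have "growth_ge (Z \<times> (UNIV :: ('j \<Rightarrow> complex) set)) (product_gens G {}) d"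
    proof (rule growth_ge_pullback[OF _ assms(2) _ ge])
      show "(\<lambda>p. g (fst p)) \<in> all_polys (product_gens G {})" if "g \<in> G" for g
        using that by (intro all_polys_gen) (auto simp: product_gens_def)
    qed auto
    then show ?case by simp
  qed (simp add: growth_ge_product_insert)
  show "growth_le (Z \<times> UNIV) (product_gens G J) (d + card J)" if le: "growth_le Z G d"
    using assms(1)
  proof induction
    case empty
    have "growth_le (Z \<times> (UNIV :: ('j \<Rightarrow> complex) set)) (product_gens G {}) d"
    proof -
      have *: "many_indep Z (polys G n) r"
        if "many_indep (Z \<times> (UNIV :: ('j \<Rightarrow> complex) set)) (polys (product_gens G {}) n) r" for n r
      proof -
        have inv: "f (x, w) = f (x, w')" "(\<lambda>x. f (x, w)) \<in> polys G n"
          if "f \<in> polys (product_gens G {}) n"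
          for f :: "'x \<times> ('j \<Rightarrow> complex) \<Rightarrow> complex" and n x w w'
          using that by induction (auto simp: product_gens_def intro: polys_intros)
        obtain f :: "nat \<Rightarrow> 'x \<times> ('j \<Rightarrow> complex) \<Rightarrow> complex" where
          f: "\<forall>k<r. f k \<in> polys (product_gens G {}) n" "lin_indep (Z \<times> UNIV) f {..<r}"
          using \<open>many_indep _ _ r\<close> unfolding many_indep_def by auto
        have "lin_indep Z (\<lambda>k x. f k (x, \<lambda>_. 0)) {..<r}"
          unfolding lin_indep_def
        proof (intro allI impI)
          fix c assume c: "\<forall>x\<in>Z. (\<Sum>k<r. c k * f k (x, \<lambda>_. 0)) = 0"
          have "(\<Sum>k<r. c k * f k p) = 0" if "p \<in> Z \<times> UNIV" for p
          proof -
            obtain x w where p: "p = (x, w)" "x \<in> Z" using \<open>p \<in> _\<close> by auto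
            have "(\<Sum>k<r. c k * f k p) = (\<Sum>k<r. c k * f k (x, \<lambda>_. 0))"
              unfolding p(1) using f(1) by (intro sum.cong refl arg_cong2[where f = "(*)"] inv(1)) auto
            then show ?thesis using c p(2) by simp
          qed
          then show "\<forall>k\<in>{..<r}. c k = 0" using f(2) unfolding lin_indep_def by blast
        qed
        then show ?thesis using f(1) inv(2) unfolding many_indep_def
          by (intro exI[of _ "\<lambda>k x. f k (x, \<lambda>_. 0)"]) auto
      qed
      then show ?thesis using le unfolding growth_le_def by blast
    qed
    then show ?case by simp
  qed (simp add: growth_le_product_insert)
qed

lemma growth_point:
  fixes x :: 'x
  shows growth_ge_point: "growth_ge {x} G 0" and growth_le_point: "growth_le {x} G 0"
proof -
  have "many_indep {x} (polys G n) 1" for n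
    unfolding many_indep_def lin_indep_def
    by (intro exI[of _ "\<lambda>_ _. 1"]) (auto intro: polys_const)
  then show "growth_ge {x} G 0" unfolding growth_ge_def by simp
  have "r \<le> 1" if indep: "many_indep {x} F r" for F r
  proof -
    obtain f :: "nat \<Rightarrow> 'x \<Rightarrow> complex" where f: "lin_indep {x} f {..<r}"
      using indep unfolding many_indep_def by blast
    have "r \<le> card {0 :: nat}"
      by (rule spanned_imp_bound[OF _ f, where g = "\<lambda>_ _. 1"]) auto
    then show ?thesis by simp
  qed
  then show "growth_le {x} G 0" unfolding growth_le_def by (auto intro!: exI[of _ 1])
qed

section \<open>Rank factorisations of matrices\<close>

text \<open>Matrix identities with the dimensions as equations between \<^const>\<open>dim_row\<close> and \<^const>\<open>dim_col\<close>. Unlike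
the versions with carriers, which leave the inner dimensions to be guessed, they are conditional
rewrite rules whose hypotheses the simplifier can discharge.\<close>

lemma mult_assoc_dim:
  fixes A :: "'a :: semiring_0 mat"
  assumes "dim_col A = dim_row B" "dim_col B = dim_row C"
  shows "(A * B) * C = A * (B * C)"
  by (rule assoc_mult_mat[of A "dim_row A" "dim_col A" B "dim_col B" C "dim_col C"]) (use assms in auto)

lemma mult_add_dim:
  fixes A :: "'a :: semiring_0 mat"
  assumes "dim_col A = dim_row B" "dim_row B = dim_row C" "dim_col B = dim_col C"
  shows "A * (B + C) = A * B + A * C"
  by (rule mult_add_distrib_mat[of A "dim_row A" "dim_col A" B "dim_col B" C]) (use assms in auto)

lemma add_mult_dim:
  fixes A :: "'a :: semiring_0 mat"
  assumes "dim_row A = dim_row B" "dim_col A = dim_col B" "dim_col B = dim_row C"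
  shows "(A + B) * C = A * C + B * C"
  by (rule add_mult_distrib_mat[of A "dim_row A" "dim_col A" B C "dim_col C"]) (use assms in auto)

lemma mult_minus_dim:
  fixes A :: "'a :: ring mat"
  assumes "dim_col A = dim_row B" "dim_row B = dim_row C" "dim_col B = dim_col C"
  shows "A * (B - C) = A * B - A * C"
  by (rule mult_minus_distrib_mat[of A "dim_row A" "dim_col A" B "dim_col B" C]) (use assms in auto)

lemma minus_mult_dim:
  fixes A :: "'a :: ring mat"
  assumes "dim_row A = dim_row B" "dim_col A = dim_col B" "dim_col B = dim_row C"
  shows "(A - B) * C = A * C - B * C"
  by (rule minus_mult_distrib_mat[of A "dim_row A" "dim_col A" B C "dim_col C"]) (use assms in auto)

lemma one_mult_dim [simp]:
  fixes A :: "'a :: semiring_1 mat"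
  shows "dim_row A = n \<Longrightarrow> 1\<^sub>m n * A = A" and "dim_col A = n \<Longrightarrow> A * 1\<^sub>m n = A"
  by (metis carrier_matI left_mult_one_mat, metis carrier_matI right_mult_one_mat)

lemma zero_mult_dim [simp]:
  fixes A :: "'a :: semiring_0 mat"
  shows "dim_row A = k \<Longrightarrow> 0\<^sub>m n k * A = 0\<^sub>m n (dim_col A)"
    and "dim_col A = k \<Longrightarrow> A * 0\<^sub>m k n = 0\<^sub>m (dim_row A) n"
  by (metis carrier_matI left_mult_zero_mat, metis carrier_matI right_mult_zero_mat)

lemma smult_mult_dim:
  fixes A :: "'a :: comm_semiring_0 mat"
  assumes "dim_col A = dim_row B"
  shows "(k \<cdot>\<^sub>m A) * B = k \<cdot>\<^sub>m (A * B)" and "A * (k \<cdot>\<^sub>m B) = k \<cdot>\<^sub>m (A * B)"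
  by (rule mult_smult_assoc_mat[of A "dim_row A" "dim_col A" B "dim_col B"], use assms in auto)

lemma minus_self_dim [simp]:
  fixes A :: "'a :: group_add mat"
  shows "A - A = 0\<^sub>m (dim_row A) (dim_col A)"
  by (rule minus_r_inv_mat) auto

lemma add_zero_dim [simp]:
  fixes A :: "'a :: monoid_add mat"
  shows "dim_row A = n \<Longrightarrow> dim_col A = k \<Longrightarrow> A + 0\<^sub>m n k = A"
    and "dim_row A = n \<Longrightarrow> dim_col A = k \<Longrightarrow> 0\<^sub>m n k + A = A"
  by (intro right_add_zero_mat, auto)+

lemma minus_zero_dim [simp]:
  fixes A :: "'a :: group_add mat"
  shows "dim_row A = n \<Longrightarrow> dim_col A = k \<Longrightarrow> A - 0\<^sub>m n k = A"
  by (intro eq_matI) auto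

lemmas mat_algebra = mult_assoc_dim mult_add_dim add_mult_dim mult_minus_dim minus_mult_dim
  smult_mult_dim

lemma mult_assoc_left:
  fixes A :: "'a :: semiring_0 mat"
  assumes "A * B = C" "dim_col A = dim_row B" "dim_col B = dim_row X"
  shows "A * (B * X) = C * X"
  using assms mult_assoc_dim by metis

lemma mat_eq_minusI:
  fixes A C X :: "complex mat"
  assumes "X = A + C" "dim_row A = dim_row C" "dim_col A = dim_col C"
  shows "C = X - A"
  using assms by (intro eq_matI) auto

subsection \<open>Coordinate inclusions and projections\<close>

text \<open>For \<open>m \<le> n\<close>, \<open>incl n m\<close> is the inclusion of the first \<open>m\<close> coordinates and \<open>incl m n\<close> the projection to
them; \<open>coincl n m\<close> and \<open>coproj n m\<close> belong to the last \<open>n - m\<close> coordinates.\<close>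

definition incl :: "nat \<Rightarrow> nat \<Rightarrow> complex mat" where
  "incl n m = mat n m (\<lambda>(a, b). if a = b then 1 else 0)"

definition coincl :: "nat \<Rightarrow> nat \<Rightarrow> complex mat" where
  "coincl n m = mat n (n - m) (\<lambda>(a, b). if a = b + m then 1 else 0)"

definition coproj :: "nat \<Rightarrow> nat \<Rightarrow> complex mat" where
  "coproj n m = mat (n - m) n (\<lambda>(a, b). if b = a + m then 1 else 0)"

lemma incl_dims [simp]:
  "dim_row (incl n m) = n" "dim_col (incl n m) = m"
  "dim_row (coincl n m) = n" "dim_col (coincl n m) = n - m"
  "dim_row (coproj n m) = n - m" "dim_col (coproj n m) = n"
  by (simp_all add: incl_def coincl_def coproj_def)

lemma incl_carrier [simp]:
  "incl n m \<in> carrier_mat n m" "coincl n m \<in> carrier_mat n (n - m)"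
  "coproj n m \<in> carrier_mat (n - m) n"
  by (auto intro: carrier_matI)

lemma sum_delta_mult:
  fixes f g :: "nat \<Rightarrow> complex"
  assumes "\<And>k. k < n \<Longrightarrow> k \<noteq> i \<Longrightarrow> f k * g k = 0"
  shows "(\<Sum>k = 0..<n. f k * g k) = (if i < n then f i * g i else 0)"
proof -
  have "(\<Sum>k = 0..<n. f k * g k) = (\<Sum>k = 0..<n. if k = i then f i * g i else 0)"
    using assms by (intro sum.cong) auto
  then show ?thesis by simp
qed

lemma incl_incl [simp]: "m \<le> n \<Longrightarrow> incl m n * incl n m = 1\<^sub>m m"
proof (intro eq_matI)
  fix a b assume "m \<le> n" "a < dim_row (1\<^sub>m m :: complex mat)" "b < dim_col (1\<^sub>m m :: complex mat)"
  then show "(incl m n * incl n m) $$ (a, b) = 1\<^sub>m m $$ (a, b)"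
    by (auto simp: incl_def scalar_prod_def sum_delta_mult[of _ a])
qed auto

lemma coproj_coincl [simp]: "coproj n m * coincl n m = 1\<^sub>m (n - m)"
proof (intro eq_matI)
  fix a b assume "a < dim_row (1\<^sub>m (n - m) :: complex mat)" "b < dim_col (1\<^sub>m (n - m) :: complex mat)"
  then show "(coproj n m * coincl n m) $$ (a, b) = 1\<^sub>m (n - m) $$ (a, b)"
    by (auto simp: coincl_def coproj_def scalar_prod_def sum_delta_mult[of _ "a + m"])
qed auto

lemma incl_coincl [simp]: "incl m n * coincl n m = 0\<^sub>m m (n - m)"
  by (intro eq_matI) (auto simp: incl_def coincl_def scalar_prod_def)

lemma coproj_incl [simp]: "coproj n m * incl n m = 0\<^sub>m (n - m) m"
  by (intro eq_matI) (auto simp: incl_def coproj_def scalar_prod_def)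

lemma incl_coincl_sum [simp]:
  assumes "m \<le> n"
  shows "incl n m * incl m n + coincl n m * coproj n m = 1\<^sub>m n"
proof (intro eq_matI)
  fix a b assume ab: "a < dim_row (1\<^sub>m n :: complex mat)" "b < dim_col (1\<^sub>m n :: complex mat)"
  have "(incl n m * incl m n) $$ (a, b) = (if a = b \<and> a < m then 1 else 0)"
    using ab assms by (auto simp: incl_def scalar_prod_def sum_delta_mult[of _ a])
  moreover have "(coincl n m * coproj n m) $$ (a, b) = (if a = b \<and> \<not> a < m then 1 else 0)"
    using ab assms
    by (auto simp: coincl_def coproj_def scalar_prod_def sum_delta_mult[of _ "a - m"])
  ultimately show "(incl n m * incl m n + coincl n m * coproj n m) $$ (a, b) = 1\<^sub>m n $$ (a, b)"
    using ab by (simp del: index_mult_mat(1))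
qed auto

lemma incl_cancel:
  shows "m \<le> n \<Longrightarrow> dim_row X = m \<Longrightarrow> incl m n * (incl n m * X) = X"
    and "dim_row X = n - m \<Longrightarrow> coproj n m * (coincl n m * X) = X"
    and "dim_row X = n - m \<Longrightarrow> incl m n * (coincl n m * X) = 0\<^sub>m m (dim_col X)"
    and "dim_row X = m \<Longrightarrow> coproj n m * (incl n m * X) = 0\<^sub>m (n - m) (dim_col X)"
  by (simp_all add: mult_assoc_dim[symmetric])

subsection \<open>Factoring a matrix through its image\<close>

lemma left_inverse_imp_le:
  fixes P \<phi> :: "complex mat"
  assumes "P \<in> carrier_mat m n" "\<phi> \<in> carrier_mat n m" "P * \<phi> = 1\<^sub>m m"
  shows "m \<le> n"
proof (rule ccontr)
  assume "\<not> m \<le> n"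
  then obtain c where c: "\<exists>k\<in>{..<m}. c k \<noteq> 0" "\<forall>l\<in>{..<n}. (\<Sum>k<m. c k * \<phi> $$ (l, k)) = 0"
    using homogeneous_system_solution[of "{..<n}" "{..<m}" "\<lambda>k l. \<phi> $$ (l, k)"] by auto
  define u where "u = vec m c"
  have "\<phi> *\<^sub>v u = 0\<^sub>v n"
    using assms(2) c(2)
    by (intro eq_vecI) (auto simp: u_def scalar_prod_def mult.commute atLeast0LessThan)
  then have "P *\<^sub>v (\<phi> *\<^sub>v u) = 0\<^sub>v m" using assms(1) by (intro eq_vecI) auto
  moreover have "P *\<^sub>v (\<phi> *\<^sub>v u) = (P * \<phi>) *\<^sub>v u"
    using assoc_mult_mat_vec[of P m n \<phi> m u] assms(1,2) by (simp add: u_def)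
  ultimately have "u = 0\<^sub>v m" using assms(3) by (simp add: u_def)
  then have "c k = 0" if "k < m" for k
    using that by (metis index_vec index_zero_vec(1) u_def)
  then show False using c(1) by auto
qed

lemma inverse_pair_dims_eq:
  fixes A B :: "complex mat"
  assumes "A \<in> carrier_mat n k" "B \<in> carrier_mat k n" "A * B = 1\<^sub>m n" "B * A = 1\<^sub>m k"
  shows "n = k"
  using left_inverse_imp_le[of A n k B] left_inverse_imp_le[of B k n A] assms by simp

text \<open>The matrix \<open>M - M T P M\<close> is the Schur complement of the identity block. A nonzero entry of it
enlarges the block by one row and one column.\<close>

lemma one_larger_identity_block:
  fixes P T M :: "complex mat"
  assumes PMT: "P \<in> carrier_mat r n" "T \<in> carrier_mat w r" "M \<in> carrier_mat n w" "P * M * T = 1\<^sub>m r"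
    and ne: "M \<noteq> M * T * (P * M)"
  shows "\<exists>P' T'. P' \<in> carrier_mat (Suc r) n \<and> T' \<in> carrier_mat w (Suc r) \<and>
    P' * M * T' = 1\<^sub>m (Suc r)"
proof -
  note dims = carrier_matD[OF PMT(1)] carrier_matD[OF PMT(2)] carrier_matD[OF PMT(3)]
  define M' where "M' = M - M * T * (P * M)"
  have M': "M' \<in> carrier_mat n w" using PMT by (auto simp: M'_def)
  have "\<exists>p<n. \<exists>q<w. M' $$ (p, q) \<noteq> 0"
  proof (rule ccontr)
    assume *: "\<not> ?thesis"
    have "M = M * T * (P * M)"
    proof (intro eq_matI)
      fix a b assume "a < dim_row (M * T * (P * M))" "b < dim_col (M * T * (P * M))"
      then show "M $$ (a, b) = (M * T * (P * M)) $$ (a, b)"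
        using * dims by (auto simp: M'_def simp del: index_mult_mat(1))
    qed (use dims in auto)
    with ne show False by simp
  qed
  then obtain p q where pq: "p < n" "q < w" "M' $$ (p, q) \<noteq> 0" by blast
  \<comment> \<open>The new row and column are killed by \<open>M T\<close> and \<open>P M\<close>, and pair to a nonzero entry of the
    part of \<open>M\<close> that does not factor yet.\<close>
  define \<rho> where "\<rho> = mat 1 n (\<lambda>(a, b). if b = p then inverse (M' $$ (p, q)) else 0) * (1\<^sub>m n - M * T * P)"
  define \<tau> where "\<tau> = (1\<^sub>m w - T * (P * M)) * mat w 1 (\<lambda>(a, b). if a = q then 1 else 0)"
  have \<rho>: "dim_row \<rho> = 1" "dim_col \<rho> = n" and \<tau>: "dim_row \<tau> = w" "dim_col \<tau> = 1"
    using dims by (auto simp: \<rho>_def \<tau>_def)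
  have PMT': "P * (M * T) = 1\<^sub>m r" using PMT(4) dims by (simp add: mat_algebra)
  note PMTX = mult_assoc_left[OF PMT']
  have PMT2: "P * (M * (T * X)) = X" if "dim_row X = r" for X
    using PMTX[of X] that dims by (simp add: mat_algebra)
  have P\<tau>: "P * (M * \<tau>) = 0\<^sub>m r 1"
    unfolding \<tau>_def using dims by (simp add: mat_algebra PMT2)
  have \<rho>T: "\<rho> * (M * T) = 0\<^sub>m 1 r"
    unfolding \<rho>_def using dims by (simp add: mat_algebra PMT')
  have \<rho>\<tau>: "(\<rho> * (M * \<tau>)) $$ (0, 0) = 1"
  proof -
    let ?e = "mat 1 n (\<lambda>(a, b). if b = p then inverse (M' $$ (p, q)) else 0)"
    let ?f = "mat w 1 (\<lambda>(a, b). if a = q then 1 else 0)"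
    have "\<rho> * (M * \<tau>) = ?e * (M' * ?f)"
      unfolding \<rho>_def \<tau>_def M'_def using dims by (simp add: mat_algebra PMT2)
    moreover have "(M' * ?f) $$ (a, 0) = M' $$ (a, q)" if "a < n" for a
      using that M' pq(2) by (auto simp: scalar_prod_def sum_delta_mult[of _ q])
    moreover have "(?e * (M' * ?f)) $$ (0, 0) = inverse (M' $$ (p, q)) * (M' * ?f) $$ (p, 0)"
    proof -
      define Y where "Y = M' * ?f"
      have Y: "dim_row Y = n" "dim_col Y = 1" using M' by (auto simp: Y_def)
      show ?thesis
        unfolding Y_def[symmetric] using Y pq(1)
        by (simp add: scalar_prod_def sum_delta_mult[of _ p])
    qed
    ultimately show ?thesis using pq by simp
  qed
  define P' where "P' = mat (Suc r) n (\<lambda>(a, b). if a < r then P $$ (a, b) else \<rho> $$ (0, b))"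
  define T' where "T' = mat w (Suc r) (\<lambda>(a, b). if b < r then T $$ (a, b) else \<tau> $$ (a, 0))"
  have MT': "(M * T') $$ (a, b) = (if b < r then (M * T) $$ (a, b) else (M * \<tau>) $$ (a, 0))"
    if "a < n" "b < Suc r" for a b
    using that dims \<tau> by (auto simp: T'_def scalar_prod_def)
  have "P' * (M * T') = 1\<^sub>m (Suc r)"
  proof (intro eq_matI)
    fix a b assume "a < dim_row (1\<^sub>m (Suc r) :: complex mat)" "b < dim_col (1\<^sub>m (Suc r) :: complex mat)"
    then have ab: "a < Suc r" "b < Suc r" by auto
    have "(P' * (M * T')) $$ (a, b) = (\<Sum>k = 0..<n. P' $$ (a, k) * (M * T') $$ (k, b))"
      using ab dims by (simp add: scalar_prod_def P'_def T'_def)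
    also have "\<dots> = (\<Sum>k = 0..<n. (if a < r then P $$ (a, k) else \<rho> $$ (0, k)) *
        (if b < r then (M * T) $$ (k, b) else (M * \<tau>) $$ (k, 0)))"
      using ab dims MT' by (intro sum.cong) (auto simp: P'_def simp del: index_mult_mat(1))
    also have "\<dots> = (if a < r then if b < r then (P * (M * T)) $$ (a, b) else (P * (M * \<tau>)) $$ (a, 0)
        else if b < r then (\<rho> * (M * T)) $$ (0, b) else (\<rho> * (M * \<tau>)) $$ (0, 0))"
    proof -
      have e: "(X * Y) $$ (i, j) = (\<Sum>k = 0..<n. X $$ (i, k) * Y $$ (k, j))"
        if "dim_col X = n" "dim_row Y = n" "i < dim_row X" "j < dim_col Y"
        for X Y :: "complex mat" and i j
        using that by (simp add: scalar_prod_def)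
      show ?thesis using dims \<rho> \<tau> ab by (auto simp: e simp del: index_mult_mat(1))
    qed
    also have "\<dots> = 1\<^sub>m (Suc r) $$ (a, b)"
      using ab by (auto simp: PMT' P\<tau> \<rho>T \<rho>\<tau> less_Suc_eq)
    finally show "(P' * (M * T')) $$ (a, b) = 1\<^sub>m (Suc r) $$ (a, b)" .
  qed (auto simp: P'_def T'_def)
  moreover have "P' * M * T' = P' * (M * T')" using dims by (simp add: mat_algebra P'_def T'_def)
  moreover have "P' \<in> carrier_mat (Suc r) n" "T' \<in> carrier_mat w (Suc r)"
    by (auto simp: P'_def T'_def)
  ultimately show ?thesis by auto
qed

text \<open>Both bounds for the rank are witnessed by matrices. Keeping the witnesses \<open>P\<close> and \<open>T\<close> constant while
\<open>M\<close> varies gives charts of the determinantal varieties.\<close>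

definition rank_ge :: "nat \<Rightarrow> complex mat \<Rightarrow> bool" where
  "rank_ge r M \<longleftrightarrow> (\<exists>P T. P \<in> carrier_mat r (dim_row M) \<and> T \<in> carrier_mat (dim_col M) r \<and>
     P * M * T = 1\<^sub>m r)"

definition rank_le :: "nat \<Rightarrow> complex mat \<Rightarrow> bool" where
  "rank_le r M \<longleftrightarrow> (\<exists>\<phi> A. \<phi> \<in> carrier_mat (dim_row M) r \<and> A \<in> carrier_mat r (dim_col M) \<and>
     M = \<phi> * A)"

lemma rank_ge_imp_le:
  assumes "rank_ge r M" "rank_le m M"
  shows "r \<le> m"
proof -
  obtain P T where PT: "P \<in> carrier_mat r (dim_row M)" "T \<in> carrier_mat (dim_col M) r" "P * M * T = 1\<^sub>m r"
    using assms(1) unfolding rank_ge_def by blast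
  obtain \<phi> A where \<phi>: "\<phi> \<in> carrier_mat (dim_row M) m" "A \<in> carrier_mat m (dim_col M)" "M = \<phi> * A"
    using assms(2) unfolding rank_le_def by blast
  note dims = carrier_matD[OF PT(1)] carrier_matD[OF PT(2)] carrier_matD[OF \<phi>(1)] carrier_matD[OF \<phi>(2)]
  have "(P * \<phi>) * (A * T) = P * (\<phi> * A) * T"
    using dims by (simp add: mat_algebra)
  then have "(P * \<phi>) * (A * T) = 1\<^sub>m r" using PT(3) \<phi>(3) by simp
  then show ?thesis by (rule left_inverse_imp_le[rotated 2]) (use dims in auto)
qed

lemma rank_ge_right_inverse:
  assumes A: "A \<in> carrier_mat m w" and rank: "rank_ge m A"
  shows "\<exists>T. T \<in> carrier_mat w m \<and> A * T = 1\<^sub>m m"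
proof -
  obtain P T where PT: "P \<in> carrier_mat m m" "T \<in> carrier_mat w m" "P * A * T = 1\<^sub>m m"
    using rank A unfolding rank_ge_def by auto
  note dims = carrier_matD[OF PT(1)] carrier_matD[OF PT(2)] carrier_matD[OF A]
  have "(A * T) * P = 1\<^sub>m m"
    by (rule mat_mult_left_right_inverse[OF PT(1)]) (use PT dims in \<open>auto simp: mult_assoc_dim\<close>)
  then have "A * (T * P) = 1\<^sub>m m" using dims by (simp add: mult_assoc_dim)
  moreover have "T * P \<in> carrier_mat w m" using PT by auto
  ultimately show ?thesis by blast
qed

lemma rank_le_dims: "rank_le (dim_row M) M"
  unfolding rank_le_def by (intro exI[of _ "1\<^sub>m (dim_row M)"] exI[of _ M]) auto

lemma rank_factorization:
  fixes M :: "complex mat"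
  assumes M: "M \<in> carrier_mat n w"
  shows "\<exists>r P T. P \<in> carrier_mat r n \<and> T \<in> carrier_mat w r \<and> P * M * T = 1\<^sub>m r \<and> M = M * T * (P * M)"
proof -
  have "rank_ge 0 M"
    unfolding rank_ge_def
    by (intro exI[of _ "0\<^sub>m 0 (dim_row M)"] exI[of _ "0\<^sub>m (dim_col M) 0"]) auto
  then obtain r where r: "rank_ge r M" and max: "\<And>r'. rank_ge r' M \<Longrightarrow> r' \<le> r"
    using GreatestI_nat[of "\<lambda>r. rank_ge r M" 0 n] Greatest_le_nat[of "\<lambda>r. rank_ge r M" _ n]
      rank_ge_imp_le[OF _ rank_le_dims] M by auto
  obtain P T where PT: "P \<in> carrier_mat r n" "T \<in> carrier_mat w r" "P * M * T = 1\<^sub>m r"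
    using r M unfolding rank_ge_def by auto
  have "M = M * T * (P * M)"
  proof (rule ccontr)
    assume "M \<noteq> M * T * (P * M)"
    from one_larger_identity_block[OF PT(1,2) M PT(3) this] M have "rank_ge (Suc r) M"
      unfolding rank_ge_def by auto
    from max[OF this] show False by simp
  qed
  with PT show ?thesis by blast
qed

lemma rank_exists: "\<exists>r. rank_ge r M \<and> rank_le r M"
proof -
  obtain r P T where "P \<in> carrier_mat r (dim_row M)" "T \<in> carrier_mat (dim_col M) r"
    "P * M * T = 1\<^sub>m r" "M = M * T * (P * M)"
    using rank_factorization[of M "dim_row M" "dim_col M"] by auto
  then have "rank_ge r M" "rank_le r M"
    unfolding rank_ge_def rank_le_def by (blast, intro exI[of _ "M * T"] exI[of _ "P * M"]) auto
  then show ?thesis by blast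
qed

text \<open>A matrix of rank at most \<open>m\<close> with an invertible block \<open>P M T\<close> is determined by \<open>P M\<close> and \<open>M T\<close>; the
matrix \<open>M T (P M T)\<^sup>-\<^sup>1\<close> is the basis of its image that is normalised by \<open>P\<close>.\<close>

lemma factor_through_chart:
  assumes M: "M \<in> carrier_mat n w" "rank_le m M"
    and PT: "P \<in> carrier_mat m n" "T \<in> carrier_mat w m"
    and D: "D \<in> carrier_mat m m" "D * (P * M * T) = 1\<^sub>m m"
  shows "M = M * T * D * (P * M)" "P * (M * T * D) = 1\<^sub>m m"
proof -
  obtain \<phi> A where \<phi>: "\<phi> \<in> carrier_mat n m" "A \<in> carrier_mat m w" "M = \<phi> * A"
    using M unfolding rank_le_def by auto
  note dims = carrier_matD[OF M(1)] carrier_matD[OF PT(1)] carrier_matD[OF PT(2)]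
    carrier_matD[OF D(1)] carrier_matD[OF \<phi>(1)] carrier_matD[OF \<phi>(2)]
  have sq: "X * Y = 1\<^sub>m m \<Longrightarrow> Y * X = 1\<^sub>m m" if "X \<in> carrier_mat m m" "Y \<in> carrier_mat m m"
    for X Y :: "complex mat"
    using mat_mult_left_right_inverse[OF that] by auto
  have "(D * (P * \<phi>)) * (A * T) = 1\<^sub>m m"
    using D(2) unfolding \<phi>(3) using dims by (simp add: mat_algebra)
  then have "(A * T) * (D * (P * \<phi>)) = 1\<^sub>m m"
    by (rule sq[rotated 2]) (use dims in auto)
  then have 1: "A * (T * (D * (P * \<phi>))) = 1\<^sub>m m" using dims by (simp add: mat_algebra)
  have "M * T * D * (P * M) = \<phi> * ((A * (T * (D * (P * \<phi>)))) * A)"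
    unfolding \<phi>(3) using dims by (simp add: mat_algebra)
  also have "\<dots> = M" unfolding 1 \<phi>(3) using dims by simp
  finally show "M = M * T * D * (P * M)" by simp
  have "(P * M * T) * D = 1\<^sub>m m" by (rule sq[OF D(1) _ D(2)]) (use dims in auto)
  then show "P * (M * T * D) = 1\<^sub>m m" using dims by (simp add: mat_algebra)
qed

text \<open>The columns of \<open>\<phi>\<close> are completed by a basis of the kernel of \<open>P\<close>, the image of the idempotent
\<open>1 - \<phi> P\<close>.\<close>

lemma complete_to_invertible:
  fixes P \<phi> :: "complex mat"
  assumes P: "P \<in> carrier_mat m n" and \<phi>: "\<phi> \<in> carrier_mat n m" and P\<phi>: "P * \<phi> = 1\<^sub>m m"
  shows "\<exists>g g'. g \<in> carrier_mat n n \<and> g' \<in> carrier_mat n n \<and> g * g' = 1\<^sub>m n \<and> g' * g = 1\<^sub>m n \<and>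
    g * incl n m = \<phi> \<and> incl m n * g' = P"
proof -
  have mn: "m \<le> n" by (rule left_inverse_imp_le[OF P \<phi> P\<phi>])
  define e where "e = 1\<^sub>m n - \<phi> * P"
  have e: "e \<in> carrier_mat n n" using P \<phi> by (auto simp: e_def)
  obtain s Q T where Q: "Q \<in> carrier_mat s n" "T \<in> carrier_mat n s" "Q * e * T = 1\<^sub>m s"
    "e = e * T * (Q * e)"
    using rank_factorization[OF e] by blast
  note dims = carrier_matD[OF P] carrier_matD[OF \<phi>] carrier_matD[OF Q(1)] carrier_matD[OF Q(2)]
    carrier_matD[OF e]
  note P\<phi>X = mult_assoc_left[OF P\<phi>]
  have Pe: "P * e = 0\<^sub>m m n" "e * \<phi> = 0\<^sub>m n m" "e * e = e"
    using dims by (simp_all add: e_def mat_algebra P\<phi> P\<phi>X)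
  define G where "G = e * T"
  define R where "R = Q * e"
  have GR: "dim_row G = n" "dim_col G = s" "dim_row R = s" "dim_col R = n"
    using dims by (auto simp: G_def R_def)
  have PG: "P * G = 0\<^sub>m m s" unfolding G_def using dims mult_assoc_left[OF Pe(1), of T] by simp
  have R\<phi>: "R * \<phi> = 0\<^sub>m s m" unfolding R_def using dims by (simp add: mat_algebra Pe)
  have RG: "R * G = 1\<^sub>m s"
    unfolding R_def G_def using dims Q(3) mult_assoc_left[OF Pe(3), of T] by (simp add: mat_algebra)
  have sum1: "\<phi> * P + G * R = 1\<^sub>m n"
  proof -
    have "G * R = e" using Q(4) by (simp add: G_def R_def)
    then show ?thesis using dims by (intro eq_matI) (auto simp: e_def)
  qed
  have s: "n = m + s"
  proof -
    let ?A = "\<phi> * incl m (m + s) + G * coproj (m + s) m"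
    let ?B = "incl (m + s) m * P + coincl (m + s) m * R"
    have "?A * ?B = 1\<^sub>m n"
      using dims GR sum1 by (simp add: mat_algebra incl_cancel)
    moreover have "?B * ?A = 1\<^sub>m (m + s)"
      using dims GR incl_coincl_sum[of m "m + s"] mult_assoc_left[OF P\<phi>] mult_assoc_left[OF PG]
        mult_assoc_left[OF R\<phi>] mult_assoc_left[OF RG]
      by (simp add: mat_algebra)
    ultimately show ?thesis
      by (rule inverse_pair_dims_eq[rotated 2]) (use dims GR in auto)
  qed
  let ?g = "\<phi> * incl m n + G * coproj n m"
  let ?g' = "incl n m * P + coincl n m * R"
  have s': "n - m = s" using s by simp
  have "?g * ?g' = 1\<^sub>m n"
    using dims GR sum1 mn s' by (simp add: mat_algebra incl_cancel)
  moreover have "?g' * ?g = 1\<^sub>m n"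
    using dims GR mn s' incl_coincl_sum[of m n] mult_assoc_left[OF P\<phi>] mult_assoc_left[OF PG]
        mult_assoc_left[OF R\<phi>] mult_assoc_left[OF RG]
    by (simp add: mat_algebra)
  moreover have "?g * incl n m = \<phi>" "incl m n * ?g' = P"
    using dims GR mn s' by (simp_all add: mat_algebra incl_cancel)
  ultimately show ?thesis using dims GR s'
    by (intro exI[of _ ?g] exI[of _ ?g']) auto
qed

lemma dim_mat_image:
  assumes "M \<in> carrier_mat n w" "rank_ge r M" "rank_le r M"
  shows "vectorspace.dim class_ring (module_vec TYPE(complex) n \<lparr>carrier := mat_image M\<rparr>) = r"
proof -
  obtain P T where PT: "P \<in> carrier_mat r n" "T \<in> carrier_mat w r" "P * M * T = 1\<^sub>m r"
    using assms(1,2) unfolding rank_ge_def by auto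
  note dims = carrier_matD[OF assms(1)] carrier_matD[OF PT(1)] carrier_matD[OF PT(2)]
  have fac: "M = M * T * (P * M)" "P * (M * T) = 1\<^sub>m r"
    using factor_through_chart[OF assms(1,3) PT(1,2), of "1\<^sub>m r"] PT dims by (simp_all add: mat_algebra)
  define \<phi> where "\<phi> = M * T"
  have \<phi>: "\<phi> \<in> carrier_mat n r" using dims by (auto simp: \<phi>_def)
  have P\<phi>: "P *\<^sub>v (\<phi> *\<^sub>v u) = u" if "u \<in> carrier_vec r" for u
    using assoc_mult_mat_vec[OF PT(1) \<phi> that] fac(2) that by (simp add: \<phi>_def)
  have image: "mat_image M = mat_image \<phi>"
  proof (intro equalityI subsetI)
    fix y assume "y \<in> mat_image M"
    then obtain u where u: "u \<in> carrier_vec w" "y = M *\<^sub>v u" using dims unfolding mat_image_def by auto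
    have "M *\<^sub>v u = \<phi> *\<^sub>v ((P * M) *\<^sub>v u)"
    proof -
      have "M *\<^sub>v u = (\<phi> * (P * M)) *\<^sub>v u" using fac(1) unfolding \<phi>_def by simp
      also have "\<dots> = \<phi> *\<^sub>v ((P * M) *\<^sub>v u)"
        by (rule assoc_mult_mat_vec[OF \<phi> _ u(1)]) (use dims in auto)
      finally show ?thesis .
    qed
    then show "y \<in> mat_image \<phi>" unfolding mat_image_def u(2) using \<phi> u(1) dims
      by (auto intro!: image_eqI[of _ _ "(P * M) *\<^sub>v u"] mult_mat_vec_carrier)
  next
    fix y assume "y \<in> mat_image \<phi>"
    then obtain u where u: "u \<in> carrier_vec r" "y = \<phi> *\<^sub>v u" using \<phi> unfolding mat_image_def by auto
    have "\<phi> *\<^sub>v u = M *\<^sub>v (T *\<^sub>v u)"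
      using assoc_mult_mat_vec[OF assms(1) PT(2) u(1)] by (simp add: \<phi>_def)
    then show "y \<in> mat_image M" unfolding mat_image_def u(2)
      using dims u(1) mult_mat_vec_carrier[OF PT(2) u(1)]
      by (auto intro!: image_eqI[of _ _ "T *\<^sub>v u"])
  qed
  interpret vec_space "TYPE(complex)" n .
  have nz: "u = 0\<^sub>v r" if "u \<in> carrier_vec r" "\<phi> *\<^sub>v u = 0\<^sub>v n" for u
  proof -
    have "P *\<^sub>v 0\<^sub>v n = 0\<^sub>v r" using PT(1) by (intro eq_vecI) auto
    then show ?thesis using P\<phi>[OF that(1)] that(2) by simp
  qed
  have dist: "distinct (cols \<phi>)"
  proof (rule ccontr)
    assume "\<not> distinct (cols \<phi>)"
    then obtain i j where ij: "i < r" "j < r" "i \<noteq> j" "col \<phi> i = col \<phi> j"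
      using \<phi> by (auto simp: distinct_conv_nth)
    have "\<phi> *\<^sub>v unit_vec r i = \<phi> *\<^sub>v unit_vec r j"
    proof -
      have "\<phi> *\<^sub>v unit_vec r k = col \<phi> k" if "k < r" for k
        using that \<phi> by (intro eq_vecI) auto
      then show ?thesis using ij by simp
    qed
    then have "unit_vec r i = (unit_vec r j :: complex vec)" using P\<phi> by (metis unit_vec_carrier)
    with ij show False by (metis index_unit_vec(1) zero_neq_one)
  qed
  have "lin_indpt (set (cols \<phi>))"
  proof
    assume "lin_dep (set (cols \<phi>))"
    from lin_depE[OF \<phi> this dist] obtain u where "u \<in> carrier_vec r" "u \<noteq> 0\<^sub>v r" "\<phi> *\<^sub>v u = 0\<^sub>v n"
      by auto
    with nz show False by auto
  qed
  from lin_indpt_full_rank[OF \<phi> dist this] have "rank \<phi> = r" .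
  moreover have "mat_image \<phi> = span (set (cols \<phi>))"
    using col_space_eq[OF \<phi>] \<phi> unfolding mat_image_def col_space_def by auto
  ultimately show ?thesis unfolding image rank_def by simp
qed

section \<open>Matrices of functions\<close>

definition mat_fun :: "('y \<Rightarrow> complex) set \<Rightarrow> nat \<Rightarrow> nat \<Rightarrow> ('y \<Rightarrow> complex mat) \<Rightarrow> bool" where
  "mat_fun F n w A \<longleftrightarrow> (\<forall>y. A y \<in> carrier_mat n w) \<and> (\<forall>a<n. \<forall>b<w. (\<lambda>y. A y $$ (a, b)) \<in> F)"

lemma mat_funD:
  assumes "mat_fun F n w A"
  shows "A y \<in> carrier_mat n w" "dim_row (A y) = n" "dim_col (A y) = w"
    and "a < n \<Longrightarrow> b < w \<Longrightarrow> (\<lambda>y. A y $$ (a, b)) \<in> F"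
  using assms carrier_matD[of "A y" n w] unfolding mat_fun_def by auto

context
  fixes F :: "('y \<Rightarrow> complex) set"
  assumes F: "function_ring F"
begin

lemma mat_fun_const: "A \<in> carrier_mat n w \<Longrightarrow> mat_fun F n w (\<lambda>y. A)"
  unfolding mat_fun_def using function_ringD(1)[OF F] by auto

lemma mat_fun_mult:
  assumes "mat_fun F n k A" "mat_fun F k w B"
  shows "mat_fun F n w (\<lambda>y. A y * B y)"
  unfolding mat_fun_def
proof (intro conjI allI impI)
  fix a b assume ab: "a < n" "b < w"
  have "(\<lambda>y. \<Sum>i = 0..<k. A y $$ (a, i) * B y $$ (i, b)) \<in> F"
    using ab assms by (intro function_ring_sum[OF F] function_ringD(3)[OF F]) (auto intro: mat_funD(4))
  then show "(\<lambda>y. (A y * B y) $$ (a, b)) \<in> F"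
    using ab by (simp add: scalar_prod_def mat_funD(2,3)[OF assms(1)] mat_funD(2,3)[OF assms(2)])
qed (rule mult_carrier_mat[OF mat_funD(1)[OF assms(1)] mat_funD(1)[OF assms(2)]])

lemma mat_fun_add:
  assumes "mat_fun F n w A" "mat_fun F n w B"
  shows "mat_fun F n w (\<lambda>y. A y + B y)"
  unfolding mat_fun_def
  using mat_funD[OF assms(1)] mat_funD[OF assms(2)] by (auto intro!: function_ringD(2)[OF F])

lemma mat_fun_smult:
  assumes "f \<in> F" "mat_fun F n w B"
  shows "mat_fun F n w (\<lambda>y. f y \<cdot>\<^sub>m B y)"
  unfolding mat_fun_def
  using assms(1) mat_funD[OF assms(2)] by (auto intro!: function_ringD(3)[OF F])

lemma function_ring_minus:
  assumes "f \<in> F" "g \<in> F"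
  shows "(\<lambda>y. f y - g y) \<in> F"
  using function_ringD(2)[OF F assms(1) function_ringD(3)[OF F function_ringD(1)[OF F, of "- 1"] assms(2)]]
  by simp

lemma mat_fun_minus:
  assumes "mat_fun F n w A" "mat_fun F n w B"
  shows "mat_fun F n w (\<lambda>y. A y - B y)"
  unfolding mat_fun_def
proof (intro conjI allI impI)
  show "A y - B y \<in> carrier_mat n w" for y
    using mat_funD(1)[OF assms(1)] mat_funD(1)[OF assms(2)] by (metis minus_carrier_mat)
  fix a b assume ab: "a < n" "b < w"
  have "(\<lambda>y. A y $$ (a, b) - B y $$ (a, b)) \<in> F"
    using ab by (intro function_ring_minus mat_funD(4)[OF assms(1)] mat_funD(4)[OF assms(2)])
  then show "(\<lambda>y. (A y - B y) $$ (a, b)) \<in> F" using ab by (simp add: mat_funD(2,3)[OF assms(2)])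
qed

lemma function_ring_det:
  assumes "mat_fun F n n A"
  shows "(\<lambda>y. det (A y)) \<in> F"
proof -
  have "det (A y) = (\<Sum>p | p permutes {0..<n}. signof p * (\<Prod>i = 0..<n. A y $$ (i, p i)))" for y
    using mat_funD(2,3)[OF assms] by (simp add: det_def)
  moreover have "(\<lambda>y. \<Sum>p | p permutes {0..<n}. signof p * (\<Prod>i = 0..<n. A y $$ (i, p i))) \<in> F"
    by (intro function_ring_sum[OF F] function_ringD(3)[OF F] function_ringD(1)[OF F]
        function_ring_prod[OF F] mat_funD(4)[OF assms])
      (auto dest: permutes_in_image)
  ultimately show ?thesis by simp
qed

lemma mat_fun_adj:
  assumes "mat_fun F n n A"
  shows "mat_fun F n n (\<lambda>y. adj_mat (A y))"
  unfolding mat_fun_def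
proof (intro conjI allI impI)
  show "adj_mat (A y) \<in> carrier_mat n n" for y using adj_mat(1)[OF mat_funD(1)[OF assms]] .
  fix a b assume ab: "a < n" "b < n"
  have "mat_fun F (n - 1) (n - 1) (\<lambda>y. mat_delete (A y) b a)"
    unfolding mat_fun_def
  proof (intro conjI allI impI)
    show "mat_delete (A y) b a \<in> carrier_mat (n - 1) (n - 1)" for y
      using mat_delete_carrier[OF mat_funD(1)[OF assms]] .
    fix i j assume "i < n - 1" "j < n - 1"
    then have "(\<lambda>y. A y $$ (if i < b then i else Suc i, if j < a then j else Suc j)) \<in> F"
      by (intro mat_funD(4)[OF assms]) auto
    then show "(\<lambda>y. mat_delete (A y) b a $$ (i, j)) \<in> F"
      using \<open>i < n - 1\<close> \<open>j < n - 1\<close> by (simp add: mat_delete_def mat_funD(2,3)[OF assms])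
  qed
  then have "(\<lambda>y. (- 1) ^ (b + a) * det (mat_delete (A y) b a)) \<in> F"
    by (intro function_ringD(3)[OF F] function_ringD(1)[OF F] function_ring_det)
  then show "(\<lambda>y. adj_mat (A y) $$ (a, b)) \<in> F"
    using ab by (simp add: adj_mat_def cofactor_def mat_funD(2,3)[OF assms])
qed

end

text \<open>If the square matrix \<open>A T\<close> is invertible, then \<open>1 - T (A T)\<^sup>-\<^sup>1 A\<close> projects onto the kernel
  of \<open>A\<close>. Multiplied by the determinant it becomes polynomial in \<open>A\<close>, and it maps into the kernel
  without any assumption.\<close>

definition ker_op :: "complex mat \<Rightarrow> complex mat \<Rightarrow> complex mat" where
  "ker_op A T = det (A * T) \<cdot>\<^sub>m 1\<^sub>m (dim_col A) - T * adj_mat (A * T) * A"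

lemma ker_op:
  assumes A: "A \<in> carrier_mat m w" and T: "T \<in> carrier_mat w m"
  shows ker_op_carrier: "ker_op A T \<in> carrier_mat w w"
    and mult_ker_op: "A * ker_op A T = 0\<^sub>m m w"
    and ker_op_mult: "ker_op A T * T = 0\<^sub>m w m"
    and ker_op_kernel: "Y \<in> carrier_mat w k \<Longrightarrow> A * Y = 0\<^sub>m m k \<Longrightarrow> ker_op A T * Y = det (A * T) \<cdot>\<^sub>m Y"
proof -
  note dims = carrier_matD[OF A] carrier_matD[OF T]
  have AT: "A * T \<in> carrier_mat m m" using A T by simp
  note adj = adj_mat[OF AT]
  have adims: "dim_row (adj_mat (A * T)) = m" "dim_col (adj_mat (A * T)) = m"
    using carrier_matD[OF adj(1)] by auto
  show "ker_op A T \<in> carrier_mat w w" unfolding ker_op_def using dims adims by auto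
  have "A * (T * (adj_mat (A * T) * A)) = (A * T * adj_mat (A * T)) * A"
    using dims adims by (simp add: mat_algebra)
  also have "\<dots> = det (A * T) \<cdot>\<^sub>m A" unfolding adj(2) using dims by (simp add: smult_mult_dim)
  finally show "A * ker_op A T = 0\<^sub>m m w"
    unfolding ker_op_def using dims adims by (simp add: mat_algebra)
  have "T * (adj_mat (A * T) * (A * T)) = det (A * T) \<cdot>\<^sub>m T"
    unfolding adj(3) using dims by (simp add: smult_mult_dim)
  then show "ker_op A T * T = 0\<^sub>m w m"
    unfolding ker_op_def using dims adims by (simp add: mat_algebra)
  show "ker_op A T * Y = det (A * T) \<cdot>\<^sub>m Y" if "Y \<in> carrier_mat w k" "A * Y = 0\<^sub>m m k" for Y k
  proof -
    have "T * (adj_mat (A * T) * (A * Y)) = 0\<^sub>m w k" unfolding that(2) using dims adims by simp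
    then show ?thesis
      unfolding ker_op_def using dims adims carrier_matD[OF that(1)] by (simp add: mat_algebra)
  qed
qed

lemma mat_fun_ker_op:
  assumes "function_ring F" "mat_fun F m w A" "T \<in> carrier_mat w m"
  shows "mat_fun F w w (\<lambda>y. ker_op (A y) T)"
proof -
  have AT: "mat_fun F m m (\<lambda>y. A y * T)"
    by (rule mat_fun_mult[OF assms(1,2) mat_fun_const[OF assms(1,3)]])
  have "mat_fun F w w (\<lambda>y. det (A y * T) \<cdot>\<^sub>m 1\<^sub>m w - T * adj_mat (A y * T) * A y)"
    by (rule mat_fun_minus[OF assms(1) mat_fun_smult[OF assms(1) function_ring_det[OF assms(1) AT]
            mat_fun_const[OF assms(1)]] mat_fun_mult[OF assms(1) mat_fun_mult[OF assms(1)
              mat_fun_const[OF assms(1,3)] mat_fun_adj[OF assms(1) AT]] assms(2)]]) simp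
  then show ?thesis by (simp add: ker_op_def mat_funD(3)[OF assms(2)])
qed

subsection \<open>Rational functions of one variable\<close>

text \<open>Rational functions whose denominator is a power of \<open>d\<close>, with arbitrary values at the zeros of \<open>d\<close>.\<close>

definition rational_off :: "complex poly \<Rightarrow> (complex \<Rightarrow> complex) set" where
  "rational_off d = {f. \<exists>p k. \<forall>t. poly d t \<noteq> 0 \<longrightarrow> f t * poly d t ^ k = poly p t}"

lemma function_ring_polynomials: "function_ring (range poly)"
  unfolding function_ring_def
proof (intro conjI allI ballI)
  fix f g :: "complex \<Rightarrow> complex" assume "f \<in> range poly" "g \<in> range poly"
  then obtain p q where pq: "f = poly p" "g = poly q" by auto
  have "(\<lambda>t. f t + g t) = poly (p + q)" "(\<lambda>t. f t * g t) = poly (p * q)" by (auto simp: pq)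
  then show "(\<lambda>t. f t + g t) \<in> range poly" "(\<lambda>t. f t * g t) \<in> range poly" by auto
next
  fix c :: complex
  have "(\<lambda>t. c) = poly [:c:]" by auto
  then show "(\<lambda>t. c) \<in> range poly" by auto
qed

lemma function_ring_rational_off: "function_ring (rational_off d)"
  unfolding function_ring_def
proof (intro conjI allI ballI)
  fix f g assume "f \<in> rational_off d" "g \<in> rational_off d"
  then obtain p k q l where p: "\<And>t. poly d t \<noteq> 0 \<Longrightarrow> f t * poly d t ^ k = poly p t"
    and q: "\<And>t. poly d t \<noteq> 0 \<Longrightarrow> g t * poly d t ^ l = poly q t"
    unfolding rational_off_def by auto
  have "(f t + g t) * poly d t ^ (k + l) = poly (p * d ^ l + q * d ^ k) t" if "poly d t \<noteq> 0" for t
    using p[OF that, symmetric] q[OF that, symmetric] by (simp add: power_add algebra_simps)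
  then show "(\<lambda>t. f t + g t) \<in> rational_off d" unfolding rational_off_def by blast
  have "(f t * g t) * poly d t ^ (k + l) = poly (p * q) t" if "poly d t \<noteq> 0" for t
    using p[OF that, symmetric] q[OF that, symmetric] by (simp add: power_add algebra_simps)
  then show "(\<lambda>t. f t * g t) \<in> rational_off d" unfolding rational_off_def by blast
next
  fix c
  have "c * poly d t ^ 0 = poly [:c:] t" for t by simp
  then show "(\<lambda>t. c) \<in> rational_off d" unfolding rational_off_def by blast
qed

lemma poly_rational_off: "poly p \<in> rational_off d"
proof -
  have "poly p t * poly d t ^ 0 = poly p t" for t by simp
  then show ?thesis unfolding rational_off_def by blast
qed

lemma inverse_rational_off: "(\<lambda>t. inverse (poly d t)) \<in> rational_off d"
proof -
  have "inverse (poly d t) * poly d t ^ 1 = poly 1 t" if "poly d t \<noteq> 0" for t using that by simp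
  then show ?thesis unfolding rational_off_def by blast
qed

text \<open>The punctured line is irreducible.\<close>

lemma rational_off_common_nonzero:
  assumes "f \<in> rational_off d" "g \<in> rational_off d"
    and "poly d s \<noteq> 0" "f s \<noteq> 0" "poly d t \<noteq> 0" "g t \<noteq> 0"
  shows "\<exists>u. poly d u \<noteq> 0 \<and> f u \<noteq> 0 \<and> g u \<noteq> 0"
proof -
  obtain p k q l where p: "\<And>t. poly d t \<noteq> 0 \<Longrightarrow> f t * poly d t ^ k = poly p t"
    and q: "\<And>t. poly d t \<noteq> 0 \<Longrightarrow> g t * poly d t ^ l = poly q t"
    using assms(1,2) unfolding rational_off_def by auto
  have "p \<noteq> 0" using p[OF assms(3)] assms(3,4) by auto
  moreover have "q \<noteq> 0" using q[OF assms(5)] assms(5,6) by auto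
  moreover have "d \<noteq> 0" using assms(3) by auto
  ultimately have "finite {u. poly (d * p * q) u = 0}" by (intro poly_roots_finite) auto
  then obtain u where "poly (d * p * q) u \<noteq> 0"
    using infinite_UNIV_char_0[where 'a = complex] by (metis (mono_tags, lifting) UNIV_eq_I mem_Collect_eq)
  then show ?thesis using p[of u] q[of u] by (intro exI[of _ u]) auto
qed

section \<open>Irreducible sets and components\<close>

lemma irreducible_inD:
  assumes "irreducible_in T S" "closedin T A" "closedin T B" "S \<subseteq> A \<union> B"
  shows "S \<subseteq> A \<or> S \<subseteq> B"
  using assms unfolding irreducible_in_def by simp

lemma irreducible_in_closure:
  assumes "irreducible_in T S"
  shows "irreducible_in T (T closure_of S)"
  unfolding irreducible_in_def
proof (intro conjI allI impI)
  have S: "S \<subseteq> topspace T" "S \<noteq> {}" using assms unfolding irreducible_in_def by auto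
  then have sub: "S \<subseteq> T closure_of S" by (intro closure_of_subset)
  then show "T closure_of S \<noteq> {}" using S(2) by auto
  show "T closure_of S \<subseteq> topspace T" by (rule closure_of_subset_topspace)
  fix A B assume AB: "closedin T A \<and> closedin T B \<and> T closure_of S \<subseteq> A \<union> B"
  then have "S \<subseteq> A \<or> S \<subseteq> B" using irreducible_inD[OF assms, of A B] sub by auto
  then show "T closure_of S \<subseteq> A \<or> T closure_of S \<subseteq> B"
    using AB closure_of_minimal[of S A T] closure_of_minimal[of S B T] by auto
qed

lemma irreducible_in_open_subset:
  assumes "irreducible_in T X" "openin T U" "U \<inter> X \<noteq> {}"
  shows "irreducible_in T (U \<inter> X)" and "X \<subseteq> T closure_of (U \<inter> X)"
proof -
  have cl: "closedin T (topspace T - U)" using assms(2) by blast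
  have notin: "\<not> X \<subseteq> topspace T - U" using assms(3) by auto
  have X: "X \<subseteq> topspace T" using assms(1) unfolding irreducible_in_def by simp
  have *: "X \<subseteq> A \<or> X \<subseteq> topspace T - U" if "U \<inter> X \<subseteq> A" "closedin T A" for A
  proof -
    have "X \<subseteq> A \<union> (topspace T - U)" using that X by auto
    then show ?thesis by (rule irreducible_inD[OF assms(1) that(2) cl])
  qed
  show "X \<subseteq> T closure_of (U \<inter> X)"
    using *[of "T closure_of (U \<inter> X)"] notin closure_of_subset[of "U \<inter> X" T] X by auto
  show "irreducible_in T (U \<inter> X)"
    unfolding irreducible_in_def
  proof (intro conjI allI impI)
    fix A B assume AB: "closedin T A \<and> closedin T B \<and> U \<inter> X \<subseteq> A \<union> B"
    then have "X \<subseteq> A \<union> B" using *[of "A \<union> B"] notin by auto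
    then show "U \<inter> X \<subseteq> A \<or> U \<inter> X \<subseteq> B"
      using irreducible_inD[OF assms(1), of A B] AB by auto
  qed (use X assms(3) in auto)
qed

lemma irreducible_in_finite_union:
  assumes "irreducible_in T S" "finite K" "\<And>A. A \<in> K \<Longrightarrow> closedin T A" "S \<subseteq> \<Union>K"
  shows "\<exists>A\<in>K. S \<subseteq> A"
  using assms(2,3,4)
proof (induction K rule: finite_induct)
  case empty
  then show ?case using assms(1) unfolding irreducible_in_def by simp
next
  case (insert A K)
  then have "closedin T A" "closedin T (\<Union>K)" "S \<subseteq> A \<union> \<Union>K" by (auto intro!: closedin_Union)
  then have "S \<subseteq> A \<or> S \<subseteq> \<Union>K" by (rule irreducible_inD[OF assms(1)])
  then show ?case using insert by auto
qed

text \<open>By Zorn's lemma: the union of a chain of irreducible sets is irreducible.\<close>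

lemma irreducible_subset_component:
  assumes "irreducible_in T S" "S \<subseteq> Y"
  shows "\<exists>X\<in>irreducible_components T Y. S \<subseteq> X"
proof -
  let ?A = "{Z. Z \<subseteq> Y \<and> irreducible_in T Z \<and> S \<subseteq> Z}"
  have "\<exists>U\<in>?A. \<forall>X\<in>C. X \<subseteq> U" if C: "subset.chain ?A C" for C
  proof (cases "C = {}")
    case True
    then show ?thesis using assms by auto
  next
    case False
    have CA: "C \<subseteq> ?A" and chain: "\<And>Z W. Z \<in> C \<Longrightarrow> W \<in> C \<Longrightarrow> Z \<subseteq> W \<or> W \<subseteq> Z"
      using C unfolding subset_chain_def by auto
    have "irreducible_in T (\<Union>C)"
      unfolding irreducible_in_def
    proof (intro conjI allI impI)
      have "\<And>Z. Z \<in> C \<Longrightarrow> Z \<subseteq> topspace T \<and> Z \<noteq> {}"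
        using CA unfolding irreducible_in_def by auto
      then show "\<Union>C \<subseteq> topspace T" "\<Union>C \<noteq> {}" using False by blast+
      fix A B assume AB: "closedin T A \<and> closedin T B \<and> \<Union>C \<subseteq> A \<union> B"
      show "\<Union>C \<subseteq> A \<or> \<Union>C \<subseteq> B"
      proof (rule ccontr)
        assume "\<not> ?thesis"
        then obtain Z W where ZW: "Z \<in> C" "\<not> Z \<subseteq> A" "W \<in> C" "\<not> W \<subseteq> B" by blast
        have "\<exists>M\<in>C. Z \<subseteq> M \<and> W \<subseteq> M" using chain[OF ZW(1,3)] ZW by blast
        then obtain M where M: "M \<in> C" "Z \<subseteq> M" "W \<subseteq> M" by blast
        then have "M \<subseteq> A \<union> B" "irreducible_in T M" using AB CA by auto
        then have "M \<subseteq> A \<or> M \<subseteq> B" using AB irreducible_inD[of T M A B] by simp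
        with M ZW show False by blast
      qed
    qed
    moreover have "\<Union>C \<subseteq> Y" "S \<subseteq> \<Union>C" using CA False by auto
    ultimately show ?thesis by auto
  qed
  from subset_Zorn[OF this] obtain M where M: "M \<in> ?A" "\<forall>X\<in>?A. M \<subseteq> X \<longrightarrow> X = M" by blast
  then have "M \<in> irreducible_components T Y" unfolding irreducible_components_def by blast
  with M(1) show ?thesis by auto
qed

lemma component_maximal:
  assumes "X \<in> irreducible_components T Y" "irreducible_in T Z" "X \<subseteq> Z" "Z \<subseteq> Y"
  shows "Z = X"
  using assms unfolding irreducible_components_def by auto

lemma componentD:
  assumes "X \<in> irreducible_components T Y"
  shows "X \<subseteq> Y" "irreducible_in T X" "X \<noteq> {}"
  using assms unfolding irreducible_components_def irreducible_in_def by auto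

lemma component_closed:
  assumes "X \<in> irreducible_components T Y" "closedin T Y"
  shows "T closure_of X = X"
proof (rule component_maximal[OF assms(1)])
  show "irreducible_in T (T closure_of X)" using irreducible_in_closure componentD(2)[OF assms(1)] .
  show "X \<subseteq> T closure_of X"
    using componentD(2)[OF assms(1)] closure_of_subset unfolding irreducible_in_def by metis
  show "T closure_of X \<subseteq> Y"
    using componentD(1)[OF assms(1)] assms(2) by (rule closure_of_minimal)
qed

section \<open>The Zariski topology\<close>

text \<open>The generators of the ring of polynomial functions, which give it the filtration by degree that the
growth of a set refers to.\<close>

definition coords :: "('i, 'e) graph \<Rightarrow> ('i \<Rightarrow> nat) \<Rightarrow> (('i, 'e) rep \<Rightarrow> complex) set" where
  "coords Q v = {(\<lambda>x. x h $$ (r, s)) | h r s.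
     h \<in> arrows Q \<and> r < v (in_vertex h) \<and> s < v (out_vertex h)}"

text \<open>The entries of a family of representations depend on the parameter through functions in \<open>F\<close>: for
polynomials on another representation space this is a polynomial map, for rational functions of one
variable a rational curve.\<close>

definition rep_fun ::
  "('y \<Rightarrow> complex) set \<Rightarrow> ('i, 'e) graph \<Rightarrow> ('i \<Rightarrow> nat) \<Rightarrow> ('y \<Rightarrow> ('i, 'e) rep) \<Rightarrow> bool" where
  "rep_fun F Q v \<Phi> \<longleftrightarrow> (\<forall>h\<in>arrows Q. \<forall>r<v (in_vertex h). \<forall>s<v (out_vertex h).
     (\<lambda>y. \<Phi> y h $$ (r, s)) \<in> F)"

lemma polynomial_functions_comp:
  assumes "function_ring F" "rep_fun F Q v \<Phi>" "p \<in> polynomial_functions Q v"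
  shows "(\<lambda>y. p (\<Phi> y)) \<in> F"
  using assms(3)
  by induction (use assms(1,2) in \<open>auto simp: rep_fun_def intro: function_ringD\<close>)

lemma polynomial_functions_eq: "polynomial_functions Q v = all_polys (coords Q v)"
proof (intro equalityI subsetI)
  fix p assume "p \<in> polynomial_functions Q v"
  moreover have "rep_fun (all_polys (coords Q v)) Q v (\<lambda>x. x)"
    unfolding rep_fun_def coords_def by (intro ballI allI impI all_polys_gen) blast
  ultimately show "p \<in> all_polys (coords Q v)"
    using polynomial_functions_comp[OF function_ring_all_polys, of "coords Q v" Q v "\<lambda>x. x"] by simp
next
  fix p assume "p \<in> all_polys (coords Q v)"
  then obtain n where "p \<in> polys (coords Q v) n" unfolding all_polys_def by auto
  then show "p \<in> polynomial_functions Q v"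
    by induction (auto simp: coords_def intro: polynomial_functions.intros)
qed

lemma function_ring_polynomial_functions: "function_ring (polynomial_functions Q v)"
  unfolding polynomial_functions_eq by (rule function_ring_all_polys)

lemma finite_arrows:
  assumes "graph Q"
  shows "finite (arrows Q)"
proof (rule finite_subset)
  show "arrows Q \<subseteq> edges Q \<times> verts Q \<times> verts Q"
    using assms unfolding arrows_def graph_def by auto
  show "finite (edges Q \<times> verts Q \<times> verts Q)" using assms unfolding graph_def by auto
qed

lemma finite_coords:
  assumes "graph Q"
  shows "finite (coords Q v)"
proof (rule finite_subset)
  let ?c = "\<lambda>(h, r, s) (x :: ('a, 'b) rep). x h $$ (r, s)"
  show "coords Q v \<subseteq> ?c ` (SIGMA h : arrows Q. {..<v (in_vertex h)} \<times> {..<v (out_vertex h)})"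
    unfolding coords_def by force
  show "finite (?c ` (SIGMA h : arrows Q. {..<v (in_vertex h)} \<times> {..<v (out_vertex h)}))"
    using finite_arrows[OF assms] by auto
qed

lemma topspace_zariski [simp]: "topspace (zariski Q v) = reps Q v"
proof -
  have "zariski_open Q v (reps Q v)"
    unfolding zariski_open_def
    by (intro exI[of _ "{\<lambda>_. 1}"]) (auto intro: polynomial_functions.const)
  then have "openin (zariski Q v) (reps Q v)" unfolding openin_zariski .
  moreover have "U \<subseteq> reps Q v" if "openin (zariski Q v) U" for U
    using that unfolding openin_zariski zariski_open_def by auto
  ultimately show ?thesis by (metis openin_topspace openin_subset subset_antisym)
qed

lemma closedin_zariski:
  "closedin (zariski Q v) A \<longleftrightarrow>
     (\<exists>P\<subseteq>polynomial_functions Q v. A = {x \<in> reps Q v. \<forall>p\<in>P. p x = 0})"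
proof
  assume "closedin (zariski Q v) A"
  then have A: "A \<subseteq> reps Q v" "zariski_open Q v (reps Q v - A)"
    unfolding closedin_def openin_zariski by auto
  then obtain P where P: "P \<subseteq> polynomial_functions Q v" "reps Q v - A = {x \<in> reps Q v. \<exists>p\<in>P. p x \<noteq> 0}"
    unfolding zariski_open_def by blast
  have "A = reps Q v - (reps Q v - A)" using A(1) by auto
  also have "\<dots> = {x \<in> reps Q v. \<forall>p\<in>P. p x = 0}" unfolding P(2) by auto
  finally show "\<exists>P\<subseteq>polynomial_functions Q v. A = {x \<in> reps Q v. \<forall>p\<in>P. p x = 0}" using P(1) by blast
next
  assume "\<exists>P\<subseteq>polynomial_functions Q v. A = {x \<in> reps Q v. \<forall>p\<in>P. p x = 0}"
  then obtain P where P: "P \<subseteq> polynomial_functions Q v" "A = {x \<in> reps Q v. \<forall>p\<in>P. p x = 0}" by blast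
  have "reps Q v - A = {x \<in> reps Q v. \<exists>p\<in>P. p x \<noteq> 0}" unfolding P(2) by auto
  then show "closedin (zariski Q v) A"
    unfolding closedin_def openin_zariski zariski_open_def using P by auto
qed

lemma in_closure_zariski:
  assumes "S \<subseteq> reps Q v"
  shows "x \<in> zariski Q v closure_of S \<longleftrightarrow>
    x \<in> reps Q v \<and> (\<forall>p\<in>polynomial_functions Q v. (\<forall>s\<in>S. p s = 0) \<longrightarrow> p x = 0)"
proof
  assume x: "x \<in> zariski Q v closure_of S"
  have "p x = 0" if "p \<in> polynomial_functions Q v" "\<forall>s\<in>S. p s = 0" for p
  proof -
    have "closedin (zariski Q v) {y \<in> reps Q v. \<forall>p'\<in>{p}. p' y = 0}"
      unfolding closedin_zariski using that(1) by blast
    moreover have "S \<subseteq> {y \<in> reps Q v. \<forall>p'\<in>{p}. p' y = 0}" using assms that(2) by auto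
    ultimately show ?thesis using closure_of_minimal x by blast
  qed
  moreover have "x \<in> reps Q v" using x closure_of_subset_topspace[of "zariski Q v" S] by auto
  ultimately show "x \<in> reps Q v \<and> (\<forall>p\<in>polynomial_functions Q v. (\<forall>s\<in>S. p s = 0) \<longrightarrow> p x = 0)"
    by blast
next
  assume x: "x \<in> reps Q v \<and> (\<forall>p\<in>polynomial_functions Q v. (\<forall>s\<in>S. p s = 0) \<longrightarrow> p x = 0)"
  have "closedin (zariski Q v) (zariski Q v closure_of S)" by simp
  then obtain P where P: "P \<subseteq> polynomial_functions Q v"
    "zariski Q v closure_of S = {x \<in> reps Q v. \<forall>p\<in>P. p x = 0}"
    unfolding closedin_zariski by blast
  have "S \<subseteq> zariski Q v closure_of S" using assms by (intro closure_of_subset) simp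
  then show "x \<in> zariski Q v closure_of S" unfolding P(2) using x P(1) by blast
qed

lemma zero_on_closure:
  assumes "S \<subseteq> reps Q v" "x \<in> zariski Q v closure_of S" "p \<in> polynomial_functions Q v"
    and "\<And>s. s \<in> S \<Longrightarrow> p s = 0"
  shows "p x = 0"
  using assms(2,3,4) unfolding in_closure_zariski[OF assms(1)] by simp

lemma irreducible_zariski:
  "irreducible_in (zariski Q v) S \<longleftrightarrow> S \<subseteq> reps Q v \<and> S \<noteq> {} \<and>
    (\<forall>p\<in>polynomial_functions Q v. \<forall>q\<in>polynomial_functions Q v.
      (\<exists>x\<in>S. p x \<noteq> 0) \<longrightarrow> (\<exists>x\<in>S. q x \<noteq> 0) \<longrightarrow> (\<exists>x\<in>S. p x \<noteq> 0 \<and> q x \<noteq> 0))"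
  (is "_ \<longleftrightarrow> _ \<and> _ \<and> ?R")
proof (intro iffI conjI ballI impI)
  assume irr: "irreducible_in (zariski Q v) S"
  then show S: "S \<subseteq> reps Q v" "S \<noteq> {}" unfolding irreducible_in_def by auto
  fix p q assume pq: "p \<in> polynomial_functions Q v" "q \<in> polynomial_functions Q v"
    "\<exists>x\<in>S. p x \<noteq> 0" "\<exists>x\<in>S. q x \<noteq> 0"
  show "\<exists>x\<in>S. p x \<noteq> 0 \<and> q x \<noteq> 0"
  proof (rule ccontr)
    assume *: "\<not> ?thesis"
    let ?A = "\<lambda>p. {x \<in> reps Q v. \<forall>p'\<in>{p}. p' x = 0}"
    have "closedin (zariski Q v) (?A p)" "closedin (zariski Q v) (?A q)"
      unfolding closedin_zariski using pq(1,2) by blast+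
    moreover have "S \<subseteq> ?A p \<union> ?A q" using * S(1) by auto
    ultimately have "S \<subseteq> ?A p \<or> S \<subseteq> ?A q" by (rule irreducible_inD[OF irr])
    then show False using pq(3,4) by auto
  qed
next
  assume R: "S \<subseteq> reps Q v \<and> S \<noteq> {} \<and> ?R"
  show "irreducible_in (zariski Q v) S"
    unfolding irreducible_in_def
  proof (intro conjI allI impI)
    fix A B assume AB: "closedin (zariski Q v) A \<and> closedin (zariski Q v) B \<and> S \<subseteq> A \<union> B"
    obtain P where P: "P \<subseteq> polynomial_functions Q v" "A = {x \<in> reps Q v. \<forall>p\<in>P. p x = 0}"
      using AB unfolding closedin_zariski by blast
    obtain P' where P': "P' \<subseteq> polynomial_functions Q v" "B = {x \<in> reps Q v. \<forall>p\<in>P'. p x = 0}"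
      using AB unfolding closedin_zariski by blast
    show "S \<subseteq> A \<or> S \<subseteq> B"
    proof (rule ccontr)
      assume "\<not> ?thesis"
      then obtain x y where xy: "x \<in> S" "x \<notin> A" "y \<in> S" "y \<notin> B" by blast
      have "x \<in> reps Q v" "y \<in> reps Q v" using R xy(1,3) by auto
      then obtain p q where pq: "p \<in> P" "p x \<noteq> 0" "q \<in> P'" "q y \<noteq> 0"
        using xy(2,4) unfolding P(2) P'(2) by auto
      then have mem: "p \<in> polynomial_functions Q v" "q \<in> polynomial_functions Q v"
        using P(1) P'(1) by auto
      have "(\<exists>x\<in>S. p x \<noteq> 0) \<longrightarrow> (\<exists>x\<in>S. q x \<noteq> 0) \<longrightarrow> (\<exists>x\<in>S. p x \<noteq> 0 \<and> q x \<noteq> 0)"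
        using R mem by simp
      then obtain z where z: "z \<in> S" "p z \<noteq> 0" "q z \<noteq> 0" using pq xy(1,3) by blast
      then have "z \<in> A \<or> z \<in> B" using AB by auto
      then show False using z(2,3) pq(1,3) unfolding P(2) P'(2) by auto
    qed
  qed (use R in auto)
qed

lemma irreducible_zariskiD:
  assumes "irreducible_in (zariski Q v) S"
    and "p \<in> polynomial_functions Q v" "q \<in> polynomial_functions Q v"
    and "x \<in> S" "p x \<noteq> 0" "y \<in> S" "q y \<noteq> 0"
  shows "\<exists>z\<in>S. p z \<noteq> 0 \<and> q z \<noteq> 0"
proof -
  have "(\<exists>x\<in>S. p x \<noteq> 0) \<longrightarrow> (\<exists>x\<in>S. q x \<noteq> 0) \<longrightarrow> (\<exists>x\<in>S. p x \<noteq> 0 \<and> q x \<noteq> 0)"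
    using assms(1-3) unfolding irreducible_zariski by simp
  then show ?thesis using assms(4-) by blast
qed

lemma openin_nonzero_locus:
  "p \<in> polynomial_functions Q v \<Longrightarrow> openin (zariski Q v) {x \<in> reps Q v. p x \<noteq> 0}"
  unfolding openin_zariski zariski_open_def by (intro exI[of _ "{p}"]) auto

lemma irreducible_nonzero_locus:
  assumes "irreducible_in (zariski Q v) X" "p \<in> polynomial_functions Q v" "x \<in> X" "p x \<noteq> 0"
  shows "irreducible_in (zariski Q v) {x \<in> X. p x \<noteq> 0}"
    and "X \<subseteq> zariski Q v closure_of {x \<in> X. p x \<noteq> 0}"
proof -
  have X: "X \<subseteq> reps Q v" using assms(1) unfolding irreducible_zariski by simp
  then have eq: "{x \<in> reps Q v. p x \<noteq> 0} \<inter> X = {x \<in> X. p x \<noteq> 0}" by auto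
  have "{x \<in> reps Q v. p x \<noteq> 0} \<inter> X \<noteq> {}" unfolding eq using assms(3,4) by auto
  from irreducible_in_open_subset[OF assms(1) openin_nonzero_locus[OF assms(2)] this]
  show "irreducible_in (zariski Q v) {x \<in> X. p x \<noteq> 0}"
    and "X \<subseteq> zariski Q v closure_of {x \<in> X. p x \<noteq> 0}" unfolding eq by auto
qed

lemma irreducible_polynomial_image:
  assumes "irreducible_in (zariski Q v1) Z" "rep_fun (polynomial_functions Q v1) Q v \<sigma>"
    and "\<And>z. z \<in> Z \<Longrightarrow> \<sigma> z \<in> reps Q v"
  shows "irreducible_in (zariski Q v) (\<sigma> ` Z)"
proof -
  have comp: "(\<lambda>z. p (\<sigma> z)) \<in> polynomial_functions Q v1" if "p \<in> polynomial_functions Q v" for p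
    by (rule polynomial_functions_comp[OF function_ring_polynomial_functions assms(2) that])
  show ?thesis
    unfolding irreducible_zariski
  proof (intro conjI ballI impI)
    show "\<sigma> ` Z \<subseteq> reps Q v" "\<sigma> ` Z \<noteq> {}"
      using assms(1,3) unfolding irreducible_zariski by auto
    fix p q assume pq: "p \<in> polynomial_functions Q v" "q \<in> polynomial_functions Q v"
      "\<exists>x\<in>\<sigma> ` Z. p x \<noteq> 0" "\<exists>x\<in>\<sigma> ` Z. q x \<noteq> 0"
    have "(\<exists>z\<in>Z. p (\<sigma> z) \<noteq> 0) \<longrightarrow> (\<exists>z\<in>Z. q (\<sigma> z) \<noteq> 0) \<longrightarrow>
        (\<exists>z\<in>Z. p (\<sigma> z) \<noteq> 0 \<and> q (\<sigma> z) \<noteq> 0)"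
      using irreducible_zariskiD[OF assms(1) comp[OF pq(1)] comp[OF pq(2)]] by blast
    then show "\<exists>x\<in>\<sigma> ` Z. p x \<noteq> 0 \<and> q x \<noteq> 0" using pq(3,4) by blast
  qed
qed

text \<open>A set that is covered by polynomial images of an irreducible set \<open>Z\<close> is irreducible if, over
  each point of \<open>Z\<close>, any two of its points are joined by a rational curve: a point of \<open>Z\<close> at which
  both given functions are nonzero somewhere on the fibre can be found because \<open>Z\<close> is irreducible,
  and the two functions are then compared on the curve.\<close>

lemma irreducible_by_sections:
  assumes Z: "irreducible_in (zariski Q v1) Z"
    and S: "S \<subseteq> reps Q v" "S \<noteq> {}"
    and cover: "\<And>x. x \<in> S \<Longrightarrow> \<exists>k\<in>K. \<exists>z\<in>Z. x = \<sigma> k z"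
    and poly: "\<And>k. k \<in> K \<Longrightarrow> rep_fun (polynomial_functions Q v1) Q v (\<sigma> k)"
    and curve: "\<And>k l z. \<lbrakk>k \<in> K; l \<in> K; z \<in> Z\<rbrakk> \<Longrightarrow> \<exists>d \<gamma>. rep_fun (rational_off d) Q v \<gamma> \<and>
      poly d 0 \<noteq> 0 \<and> poly d 1 \<noteq> 0 \<and> \<gamma> 0 = \<sigma> k z \<and> \<gamma> 1 = \<sigma> l z \<and>
      (\<forall>t. poly d t \<noteq> 0 \<longrightarrow> \<gamma> t \<in> S)"
  shows "irreducible_in (zariski Q v) S"
  unfolding irreducible_zariski
proof (intro conjI ballI impI)
  fix p q assume p: "p \<in> polynomial_functions Q v" "\<exists>x\<in>S. p x \<noteq> 0"
    and q: "q \<in> polynomial_functions Q v" "\<exists>x\<in>S. q x \<noteq> 0"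
  obtain k y where k: "k \<in> K" "y \<in> Z" "p (\<sigma> k y) \<noteq> 0" using p(2) cover by blast
  obtain l z where l: "l \<in> K" "z \<in> Z" "q (\<sigma> l z) \<noteq> 0" using q(2) cover by blast
  have comp: "(\<lambda>z. f (\<sigma> j z)) \<in> polynomial_functions Q v1"
    if "f \<in> polynomial_functions Q v" "j \<in> K" for f j
    by (rule polynomial_functions_comp[OF function_ring_polynomial_functions poly[OF that(2)] that(1)])
  have pq: "(\<exists>z\<in>Z. p (\<sigma> k z) \<noteq> 0) \<longrightarrow> (\<exists>z\<in>Z. q (\<sigma> l z) \<noteq> 0) \<longrightarrow>
      (\<exists>z\<in>Z. p (\<sigma> k z) \<noteq> 0 \<and> q (\<sigma> l z) \<noteq> 0)"
    using irreducible_zariskiD[OF Z comp[OF p(1) k(1)] comp[OF q(1) l(1)]] by blast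
  then obtain u where u: "u \<in> Z" "p (\<sigma> k u) \<noteq> 0" "q (\<sigma> l u) \<noteq> 0" using k(2,3) l(2,3) by blast
  obtain d \<gamma> where \<gamma>: "rep_fun (rational_off d) Q v \<gamma>" "poly d 0 \<noteq> 0" "poly d 1 \<noteq> 0"
    "\<gamma> 0 = \<sigma> k u" "\<gamma> 1 = \<sigma> l u" "\<And>t. poly d t \<noteq> 0 \<Longrightarrow> \<gamma> t \<in> S"
    using curve[OF k(1) l(1) u(1)] by blast
  have "(\<lambda>t. f (\<gamma> t)) \<in> rational_off d" if "f \<in> polynomial_functions Q v" for f
    by (rule polynomial_functions_comp[OF function_ring_rational_off \<gamma>(1) that])
  then obtain t where "poly d t \<noteq> 0" "p (\<gamma> t) \<noteq> 0" "q (\<gamma> t) \<noteq> 0"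
    using rational_off_common_nonzero[of "\<lambda>t. p (\<gamma> t)" d "\<lambda>t. q (\<gamma> t)" 0 1] \<gamma>(2-5) p(1) q(1) u(2,3)
    by auto
  then show "\<exists>x\<in>S. p x \<noteq> 0 \<and> q x \<noteq> 0" using \<gamma>(6) by blast
qed (use S in auto)

section \<open>Representations seen from one vertex\<close>

locale quiver =
  fixes Q :: "('i, 'e) graph" and \<Omega> :: "('i, 'e) arrow set"
  assumes graph: "graph Q" and orientation: "orientation Q \<Omega>"
begin

abbreviation components :: "('i \<Rightarrow> nat) \<Rightarrow> ('i, 'e) rep set set" where
  "components v \<equiv> irreducible_components (zariski Q v) (Lam Q \<Omega> v)"

lemma in_rev [simp]: "in_vertex (rev_arrow h) = out_vertex h"
  and out_rev [simp]: "out_vertex (rev_arrow h) = in_vertex h"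
  and rev_rev [simp]: "rev_arrow (rev_arrow h) = h"
  by (cases h; simp)+

lemma rev_arrows [simp]: "rev_arrow h \<in> arrows Q \<longleftrightarrow> h \<in> arrows Q"
  by (cases h) (auto simp: arrows_def insert_commute)

lemma arrowsD:
  assumes "h \<in> arrows Q"
  shows "in_vertex h \<in> verts Q" "out_vertex h \<in> verts Q" "in_vertex h \<noteq> out_vertex h"
proof -
  obtain e i j where h: "h = (e, i, j)" "e \<in> edges Q" "ends Q e = {i, j}"
    using assms unfolding arrows_def by auto
  have "{i, j} \<subseteq> verts Q" "card {i, j} = 2"
    using graph h(2,3) unfolding graph_def by auto
  then show "in_vertex h \<in> verts Q" "out_vertex h \<in> verts Q" "in_vertex h \<noteq> out_vertex h"
    using h(1) by (auto simp: card_insert_if split: if_splits)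
qed

lemma arrows_intoD:
  assumes "h \<in> arrows_into Q i"
  shows "h \<in> arrows Q" "in_vertex h = i" "out_vertex h \<noteq> i" "out_vertex h \<in> verts Q" "i \<in> verts Q"
  using assms arrowsD[of h] unfolding arrows_into_def by auto

lemma finite_arrows_into [simp]: "finite (arrows_into Q i)"
  using finite_arrows[OF graph] unfolding arrows_into_def by simp

lemma sign_square [simp]: "arrow_sign \<Omega> h * (arrow_sign \<Omega> h * c) = c"
  by (simp add: arrow_sign_def)

lemma sign_nonzero [simp]: "arrow_sign \<Omega> h \<noteq> 0"
  by (simp add: arrow_sign_def)

text \<open>The dimension vectors and representations that occur together differ only at one vertex \<open>i\<close>. This
relation and its analogue for representations, \<open>agree_away\<close>, avoid any explicit subtraction of
dimension vectors.\<close>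

definition agree_off :: "'i \<Rightarrow> ('i \<Rightarrow> nat) \<Rightarrow> ('i \<Rightarrow> nat) \<Rightarrow> bool" where
  "agree_off i v v' \<longleftrightarrow> (\<forall>j\<in>verts Q. j \<noteq> i \<longrightarrow> v j = v' j)"

lemma agree_off_refl [simp]: "agree_off i v v"
  by (simp add: agree_off_def)

text \<open>The basis vectors of the sum of all \<open>V\<^bsub>out(h)\<^esub>\<close> with \<open>in(h) = i\<close> are listed once and for all,
  which turns the incoming maps into a single matrix and the outgoing maps into another. The list
  does not depend on the dimension at \<open>i\<close>, because there are no loops.\<close>

definition in_index :: "('i \<Rightarrow> nat) \<Rightarrow> 'i \<Rightarrow> (('i, 'e) arrow \<times> nat) list" where
  "in_index v i = (SOME xs. distinct xs \<and>
     set xs = (SIGMA h : arrows_into Q i. {..<v (out_vertex h)}))"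

definition width :: "('i \<Rightarrow> nat) \<Rightarrow> 'i \<Rightarrow> nat" where
  "width v i = length (in_index v i)"

definition in_pos :: "('i \<Rightarrow> nat) \<Rightarrow> 'i \<Rightarrow> ('i, 'e) arrow \<Rightarrow> nat \<Rightarrow> nat" where
  "in_pos v i h s = (THE k. k < width v i \<and> in_index v i ! k = (h, s))"

lemma in_index:
  "distinct (in_index v i)" "set (in_index v i) = (SIGMA h : arrows_into Q i. {..<v (out_vertex h)})"
proof -
  have "finite (SIGMA h : arrows_into Q i. {..<v (out_vertex h)})" by simp
  then have "\<exists>xs. distinct xs \<and> set xs = (SIGMA h : arrows_into Q i. {..<v (out_vertex h)})"
    using finite_distinct_list by metis
  from someI_ex[OF this]
  show "distinct (in_index v i)" "set (in_index v i) = (SIGMA h : arrows_into Q i. {..<v (out_vertex h)})"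
    unfolding in_index_def by blast+
qed

lemma width_eq: "width v i = (\<Sum>h\<in>arrows_into Q i. v (out_vertex h))"
  unfolding width_def distinct_card[OF in_index(1), symmetric] in_index(2) by simp

lemma in_index_cong:
  assumes "agree_off i v v'"
  shows "in_index v i = in_index v' i" "width v i = width v' i" "in_pos v i = in_pos v' i"
proof -
  have "{..<v (out_vertex h)} = {..<v' (out_vertex h)}" if "h \<in> arrows_into Q i" for h
    using assms arrows_intoD[OF that] unfolding agree_off_def by auto
  then have "(SIGMA h : arrows_into Q i. {..<v (out_vertex h)}) =
      (SIGMA h : arrows_into Q i. {..<v' (out_vertex h)})"
    by (intro Sigma_cong refl)
  then show 1: "in_index v i = in_index v' i" unfolding in_index_def by simp
  then show 2: "width v i = width v' i" unfolding width_def by simp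
  show "in_pos v i = in_pos v' i" unfolding in_pos_def 1 2 by simp
qed

lemma in_index_nth:
  assumes "k < width v i"
  shows "fst (in_index v i ! k) \<in> arrows_into Q i"
    and "snd (in_index v i ! k) < v (out_vertex (fst (in_index v i ! k)))"
proof -
  have "in_index v i ! k \<in> set (in_index v i)" using assms unfolding width_def by simp
  then show "fst (in_index v i ! k) \<in> arrows_into Q i"
    "snd (in_index v i ! k) < v (out_vertex (fst (in_index v i ! k)))"
    unfolding in_index(2) by auto
qed

lemma in_pos:
  assumes "h \<in> arrows_into Q i" "s < v (out_vertex h)"
  shows "in_pos v i h s < width v i" "in_index v i ! in_pos v i h s = (h, s)"
proof -
  have "(h, s) \<in> set (in_index v i)" unfolding in_index(2) using assms by auto
  then obtain k where k: "k < width v i" "in_index v i ! k = (h, s)"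
    unfolding width_def by (auto simp: in_set_conv_nth)
  have uniq: "k' = k" if "k' < width v i \<and> in_index v i ! k' = (h, s)" for k'
    using that k nth_eq_iff_index_eq[OF in_index(1), of k' v i k] unfolding width_def by simp
  have "in_pos v i h s = k"
    unfolding in_pos_def by (rule the_equality[OF _ uniq]) (simp_all add: k)
  then show "in_pos v i h s < width v i" "in_index v i ! in_pos v i h s = (h, s)" using k by auto
qed

lemma in_pos_nth [simp]:
  assumes "k < width v i"
  shows "in_pos v i (fst (in_index v i ! k)) (snd (in_index v i ! k)) = k"
proof -
  note p = in_pos[where v = v, OF in_index_nth[OF assms]]
  then show ?thesis
    using in_index(1)[of v i] nth_eq_iff_index_eq[of "in_index v i"] assms unfolding width_def by auto
qed

lemma sum_in_index:
  "(\<Sum>k = 0..<width v i. f (fst (in_index v i ! k)) (snd (in_index v i ! k))) =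
    (\<Sum>h\<in>arrows_into Q i. \<Sum>s = 0..<v (out_vertex h). f h s)"
proof -
  have "bij_betw ((!) (in_index v i)) {0..<width v i} (set (in_index v i))"
    using in_index(1) by (intro bij_betw_nth) (auto simp: width_def)
  from sum.reindex_bij_betw[OF this, of "\<lambda>p. f (fst p) (snd p)"]
  show ?thesis unfolding in_index(2) by (simp add: sum.Sigma case_prod_beta atLeast0LessThan)
qed

text \<open>The signs of the relation are put into the outgoing matrix, so that the relation at \<open>i\<close> becomes
the vanishing of the product of the two matrices.\<close>

definition in_mat :: "('i \<Rightarrow> nat) \<Rightarrow> 'i \<Rightarrow> ('i, 'e) rep \<Rightarrow> complex mat" where
  "in_mat v i x = mat (v i) (width v i)
     (\<lambda>(r, k). x (fst (in_index v i ! k)) $$ (r, snd (in_index v i ! k)))"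

definition out_mat :: "('i \<Rightarrow> nat) \<Rightarrow> 'i \<Rightarrow> ('i, 'e) rep \<Rightarrow> complex mat" where
  "out_mat v i x = mat (width v i) (v i)
     (\<lambda>(k, r). arrow_sign \<Omega> (fst (in_index v i ! k)) *
        x (rev_arrow (fst (in_index v i ! k))) $$ (snd (in_index v i ! k), r))"

lemma in_mat_carrier [simp]:
  "in_mat v i x \<in> carrier_mat (v i) (width v i)" "out_mat v i x \<in> carrier_mat (width v i) (v i)"
  "dim_row (in_mat v i x) = v i" "dim_col (in_mat v i x) = width v i"
  "dim_row (out_mat v i x) = width v i" "dim_col (out_mat v i x) = v i"
  unfolding in_mat_def out_mat_def by auto

lemma in_mat_pos:
  assumes "h \<in> arrows_into Q i" "s < v (out_vertex h)" "r < v i"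
  shows "in_mat v i x $$ (r, in_pos v i h s) = x h $$ (r, s)"
    and "out_mat v i x $$ (in_pos v i h s, r) = arrow_sign \<Omega> h * x (rev_arrow h) $$ (s, r)"
  unfolding in_mat_def out_mat_def using in_pos[where v = v, OF assms(1,2)] assms(3) by auto

text \<open>The representation with prescribed incoming and outgoing matrices at \<open>i\<close>; the sign of an arrow is its
own inverse.\<close>

definition glue ::
  "('i \<Rightarrow> nat) \<Rightarrow> 'i \<Rightarrow> complex mat \<Rightarrow> complex mat \<Rightarrow> ('i, 'e) rep \<Rightarrow> ('i, 'e) rep" where
  "glue v i A B y = (\<lambda>h\<in>arrows Q.
     if in_vertex h = i then mat (v i) (v (out_vertex h)) (\<lambda>(r, s). A $$ (r, in_pos v i h s))
     else if out_vertex h = i then mat (v (in_vertex h)) (v i)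
       (\<lambda>(s, r). arrow_sign \<Omega> (rev_arrow h) * B $$ (in_pos v i (rev_arrow h) s, r))
     else y h)"

definition agree_away :: "'i \<Rightarrow> ('i, 'e) rep \<Rightarrow> ('i, 'e) rep \<Rightarrow> bool" where
  "agree_away i x y \<longleftrightarrow>
     (\<forall>h\<in>arrows Q. in_vertex h \<noteq> i \<longrightarrow> out_vertex h \<noteq> i \<longrightarrow> x h = y h)"

lemma repsD: "x \<in> reps Q v \<Longrightarrow> h \<in> arrows Q \<Longrightarrow> x h \<in> carrier_mat (v (in_vertex h)) (v (out_vertex h))"
  unfolding reps_def by auto

lemma repsI:
  "\<lbrakk>\<And>h. h \<in> arrows Q \<Longrightarrow> x h \<in> carrier_mat (v (in_vertex h)) (v (out_vertex h));
    x \<in> extensional (arrows Q)\<rbrakk> \<Longrightarrow> x \<in> reps Q v"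
  unfolding reps_def by (auto simp: PiE_iff)

lemma glue_reps:
  assumes "agree_off i v v1" "z \<in> reps Q v1"
  shows "glue v i A B z \<in> reps Q v"
proof (rule repsI)
  fix h assume h: "h \<in> arrows Q"
  have "z h \<in> carrier_mat (v (in_vertex h)) (v (out_vertex h))" if "in_vertex h \<noteq> i" "out_vertex h \<noteq> i"
    using repsD[OF assms(2) h] assms(1) arrowsD[OF h] that unfolding agree_off_def by auto
  then show "glue v i A B z h \<in> carrier_mat (v (in_vertex h)) (v (out_vertex h))"
    using h by (auto simp: glue_def)
qed (auto simp: glue_def)

lemma glue_agree_away: "agree_away i (glue v i A B z) z"
  unfolding agree_away_def glue_def by auto

lemma in_mat_glue:
  assumes "A \<in> carrier_mat (v i) (width v i)"
  shows "in_mat v i (glue v i A B z) = A"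
proof (intro eq_matI)
  fix r k assume "r < dim_row A" "k < dim_col A"
  then have rk: "r < v i" "k < width v i" using assms by auto
  note h = in_index_nth[OF rk(2)]
  show "in_mat v i (glue v i A B z) $$ (r, k) = A $$ (r, k)"
    using rk h arrows_intoD(1,2)[OF h(1)] by (simp add: in_mat_def glue_def)
qed (use assms in auto)

lemma out_mat_glue:
  assumes "B \<in> carrier_mat (width v i) (v i)"
  shows "out_mat v i (glue v i A B z) = B"
proof (intro eq_matI)
  fix k r assume "k < dim_row B" "r < dim_col B"
  then have rk: "r < v i" "k < width v i" using assms by auto
  note h = in_index_nth[OF rk(2)]
  show "out_mat v i (glue v i A B z) $$ (k, r) = B $$ (k, r)"
    using rk h arrows_intoD(1,2,3)[OF h(1)] by (simp add: out_mat_def glue_def)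
qed (use assms in auto)

lemma rep_eqI:
  assumes x: "x \<in> reps Q v" and y: "y \<in> reps Q v"
    and eq: "in_mat v i x = in_mat v i y" "out_mat v i x = out_mat v i y" "agree_away i x y"
  shows "x = y"
proof (rule extensionalityI)
  show "x \<in> extensional (arrows Q)" "y \<in> extensional (arrows Q)"
    using x y unfolding reps_def by (auto simp: PiE_iff)
  fix h assume h: "h \<in> arrows Q"
  note xy = repsD[OF x h] repsD[OF y h]
  consider "in_vertex h = i" | "out_vertex h = i" | "in_vertex h \<noteq> i" "out_vertex h \<noteq> i" by auto
  then show "x h = y h"
  proof cases
    case 1
    then have hi: "h \<in> arrows_into Q i" using h unfolding arrows_into_def by simp
    show ?thesis
    proof (intro eq_matI)
      fix r s assume "r < dim_row (y h)" "s < dim_col (y h)"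
      then have "s < v (out_vertex h)" "r < v i" using xy 1 by auto
      from in_mat_pos(1)[where v = v, OF hi this, of x] in_mat_pos(1)[where v = v, OF hi this, of y]
      show "x h $$ (r, s) = y h $$ (r, s)" using eq(1) by simp
    qed (use xy in auto)
  next
    case 2
    then have hi: "rev_arrow h \<in> arrows_into Q i" using h unfolding arrows_into_def by simp
    show ?thesis
    proof (intro eq_matI)
      fix s r assume "s < dim_row (y h)" "r < dim_col (y h)"
      then have "s < v (out_vertex (rev_arrow h))" "r < v i" using xy 2 by auto
      from in_mat_pos(2)[where v = v, OF hi this, of x] in_mat_pos(2)[where v = v, OF hi this, of y]
      show "x h $$ (s, r) = y h $$ (s, r)" using eq(2) by simp
    qed (use xy in auto)
  next
    case 3
    then show ?thesis using eq(3) h unfolding agree_away_def by simp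
  qed
qed

lemma glue_self:
  assumes "x \<in> reps Q v"
  shows "glue v i (in_mat v i x) (out_mat v i x) x = x"
  by (rule rep_eqI[of _ v _ i])
    (simp_all add: assms glue_reps[OF agree_off_refl assms] in_mat_glue out_mat_glue glue_agree_away)

lemma glue_cong:
  assumes "agree_away i y z"
  shows "glue v i A B y = glue v i A B z"
  using assms unfolding glue_def agree_away_def by (intro restrict_ext) auto

subsection \<open>Polynomial dependence\<close>

lemma mat_fun_in_out_mat:
  assumes "function_ring F" "rep_fun F Q v \<Phi>"
  shows mat_fun_in_mat: "mat_fun F (v i) (width v i) (\<lambda>y. in_mat v i (\<Phi> y))"
    and mat_fun_out_mat: "mat_fun F (width v i) (v i) (\<lambda>y. out_mat v i (\<Phi> y))"
proof -
  show "mat_fun F (v i) (width v i) (\<lambda>y. in_mat v i (\<Phi> y))"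
    unfolding mat_fun_def
  proof (intro conjI allI impI)
    fix r k assume rk: "r < v i" "k < width v i"
    note h = in_index_nth[OF rk(2)]
    from rk h arrows_intoD(1,2)[OF h(1)] show "(\<lambda>y. in_mat v i (\<Phi> y) $$ (r, k)) \<in> F"
      using assms(2) unfolding rep_fun_def by (simp add: in_mat_def)
  qed simp
  show "mat_fun F (width v i) (v i) (\<lambda>y. out_mat v i (\<Phi> y))"
    unfolding mat_fun_def
  proof (intro conjI allI impI)
    fix r k assume rk: "k < width v i" "r < v i"
    note h = in_index_nth[OF rk(1)]
    from rk h arrows_intoD(1,2)[OF h(1)]
    have "(\<lambda>y. \<Phi> y (rev_arrow (fst (in_index v i ! k))) $$ (snd (in_index v i ! k), r)) \<in> F"
      using assms(2) unfolding rep_fun_def by simp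
    then show "(\<lambda>y. out_mat v i (\<Phi> y) $$ (k, r)) \<in> F"
      using rk by (simp add: out_mat_def function_ringD(1,3)[OF assms(1)])
  qed simp
qed

lemma rep_fun_glue:
  assumes F: "function_ring F" and A: "mat_fun F (v i) (width v i) A"
    and B: "mat_fun F (width v i) (v i) B"
    and \<Phi>: "\<And>h r s. \<lbrakk>h \<in> arrows Q; in_vertex h \<noteq> i; out_vertex h \<noteq> i;
      r < v (in_vertex h); s < v (out_vertex h)\<rbrakk> \<Longrightarrow> (\<lambda>y. \<Phi> y h $$ (r, s)) \<in> F"
  shows "rep_fun F Q v (\<lambda>y. glue v i (A y) (B y) (\<Phi> y))"
  unfolding rep_fun_def
proof (intro ballI allI impI)
  fix h r s assume h: "h \<in> arrows Q" and rs: "r < v (in_vertex h)" "s < v (out_vertex h)"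
  consider "in_vertex h = i" | "in_vertex h \<noteq> i" "out_vertex h = i"
    | "in_vertex h \<noteq> i" "out_vertex h \<noteq> i" by auto
  then show "(\<lambda>y. glue v i (A y) (B y) (\<Phi> y) h $$ (r, s)) \<in> F"
  proof cases
    case 1
    then have "h \<in> arrows_into Q i" using h unfolding arrows_into_def by simp
    then have "in_pos v i h s < width v i" using rs by (intro in_pos)
    then show ?thesis using 1 h rs mat_funD(4)[OF A] by (simp add: glue_def)
  next
    case 2
    then have "rev_arrow h \<in> arrows_into Q i" using h unfolding arrows_into_def by simp
    then have "in_pos v i (rev_arrow h) r < width v i" using rs by (intro in_pos) simp_all
    then show ?thesis using 2 h rs mat_funD(4)[OF B]
      by (simp add: glue_def function_ringD(1,3)[OF F])
  next
    case 3
    then show ?thesis using \<Phi>[OF h 3 rs] h by (simp add: glue_def)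
  qed
qed

subsection \<open>The preprojective relations\<close>

definition preproj_at :: "('i \<Rightarrow> nat) \<Rightarrow> 'i \<Rightarrow> ('i, 'e) rep \<Rightarrow> bool" where
  "preproj_at v i x \<longleftrightarrow> (\<forall>r<v i. \<forall>s<v i.
     (\<Sum>h\<in>arrows_into Q i. arrow_sign \<Omega> h * (x h * x (rev_arrow h)) $$ (r, s)) = 0)"

lemma preprojective_iff: "preprojective Q \<Omega> v x \<longleftrightarrow> (\<forall>i\<in>verts Q. preproj_at v i x)"
  unfolding preprojective_def preproj_at_def ..

lemma mult_entry:
  assumes "A \<in> carrier_mat n k" "B \<in> carrier_mat k m" "r < n" "s < m"
  shows "(A * B) $$ (r, s) = (\<Sum>t = 0..<k. A $$ (r, t) * B $$ (t, s))"
  using assms by (simp add: scalar_prod_def)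

lemma preproj_at_iff:
  assumes x: "x \<in> reps Q v"
  shows "preproj_at v i x \<longleftrightarrow> in_mat v i x * out_mat v i x = 0\<^sub>m (v i) (v i)"
proof -
  have "(\<Sum>h\<in>arrows_into Q i. arrow_sign \<Omega> h * (x h * x (rev_arrow h)) $$ (r, s)) =
      (in_mat v i x * out_mat v i x) $$ (r, s)" if rs: "r < v i" "s < v i" for r s
  proof -
    have "(in_mat v i x * out_mat v i x) $$ (r, s) =
        (\<Sum>k = 0..<width v i. in_mat v i x $$ (r, k) * out_mat v i x $$ (k, s))"
      using rs by (intro mult_entry) auto
    also have "\<dots> = (\<Sum>k = 0..<width v i. (\<lambda>h t. arrow_sign \<Omega> h *
        (x h $$ (r, t) * x (rev_arrow h) $$ (t, s))) (fst (in_index v i ! k)) (snd (in_index v i ! k)))"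
      using rs by (intro sum.cong) (auto simp: in_mat_def out_mat_def)
    also have "\<dots> = (\<Sum>h\<in>arrows_into Q i. \<Sum>t = 0..<v (out_vertex h). arrow_sign \<Omega> h *
        (x h $$ (r, t) * x (rev_arrow h) $$ (t, s)))"
      by (rule sum_in_index)
    also have "\<dots> = (\<Sum>h\<in>arrows_into Q i. arrow_sign \<Omega> h * (x h * x (rev_arrow h)) $$ (r, s))"
    proof (intro sum.cong refl)
      fix h assume h: "h \<in> arrows_into Q i"
      note hD = arrows_intoD[OF h]
      have "x h \<in> carrier_mat (v i) (v (out_vertex h))" using repsD[OF x hD(1)] hD(2) by simp
      moreover have "x (rev_arrow h) \<in> carrier_mat (v (out_vertex h)) (v i)"
        using repsD[OF x, of "rev_arrow h"] hD(1,2) by simp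
      ultimately show "(\<Sum>t = 0..<v (out_vertex h). arrow_sign \<Omega> h *
        (x h $$ (r, t) * x (rev_arrow h) $$ (t, s))) = arrow_sign \<Omega> h * (x h * x (rev_arrow h)) $$ (r, s)"
        using rs by (simp add: mult_entry sum_distrib_left del: index_mult_mat(1))
    qed
    finally show ?thesis by simp
  qed
  then show ?thesis
    unfolding preproj_at_def
    by (auto intro!: eq_matI simp del: index_mult_mat(1))
qed

text \<open>The relation at \<open>j\<close> sees the arrows at \<open>i\<close> only through paths from \<open>j\<close> to \<open>i\<close> and back, whose matrices
are blocks of the product of the outgoing and the incoming matrix at \<open>i\<close>.\<close>

lemma preproj_at_other:
  assumes x: "x \<in> reps Q v" and z: "z \<in> reps Q v1" and v: "agree_off i v v1"
    and away: "agree_away i x z" and j: "j \<in> verts Q" "j \<noteq> i"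
    and loop: "out_mat v i x * in_mat v i x = out_mat v1 i z * in_mat v1 i z"
  shows "preproj_at v j x \<longleftrightarrow> preproj_at v1 j z"
proof -
  have vj: "v j = v1 j" using v j unfolding agree_off_def by simp
  have "(x h * x (rev_arrow h)) $$ (r, s) = (z h * z (rev_arrow h)) $$ (r, s)"
    if h: "h \<in> arrows_into Q j" and rs: "r < v j" "s < v j" for h r s
  proof (cases "out_vertex h = i")
    case False
    then have "x h = z h" "x (rev_arrow h) = z (rev_arrow h)"
      using away arrows_intoD[OF h] j(2) unfolding agree_away_def by auto
    then show ?thesis by simp
  next
    case True
    note hD = arrows_intoD[OF h]
    have hi: "rev_arrow h \<in> arrows_into Q i" using True hD unfolding arrows_into_def by simp
    have entry: "(out_mat v' i y * in_mat v' i y) $$ (in_pos v' i (rev_arrow h) r, in_pos v' i (rev_arrow h) s)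
        = arrow_sign \<Omega> (rev_arrow h) * (y h * y (rev_arrow h)) $$ (r, s)"
      if y: "y \<in> reps Q v'" and rs: "r < v' j" "s < v' j" for y v'
    proof -
      have c: "y h \<in> carrier_mat (v' j) (v' i)" "y (rev_arrow h) \<in> carrier_mat (v' i) (v' j)"
        using repsD[OF y, of h] repsD[OF y, of "rev_arrow h"] hD True by auto
      have rs': "r < v' (out_vertex (rev_arrow h))" "s < v' (out_vertex (rev_arrow h))"
        using rs hD by auto
      note pos = in_pos(1)[where v = v', OF hi rs'(1)] in_pos(1)[where v = v', OF hi rs'(2)]
      have "(out_mat v' i y * in_mat v' i y) $$ (in_pos v' i (rev_arrow h) r, in_pos v' i (rev_arrow h) s)
        = (\<Sum>t = 0..<v' i. out_mat v' i y $$ (in_pos v' i (rev_arrow h) r, t) *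
            in_mat v' i y $$ (t, in_pos v' i (rev_arrow h) s))"
        using pos by (intro mult_entry) auto
      also have "\<dots> = (\<Sum>t = 0..<v' i. arrow_sign \<Omega> (rev_arrow h) * (y h $$ (r, t) * y (rev_arrow h) $$ (t, s)))"
        by (intro sum.cong refl) (simp add: in_mat_pos(1)[where v = v', OF hi rs'(2)]
            in_mat_pos(2)[where v = v', OF hi rs'(1)])
      also have "\<dots> = arrow_sign \<Omega> (rev_arrow h) * (y h * y (rev_arrow h)) $$ (r, s)"
        using mult_entry[OF c rs] by (simp add: sum_distrib_left)
      finally show ?thesis .
    qed
    have rs1: "r < v1 j" "s < v1 j" using rs vj by auto
    show ?thesis
      using entry[OF x rs] entry[OF z rs1] loop in_index_cong(3)[OF v] by simp
  qed
  then show ?thesis unfolding preproj_at_def vj[symmetric] by (auto cong: sum.cong)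
qed

subsection \<open>Subrepresentations of full dimension away from one vertex\<close>

text \<open>\<open>restricts i \<phi> x z\<close> expresses that \<open>z\<close> is the restriction of \<open>x\<close> along the map that is \<open>\<phi>\<close> at
  the vertex \<open>i\<close> and the identity at all other vertices.\<close>

definition restricts :: "'i \<Rightarrow> complex mat \<Rightarrow> ('i, 'e) rep \<Rightarrow> ('i, 'e) rep \<Rightarrow> bool" where
  "restricts i \<phi> x z \<longleftrightarrow> (\<forall>h\<in>arrows Q.
     (in_vertex h = i \<longrightarrow> x h = \<phi> * z h) \<and> (out_vertex h = i \<longrightarrow> z h = x h * \<phi>) \<and>
     (in_vertex h \<noteq> i \<longrightarrow> out_vertex h \<noteq> i \<longrightarrow> x h = z h))"

lemma restricts_iff:
  assumes x: "x \<in> reps Q v" and z: "z \<in> reps Q v1" and v: "agree_off i v v1"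
    and \<phi>: "\<phi> \<in> carrier_mat (v i) (v1 i)"
  shows "restricts i \<phi> x z \<longleftrightarrow> in_mat v i x = \<phi> * in_mat v1 i z \<and>
    out_mat v1 i z = out_mat v i x * \<phi> \<and> agree_away i x z"
proof -
  note cong = in_index_cong[OF v]
  have vout: "v (out_vertex h) = v1 (out_vertex h)" if "h \<in> arrows_into Q i" for h
    using arrows_intoD[OF that] v unfolding agree_off_def by auto
  have in_eq: "(\<forall>h\<in>arrows_into Q i. x h = \<phi> * z h) \<longleftrightarrow> in_mat v i x = \<phi> * in_mat v1 i z"
  proof
    assume *: "\<forall>h\<in>arrows_into Q i. x h = \<phi> * z h"
    show "in_mat v i x = \<phi> * in_mat v1 i z"
    proof (intro eq_matI)
      fix r k assume "r < dim_row (\<phi> * in_mat v1 i z)" "k < dim_col (\<phi> * in_mat v1 i z)"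
      then have rk: "r < v i" "k < width v1 i" using \<phi> by auto
      note h = in_index_nth[OF rk(2)]
      let ?h = "fst (in_index v1 i ! k)" and ?s = "snd (in_index v1 i ! k)"
      have zc: "z ?h \<in> carrier_mat (v1 i) (v1 (out_vertex ?h))"
        using repsD[OF z, of ?h] arrows_intoD[OF h(1)] by auto
      have "in_mat v i x $$ (r, k) = (\<phi> * z ?h) $$ (r, ?s)"
        using rk h(1) * cong by (simp add: in_mat_def)
      also have "\<dots> = (\<Sum>t = 0..<v1 i. \<phi> $$ (r, t) * z ?h $$ (t, ?s))"
        using rk h(2) by (intro mult_entry[OF \<phi> zc])
      also have "\<dots> = (\<phi> * in_mat v1 i z) $$ (r, k)"
        unfolding mult_entry[OF \<phi> in_mat_carrier(1) rk] using rk by (simp add: in_mat_def)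
      finally show "in_mat v i x $$ (r, k) = (\<phi> * in_mat v1 i z) $$ (r, k)" .
    qed (use \<phi> cong in auto)
  next
    assume *: "in_mat v i x = \<phi> * in_mat v1 i z"
    show "\<forall>h\<in>arrows_into Q i. x h = \<phi> * z h"
    proof
      fix h assume h: "h \<in> arrows_into Q i"
      have zc: "z h \<in> carrier_mat (v1 i) (v1 (out_vertex h))"
        using repsD[OF z, of h] arrows_intoD[OF h] by auto
      have xc: "x h \<in> carrier_mat (v i) (v1 (out_vertex h))"
        using repsD[OF x, of h] arrows_intoD[OF h] vout[OF h] by auto
      show "x h = \<phi> * z h"
      proof (intro eq_matI)
        fix r s assume "r < dim_row (\<phi> * z h)" "s < dim_col (\<phi> * z h)"
        then have rs: "r < v i" "s < v1 (out_vertex h)" using \<phi> zc by auto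
        have "x h $$ (r, s) = in_mat v i x $$ (r, in_pos v i h s)"
          using in_mat_pos(1)[where v = v, OF h _ rs(1)] rs(2) vout[OF h] by simp
        also have "\<dots> = (\<phi> * in_mat v1 i z) $$ (r, in_pos v1 i h s)" using * cong by simp
        also have "\<dots> = (\<Sum>t = 0..<v1 i. \<phi> $$ (r, t) * in_mat v1 i z $$ (t, in_pos v1 i h s))"
          using rs in_pos(1)[where v = v1, OF h rs(2)] by (intro mult_entry[OF \<phi>]) auto
        also have "\<dots> = (\<phi> * z h) $$ (r, s)"
          unfolding mult_entry[OF \<phi> zc rs] by (simp add: in_mat_pos(1)[where v = v1, OF h rs(2)])
        finally show "x h $$ (r, s) = (\<phi> * z h) $$ (r, s)" .
      qed (use \<phi> zc xc in auto)
    qed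
  qed
  have out_eq: "(\<forall>h\<in>arrows_into Q i. z (rev_arrow h) = x (rev_arrow h) * \<phi>) \<longleftrightarrow>
      out_mat v1 i z = out_mat v i x * \<phi>"
  proof
    assume *: "\<forall>h\<in>arrows_into Q i. z (rev_arrow h) = x (rev_arrow h) * \<phi>"
    show "out_mat v1 i z = out_mat v i x * \<phi>"
    proof (intro eq_matI)
      fix k r assume "k < dim_row (out_mat v i x * \<phi>)" "r < dim_col (out_mat v i x * \<phi>)"
      then have rk: "k < width v i" "r < v1 i" using \<phi> by auto
      note h = in_index_nth[OF rk(1)]
      let ?h = "fst (in_index v i ! k)" and ?s = "snd (in_index v i ! k)"
      have xc: "x (rev_arrow ?h) \<in> carrier_mat (v (out_vertex ?h)) (v i)"
        using repsD[OF x, of "rev_arrow ?h"] arrows_intoD[OF h(1)] by auto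
      have "out_mat v1 i z $$ (k, r) = arrow_sign \<Omega> ?h * (x (rev_arrow ?h) * \<phi>) $$ (?s, r)"
        using rk h(1) * cong by (simp add: out_mat_def)
      also have "\<dots> = arrow_sign \<Omega> ?h * (\<Sum>t = 0..<v i. x (rev_arrow ?h) $$ (?s, t) * \<phi> $$ (t, r))"
        using mult_entry[OF xc \<phi> h(2) rk(2)] by simp
      also have "\<dots> = (\<Sum>t = 0..<v i. out_mat v i x $$ (k, t) * \<phi> $$ (t, r))"
        using rk by (simp add: out_mat_def sum_distrib_left mult.assoc)
      also have "\<dots> = (out_mat v i x * \<phi>) $$ (k, r)"
        using mult_entry[OF in_mat_carrier(2) \<phi> rk] by simp
      finally show "out_mat v1 i z $$ (k, r) = (out_mat v i x * \<phi>) $$ (k, r)" .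
    qed (use \<phi> cong in auto)
  next
    assume *: "out_mat v1 i z = out_mat v i x * \<phi>"
    show "\<forall>h\<in>arrows_into Q i. z (rev_arrow h) = x (rev_arrow h) * \<phi>"
    proof
      fix h assume h: "h \<in> arrows_into Q i"
      have zc: "z (rev_arrow h) \<in> carrier_mat (v (out_vertex h)) (v1 i)"
        using repsD[OF z, of "rev_arrow h"] arrows_intoD[OF h] vout[OF h] by auto
      have xc: "x (rev_arrow h) \<in> carrier_mat (v (out_vertex h)) (v i)"
        using repsD[OF x, of "rev_arrow h"] arrows_intoD[OF h] by auto
      show "z (rev_arrow h) = x (rev_arrow h) * \<phi>"
      proof (intro eq_matI)
        fix s r assume "s < dim_row (x (rev_arrow h) * \<phi>)" "r < dim_col (x (rev_arrow h) * \<phi>)"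
        then have rs: "s < v (out_vertex h)" "r < v1 i" using \<phi> xc by auto
        have "arrow_sign \<Omega> h * z (rev_arrow h) $$ (s, r) = out_mat v1 i z $$ (in_pos v1 i h s, r)"
          using in_mat_pos(2)[where v = v1, OF h _ rs(2)] rs(1) vout[OF h] by simp
        also have "\<dots> = (out_mat v i x * \<phi>) $$ (in_pos v i h s, r)" using * cong by simp
        also have "\<dots> = (\<Sum>t = 0..<v i. out_mat v i x $$ (in_pos v i h s, t) * \<phi> $$ (t, r))"
          using rs in_pos(1)[where v = v, OF h rs(1)] by (intro mult_entry[OF _ \<phi>]) auto
        also have "\<dots> = (\<Sum>t = 0..<v i. arrow_sign \<Omega> h * (x (rev_arrow h) $$ (s, t) * \<phi> $$ (t, r)))"
          by (intro sum.cong) (auto simp: in_mat_pos(2)[where v = v, OF h rs(1)] mult.assoc)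
        also have "\<dots> = arrow_sign \<Omega> h * (x (rev_arrow h) * \<phi>) $$ (s, r)"
          unfolding mult_entry[OF xc \<phi> rs] by (simp add: sum_distrib_left)
        finally show "z (rev_arrow h) $$ (s, r) = (x (rev_arrow h) * \<phi>) $$ (s, r)" by simp
      qed (use \<phi> zc xc in auto)
    qed
  qed
  have "restricts i \<phi> x z \<longleftrightarrow> (\<forall>h\<in>arrows_into Q i. x h = \<phi> * z h) \<and>
      (\<forall>h\<in>arrows_into Q i. z (rev_arrow h) = x (rev_arrow h) * \<phi>) \<and> agree_away i x z"
  proof
    assume "restricts i \<phi> x z"
    then show "(\<forall>h\<in>arrows_into Q i. x h = \<phi> * z h) \<and>
      (\<forall>h\<in>arrows_into Q i. z (rev_arrow h) = x (rev_arrow h) * \<phi>) \<and> agree_away i x z"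
      unfolding restricts_def agree_away_def arrows_into_def by simp
  next
    assume "(\<forall>h\<in>arrows_into Q i. x h = \<phi> * z h) \<and>
      (\<forall>h\<in>arrows_into Q i. z (rev_arrow h) = x (rev_arrow h) * \<phi>) \<and> agree_away i x z"
    then have *: "\<And>h. h \<in> arrows_into Q i \<Longrightarrow> x h = \<phi> * z h"
      "\<And>h. h \<in> arrows_into Q i \<Longrightarrow> z (rev_arrow h) = x (rev_arrow h) * \<phi>"
      "agree_away i x z" by blast+
    show "restricts i \<phi> x z"
      unfolding restricts_def
    proof (intro ballI conjI impI)
      fix h assume h: "h \<in> arrows Q"
      show "x h = \<phi> * z h" if "in_vertex h = i"
        using *(1)[of h] h that unfolding arrows_into_def by simp
      show "z h = x h * \<phi>" if "out_vertex h = i"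
      proof -
        have "rev_arrow h \<in> arrows_into Q i" using h that unfolding arrows_into_def by simp
        from *(2)[OF this] show ?thesis by simp
      qed
      show "x h = z h" if "in_vertex h \<noteq> i" "out_vertex h \<noteq> i"
        using *(3) h that unfolding agree_away_def by simp
    qed
  qed
  then show ?thesis unfolding in_eq out_eq .
qed

subsection \<open>Nilpotency\<close>

definition is_path :: "('i, 'e) arrow list \<Rightarrow> bool" where
  "is_path hs \<longleftrightarrow> hs \<noteq> [] \<and> set hs \<subseteq> arrows Q \<and>
     successively (\<lambda>h h'. out_vertex h = in_vertex h') hs"

lemma is_path_single [simp]: "is_path [h] \<longleftrightarrow> h \<in> arrows Q"
  by (simp add: is_path_def)

lemma is_path_Cons:
  "hs \<noteq> [] \<Longrightarrow> is_path (h # hs) \<longleftrightarrow> h \<in> arrows Q \<and> out_vertex h = in_vertex (hd hs) \<and> is_path hs"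
  by (cases hs) (auto simp: is_path_def)

lemma is_path_snoc:
  "hs \<noteq> [] \<Longrightarrow> is_path (hs @ [h]) \<longleftrightarrow> h \<in> arrows Q \<and> out_vertex (last hs) = in_vertex h \<and> is_path hs"
  by (auto simp: is_path_def successively_append_iff)

lemma is_path_ends:
  assumes "is_path hs"
  shows "hd hs \<in> arrows Q" "last hs \<in> arrows Q"
    "in_vertex (hd hs) \<in> verts Q" "out_vertex (last hs) \<in> verts Q"
proof -
  show "hd hs \<in> arrows Q" "last hs \<in> arrows Q"
    using assms hd_in_set[of hs] last_in_set[of hs] unfolding is_path_def by blast+
  then show "in_vertex (hd hs) \<in> verts Q" "out_vertex (last hs) \<in> verts Q"
    by (simp_all add: arrowsD)
qed

lemma path_mat_Cons: "hs \<noteq> [] \<Longrightarrow> path_mat x (h # hs) = x h * path_mat x hs"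
  by (cases hs) auto

lemma path_mat_carrier:
  assumes x: "\<And>h. h \<in> arrows Q \<Longrightarrow> x h \<in> carrier_mat (v (in_vertex h)) (v (out_vertex h))"
    and "is_path hs"
  shows "path_mat x hs \<in> carrier_mat (v (in_vertex (hd hs))) (v (out_vertex (last hs)))"
proof -
  have "hs \<noteq> []" using assms(2) by (simp add: is_path_def)
  then show ?thesis using assms(2)
  proof (induction hs rule: list_nonempty_induct)
    case (cons h hs)
    then have "x h \<in> carrier_mat (v (in_vertex h)) (v (in_vertex (hd hs)))"
      using x[of h] by (auto simp: is_path_Cons)
    moreover have "path_mat x hs \<in> carrier_mat (v (in_vertex (hd hs))) (v (out_vertex (last hs)))"
      using cons by (auto simp: is_path_Cons)
    ultimately show ?case using cons.hyps by (auto simp: path_mat_Cons)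
  qed (use x in auto)
qed

lemma path_mat_snoc:
  assumes x: "\<And>h. h \<in> arrows Q \<Longrightarrow> x h \<in> carrier_mat (v (in_vertex h)) (v (out_vertex h))"
    and "hs \<noteq> []" "is_path (hs @ [h])"
  shows "path_mat x (hs @ [h]) = path_mat x hs * x h"
  using assms(2,3)
proof (induction hs rule: list_nonempty_induct)
  case (cons h' hs)
  have p: "is_path (hs @ [h])" "h' \<in> arrows Q" "out_vertex h' = in_vertex (hd hs)" "h \<in> arrows Q"
    "is_path hs" "out_vertex (last hs) = in_vertex h"
    using cons.prems cons.hyps is_path_Cons[of "hs @ [h]" h'] is_path_snoc[of hs h] by auto
  have "path_mat x ((h' # hs) @ [h]) = x h' * (path_mat x hs * x h)"
    using cons.IH[OF p(1)] by (simp add: path_mat_Cons)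
  also have "\<dots> = (x h' * path_mat x hs) * x h"
    by (rule assoc_mult_mat[symmetric])
      (use x[OF p(2)] x[OF p(4)] path_mat_carrier[of x v, OF x p(5)] p(3,6) in auto)
  finally show ?case using cons.hyps by (simp add: path_mat_Cons)
qed simp

definition nilp_bound :: "('i \<Rightarrow> nat) \<Rightarrow> nat \<Rightarrow> ('i, 'e) rep \<Rightarrow> bool" where
  "nilp_bound v N x \<longleftrightarrow> (\<forall>hs. is_path hs \<and> length hs = N \<longrightarrow>
     path_mat x hs = 0\<^sub>m (v (in_vertex (hd hs))) (v (out_vertex (last hs))))"

lemma nilpotent_iff: "nilpotent_rep Q v x \<longleftrightarrow> (\<exists>N\<ge>1. nilp_bound v N x)"
  unfolding nilpotent_rep_def nilp_bound_def is_path_def by (metis One_nat_def length_0_conv not_one_le_zero)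

lemma nilp_bound_mono:
  assumes x: "x \<in> reps Q v" and "nilp_bound v N x" "1 \<le> N" "N \<le> M"
  shows "nilp_bound v M x"
  using assms(4)
proof (induction rule: dec_induct)
  case (step n)
  show ?case
    unfolding nilp_bound_def
  proof (intro allI impI)
    fix hs assume hs: "is_path hs \<and> length hs = Suc n"
    then obtain h hs' where h: "hs = h # hs'" "length hs' = n" by (cases hs) auto
    with step(1) assms(3) have ne: "hs' \<noteq> []" by auto
    have p: "h \<in> arrows Q" "out_vertex h = in_vertex (hd hs')" "is_path hs'"
      using hs ne is_path_Cons[OF ne, of h] unfolding h by auto
    have "path_mat x hs' = 0\<^sub>m (v (in_vertex (hd hs'))) (v (out_vertex (last hs')))"
      using step.IH p(3) h(2) unfolding nilp_bound_def by simp
    then show "path_mat x hs = 0\<^sub>m (v (in_vertex (hd hs))) (v (out_vertex (last hs)))"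
      using ne repsD[OF x p(1)] p(2) by (simp add: h path_mat_Cons)
  qed
qed (rule assms(2))

context
  fixes i :: 'i and v v1 :: "'i \<Rightarrow> nat" and \<phi> P :: "complex mat" and x z :: "('i, 'e) rep"
  assumes i: "i \<in> verts Q" and x: "x \<in> reps Q v" and z: "z \<in> reps Q v1" and v: "agree_off i v v1"
    and \<phi>: "\<phi> \<in> carrier_mat (v i) (v1 i)" and P: "P \<in> carrier_mat (v1 i) (v i)" "P * \<phi> = 1\<^sub>m (v1 i)"
    and restr: "restricts i \<phi> x z"
begin

text \<open>The map that is \<open>\<phi>\<close> at \<open>i\<close> and the identity elsewhere is a morphism of representations.\<close>

lemma path_mat_intertwines:
  assumes "is_path hs"
  shows "(if in_vertex (hd hs) = i then \<phi> else 1\<^sub>m (v (in_vertex (hd hs)))) * path_mat z hs =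
    path_mat x hs * (if out_vertex (last hs) = i then \<phi> else 1\<^sub>m (v (out_vertex (last hs))))"
    (is "?\<Phi> (in_vertex (hd hs)) * _ = _ * ?\<Phi> _")
proof -
  have \<Phi>c: "?\<Phi> j \<in> carrier_mat (v j) (v1 j)" if "j \<in> verts Q" for j
    using \<phi> v that unfolding agree_off_def by auto
  have one: "?\<Phi> (in_vertex h) * z h = x h * ?\<Phi> (out_vertex h)" if h: "h \<in> arrows Q" for h
  proof -
    note c = carrier_matD[OF repsD[OF x h]] carrier_matD[OF repsD[OF z h]] arrowsD[OF h]
    have v': "in_vertex h \<noteq> i \<Longrightarrow> v (in_vertex h) = v1 (in_vertex h)"
      "out_vertex h \<noteq> i \<Longrightarrow> v (out_vertex h) = v1 (out_vertex h)"
      using v c unfolding agree_off_def by auto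
    have "in_vertex h = i \<Longrightarrow> x h = \<phi> * z h" "out_vertex h = i \<Longrightarrow> z h = x h * \<phi>"
      "in_vertex h \<noteq> i \<Longrightarrow> out_vertex h \<noteq> i \<Longrightarrow> x h = z h"
      using restr h unfolding restricts_def by auto
    note r = this
    consider "in_vertex h = i" "out_vertex h \<noteq> i" | "in_vertex h \<noteq> i" "out_vertex h = i"
      | "in_vertex h \<noteq> i" "out_vertex h \<noteq> i" using c(7) by metis
    then show ?thesis
    proof cases
      case 1
      then have "x h * 1\<^sub>m (v (out_vertex h)) = x h" using c(2) by (intro one_mult_dim(2))
      then show ?thesis unfolding if_P[OF 1(1)] if_not_P[OF 1(2)] using r(1)[OF 1(1)] by simp
    next
      case 2
      then have "1\<^sub>m (v (in_vertex h)) * z h = z h" using c(3) v'(1) by (intro one_mult_dim(1)) simp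
      then show ?thesis unfolding if_P[OF 2(2)] if_not_P[OF 2(1)] using r(2)[OF 2(2)] by simp
    next
      case 3
      then have "x h * 1\<^sub>m (v (out_vertex h)) = x h" "1\<^sub>m (v (in_vertex h)) * z h = z h"
        using c(2,3) v'(1) by (auto intro!: one_mult_dim)
      then show ?thesis unfolding if_not_P[OF 3(1)] if_not_P[OF 3(2)] using r(3)[OF 3] by simp
    qed
  qed
  have "hs \<noteq> []" using assms by (simp add: is_path_def)
  then show ?thesis using assms
  proof (induction hs rule: list_nonempty_induct)
    case (cons h hs)
    have p: "h \<in> arrows Q" "out_vertex h = in_vertex (hd hs)" "is_path hs"
      using cons by (auto simp: is_path_Cons)
    have l: "last hs \<in> arrows Q" "hd hs \<in> arrows Q"
      using is_path_ends[OF p(3)] by auto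
    note c = repsD[OF x p(1)] repsD[OF z p(1)] path_mat_carrier[of x v, OF repsD[OF x] p(3)]
      path_mat_carrier[of z v1, OF repsD[OF z] p(3)] \<Phi>c[OF arrowsD(1)[OF p(1)]]
      \<Phi>c[OF arrowsD(2)[OF p(1)]] \<Phi>c[OF arrowsD(2)[OF l(1)]]
    have "?\<Phi> (in_vertex h) * (z h * path_mat z hs) = (?\<Phi> (in_vertex h) * z h) * path_mat z hs"
      by (rule assoc_mult_mat[symmetric]) (use c p(2) in auto)
    also have "\<dots> = x h * (?\<Phi> (in_vertex (hd hs)) * path_mat z hs)"
      unfolding one[OF p(1)] p(2)[symmetric]
      by (rule assoc_mult_mat) (use c p(2) in auto)
    also have "\<dots> = x h * (path_mat x hs * ?\<Phi> (out_vertex (last hs)))"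
      using cons.IH[OF p(3)] by simp
    also have "\<dots> = (x h * path_mat x hs) * ?\<Phi> (out_vertex (last hs))"
      by (rule assoc_mult_mat[symmetric]) (use c p(2) in auto)
    finally show ?case
      by (simp only: path_mat_Cons[OF cons.hyps] list.sel(1) last_ConsR[OF cons.hyps])
  next
    case (single h)
    then have "h \<in> arrows Q" by simp
    from one[OF this] show ?case by (simp only: path_mat.simps list.sel(1) last_ConsL[OF refl])
  qed
qed

lemma nilp_bound_restriction:
  assumes "nilp_bound v N x"
  shows "nilp_bound v1 N z"
  unfolding nilp_bound_def
proof (intro allI impI)
  fix hs assume hs: "is_path hs \<and> length hs = N"
  let ?i = "in_vertex (hd hs)" and ?o = "out_vertex (last hs)"
  have ends: "?i \<in> verts Q" "?o \<in> verts Q" using hs is_path_ends[of hs] by auto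
  have zc: "path_mat z hs \<in> carrier_mat (v1 ?i) (v1 ?o)"
    using path_mat_carrier[of z v1, OF repsD[OF z]] hs by simp
  have "path_mat x hs = 0\<^sub>m (v ?i) (v ?o)"
    using assms hs unfolding nilp_bound_def by simp
  then have *: "(if ?i = i then \<phi> else 1\<^sub>m (v ?i)) * path_mat z hs = 0\<^sub>m (v ?i) (v1 ?o)"
    using path_mat_intertwines[of hs] hs \<phi> ends v unfolding agree_off_def by auto
  show "path_mat z hs = 0\<^sub>m (v1 ?i) (v1 ?o)"
  proof (cases "?i = i")
    case True
    have "P * (\<phi> * path_mat z hs) = (P * \<phi>) * path_mat z hs"
      by (rule assoc_mult_mat[symmetric]) (use P \<phi> zc True in auto)
    then show ?thesis using * P zc True by simp
  next
    case False
    then show ?thesis using * zc ends v unfolding agree_off_def by simp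
  qed
qed

text \<open>The quotient by the subrepresentation is concentrated at \<open>i\<close>, where there are no loops, so one more
arrow always leads into the subrepresentation.\<close>

lemma nilp_bound_extension:
  assumes "nilp_bound v1 N z" "1 \<le> N"
  shows "nilp_bound v (Suc N) x"
  unfolding nilp_bound_def
proof (intro allI impI)
  fix hs assume hs: "is_path hs \<and> length hs = Suc N"
  let ?i = "in_vertex (hd hs)" and ?o = "out_vertex (last hs)"
  have *: "path_mat x hs' = 0\<^sub>m (v (in_vertex (hd hs'))) (v (out_vertex (last hs')))"
    if hs': "is_path hs'" "N \<le> length hs'" "out_vertex (last hs') \<noteq> i" for hs'
  proof -
    have ends: "in_vertex (hd hs') \<in> verts Q" "out_vertex (last hs') \<in> verts Q"
      using is_path_ends[OF hs'(1)] by auto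
    have "path_mat z hs' = 0\<^sub>m (v1 (in_vertex (hd hs'))) (v1 (out_vertex (last hs')))"
      using nilp_bound_mono[OF z assms(1,2) hs'(2)] hs'(1) unfolding nilp_bound_def by simp
    moreover have "path_mat x hs' \<in> carrier_mat (v (in_vertex (hd hs'))) (v (out_vertex (last hs')))"
      using path_mat_carrier[of x v, OF repsD[OF x] hs'(1)] .
    ultimately show ?thesis
      using path_mat_intertwines[OF hs'(1)] hs'(3) \<phi> ends v unfolding agree_off_def
      by (auto split: if_splits)
  qed
  show "path_mat x hs = 0\<^sub>m (v ?i) (v ?o)"
  proof (cases "?o = i")
    case False
    then show ?thesis using * hs by simp
  next
    case True
    \<comment> \<open>The last arrow of the path starts at \<open>i\<close>, so it does not end there, and the path without
      it vanishes.\<close>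
    obtain hs' h where h: "hs = hs' @ [h]" "length hs' = N" using hs by (cases hs rule: rev_cases) auto
    have ne: "hs' \<noteq> []" using h(2) assms(2) by auto
    have p: "h \<in> arrows Q" "out_vertex (last hs') = in_vertex h" "is_path hs'"
      using hs is_path_snoc[OF ne, of h] unfolding h(1) by auto
    have "path_mat x hs' = 0\<^sub>m (v (in_vertex (hd hs'))) (v (out_vertex (last hs')))"
      using *[OF p(3)] h(2) p(2) arrowsD(3)[OF p(1)] True by (simp add: h(1))
    moreover have "path_mat x hs = path_mat x hs' * x h"
      unfolding h(1) by (rule path_mat_snoc[of x v]) (use repsD[OF x] ne hs h(1) in auto)
    ultimately show ?thesis using repsD[OF x p(1)] p(2) ne by (simp add: h(1))
  qed
qed

lemma in_mat_restriction: "in_mat v i x = \<phi> * in_mat v1 i z"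
  and out_mat_restriction: "out_mat v1 i z = out_mat v i x * \<phi>"
  and agree_away_restriction: "agree_away i x z"
  using restr restricts_iff[OF x z v \<phi>] by auto

lemma preproj_at_restriction_other:
  assumes "j \<in> verts Q" "j \<noteq> i"
  shows "preproj_at v j x \<longleftrightarrow> preproj_at v1 j z"
proof (rule preproj_at_other[OF x z v agree_away_restriction assms])
  show "out_mat v i x * in_mat v i x = out_mat v1 i z * in_mat v1 i z"
    unfolding in_mat_restriction out_mat_restriction using \<phi> by (simp add: mat_algebra)
qed

text \<open>Nilpotency and the relations at the other vertices pass between \<open>x\<close> and its restriction in both
directions. Only the relation at \<open>i\<close> is stronger for \<open>x\<close>: after cancelling the injective \<open>\<phi>\<close> it says
that the outgoing matrix of \<open>x\<close> maps into the kernel of the incoming matrix of \<open>z\<close>.\<close>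

lemma Lam_restriction_iff:
  "x \<in> Lam Q \<Omega> v \<longleftrightarrow> z \<in> Lam Q \<Omega> v1 \<and> in_mat v1 i z * out_mat v i x = 0\<^sub>m (v1 i) (v i)"
proof -
  note cong = in_index_cong(2)[OF v]
  have "nilpotent_rep Q v x \<longleftrightarrow> nilpotent_rep Q v1 z"
    unfolding nilpotent_iff using nilp_bound_restriction nilp_bound_extension by (metis le_SucI)
  moreover have "preproj_at v i x \<longleftrightarrow> in_mat v1 i z * out_mat v i x = 0\<^sub>m (v1 i) (v i)"
  proof
    assume "preproj_at v i x"
    then have "\<phi> * (in_mat v1 i z * out_mat v i x) = 0\<^sub>m (v i) (v i)"
      unfolding preproj_at_iff[OF x] in_mat_restriction using \<phi> cong by (simp add: mat_algebra)
    then have "P * (\<phi> * (in_mat v1 i z * out_mat v i x)) = 0\<^sub>m (v1 i) (v i)"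
      using P(1) by simp
    moreover have "P * (\<phi> * (in_mat v1 i z * out_mat v i x)) = in_mat v1 i z * out_mat v i x"
      using mult_assoc_left[OF P(2), of "in_mat v1 i z * out_mat v i x"] P(1) \<phi> by simp
    ultimately show "in_mat v1 i z * out_mat v i x = 0\<^sub>m (v1 i) (v i)" by simp
  next
    assume "in_mat v1 i z * out_mat v i x = 0\<^sub>m (v1 i) (v i)"
    then show "preproj_at v i x"
      unfolding preproj_at_iff[OF x] in_mat_restriction using \<phi> cong by (simp add: mat_algebra)
  qed
  moreover have "preproj_at v1 i z" if "in_mat v1 i z * out_mat v i x = 0\<^sub>m (v1 i) (v i)"
  proof -
    have "in_mat v1 i z * (out_mat v i x * \<phi>) = (in_mat v1 i z * out_mat v i x) * \<phi>"
      using \<phi> cong by (simp add: mat_algebra)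
    then show ?thesis unfolding preproj_at_iff[OF z] out_mat_restriction that using \<phi> by simp
  qed
  ultimately show ?thesis
    using x z preproj_at_restriction_other i unfolding Lam_def preprojective_iff by auto
qed

end

lemma restriction_exists:
  assumes i: "i \<in> verts Q" and x: "x \<in> Lam Q \<Omega> v" and v: "agree_off i v v1"
    and \<phi>: "\<phi> \<in> carrier_mat (v i) (v1 i)" and P: "P \<in> carrier_mat (v1 i) (v i)" "P * \<phi> = 1\<^sub>m (v1 i)"
    and image: "in_mat v i x = \<phi> * (P * in_mat v i x)"
  defines "z \<equiv> glue v1 i (P * in_mat v i x) (out_mat v i x * \<phi>) x"
  shows "z \<in> Lam Q \<Omega> v1" "restricts i \<phi> x z" "in_mat v1 i z = P * in_mat v i x"
proof -
  have xr: "x \<in> reps Q v" using x unfolding Lam_def by simp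
  have v': "agree_off i v1 v" using v unfolding agree_off_def by simp
  note cong = in_index_cong(2)[OF v]
  have zr: "z \<in> reps Q v1" unfolding z_def by (rule glue_reps[OF v' xr])
  show zin: "in_mat v1 i z = P * in_mat v i x"
    unfolding z_def using P(1) cong by (intro in_mat_glue) auto
  have zout: "out_mat v1 i z = out_mat v i x * \<phi>"
    unfolding z_def using \<phi> cong by (intro out_mat_glue) auto
  have "agree_away i x z"
    using glue_agree_away[of i v1 "P * in_mat v i x" "out_mat v i x * \<phi>" x]
    unfolding z_def agree_away_def by auto
  then show restr: "restricts i \<phi> x z"
    unfolding restricts_iff[OF xr zr v \<phi>] zin zout using image by simp
  show "z \<in> Lam Q \<Omega> v1" using Lam_restriction_iff[OF i xr zr v \<phi> P restr] x by simp
qed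

subsection \<open>The cokernel dimension at a vertex\<close>

lemma incoming_image_eq:
  assumes x: "x \<in> reps Q v"
  shows "incoming_image Q v i x = mat_image (in_mat v i x)"
proof -
  have key: "(in_mat v i x *\<^sub>v u) $ r = (\<Sum>h\<in>arrows_into Q i. (x h *\<^sub>v w h) $ r)"
    if w: "\<And>h. h \<in> arrows_into Q i \<Longrightarrow> w h \<in> carrier_vec (v (out_vertex h))"
      and u: "u \<in> carrier_vec (width v i)"
      "\<And>k. k < width v i \<Longrightarrow> u $ k = w (fst (in_index v i ! k)) $ snd (in_index v i ! k)"
      and r: "r < v i" for u w r
  proof -
    have "(in_mat v i x *\<^sub>v u) $ r = (\<Sum>k = 0..<width v i. in_mat v i x $$ (r, k) * u $ k)"
      using r u(1) by (simp add: scalar_prod_def)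
    also have "\<dots> = (\<Sum>k = 0..<width v i. (\<lambda>h s. x h $$ (r, s) * w h $ s)
        (fst (in_index v i ! k)) (snd (in_index v i ! k)))"
      using r u(2) by (intro sum.cong) (auto simp: in_mat_def)
    also have "\<dots> = (\<Sum>h\<in>arrows_into Q i. \<Sum>s = 0..<v (out_vertex h). x h $$ (r, s) * w h $ s)"
      by (rule sum_in_index)
    also have "\<dots> = (\<Sum>h\<in>arrows_into Q i. (x h *\<^sub>v w h) $ r)"
    proof (intro sum.cong refl)
      fix h assume h: "h \<in> arrows_into Q i"
      have "x h \<in> carrier_mat (v i) (v (out_vertex h))"
        using repsD[OF x, of h] arrows_intoD[OF h] by auto
      then show "(\<Sum>s = 0..<v (out_vertex h). x h $$ (r, s) * w h $ s) = (x h *\<^sub>v w h) $ r"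
        using w[OF h] r by (simp add: scalar_prod_def)
    qed
    finally show ?thesis .
  qed
  show ?thesis
  proof (intro equalityI subsetI)
    fix y assume "y \<in> incoming_image Q v i x"
    then obtain w where w: "w \<in> (\<Pi>\<^sub>E h\<in>arrows_into Q i. carrier_vec (v (out_vertex h)))"
      "y = vec (v i) (\<lambda>r. \<Sum>h\<in>arrows_into Q i. (x h *\<^sub>v w h) $ r)"
      unfolding incoming_image_def by auto
    define u where "u = vec (width v i) (\<lambda>k. w (fst (in_index v i ! k)) $ snd (in_index v i ! k))"
    have "in_mat v i x *\<^sub>v u = y"
      using key[of w u] w by (intro eq_vecI) (auto simp: u_def PiE_iff)
    then show "y \<in> mat_image (in_mat v i x)"
      unfolding mat_image_def by (auto simp: u_def intro!: image_eqI[of _ _ u])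
  next
    fix y assume "y \<in> mat_image (in_mat v i x)"
    then obtain u where u: "u \<in> carrier_vec (width v i)" "y = in_mat v i x *\<^sub>v u"
      unfolding mat_image_def by auto
    define w where "w = (\<lambda>h\<in>arrows_into Q i. vec (v (out_vertex h)) (\<lambda>s. u $ in_pos v i h s))"
    have "y = vec (v i) (\<lambda>r. \<Sum>h\<in>arrows_into Q i. (x h *\<^sub>v w h) $ r)"
      using key[of w u] u in_index_nth by (intro eq_vecI) (auto simp: w_def)
    moreover have "w \<in> (\<Pi>\<^sub>E h\<in>arrows_into Q i. carrier_vec (v (out_vertex h)))"
      by (auto simp: w_def)
    ultimately show "y \<in> incoming_image Q v i x" unfolding incoming_image_def by blast
  qed
qed

lemma eps_rep_eq:
  assumes "x \<in> reps Q v" "rank_ge r (in_mat v i x)" "rank_le r (in_mat v i x)"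
  shows "eps_rep Q v i x = v i - r"
  unfolding eps_rep_def incoming_image_eq[OF assms(1)]
  using dim_mat_image[OF in_mat_carrier(1) assms(2,3)] by simp

lemma rank_ge_antimono:
  assumes "rank_ge r M" "m \<le> r"
  shows "rank_ge m M"
proof -
  obtain P T where PT: "P \<in> carrier_mat r (dim_row M)" "T \<in> carrier_mat (dim_col M) r" "P * M * T = 1\<^sub>m r"
    using assms(1) unfolding rank_ge_def by blast
  note dims = carrier_matD[OF PT(1)] carrier_matD[OF PT(2)]
  have "(incl m r * P) * M * (T * incl r m) = incl m r * ((P * M * T) * incl r m)"
    using dims by (simp add: mat_algebra)
  also have "\<dots> = 1\<^sub>m m" unfolding PT(3) using assms(2) by simp
  finally show ?thesis
    unfolding rank_ge_def using dims
    by (intro exI[of _ "incl m r * P"] exI[of _ "T * incl r m"]) auto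
qed

text \<open>Semicontinuity will follow from this form, in which the rank is bounded from below by witnesses.\<close>

lemma eps_rep_le_iff:
  assumes x: "x \<in> reps Q v" and m: "m \<le> v i"
  shows "eps_rep Q v i x \<le> v i - m \<longleftrightarrow> rank_ge m (in_mat v i x)"
proof -
  obtain r where r: "rank_ge r (in_mat v i x)" "rank_le r (in_mat v i x)" using rank_exists by blast
  have "r \<le> v i" using rank_ge_imp_le[OF r(1) rank_le_dims] by simp
  moreover have "eps_rep Q v i x = v i - r" by (rule eps_rep_eq[OF x r])
  moreover have "rank_ge m (in_mat v i x) \<longleftrightarrow> m \<le> r"
    using rank_ge_antimono[OF r(1)] rank_ge_imp_le[OF _ r(2)] by blast
  ultimately show ?thesis using m by auto
qed

lemma eps_rep_le: "eps_rep Q v i x \<le> v i"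
  unfolding eps_rep_def by simp

lemma eps_rep_rank:
  assumes x: "x \<in> reps Q v" and m: "eps_rep Q v i x = v i - m" "m \<le> v i"
  shows "rank_ge m (in_mat v i x)" "rank_le m (in_mat v i x)"
proof -
  obtain r where r: "rank_ge r (in_mat v i x)" "rank_le r (in_mat v i x)" using rank_exists by blast
  have "r \<le> v i" using rank_ge_imp_le[OF r(1) rank_le_dims] by simp
  moreover have "eps_rep Q v i x = v i - r" by (rule eps_rep_eq[OF x r])
  ultimately have "r = m" using m by simp
  with r show "rank_ge m (in_mat v i x)" "rank_le m (in_mat v i x)" by auto
qed

text \<open>A nilpotent representation on a nonzero space is not surjective at every vertex: a nonzero
  linear form could otherwise be pulled back along paths of any length.\<close>

lemma exists_eps_rep_positive:
  assumes x: "x \<in> Lam Q \<Omega> v" and j: "j \<in> verts Q" "v j > 0"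
  shows "\<exists>i\<in>verts Q. eps_rep Q v i x > 0"
proof (rule ccontr)
  assume contra: "\<not> ?thesis"
  have xr: "x \<in> reps Q v" and nil: "nilpotent_rep Q v x" using x unfolding Lam_def by auto
  have step: "\<exists>h\<in>arrows_into Q i. l * x h \<noteq> 0\<^sub>m 1 (v (out_vertex h))"
    if i: "i \<in> verts Q" and l: "l \<in> carrier_mat 1 (v i)" "l \<noteq> 0\<^sub>m 1 (v i)" for i l
  proof (rule ccontr)
    assume *: "\<not> ?thesis"
    have "eps_rep Q v i x = v i - v i" using contra i by simp
    from eps_rep_rank(1)[OF xr this] obtain P T where PT: "P \<in> carrier_mat (v i) (v i)"
      "T \<in> carrier_mat (width v i) (v i)" "P * in_mat v i x * T = 1\<^sub>m (v i)"
      unfolding rank_ge_def by auto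
    have "l * in_mat v i x = 0\<^sub>m 1 (width v i)"
    proof (intro eq_matI)
      fix r k assume "r < dim_row (0\<^sub>m 1 (width v i) :: complex mat)" "k < dim_col (0\<^sub>m 1 (width v i) :: complex mat)"
      then have rk: "r < 1" "k < width v i" by auto
      note h = in_index_nth[OF rk(2)]
      let ?h = "fst (in_index v i ! k)" and ?s = "snd (in_index v i ! k)"
      have xc: "x ?h \<in> carrier_mat (v i) (v (out_vertex ?h))"
        using repsD[OF xr, of ?h] arrows_intoD[OF h(1)] by auto
      have "(l * in_mat v i x) $$ (r, k) = (l * x ?h) $$ (r, ?s)"
        unfolding mult_entry[OF l(1) in_mat_carrier(1) rk] mult_entry[OF l(1) xc rk(1) h(2)]
        using rk by (simp add: in_mat_def)
      also have "\<dots> = 0" using * h rk by simp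
      finally show "(l * in_mat v i x) $$ (r, k) = 0\<^sub>m 1 (width v i) $$ (r, k)" using rk by simp
    qed (use l in auto)
    moreover have "(in_mat v i x * T) * P = 1\<^sub>m (v i)"
      by (rule mat_mult_left_right_inverse[of P "v i" "in_mat v i x * T"])
        (use PT in \<open>auto simp: mult_assoc_dim\<close>)
    then have "l = (l * in_mat v i x) * (T * P)"
      using l(1) PT(1,2) by (simp add: mat_algebra)
    ultimately have "l = 0\<^sub>m 1 (v i)" using PT(1,2) by simp
    with l(2) show False by simp
  qed
  have paths: "\<exists>hs. is_path hs \<and> length hs = Suc N \<and> in_vertex (hd hs) = i \<and>
      l * path_mat x hs \<noteq> 0\<^sub>m 1 (v (out_vertex (last hs)))"
    if "i \<in> verts Q" "l \<in> carrier_mat 1 (v i)" "l \<noteq> 0\<^sub>m 1 (v i)" for N i l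
    using that
  proof (induction N arbitrary: i l)
    case 0
    from step[OF this] obtain h where "h \<in> arrows_into Q i" "l * x h \<noteq> 0\<^sub>m 1 (v (out_vertex h))" by blast
    then show ?case by (intro exI[of _ "[h]"]) (auto dest: arrows_intoD)
  next
    case (Suc N)
    from step[OF Suc.prems] obtain h where h: "h \<in> arrows_into Q i" "l * x h \<noteq> 0\<^sub>m 1 (v (out_vertex h))" by blast
    note hD = arrows_intoD[OF h(1)]
    have xc: "x h \<in> carrier_mat (v i) (v (out_vertex h))" using repsD[OF xr hD(1)] hD(2) by simp
    have "l * x h \<in> carrier_mat 1 (v (out_vertex h))" using Suc.prems(2) xc by auto
    from Suc.IH[OF hD(4) this h(2)] obtain hs where hs: "is_path hs" "length hs = Suc N"
      "in_vertex (hd hs) = out_vertex h" "l * x h * path_mat x hs \<noteq> 0\<^sub>m 1 (v (out_vertex (last hs)))" by blast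
    have ne: "hs \<noteq> []" using hs(2) by auto
    have "l * (x h * path_mat x hs) = l * x h * path_mat x hs"
      by (rule assoc_mult_mat[symmetric])
        (use Suc.prems(2) xc path_mat_carrier[of x v, OF repsD[OF xr] hs(1)] hs(3) in auto)
    then show ?case
      using hs hD ne by (intro exI[of _ "h # hs"]) (auto simp: is_path_Cons path_mat_Cons)
  qed
  obtain N where N: "N \<ge> 1" "nilp_bound v N x" using nil unfolding nilpotent_iff by blast
  define l where "l = (mat 1 (v j) (\<lambda>_. 1) :: complex mat)"
  have l: "l \<in> carrier_mat 1 (v j)" by (simp add: l_def)
  have "l $$ (0, 0) = 1" using j(2) by (simp add: l_def)
  moreover have "(0\<^sub>m 1 (v j) :: complex mat) $$ (0, 0) = 0" using j(2) by simp
  ultimately have "l \<noteq> 0\<^sub>m 1 (v j)" by auto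
  from paths[OF j(1) l this, of "N - 1"] N(1) obtain hs where
    hs: "is_path hs" "length hs = N" "in_vertex (hd hs) = j" "l * path_mat x hs \<noteq> 0\<^sub>m 1 (v (out_vertex (last hs)))"
    by auto
  then have "path_mat x hs = 0\<^sub>m (v j) (v (out_vertex (last hs)))"
    using N(2) unfolding nilp_bound_def by auto
  with hs(4) l show False by simp
qed

definition total_dim :: "('i \<Rightarrow> nat) \<Rightarrow> nat" where
  "total_dim v = (\<Sum>j\<in>verts Q. v j)"

lemma finite_verts: "finite (verts Q)"
  using graph unfolding graph_def by simp

lemma total_dim_zero: "total_dim v = 0 \<longleftrightarrow> (\<forall>j\<in>verts Q. v j = 0)"
  unfolding total_dim_def using finite_verts by simp

lemma total_dim_agree:
  assumes "agree_off i v v1" "i \<in> verts Q"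
  shows "total_dim v + v1 i = total_dim v1 + v i"
proof -
  have "(\<Sum>j\<in>verts Q - {i}. v j) = (\<Sum>j\<in>verts Q - {i}. v1 j)"
    using assms(1) unfolding agree_off_def by (intro sum.cong) auto
  then show ?thesis
    unfolding total_dim_def using finite_verts assms(2) by (simp add: sum.remove[of _ i])
qed

lemma restriction_to_image:
  assumes i: "i \<in> verts Q" and x: "x \<in> Lam Q \<Omega> v" and v: "agree_off i v v1"
    and c: "eps_rep Q v i x = v i - v1 i" "v1 i \<le> v i"
  shows "\<exists>\<phi> P z. \<phi> \<in> carrier_mat (v i) (v1 i) \<and> P \<in> carrier_mat (v1 i) (v i) \<and>
    P * \<phi> = 1\<^sub>m (v1 i) \<and> z \<in> Lam Q \<Omega> v1 \<and> restricts i \<phi> x z"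
proof -
  have xr: "x \<in> reps Q v" using x unfolding Lam_def by simp
  note r = eps_rep_rank[OF xr c]
  obtain P T where PT: "P \<in> carrier_mat (v1 i) (v i)" "T \<in> carrier_mat (width v i) (v1 i)"
    "P * in_mat v i x * T = 1\<^sub>m (v1 i)"
    using r(1) unfolding rank_ge_def by auto
  have fac: "in_mat v i x = in_mat v i x * T * (P * in_mat v i x)" "P * (in_mat v i x * T) = 1\<^sub>m (v1 i)"
    using factor_through_chart[OF in_mat_carrier(1) r(2) PT(1,2), of "1\<^sub>m (v1 i)"] PT
    by (auto simp: mult_assoc_dim)
  have \<phi>: "in_mat v i x * T \<in> carrier_mat (v i) (v1 i)"
    by (rule mult_carrier_mat[OF in_mat_carrier(1) PT(2)])
  from restriction_exists(1,2)[OF i x v \<phi> PT(1) fac(2) fac(1)] \<phi> PT(1) fac(2)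
  show ?thesis by blast
qed

text \<open>By induction on the total dimension: the restriction to the image at a vertex that is not reached
  surjectively shortens the nonzero paths by at most one. The uniform bound makes nilpotency a closed
  condition.\<close>

lemma Lam_nilp_bound:
  assumes "x \<in> Lam Q \<Omega> v"
  shows "nilp_bound v (Suc (total_dim v)) x"
  using assms
proof (induction "total_dim v" arbitrary: v x rule: less_induct)
  case less
  have xr: "x \<in> reps Q v" using less.prems unfolding Lam_def by simp
  show ?case
  proof (cases "total_dim v = 0")
    case True
    show ?thesis
      unfolding nilp_bound_def
    proof (intro allI impI)
      fix hs assume hs: "is_path hs \<and> length hs = Suc (total_dim v)"
      then have "in_vertex (hd hs) \<in> verts Q" using is_path_ends(3)[of hs] by simp
      then have "v (in_vertex (hd hs)) = 0" using True total_dim_zero by simp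
      then show "path_mat x hs = 0\<^sub>m (v (in_vertex (hd hs))) (v (out_vertex (last hs)))"
        using path_mat_carrier[of x v, OF repsD[OF xr], of hs] hs by (intro eq_matI) auto
    qed
  next
    case False
    then obtain j where "j \<in> verts Q" "v j > 0" using total_dim_zero by auto
    from exists_eps_rep_positive[OF less.prems this] obtain i
      where i: "i \<in> verts Q" "eps_rep Q v i x > 0" by blast
    define v1 where "v1 = v(i := v i - eps_rep Q v i x)"
    have v: "agree_off i v v1" by (simp add: v1_def agree_off_def)
    have c: "eps_rep Q v i x = v i - v1 i" "v1 i < v i"
      using eps_rep_le[of v i x] i(2) by (auto simp: v1_def)
    obtain \<phi> P z where z: "\<phi> \<in> carrier_mat (v i) (v1 i)" "P \<in> carrier_mat (v1 i) (v i)"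
      "P * \<phi> = 1\<^sub>m (v1 i)" "z \<in> Lam Q \<Omega> v1" "restricts i \<phi> x z"
      using restriction_to_image[OF i(1) less.prems v c(1)] c(2) by auto
    have zr: "z \<in> reps Q v1" using z(4) unfolding Lam_def by simp
    have t: "total_dim v1 < total_dim v" using total_dim_agree[OF v i(1)] c(2) by simp
    have "nilp_bound v (Suc (Suc (total_dim v1))) x"
      by (rule nilp_bound_extension[OF i(1) xr zr v z(1-3,5) less.hyps[OF t z(4)]]) simp
    then show ?thesis by (rule nilp_bound_mono[OF xr]) (use t in auto)
  qed
qed

section \<open>Closedness, semicontinuity and invariance of components\<close>

lemma Lam_reps: "x \<in> Lam Q \<Omega> v \<Longrightarrow> x \<in> reps Q v"
  unfolding Lam_def by simp

lemma rep_fun_id: "rep_fun (polynomial_functions Q v) Q v (\<lambda>x. x)"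
  unfolding rep_fun_def by (auto intro: polynomial_functions.coord)

lemma smult_twice: "a \<cdot>\<^sub>m (b \<cdot>\<^sub>m A) = (a * b :: complex) \<cdot>\<^sub>m A"
  by (intro eq_matI) auto

lemma smult_one: "(1 :: complex) \<cdot>\<^sub>m A = A"
  by (intro eq_matI) auto

lemmas pf_ring = function_ring_polynomial_functions[of Q]
lemmas mat_fun_in_mat_id = mat_fun_in_mat[OF pf_ring rep_fun_id]
lemmas mat_fun_out_mat_id = mat_fun_out_mat[OF pf_ring rep_fun_id]

text \<open>Since the length of nonzero paths is bounded uniformly on \<open>\<Lambda>(v)\<close>, nilpotency is given by polynomial
equations.\<close>

lemma closed_Lam: "closedin (zariski Q v) (Lam Q \<Omega> v)"
proof -
  let ?F = "polynomial_functions Q v"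
  define nf where "nf x = (\<lambda>h\<in>arrows Q. mat (v (in_vertex h)) (v (out_vertex h)) (\<lambda>p. x h $$ p))"
    for x :: "('i, 'e) rep"
  have nf: "nf x = x" if "x \<in> reps Q v" for x
  proof (rule extensionalityI)
    show "nf x \<in> extensional (arrows Q)" "x \<in> extensional (arrows Q)"
      using that unfolding reps_def nf_def by (auto simp: PiE_iff)
    show "nf x h = x h" if "h \<in> arrows Q" for h
      using repsD[OF \<open>x \<in> reps Q v\<close> that] that by (intro eq_matI) (auto simp: nf_def)
  qed
  have nfc: "nf x h \<in> carrier_mat (v (in_vertex h)) (v (out_vertex h))" if "h \<in> arrows Q" for x h
    using that by (simp add: nf_def)
  have arrow_fun: "mat_fun ?F (v (in_vertex h)) (v (out_vertex h)) (\<lambda>x. nf x h)" if "h \<in> arrows Q" for h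
    using that unfolding mat_fun_def nf_def by (auto intro: polynomial_functions.coord)
  have path_fun: "mat_fun ?F (v (in_vertex (hd hs))) (v (out_vertex (last hs))) (\<lambda>x. path_mat (nf x) hs)"
    if "is_path hs" for hs
  proof -
    have "hs \<noteq> []" using that by (simp add: is_path_def)
    then show ?thesis using that
    proof (induction hs rule: list_nonempty_induct)
      case (cons h hs)
      have p: "h \<in> arrows Q" "out_vertex h = in_vertex (hd hs)" "is_path hs"
        using cons by (auto simp: is_path_Cons)
      have "mat_fun ?F (v (in_vertex h)) (v (out_vertex (last hs))) (\<lambda>x. nf x h * path_mat (nf x) hs)"
        by (rule mat_fun_mult[OF pf_ring arrow_fun[OF p(1)]]) (use cons.IH[OF p(3)] p(2) in simp)
      then show ?case using cons.hyps by (simp add: path_mat_Cons)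
    qed (use arrow_fun in auto)
  qed
  let ?N = "Suc (total_dim v)"
  define P1 where "P1 = {\<lambda>x. (in_mat v i x * out_mat v i x) $$ (r, s) | i r s. i \<in> verts Q \<and> r < v i \<and> s < v i}"
  define P2 where "P2 = {\<lambda>x. path_mat (nf x) hs $$ (r, s) | hs r s. is_path hs \<and> length hs = ?N \<and>
    r < v (in_vertex (hd hs)) \<and> s < v (out_vertex (last hs))}"
  have "P1 \<subseteq> ?F"
    unfolding P1_def
    using mat_funD(4)[OF mat_fun_mult[OF pf_ring mat_fun_in_mat_id mat_fun_out_mat_id]] by auto
  moreover have "P2 \<subseteq> ?F"
    unfolding P2_def using mat_funD(4)[OF path_fun] by auto
  moreover have "x \<in> Lam Q \<Omega> v \<longleftrightarrow> (\<forall>p\<in>P1 \<union> P2. p x = 0)" if x: "x \<in> reps Q v" for x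
  proof -
    have zero_iff: "A = 0\<^sub>m n m \<longleftrightarrow> (\<forall>r s. r < n \<and> s < m \<longrightarrow> A $$ (r, s) = 0)"
      if "A \<in> carrier_mat n m" for A :: "complex mat" and n m
      using that by (auto intro!: eq_matI)
    have "preprojective Q \<Omega> v x \<longleftrightarrow> (\<forall>p\<in>P1. p x = 0)"
    proof -
      have "preproj_at v i x \<longleftrightarrow> (\<forall>r s. r < v i \<and> s < v i \<longrightarrow> (in_mat v i x * out_mat v i x) $$ (r, s) = 0)" for i
        unfolding preproj_at_iff[OF x]
        by (rule zero_iff) (rule mult_carrier_mat[OF in_mat_carrier(1,2)])
      moreover have "(\<forall>p\<in>P1. p x = 0) \<longleftrightarrow>
          (\<forall>i r s. i \<in> verts Q \<and> r < v i \<and> s < v i \<longrightarrow> (in_mat v i x * out_mat v i x) $$ (r, s) = 0)"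
        unfolding P1_def by (auto simp del: index_mult_mat(1))
      ultimately show ?thesis unfolding preprojective_iff by blast
    qed
    moreover have "nilp_bound v ?N x \<longleftrightarrow> (\<forall>p\<in>P2. p x = 0)"
    proof -
      have "path_mat x hs = 0\<^sub>m (v (in_vertex (hd hs))) (v (out_vertex (last hs))) \<longleftrightarrow>
        (\<forall>r s. r < v (in_vertex (hd hs)) \<and> s < v (out_vertex (last hs)) \<longrightarrow> path_mat (nf x) hs $$ (r, s) = 0)"
        if "is_path hs" for hs
        unfolding nf[OF x] using path_mat_carrier[of x v, OF repsD[OF x] that] by (rule zero_iff)
      moreover have "(\<forall>p\<in>P2. p x = 0) \<longleftrightarrow> (\<forall>hs r s. is_path hs \<and> length hs = ?N \<and>
          r < v (in_vertex (hd hs)) \<and> s < v (out_vertex (last hs)) \<longrightarrow> path_mat (nf x) hs $$ (r, s) = 0)"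
        unfolding P2_def by auto
      ultimately show ?thesis unfolding nilp_bound_def by blast
    qed
    moreover have "nilpotent_rep Q v x \<longleftrightarrow> nilp_bound v ?N x" if "preprojective Q \<Omega> v x"
    proof
      assume "nilpotent_rep Q v x"
      then have "x \<in> Lam Q \<Omega> v" using that x unfolding Lam_def by simp
      then show "nilp_bound v ?N x" by (rule Lam_nilp_bound)
    qed (auto simp: nilpotent_iff intro!: exI[of _ ?N])
    ultimately show ?thesis using x unfolding Lam_def by auto
  qed
  then have "Lam Q \<Omega> v = {x \<in> reps Q v. \<forall>p\<in>P1 \<union> P2. p x = 0}" using Lam_reps by blast
  ultimately show ?thesis unfolding closedin_zariski by (intro exI[of _ "P1 \<union> P2"]) blast
qed

lemma rank_ge_iff_det:
  "rank_ge r M \<longleftrightarrow> (\<exists>P T. P \<in> carrier_mat r (dim_row M) \<and> T \<in> carrier_mat (dim_col M) r \<and>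
     det (P * M * T) \<noteq> 0)"
proof
  assume "rank_ge r M"
  then obtain P T where PT: "P \<in> carrier_mat r (dim_row M)" "T \<in> carrier_mat (dim_col M) r" "P * M * T = 1\<^sub>m r"
    unfolding rank_ge_def by blast
  then have "det (P * M * T) \<noteq> 0" by simp
  with PT(1,2) show "\<exists>P T. P \<in> carrier_mat r (dim_row M) \<and> T \<in> carrier_mat (dim_col M) r \<and>
     det (P * M * T) \<noteq> 0" by blast
next
  assume "\<exists>P T. P \<in> carrier_mat r (dim_row M) \<and> T \<in> carrier_mat (dim_col M) r \<and> det (P * M * T) \<noteq> 0"
  then obtain P T where PT: "P \<in> carrier_mat r (dim_row M)" "T \<in> carrier_mat (dim_col M) r"
    "det (P * M * T) \<noteq> 0" by blast
  define D where "D = inverse (det (P * M * T)) \<cdot>\<^sub>m adj_mat (P * M * T)"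
  have c: "P * M * T \<in> carrier_mat r r" using PT by auto
  have D: "D \<in> carrier_mat r r" "D * (P * M * T) = 1\<^sub>m r"
    using adj_mat[OF c] PT(3) carrier_matD[OF adj_mat(1)[OF c]]
    by (auto simp: D_def smult_mult_dim smult_twice smult_one simp del: index_mult_mat(2,3)
        simp: carrier_matD[OF c])
  have "(D * P) * M * T = D * (P * M * T)"
    using D(1) PT(1,2) by (simp add: mult_assoc_dim)
  then show "rank_ge r M"
    unfolding rank_ge_def using D PT by (intro exI[of _ "D * P"] exI[of _ T]) auto
qed

text \<open>The set is the union of the loci where \<open>det (P M T)\<close> is nonzero, over constant \<open>P\<close> and \<open>T\<close>.\<close>

lemma openin_eps_rep_le: "openin (zariski Q v) {x \<in> reps Q v. eps_rep Q v i x \<le> p}"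
proof (cases "p < v i")
  case False
  then have "{x \<in> reps Q v. eps_rep Q v i x \<le> p} = reps Q v"
    by (auto intro: le_trans[OF eps_rep_le])
  then show ?thesis using openin_topspace[of "zariski Q v"] by simp
next
  case True
  let ?m = "v i - p"
  have e: "eps_rep Q v i x \<le> p \<longleftrightarrow> (\<exists>P\<in>carrier_mat ?m (v i).
      \<exists>T\<in>carrier_mat (width v i) ?m. det (P * in_mat v i x * T) \<noteq> 0)" if "x \<in> reps Q v" for x
  proof -
    have "eps_rep Q v i x \<le> p \<longleftrightarrow> rank_ge ?m (in_mat v i x)"
      using eps_rep_le_iff[OF that, of ?m i] True by simp
    then show ?thesis unfolding rank_ge_iff_det in_mat_carrier by blast
  qed
  have "{x \<in> reps Q v. eps_rep Q v i x \<le> p} = (\<Union>P\<in>carrier_mat ?m (v i).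
      \<Union>T\<in>carrier_mat (width v i) ?m. {x \<in> reps Q v. det (P * in_mat v i x * T) \<noteq> 0})"
    using e by blast
  moreover have "openin (zariski Q v) {x \<in> reps Q v. det (P * in_mat v i x * T) \<noteq> 0}"
    if PT: "P \<in> carrier_mat ?m (v i)" "T \<in> carrier_mat (width v i) ?m" for P T
  proof -
    have PM: "mat_fun (polynomial_functions Q v) ?m (width v i) (\<lambda>x. P * in_mat v i x)"
      by (rule mat_fun_mult[OF pf_ring, where k = "v i"])
        (rule mat_fun_const[OF pf_ring PT(1)], rule mat_fun_in_mat_id)
    have "mat_fun (polynomial_functions Q v) ?m ?m (\<lambda>x. P * in_mat v i x * T)"
      by (rule mat_fun_mult[OF pf_ring PM mat_fun_const[OF pf_ring PT(2)]])
    then show ?thesis by (rule openin_nonzero_locus[OF function_ring_det[OF pf_ring]])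
  qed
  ultimately show ?thesis by (auto intro!: openin_Union)
qed

lemma closedin_eps_rep_ge: "closedin (zariski Q v) {x \<in> reps Q v. c \<le> eps_rep Q v i x}"
proof (cases c)
  case 0
  then show ?thesis using closedin_topspace[of "zariski Q v"] by simp
next
  case (Suc p)
  have "{x \<in> reps Q v. c \<le> eps_rep Q v i x} = topspace (zariski Q v) - {x \<in> reps Q v. eps_rep Q v i x \<le> p}"
    using Suc by auto
  then show ?thesis using openin_eps_rep_le[of v i p] by (simp add: closedin_def Diff_Diff_Int Int_absorb1)
qed

text \<open>By semicontinuity the generic value on an irreducible set is the minimal one.\<close>

lemma eps_eqI:
  assumes X: "irreducible_in (zariski Q v) X" and x: "x \<in> X" "eps_rep Q v i x = p"
    and ge: "\<And>x. x \<in> X \<Longrightarrow> p \<le> eps_rep Q v i x"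
  shows "eps Q i (v, X) = p"
proof -
  let ?U = "{x \<in> reps Q v. eps_rep Q v i x \<le> p}"
  have XR: "X \<subseteq> reps Q v" using X unfolding irreducible_zariski by simp
  have U: "openin (zariski Q v) ?U" "?U \<inter> X \<noteq> {}" "\<forall>y\<in>?U \<inter> X. eps_rep Q v i y = p"
    using openin_eps_rep_le x XR ge by (auto intro: antisym)
  have uniq: "p' = p" if p': "\<exists>U. openin (zariski Q v) U \<and> U \<inter> X \<noteq> {} \<and> (\<forall>y\<in>U \<inter> X. eps_rep Q v i y = p')" for p'
  proof -
    obtain U' where U': "openin (zariski Q v) U'" "U' \<inter> X \<noteq> {}" "\<forall>y\<in>U' \<inter> X. eps_rep Q v i y = p'"
      using p' by blast
    obtain y where y: "y \<in> U'" "y \<in> X" using U'(2) by blast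
    have "y \<in> zariski Q v closure_of (?U \<inter> X)"
      using irreducible_in_open_subset(2)[OF X U(1,2)] y(2) by blast
    then obtain w where w: "w \<in> ?U \<inter> X" "w \<in> U' \<inter> X"
      using U'(1) y(1) unfolding in_closure_of by blast
    show "p' = p" using bspec[OF U(3) w(1)] bspec[OF U'(3) w(2)] by simp
  qed
  show ?thesis
    unfolding eps_def prod.case
  proof (rule the_equality)
    show "\<exists>U. openin (zariski Q v) U \<and> U \<inter> X \<noteq> {} \<and> (\<forall>x\<in>U \<inter> X. eps_rep Q v i x = p)"
      by (intro exI[of _ ?U] conjI U)
  qed (rule uniq)
qed

lemma eps_attained:
  assumes X: "irreducible_in (zariski Q v) X"
  shows "\<exists>x\<in>X. eps_rep Q v i x = eps Q i (v, X)"
    and "x \<in> X \<Longrightarrow> eps Q i (v, X) \<le> eps_rep Q v i x"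
proof -
  have "X \<noteq> {}" using X unfolding irreducible_in_def by simp
  then obtain x0 where "x0 \<in> X" by blast
  from ex_has_least_nat[of "\<lambda>x. x \<in> X", OF this, of "eps_rep Q v i"]
  obtain y where y: "y \<in> X" "\<And>x. x \<in> X \<Longrightarrow> eps_rep Q v i y \<le> eps_rep Q v i x" by blast
  have "eps Q i (v, X) = eps_rep Q v i y" by (rule eps_eqI[OF X y(1) refl y(2)])
  with y show "\<exists>x\<in>X. eps_rep Q v i x = eps Q i (v, X)"
    "x \<in> X \<Longrightarrow> eps Q i (v, X) \<le> eps_rep Q v i x" by auto
qed

definition eps_stratum :: "('i \<Rightarrow> nat) \<Rightarrow> 'i \<Rightarrow> ('i, 'e) rep set \<Rightarrow> ('i, 'e) rep set" where
  "eps_stratum v i X = {x \<in> X. eps_rep Q v i x = eps Q i (v, X)}"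

lemma eps_stratum:
  assumes X: "irreducible_in (zariski Q v) X"
  shows "irreducible_in (zariski Q v) (eps_stratum v i X)"
    and "X \<subseteq> zariski Q v closure_of (eps_stratum v i X)"
proof -
  let ?U = "{x \<in> reps Q v. eps_rep Q v i x \<le> eps Q i (v, X)}"
  have XR: "X \<subseteq> reps Q v" using X unfolding irreducible_zariski by simp
  have eq: "?U \<inter> X = eps_stratum v i X"
    using XR eps_attained(2)[OF X] unfolding eps_stratum_def by (auto intro: antisym)
  have "?U \<inter> X \<noteq> {}" using eps_attained(1)[OF X] unfolding eq eps_stratum_def by auto
  from irreducible_in_open_subset[OF X openin_eps_rep_le this]
  show "irreducible_in (zariski Q v) (eps_stratum v i X)"
    "X \<subseteq> zariski Q v closure_of (eps_stratum v i X)" unfolding eq .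
qed

subsection \<open>Scaling\<close>

definition scale :: "('i \<Rightarrow> nat) \<Rightarrow> complex \<Rightarrow> ('i, 'e) rep \<Rightarrow> ('i, 'e) rep" where
  "scale v t x = (\<lambda>h\<in>arrows Q. mat (v (in_vertex h)) (v (out_vertex h)) (\<lambda>p. t * x h $$ p))"

lemma scale_reps: "scale v t x \<in> reps Q v"
  by (rule repsI) (auto simp: scale_def)

lemma scale_arrow: "x \<in> reps Q v \<Longrightarrow> h \<in> arrows Q \<Longrightarrow> scale v t x h = t \<cdot>\<^sub>m x h"
  by (intro eq_matI) (auto simp: scale_def dest: repsD)

lemma scale_mats:
  shows "in_mat v i (scale v t x) = t \<cdot>\<^sub>m in_mat v i x" "out_mat v i (scale v t x) = t \<cdot>\<^sub>m out_mat v i x"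
proof -
  show "in_mat v i (scale v t x) = t \<cdot>\<^sub>m in_mat v i x"
  proof (intro eq_matI)
    fix r k assume "r < dim_row (t \<cdot>\<^sub>m in_mat v i x)" "k < dim_col (t \<cdot>\<^sub>m in_mat v i x)"
    then have rk: "r < v i" "k < width v i" by auto
    note h = in_index_nth[OF rk(2)]
    show "in_mat v i (scale v t x) $$ (r, k) = (t \<cdot>\<^sub>m in_mat v i x) $$ (r, k)"
      using rk h arrows_intoD(1,2)[OF h(1)] by (simp add: in_mat_def scale_def)
  qed auto
  show "out_mat v i (scale v t x) = t \<cdot>\<^sub>m out_mat v i x"
  proof (intro eq_matI)
    fix k r assume "k < dim_row (t \<cdot>\<^sub>m out_mat v i x)" "r < dim_col (t \<cdot>\<^sub>m out_mat v i x)"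
    then have rk: "k < width v i" "r < v i" by auto
    note h = in_index_nth[OF rk(1)]
    show "out_mat v i (scale v t x) $$ (k, r) = (t \<cdot>\<^sub>m out_mat v i x) $$ (k, r)"
      using rk h arrows_intoD(1,2)[OF h(1)] by (simp add: out_mat_def scale_def)
  qed auto
qed

lemma path_mat_scale:
  assumes x: "x \<in> reps Q v" and "is_path hs"
  shows "path_mat (scale v t x) hs = t ^ length hs \<cdot>\<^sub>m path_mat x hs"
proof -
  have "hs \<noteq> []" using assms(2) by (simp add: is_path_def)
  then show ?thesis using assms(2)
  proof (induction hs rule: list_nonempty_induct)
    case (cons h hs)
    have p: "h \<in> arrows Q" "out_vertex h = in_vertex (hd hs)" "is_path hs"
      using cons by (auto simp: is_path_Cons)
    note c = carrier_matD[OF repsD[OF x p(1)]] carrier_matD[OF path_mat_carrier[of x v, OF repsD[OF x] p(3)]]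
    show ?case using cons.hyps cons.IH[OF p(3)] p c
      by (simp add: path_mat_Cons scale_arrow[OF x] smult_mult_dim smult_twice mult.commute)
  qed (simp add: scale_arrow[OF x])
qed

lemma Lam_scale:
  assumes "x \<in> Lam Q \<Omega> v"
  shows "scale v t x \<in> Lam Q \<Omega> v"
proof -
  have x: "x \<in> reps Q v" using assms by (rule Lam_reps)
  have "preproj_at v i (scale v t x)" if "i \<in> verts Q" for i
  proof -
    have "in_mat v i x * out_mat v i x = 0\<^sub>m (v i) (v i)"
      using assms that unfolding preproj_at_iff[OF x, symmetric] Lam_def preprojective_iff by simp
    then show ?thesis
      unfolding preproj_at_iff[OF scale_reps] scale_mats by (simp add: smult_mult_dim)
  qed
  moreover obtain N where N: "1 \<le> N" "nilp_bound v N x"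
    using assms unfolding Lam_def nilpotent_iff by blast
  then have "nilp_bound v N (scale v t x)"
    using path_mat_scale[OF x] unfolding nilp_bound_def by simp
  ultimately show ?thesis
    using scale_reps N(1) unfolding Lam_def preprojective_iff nilpotent_iff by blast
qed

lemma scale_one: "x \<in> reps Q v \<Longrightarrow> scale v 1 x = x"
proof (rule extensionalityI[of _ "arrows Q"])
  show "scale v 1 x h = x h" if "x \<in> reps Q v" "h \<in> arrows Q" for h
    using scale_arrow[OF that, of 1] by (auto intro!: eq_matI)
qed (auto simp: scale_def reps_def PiE_iff)

text \<open>Multiplying by nonzero scalars moves a component only inside the irreducible set swept out by
  all of them, so it does not move the component at all.\<close>

lemma component_scale:
  assumes X: "X \<in> components v" and x: "x \<in> X" and t: "t \<noteq> 0"
  shows "scale v t x \<in> X"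
proof -
  note XD = componentD[OF X]
  have XR: "X \<subseteq> reps Q v" using XD(1) Lam_reps by auto
  define S where "S = {scale v t x | t x. t \<noteq> 0 \<and> x \<in> X}"
  have SL: "S \<subseteq> Lam Q \<Omega> v" unfolding S_def using XD(1) Lam_scale by auto
  have XS: "X \<subseteq> S"
  proof
    fix y assume y: "y \<in> X"
    then have "y = scale v 1 y" using scale_one[of y v] XR by auto
    then show "y \<in> S" unfolding S_def using y by (intro CollectI exI[of _ 1] exI[of _ y]) auto
  qed
  have "irreducible_in (zariski Q v) S"
  proof (rule irreducible_by_sections[OF XD(2), where K = "- {0}" and \<sigma> = "scale v"])
    show "S \<subseteq> reps Q v" using SL Lam_reps by auto
    show "S \<noteq> {}" using XS XD(3) by auto
    show "\<exists>k\<in>- {0}. \<exists>z\<in>X. y = scale v k z" if "y \<in> S" for y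
      using that unfolding S_def by blast
    show "rep_fun (polynomial_functions Q v) Q v (scale v k)" for k
      unfolding rep_fun_def scale_def
      by (auto intro!: function_ringD(3)[OF pf_ring] function_ringD(1)[OF pf_ring] polynomial_functions.coord)
    fix k l z assume klz: "k \<in> - {0 :: complex}" "l \<in> - {0 :: complex}" "z \<in> X"
    let ?d = "[:k, l - k:]"
    have z: "z \<in> reps Q v" using klz(3) XR by auto
    define f where "f = poly ?d"
    have f: "f \<in> rational_off ?d" unfolding f_def by (rule poly_rational_off)
    have "rep_fun (rational_off ?d) Q v (\<lambda>t. scale v (f t) z)"
      unfolding rep_fun_def scale_def
      by (auto intro!: function_ringD(3)[OF function_ring_rational_off]
          function_ringD(1)[OF function_ring_rational_off] f)
    moreover have "scale v (f t) z \<in> S" if "poly ?d t \<noteq> 0" for t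
      unfolding S_def f_def using klz(3) that by blast
    moreover have "poly ?d 0 \<noteq> 0" "poly ?d 1 \<noteq> 0" "f 0 = k" "f 1 = l"
      using klz(1,2) by (auto simp: f_def)
    ultimately show "\<exists>d \<gamma>. rep_fun (rational_off d) Q v \<gamma> \<and> poly d 0 \<noteq> 0 \<and> poly d 1 \<noteq> 0 \<and>
        \<gamma> 0 = scale v k z \<and> \<gamma> 1 = scale v l z \<and> (\<forall>t. poly d t \<noteq> 0 \<longrightarrow> \<gamma> t \<in> S)"
      by (intro exI[of _ ?d] exI[of _ "\<lambda>t. scale v (f t) z"] conjI allI impI) simp_all
  qed
  from component_maximal[OF X this XS SL] have "S = X" .
  then show ?thesis using x t unfolding S_def by blast
qed

section \<open>Lifting sets of representations along one vertex\<close>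

text \<open>The representations that restrict to an element of \<open>U\<close>, up to the choice of a basis of the subspace.
For \<open>U\<close> invariant under base change at the other vertices this is the image of the preimage of \<open>U\<close>
under the two projections of the correspondence.\<close>

definition lifts ::
  "'i \<Rightarrow> ('i \<Rightarrow> nat) \<Rightarrow> ('i \<Rightarrow> nat) \<Rightarrow> ('i, 'e) rep set \<Rightarrow> ('i, 'e) rep set" where
  "lifts i v v1 U = {x \<in> Lam Q \<Omega> v. \<exists>\<phi> P z. \<phi> \<in> carrier_mat (v i) (v1 i) \<and>
     P \<in> carrier_mat (v1 i) (v i) \<and> P * \<phi> = 1\<^sub>m (v1 i) \<and> z \<in> U \<and> restricts i \<phi> x z}"

text \<open>In the basis given by the columns of \<open>g\<close>, the first \<open>v1 i\<close> of which span the image, a lift of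
  \<open>z\<close> is determined by its outgoing map \<open>Y\<close> on the remaining basis vectors. The relation at \<open>i\<close>
  amounts to the incoming matrix of \<open>z\<close> killing \<open>Y\<close>.\<close>

definition frame_lift ::
  "'i \<Rightarrow> ('i \<Rightarrow> nat) \<Rightarrow> ('i \<Rightarrow> nat) \<Rightarrow> complex mat \<Rightarrow> complex mat \<Rightarrow> complex mat \<Rightarrow>
   ('i, 'e) rep \<Rightarrow> ('i, 'e) rep" where
  "frame_lift i v v1 g g' Y z = glue v i (g * incl (v i) (v1 i) * in_mat v1 i z)
     ((out_mat v1 i z * incl (v1 i) (v i) + Y * coproj (v i) (v1 i)) * g') z"

context
  fixes i :: 'i and v v1 :: "'i \<Rightarrow> nat"
  assumes i: "i \<in> verts Q" and v: "agree_off i v v1" and le: "v1 i \<le> v i"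
begin

private abbreviation (input) "n \<equiv> v i"
private abbreviation (input) "m \<equiv> v1 i"
private abbreviation (input) "w \<equiv> width v i"

lemma width_eq1: "width v1 i = w"
  using in_index_cong(2)[OF v] by simp

lemma frame_lift:
  assumes z: "z \<in> Lam Q \<Omega> v1"
    and g: "g \<in> carrier_mat n n" "g' \<in> carrier_mat n n" "g' * g = 1\<^sub>m n"
    and Y: "Y \<in> carrier_mat w (n - m)" "in_mat v1 i z * Y = 0\<^sub>m m (n - m)"
  shows frame_lift_restricts: "restricts i (g * incl n m) (frame_lift i v v1 g g' Y z) z"
    and frame_lift_Lam: "frame_lift i v v1 g g' Y z \<in> Lam Q \<Omega> v"
    and frame_lift_lifts: "z \<in> U \<Longrightarrow> frame_lift i v v1 g g' Y z \<in> lifts i v v1 U"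
proof -
  let ?x = "frame_lift i v v1 g g' Y z"
  note zr = Lam_reps[OF z]
  note dims = carrier_matD[OF g(1)] carrier_matD[OF g(2)] carrier_matD[OF Y(1)] width_eq1 le
  have xr: "?x \<in> reps Q v" unfolding frame_lift_def by (rule glue_reps[OF v zr])
  have \<phi>: "g * incl n m \<in> carrier_mat n m" and P: "incl m n * g' \<in> carrier_mat m n"
    using g by auto
  have g'gX: "g' * (g * X) = X" if "dim_row X = n" for X
    using mult_assoc_left[OF g(3), of X] that dims by simp
  have P\<phi>: "(incl m n * g') * (g * incl n m) = 1\<^sub>m m" using dims by (simp add: mult_assoc_dim g'gX)
  have xin: "in_mat v i ?x = g * incl n m * in_mat v1 i z"
    unfolding frame_lift_def by (rule in_mat_glue) (use dims in auto)
  have xout: "out_mat v i ?x = (out_mat v1 i z * incl m n + Y * coproj n m) * g'"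
    unfolding frame_lift_def by (rule out_mat_glue) (use dims in auto)
  have "out_mat v1 i z = out_mat v i ?x * (g * incl n m)"
    unfolding xout using dims by (simp add: mat_algebra g'gX)
  then show restr: "restricts i (g * incl n m) ?x z"
    unfolding restricts_iff[OF xr zr v \<phi>] xin using glue_agree_away[of i v _ _ z]
    by (simp add: frame_lift_def)
  have "in_mat v1 i z * out_mat v1 i z = 0\<^sub>m m m"
    using z i unfolding preproj_at_iff[OF zr, symmetric] Lam_def preprojective_iff by simp
  from mult_assoc_left[OF this] mult_assoc_left[OF Y(2)]
  have "in_mat v1 i z * out_mat v i ?x = 0\<^sub>m m n"
    unfolding xout using dims by (simp add: mat_algebra)
  then show L: "?x \<in> Lam Q \<Omega> v"
    using Lam_restriction_iff[OF i xr zr v \<phi> P P\<phi> restr] z by simp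
  show "?x \<in> lifts i v v1 U" if "z \<in> U"
    unfolding lifts_def using L \<phi> P P\<phi> restr that by blast
qed

lemma eq_frame_lift:
  assumes x: "x \<in> Lam Q \<Omega> v" and z: "z \<in> Lam Q \<Omega> v1"
    and g: "g \<in> carrier_mat n n" "g' \<in> carrier_mat n n" "g * g' = 1\<^sub>m n" "g' * g = 1\<^sub>m n"
    and restr: "restricts i (g * incl n m) x z"
  defines "Y \<equiv> out_mat v i x * (g * coincl n m)"
  shows "Y \<in> carrier_mat w (n - m)" "in_mat v1 i z * Y = 0\<^sub>m m (n - m)"
    and "x = frame_lift i v v1 g g' Y z"
proof -
  note xr = Lam_reps[OF x] and zr = Lam_reps[OF z]
  note dims = carrier_matD[OF g(1)] carrier_matD[OF g(2)] width_eq1 le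
  show "Y \<in> carrier_mat w (n - m)" using dims by (auto simp: Y_def)
  have \<phi>: "g * incl n m \<in> carrier_mat n m" and P: "incl m n * g' \<in> carrier_mat m n"
    using g by auto
  have P\<phi>: "(incl m n * g') * (g * incl n m) = 1\<^sub>m m"
    using dims mult_assoc_left[OF g(4), of "incl n m"] by (simp add: mult_assoc_dim)
  note R = in_mat_restriction[OF i xr zr v \<phi> P P\<phi> restr] out_mat_restriction[OF i xr zr v \<phi> P P\<phi> restr]
    agree_away_restriction[OF i xr zr v \<phi> P P\<phi> restr]
  have "in_mat v1 i z * out_mat v i x = 0\<^sub>m m n"
    using Lam_restriction_iff[OF i xr zr v \<phi> P P\<phi> restr] x by simp
  from mult_assoc_left[OF this] show "in_mat v1 i z * Y = 0\<^sub>m m (n - m)"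
    unfolding Y_def using dims by simp
  have "x = glue v i (in_mat v i x) (out_mat v i x) z"
    using glue_self[OF xr, of i] glue_cong[OF R(3), of v] by simp
  moreover have "out_mat v i x = (out_mat v1 i z * incl m n + Y * coproj n m) * g'"
  proof -
    have "out_mat v1 i z * incl m n + Y * coproj n m =
        (out_mat v i x * g) * (incl n m * incl m n + coincl n m * coproj n m)"
      unfolding R(2) Y_def using dims by (simp add: mat_algebra del: incl_coincl_sum)
    also have "\<dots> = out_mat v i x * g" unfolding incl_coincl_sum[OF le] using dims by simp
    finally show ?thesis using g(3) dims by (simp add: mult_assoc_dim)
  qed
  ultimately show "x = frame_lift i v v1 g g' Y z"
    unfolding frame_lift_def using R(1) by metis
qed

text \<open>Every lift is the value at \<open>z\<close> of a family of lifts that depends polynomially on \<open>z\<close>: the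
  freely chosen part of the outgoing map is moved along with the kernel of the incoming matrix.\<close>

lemma lift_eq_frame_lift:
  assumes x: "x \<in> Lam Q \<Omega> v" and z: "z \<in> Lam Q \<Omega> v1"
    and \<phi>: "\<phi> \<in> carrier_mat n m" "P \<in> carrier_mat m n" "P * \<phi> = 1\<^sub>m m" "restricts i \<phi> x z"
    and surj: "rank_ge m (in_mat v1 i z) \<or> n = m"
  shows "\<exists>g g' T y. g \<in> carrier_mat n n \<and> g' \<in> carrier_mat n n \<and> g * g' = 1\<^sub>m n \<and> g' * g = 1\<^sub>m n \<and>
    T \<in> carrier_mat w m \<and> y \<in> carrier_mat w (n - m) \<and>
    x = frame_lift i v v1 g g' (ker_op (in_mat v1 i z) T * y) z"
proof -
  note xr = Lam_reps[OF x] and zr = Lam_reps[OF z]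
  obtain g g' where g: "g \<in> carrier_mat n n" "g' \<in> carrier_mat n n" "g * g' = 1\<^sub>m n" "g' * g = 1\<^sub>m n"
    "g * incl n m = \<phi>" "incl m n * g' = P"
    using complete_to_invertible[OF \<phi>(2,1,3)] by blast
  note dims = carrier_matD[OF g(1)] carrier_matD[OF g(2)] width_eq1 le
  define y where "y = out_mat v i x * (g * coincl n m)"
  note eq = eq_frame_lift[OF x z g(1-4) \<phi>(4)[folded g(5)], folded y_def]
  note y = eq(1) and Ay = eq(2)
  have "\<exists>T. T \<in> carrier_mat w m \<and> ker_op (in_mat v1 i z) T * y = y"
  proof (cases "n = m")
    case True
    have "ker_op (in_mat v1 i z) (0\<^sub>m w m) \<in> carrier_mat w w"
      by (rule ker_op_carrier[of _ m]) (use dims in auto)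
    then have "ker_op (in_mat v1 i z) (0\<^sub>m w m) * y = y" using y True by (intro eq_matI) auto
    then show ?thesis by (intro exI[of _ "0\<^sub>m w m"]) simp
  next
    case False
    then obtain P' T where PT: "P' \<in> carrier_mat m m" "T \<in> carrier_mat w m"
      "P' * in_mat v1 i z * T = 1\<^sub>m m"
      using surj dims unfolding rank_ge_def by auto
    have "(in_mat v1 i z * T) * P' = 1\<^sub>m m"
      by (rule mat_mult_left_right_inverse[OF PT(1)]) (use PT dims in \<open>auto simp: mult_assoc_dim\<close>)
    then have AT: "in_mat v1 i z * (T * P') = 1\<^sub>m m"
      using PT(1,2) dims by (simp add: mult_assoc_dim)
    have TP: "T * P' \<in> carrier_mat w m" using PT by auto
    have "ker_op (in_mat v1 i z) (T * P') * y = y"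
    proof -
      have "in_mat v1 i z \<in> carrier_mat m w" using in_mat_carrier(1)[of v1 i z] width_eq1 by simp
      from ker_op_kernel[OF this TP y Ay] show ?thesis unfolding AT by (simp add: smult_one)
    qed
    with TP show ?thesis by blast
  qed
  then obtain T where T: "T \<in> carrier_mat w m" "ker_op (in_mat v1 i z) T * y = y" by blast
  have "x = frame_lift i v v1 g g' (ker_op (in_mat v1 i z) T * y) z"
    using eq(3) unfolding T(2) .
  with g(1-4) T(1) y show ?thesis by blast
qed

lemma rep_fun_frame_lift:
  assumes F: "function_ring F" and z: "rep_fun F Q v1 \<Phi>"
    and g: "mat_fun F n n g" "mat_fun F n n g'" and Y: "mat_fun F w (n - m) Y"
  shows "rep_fun F Q v (\<lambda>t. frame_lift i v v1 (g t) (g' t) (Y t) (\<Phi> t))"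
  unfolding frame_lift_def
proof (rule rep_fun_glue[OF F])
  have A: "mat_fun F m w (\<lambda>t. in_mat v1 i (\<Phi> t))" "mat_fun F w m (\<lambda>t. out_mat v1 i (\<Phi> t))"
    using mat_fun_in_mat[OF F z, of i] mat_fun_out_mat[OF F z, of i] width_eq1 by simp_all
  show "mat_fun F n w (\<lambda>t. g t * incl n m * in_mat v1 i (\<Phi> t))"
    by (intro mat_fun_mult[OF F _ A(1)] mat_fun_mult[OF F g(1)] mat_fun_const[OF F]) simp
  show "mat_fun F w n (\<lambda>t. (out_mat v1 i (\<Phi> t) * incl m n + Y t * coproj n m) * g' t)"
    by (intro mat_fun_mult[OF F _ g(2)] mat_fun_add[OF F] mat_fun_mult[OF F A(2)]
        mat_fun_mult[OF F Y] mat_fun_const[OF F]) simp_all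
  show "(\<lambda>t. \<Phi> t h $$ (r, s)) \<in> F"
    if "h \<in> arrows Q" "in_vertex h \<noteq> i" "out_vertex h \<noteq> i" "r < v (in_vertex h)" "s < v (out_vertex h)"
    for h r s
    using z that arrowsD[OF that(1)] v unfolding rep_fun_def agree_off_def by auto
qed

lemma rep_fun_polynomial_lift:
  assumes "g \<in> carrier_mat n n" "g' \<in> carrier_mat n n" "T \<in> carrier_mat w m" "y \<in> carrier_mat w (n - m)"
  shows "rep_fun (polynomial_functions Q v1) Q v
    (\<lambda>z. frame_lift i v v1 g g' (ker_op (in_mat v1 i z) T * y) z)"
proof (rule rep_fun_frame_lift[OF pf_ring rep_fun_id])
  have "mat_fun (polynomial_functions Q v1) m w (in_mat v1 i)"
    using mat_fun_in_mat_id[of v1 i] width_eq1 by simp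
  then show "mat_fun (polynomial_functions Q v1) w (n - m) (\<lambda>z. ker_op (in_mat v1 i z) T * y)"
    by (intro mat_fun_mult[OF pf_ring mat_fun_ker_op[OF pf_ring _ assms(3)]] mat_fun_const[OF pf_ring assms(4)])
qed (use assms in \<open>auto intro: mat_fun_const[OF pf_ring]\<close>)

lemma in_mat_ker_op_zero:
  assumes "T \<in> carrier_mat w m" "y \<in> carrier_mat w k"
  shows "ker_op (in_mat v1 i z) T * y \<in> carrier_mat w k"
    and "in_mat v1 i z * (ker_op (in_mat v1 i z) T * y) = 0\<^sub>m m k"
proof -
  have A: "in_mat v1 i z \<in> carrier_mat m w" using width_eq1 by auto
  note K = ker_op_carrier[OF A assms(1)]
  show "ker_op (in_mat v1 i z) T * y \<in> carrier_mat w k" using K assms(2) by auto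
  show "in_mat v1 i z * (ker_op (in_mat v1 i z) T * y) = 0\<^sub>m m k"
    using mult_assoc_left[OF mult_ker_op[OF A assms(1)], of y] carrier_matD[OF K] carrier_matD[OF assms(2)]
      carrier_matD[OF A] by simp
qed

lemma inverse_eq_adj:
  fixes g g' :: "complex mat"
  assumes g: "g \<in> carrier_mat n n" "g' \<in> carrier_mat n n" "g * g' = 1\<^sub>m n"
  shows "det g \<noteq> 0" "g' = inverse (det g) \<cdot>\<^sub>m adj_mat g"
proof -
  have "det g * det g' = 1" using det_mult[OF g(1,2)] g(3) by simp
  then show d: "det g \<noteq> 0" by auto
  note adj = adj_mat[OF g(1)]
  have "adj_mat g = (adj_mat g * g) * g'"
    using g carrier_matD[OF adj(1)] by (simp add: mult_assoc_dim)
  also have "\<dots> = det g \<cdot>\<^sub>m g'" unfolding adj(3) using g(2) by (simp add: smult_mult_dim)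
  finally have "inverse (det g) \<cdot>\<^sub>m adj_mat g = inverse (det g) \<cdot>\<^sub>m (det g \<cdot>\<^sub>m g')" by simp
  then show "g' = inverse (det g) \<cdot>\<^sub>m adj_mat g" using d by (simp add: smult_twice smult_one)
qed

lemma adj_inverse:
  fixes g :: "complex mat"
  assumes "g \<in> carrier_mat n n" "det g \<noteq> 0"
  shows "inverse (det g) \<cdot>\<^sub>m adj_mat g \<in> carrier_mat n n"
    "(inverse (det g) \<cdot>\<^sub>m adj_mat g) * g = 1\<^sub>m n" "g * (inverse (det g) \<cdot>\<^sub>m adj_mat g) = 1\<^sub>m n"
  using adj_mat[OF assms(1)] assms carrier_matD[OF adj_mat(1)[OF assms(1)]]
  by (auto simp: smult_mult_dim smult_twice smult_one)

text \<open>The curve runs along the straight lines between the frames and between the free parts. The inverse of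
the moving frame is rational with the determinant as denominator.\<close>

lemma frame_lift_curve:
  assumes z: "z \<in> Lam Q \<Omega> v1" "z \<in> U"
    and g: "g \<in> carrier_mat n n" "g' \<in> carrier_mat n n" "g * g' = 1\<^sub>m n"
    and h: "h \<in> carrier_mat n n" "h' \<in> carrier_mat n n" "h * h' = 1\<^sub>m n"
    and Y: "Y \<in> carrier_mat w (n - m)" "in_mat v1 i z * Y = 0\<^sub>m m (n - m)"
    and Y': "Y' \<in> carrier_mat w (n - m)" "in_mat v1 i z * Y' = 0\<^sub>m m (n - m)"
  shows "\<exists>d \<gamma>. rep_fun (rational_off d) Q v \<gamma> \<and> poly d 0 \<noteq> 0 \<and> poly d 1 \<noteq> 0 \<and>
    \<gamma> 0 = frame_lift i v v1 g g' Y z \<and> \<gamma> 1 = frame_lift i v v1 h h' Y' z \<and>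
    (\<forall>t. poly d t \<noteq> 0 \<longrightarrow> \<gamma> t \<in> lifts i v v1 U)"
proof -
  define G where "G t = (1 - t) \<cdot>\<^sub>m g + t \<cdot>\<^sub>m h" for t
  define Z where "Z t = (1 - t) \<cdot>\<^sub>m Y + t \<cdot>\<^sub>m Y'" for t
  have lin: "(\<lambda>t :: complex. 1 - t) = poly [:1, - 1:]" "(\<lambda>t. t) = poly [:0, 1 :: complex:]"
    by (auto simp: fun_eq_iff)
  have line: "mat_fun F a b (\<lambda>t. (1 - t) \<cdot>\<^sub>m A + t \<cdot>\<^sub>m B)"
    if "function_ring F" "range poly \<subseteq> F" "A \<in> carrier_mat a b" "B \<in> carrier_mat a b" for F a b A B
  proof -
    have "(\<lambda>t. 1 - t) \<in> F" unfolding lin(1) using that(2) by blast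
    moreover have "(\<lambda>t. t) \<in> F" unfolding lin(2) using that(2) by blast
    ultimately show ?thesis
      by (intro mat_fun_add[OF that(1)] mat_fun_smult[OF that(1)] mat_fun_const[OF that(1)] that(3,4))
  qed
  have "mat_fun (range poly) n n G"
    unfolding G_def by (rule line[OF function_ring_polynomials subset_refl g(1) h(1)])
  from function_ring_det[OF function_ring_polynomials this] obtain d where d: "\<And>t. det (G t) = poly d t"
    by (auto simp: fun_eq_iff)
  have sub: "range poly \<subseteq> rational_off d" using poly_rational_off by auto
  have GF: "mat_fun (rational_off d) n n G"
    unfolding G_def by (rule line[OF function_ring_rational_off sub g(1) h(1)])
  have ZF: "mat_fun (rational_off d) w (n - m) Z"
    unfolding Z_def by (rule line[OF function_ring_rational_off sub Y(1) Y'(1)])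
  have G: "G t \<in> carrier_mat n n" for t using g h by (auto simp: G_def)
  have Zc: "Z t \<in> carrier_mat w (n - m)" for t using Y Y' by (auto simp: Z_def)
  define G' where "G' t = inverse (det (G t)) \<cdot>\<^sub>m adj_mat (G t)" for t
  have GF': "mat_fun (rational_off d) n n G'"
    unfolding G'_def d
    by (rule mat_fun_smult[OF function_ring_rational_off inverse_rational_off mat_fun_adj[OF function_ring_rational_off GF]])
  define \<gamma> where "\<gamma> t = frame_lift i v v1 (G t) (G' t) (Z t) z" for t
  have "rep_fun (rational_off d) Q v1 (\<lambda>t. z)"
    unfolding rep_fun_def by (auto intro: function_ringD(1)[OF function_ring_rational_off])
  then have "rep_fun (rational_off d) Q v \<gamma>"
    unfolding \<gamma>_def by (rule rep_fun_frame_lift[OF function_ring_rational_off _ GF GF' ZF])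
  moreover
  have ends: "G 0 = g" "G 1 = h" "Z 0 = Y" "Z 1 = Y'"
    using g(1) h(1) Y(1) Y'(1) by (auto simp: G_def Z_def intro!: eq_matI)
  have "G' 0 = g'" "G' 1 = h'"
    unfolding G'_def ends using inverse_eq_adj(2)[OF g] inverse_eq_adj(2)[OF h] by simp_all
  then have "\<gamma> 0 = frame_lift i v v1 g g' Y z" "\<gamma> 1 = frame_lift i v v1 h h' Y' z"
    unfolding \<gamma>_def ends by simp_all
  moreover have "poly d 0 \<noteq> 0" "poly d 1 \<noteq> 0"
    unfolding d[symmetric] ends using inverse_eq_adj(1)[OF g] inverse_eq_adj(1)[OF h] .
  moreover have "\<gamma> t \<in> lifts i v v1 U" if "poly d t \<noteq> 0" for t
    unfolding \<gamma>_def
  proof (rule frame_lift_lifts[OF z(1) G _ _ Zc _ z(2)])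
    show "G' t \<in> carrier_mat n n" "G' t * G t = 1\<^sub>m n"
      using adj_inverse[OF G] that unfolding G'_def d by auto
    have "in_mat v1 i z * Z t = (1 - t) \<cdot>\<^sub>m (in_mat v1 i z * Y) + t \<cdot>\<^sub>m (in_mat v1 i z * Y')"
      using carrier_matD[OF Y(1)] carrier_matD[OF Y'(1)] width_eq1 by (simp add: Z_def mat_algebra)
    then show "in_mat v1 i z * Z t = 0\<^sub>m m (n - m)" unfolding Y(2) Y'(2) by (auto intro!: eq_matI)
  qed
  ultimately show ?thesis by blast
qed

lemma lifts_nonempty:
  assumes "z \<in> Lam Q \<Omega> v1" "z \<in> U"
  shows "frame_lift i v v1 (1\<^sub>m n) (1\<^sub>m n) (0\<^sub>m w (n - m)) z \<in> lifts i v v1 U"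
    and "frame_lift i v v1 (1\<^sub>m n) (1\<^sub>m n) (0\<^sub>m w (n - m)) z \<in> Lam Q \<Omega> v"
  using frame_lift_lifts[OF assms(1) _ _ _ _ _ assms(2), of "1\<^sub>m n" "1\<^sub>m n" "0\<^sub>m w (n - m)"]
    frame_lift_Lam[OF assms(1), of "1\<^sub>m n" "1\<^sub>m n" "0\<^sub>m w (n - m)"] width_eq1
  by auto

lemma lifts_Lam: "lifts i v v1 U \<subseteq> Lam Q \<Omega> v"
  unfolding lifts_def by auto

lemma lifts_mono: "U \<subseteq> U' \<Longrightarrow> lifts i v v1 U \<subseteq> lifts i v v1 U'"
  unfolding lifts_def by blast

definition lift_params :: "(complex mat \<times> complex mat \<times> complex mat \<times> complex mat) set" where
  "lift_params = {(g, g', T, y). g \<in> carrier_mat n n \<and> g' \<in> carrier_mat n n \<and> g * g' = 1\<^sub>m n \<and>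
     g' * g = 1\<^sub>m n \<and> T \<in> carrier_mat w m \<and> y \<in> carrier_mat w (n - m)}"

definition lift_at :: "complex mat \<times> complex mat \<times> complex mat \<times> complex mat \<Rightarrow> ('i, 'e) rep \<Rightarrow> ('i, 'e) rep" where
  "lift_at = (\<lambda>(g, g', T, y) z. frame_lift i v v1 g g' (ker_op (in_mat v1 i z) T * y) z)"

lemma lift_at:
  assumes "k \<in> lift_params"
  shows "rep_fun (polynomial_functions Q v1) Q v (lift_at k)"
    and "z \<in> Lam Q \<Omega> v1 \<Longrightarrow> z \<in> U \<Longrightarrow> lift_at k z \<in> lifts i v v1 U"
proof -
  obtain g g' T y where k: "k = (g, g', T, y)" by (cases k)
  then have g: "g \<in> carrier_mat n n" "g' \<in> carrier_mat n n" "g' * g = 1\<^sub>m n"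
    "T \<in> carrier_mat w m" "y \<in> carrier_mat w (n - m)"
    using assms unfolding lift_params_def by auto
  show "rep_fun (polynomial_functions Q v1) Q v (lift_at k)"
    using rep_fun_polynomial_lift[OF g(1,2,4,5)] by (simp add: k lift_at_def)
  show "lift_at k z \<in> lifts i v v1 U" if "z \<in> Lam Q \<Omega> v1" "z \<in> U"
    using frame_lift_lifts[OF that(1) g(1-3) in_mat_ker_op_zero[OF g(4,5)] that(2)]
    by (simp add: k lift_at_def)
qed

lemma lifts_cover:
  assumes "x \<in> lifts i v v1 Z" "Z \<subseteq> Lam Q \<Omega> v1"
    and "\<And>z. z \<in> Z \<Longrightarrow> rank_ge m (in_mat v1 i z) \<or> n = m"
  shows "\<exists>k\<in>lift_params. \<exists>z\<in>Z. x = lift_at k z"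
proof -
  obtain \<phi> P z where z: "x \<in> Lam Q \<Omega> v" "\<phi> \<in> carrier_mat n m" "P \<in> carrier_mat m n" "P * \<phi> = 1\<^sub>m m"
    "z \<in> Z" "restricts i \<phi> x z"
    using assms(1) unfolding lifts_def by blast
  have zL: "z \<in> Lam Q \<Omega> v1" using z(5) assms(2) by auto
  from lift_eq_frame_lift[OF z(1) zL z(2,3,4,6) assms(3)[OF z(5)]] obtain g g' T y where
    "(g, g', T, y) \<in> lift_params" "x = lift_at (g, g', T, y) z"
    unfolding lift_params_def lift_at_def by auto
  with z(5) show ?thesis by blast
qed

lemma irreducible_lifts:
  assumes Z: "irreducible_in (zariski Q v1) Z" "Z \<subseteq> Lam Q \<Omega> v1"
    and surj: "\<And>z. z \<in> Z \<Longrightarrow> rank_ge m (in_mat v1 i z) \<or> n = m"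
  shows "irreducible_in (zariski Q v) (lifts i v v1 Z)"
proof (rule irreducible_by_sections[OF Z(1), where K = lift_params and \<sigma> = lift_at])
  show "lifts i v v1 Z \<subseteq> reps Q v" using lifts_Lam Lam_reps by blast
  obtain z where "z \<in> Z" using Z(1) unfolding irreducible_in_def by auto
  then show "lifts i v v1 Z \<noteq> {}" using lifts_nonempty(1)[of z Z] Z(2) by auto
  show "\<exists>k\<in>lift_params. \<exists>z\<in>Z. x = lift_at k z" if "x \<in> lifts i v v1 Z" for x
    by (rule lifts_cover[OF that Z(2) surj])
  show "rep_fun (polynomial_functions Q v1) Q v (lift_at k)" if "k \<in> lift_params" for k
    by (rule lift_at(1)[OF that])
  fix k l z assume kl: "k \<in> lift_params" "l \<in> lift_params" and z: "z \<in> Z"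
  obtain g g' T y where k: "k = (g, g', T, y)" by (cases k)
  obtain h h' S y' where l: "l = (h, h', S, y')" by (cases l)
  have g: "g \<in> carrier_mat n n" "g' \<in> carrier_mat n n" "g * g' = 1\<^sub>m n"
    "T \<in> carrier_mat w m" "y \<in> carrier_mat w (n - m)"
    using kl(1) unfolding k lift_params_def by auto
  have h: "h \<in> carrier_mat n n" "h' \<in> carrier_mat n n" "h * h' = 1\<^sub>m n"
    "S \<in> carrier_mat w m" "y' \<in> carrier_mat w (n - m)"
    using kl(2) unfolding l lift_params_def by auto
  have "z \<in> Lam Q \<Omega> v1" using z Z(2) by auto
  from frame_lift_curve[OF this z g(1-3) h(1-3) in_mat_ker_op_zero[OF g(4,5)] in_mat_ker_op_zero[OF h(4,5)]]
  show "\<exists>d \<gamma>. rep_fun (rational_off d) Q v \<gamma> \<and> poly d 0 \<noteq> 0 \<and> poly d 1 \<noteq> 0 \<and>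
      \<gamma> 0 = lift_at k z \<and> \<gamma> 1 = lift_at l z \<and> (\<forall>t. poly d t \<noteq> 0 \<longrightarrow> \<gamma> t \<in> lifts i v v1 Z)"
    by (simp add: k l lift_at_def)
qed

text \<open>A polynomial that vanishes on the lifts of \<open>D\<close> vanishes, for each polynomial family of lifts, on the
closure of \<open>D\<close>.\<close>

lemma lifts_dense:
  assumes Z: "Z \<subseteq> Lam Q \<Omega> v1" and surj: "\<And>z. z \<in> Z \<Longrightarrow> rank_ge m (in_mat v1 i z) \<or> n = m"
    and D: "D \<subseteq> Z" "Z \<subseteq> zariski Q v1 closure_of D"
  shows "lifts i v v1 Z \<subseteq> zariski Q v closure_of (lifts i v v1 D)"
proof
  fix x assume x: "x \<in> lifts i v v1 Z"
  from lifts_cover[OF x Z surj] obtain k z where k: "k \<in> lift_params" "z \<in> Z" "x = lift_at k z" by blast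
  have DL: "D \<subseteq> Lam Q \<Omega> v1" using D(1) Z by auto
  have DR: "D \<subseteq> reps Q v1" using DL Lam_reps by auto
  have LR: "lifts i v v1 D \<subseteq> reps Q v" using lifts_Lam Lam_reps by blast
  have "p x = 0" if p: "p \<in> polynomial_functions Q v" "\<forall>s\<in>lifts i v v1 D. p s = 0" for p
  proof -
    have "p (lift_at k z) = 0"
    proof (rule zero_on_closure[OF DR, where p = "\<lambda>z. p (lift_at k z)"])
      show "z \<in> zariski Q v1 closure_of D" using k(2) D(2) by auto
      show "(\<lambda>z. p (lift_at k z)) \<in> polynomial_functions Q v1"
        by (rule polynomial_functions_comp[OF pf_ring lift_at(1)[OF k(1)] p(1)])
      show "p (lift_at k s) = 0" if "s \<in> D" for s
        using bspec[OF p(2)] lift_at(2)[OF k(1), of s D] that DL by auto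
    qed
    then show ?thesis using k(3) by simp
  qed
  moreover have "x \<in> reps Q v" using x lifts_Lam Lam_reps by blast
  ultimately show "x \<in> zariski Q v closure_of (lifts i v v1 D)"
    unfolding in_closure_zariski[OF LR] by blast
qed

end

text \<open>Without change of dimension the lifts are the base changes at \<open>i\<close>. They form an irreducible set that
contains \<open>X\<close>, hence components are invariant under base change.\<close>

lemma lifts_component:
  assumes X: "X \<in> components v" and i: "i \<in> verts Q"
  shows "lifts i v v X = X"
proof (rule component_maximal[OF X])
  note XD = componentD[OF X]
  show "irreducible_in (zariski Q v) (lifts i v v X)"
    by (rule irreducible_lifts[OF i agree_off_refl order_refl XD(2,1)]) simp
  show "lifts i v v X \<subseteq> Lam Q \<Omega> v" unfolding lifts_def by auto
  show "X \<subseteq> lifts i v v X"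
  proof
    fix x assume x: "x \<in> X"
    then have xL: "x \<in> Lam Q \<Omega> v" using XD(1) by auto
    have one: "1\<^sub>m (v i) * x h = x h" if "h \<in> arrows Q" "in_vertex h = i" for h
      using carrier_matD[OF repsD[OF Lam_reps[OF xL] that(1)]] that(2) by simp
    have one': "x h * 1\<^sub>m (v i) = x h" if "h \<in> arrows Q" "out_vertex h = i" for h
      using carrier_matD[OF repsD[OF Lam_reps[OF xL] that(1)]] that(2) by simp
    have "restricts i (1\<^sub>m (v i)) x x" unfolding restricts_def using one one' by metis
    then show "x \<in> lifts i v v X"
      unfolding lifts_def using x xL
      by (intro CollectI conjI exI[of _ "1\<^sub>m (v i)"] exI[of _ x]) auto
  qed
qed

section \<open>The bijection between components\<close>

text \<open>The restriction of \<open>x\<close> to the image of the incoming matrix, in the basis determined by the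
  constant matrices \<open>P\<close> and \<open>T\<close>, has the determinant of \<open>P M T\<close> as its only denominator. Multiplying
  all arrows by this determinant makes it polynomial in \<open>x\<close>; since components are invariant under
  scaling, nothing is lost.\<close>

definition scaled_restriction ::
  "'i \<Rightarrow> ('i \<Rightarrow> nat) \<Rightarrow> ('i \<Rightarrow> nat) \<Rightarrow> complex mat \<Rightarrow> complex mat \<Rightarrow> ('i, 'e) rep \<Rightarrow> ('i, 'e) rep" where
  "scaled_restriction i v v1 P T x =
     glue v1 i (det (P * in_mat v i x * T) \<cdot>\<^sub>m (P * in_mat v i x))
       (out_mat v i x * (in_mat v i x * T) * adj_mat (P * in_mat v i x * T))
       (scale v1 (det (P * in_mat v i x * T)) x)"

context
  fixes i :: 'i and v v1 :: "'i \<Rightarrow> nat"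
  assumes i: "i \<in> verts Q" and v: "agree_off i v v1" and le: "v1 i \<le> v i"
begin

lemma width1: "width v1 i = width v i"
  using in_index_cong(2)[OF v] by simp

context
  fixes P T :: "complex mat"
  assumes P: "P \<in> carrier_mat (v1 i) (v i)" and T: "T \<in> carrier_mat (width v i) (v1 i)"
begin

lemma mat_fun_chart:
  "mat_fun (polynomial_functions Q v) (v1 i) (v1 i) (\<lambda>x. P * in_mat v i x * T)"
  "mat_fun (polynomial_functions Q v) (v1 i) (width v i) (\<lambda>x. P * in_mat v i x)"
proof -
  show PM: "mat_fun (polynomial_functions Q v) (v1 i) (width v i) (\<lambda>x. P * in_mat v i x)"
    by (rule mat_fun_mult[OF pf_ring, where k = "v i"])
      (rule mat_fun_const[OF pf_ring P], rule mat_fun_in_mat_id)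
  show "mat_fun (polynomial_functions Q v) (v1 i) (v1 i) (\<lambda>x. P * in_mat v i x * T)"
    by (rule mat_fun_mult[OF pf_ring PM mat_fun_const[OF pf_ring T]])
qed

lemma chart_det_polynomial: "(\<lambda>x. det (P * in_mat v i x * T)) \<in> polynomial_functions Q v"
  by (rule function_ring_det[OF pf_ring mat_fun_chart(1)])

lemma rep_fun_scaled_restriction:
  "rep_fun (polynomial_functions Q v) Q v1 (scaled_restriction i v v1 P T)"
proof -
  let ?F = "polynomial_functions Q v"
  have 1: "mat_fun ?F (v1 i) (width v1 i) (\<lambda>x. det (P * in_mat v i x * T) \<cdot>\<^sub>m (P * in_mat v i x))"
    unfolding width1 by (rule mat_fun_smult[OF pf_ring chart_det_polynomial mat_fun_chart(2)])
  have MT: "mat_fun ?F (v i) (v1 i) (\<lambda>x. in_mat v i x * T)"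
    by (rule mat_fun_mult[OF pf_ring mat_fun_in_mat_id mat_fun_const[OF pf_ring T]])
  have NMT: "mat_fun ?F (width v i) (v1 i) (\<lambda>x. out_mat v i x * (in_mat v i x * T))"
    by (rule mat_fun_mult[OF pf_ring mat_fun_out_mat_id MT])
  have 2: "mat_fun ?F (width v1 i) (v1 i)
      (\<lambda>x. out_mat v i x * (in_mat v i x * T) * adj_mat (P * in_mat v i x * T))"
    unfolding width1 by (rule mat_fun_mult[OF pf_ring NMT mat_fun_adj[OF pf_ring mat_fun_chart(1)]])
  have "rep_fun ?F Q v1 (\<lambda>x. glue v1 i (det (P * in_mat v i x * T) \<cdot>\<^sub>m (P * in_mat v i x))
       (out_mat v i x * (in_mat v i x * T) * adj_mat (P * in_mat v i x * T))
       (scale v1 (det (P * in_mat v i x * T)) x))"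
  proof (rule rep_fun_glue[OF pf_ring 1 2])
    fix h r s assume h: "h \<in> arrows Q" "in_vertex h \<noteq> i" "out_vertex h \<noteq> i"
      "r < v1 (in_vertex h)" "s < v1 (out_vertex h)"
    then have "r < v (in_vertex h)" "s < v (out_vertex h)"
      using v arrowsD[OF h(1)] unfolding agree_off_def by auto
    then have "(\<lambda>x. det (P * in_mat v i x * T) * x h $$ (r, s)) \<in> ?F"
      by (intro function_ringD(3)[OF pf_ring] chart_det_polynomial polynomial_functions.coord h(1))
    then show "(\<lambda>x. scale v1 (det (P * in_mat v i x * T)) x h $$ (r, s)) \<in> ?F"
      using h by (simp add: scale_def)
  qed
  then show ?thesis unfolding scaled_restriction_def .
qed

text \<open>The basis of the image in which the restriction is written is the one normalised by \<open>P\<close>.\<close>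

lemma scaled_restriction_eq:
  assumes x: "x \<in> Lam Q \<Omega> v" and z: "z \<in> Lam Q \<Omega> v1"
    and \<phi>: "\<phi> \<in> carrier_mat (v i) (v1 i)" "P * \<phi> = 1\<^sub>m (v1 i)" "restricts i \<phi> x z"
  shows "P * in_mat v i x = in_mat v1 i z"
    and "scaled_restriction i v v1 P T x = scale v1 (det (P * in_mat v i x * T)) z"
proof -
  note xr = Lam_reps[OF x] and zr = Lam_reps[OF z]
  note M = in_mat_restriction[OF i xr zr v \<phi>(1) P \<phi>(2,3)]
    and N = out_mat_restriction[OF i xr zr v \<phi>(1) P \<phi>(2,3)]
    and away = agree_away_restriction[OF i xr zr v \<phi>(1) P \<phi>(2,3)]
  let ?A = "in_mat v1 i z * T"
  have A: "?A \<in> carrier_mat (v1 i) (v1 i)" using T width1 by (intro carrier_matI) auto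
  note dims = carrier_matD[OF P] carrier_matD[OF T] width1 carrier_matD[OF \<phi>(1)] carrier_matD[OF adj_mat(1)[OF A]]
  show PM: "P * in_mat v i x = in_mat v1 i z"
    unfolding M using dims by (simp add: mult_assoc_left[OF \<phi>(2)])
  have "out_mat v i x * (in_mat v i x * T) * adj_mat ?A = out_mat v1 i z * (?A * adj_mat ?A)"
    unfolding M N using dims by (simp add: mult_assoc_dim)
  then have NA: "out_mat v i x * (in_mat v i x * T) * adj_mat ?A = det ?A \<cdot>\<^sub>m out_mat v1 i z"
    unfolding adj_mat(2)[OF A] using dims by (simp add: smult_mult_dim)
  show "scaled_restriction i v v1 P T x = scale v1 (det (P * in_mat v i x * T)) z"
  proof (rule rep_eqI[of _ v1 _ i])
    show "scale v1 (det (P * in_mat v i x * T)) z \<in> reps Q v1" by (rule scale_reps)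
    show "scaled_restriction i v v1 P T x \<in> reps Q v1"
      unfolding scaled_restriction_def by (rule glue_reps[OF agree_off_refl scale_reps])
    show "in_mat v1 i (scaled_restriction i v v1 P T x) = in_mat v1 i (scale v1 (det (P * in_mat v i x * T)) z)"
      unfolding scaled_restriction_def scale_mats PM by (rule in_mat_glue) auto
    show "out_mat v1 i (scaled_restriction i v v1 P T x) = out_mat v1 i (scale v1 (det (P * in_mat v i x * T)) z)"
      unfolding scaled_restriction_def scale_mats PM NA by (rule out_mat_glue) auto
    show "agree_away i (scaled_restriction i v v1 P T x) (scale v1 (det (P * in_mat v i x * T)) z)"
      using glue_agree_away[of i v1 _ _ "scale v1 (det (P * in_mat v i x * T)) x"] away
      unfolding scaled_restriction_def agree_away_def by (simp add: scale_def)
  qed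
qed

lemma scaled_restriction:
  assumes x: "x \<in> Lam Q \<Omega> v" and rank: "rank_le (v1 i) (in_mat v i x)"
    and det: "det (P * in_mat v i x * T) \<noteq> 0"
  obtains \<phi> z where "\<phi> \<in> carrier_mat (v i) (v1 i)" "P * \<phi> = 1\<^sub>m (v1 i)" "z \<in> Lam Q \<Omega> v1"
    "restricts i \<phi> x z" "in_mat v1 i z = P * in_mat v i x"
    "scaled_restriction i v v1 P T x = scale v1 (det (P * in_mat v i x * T)) z"
    "rank_ge (v1 i) (in_mat v1 i z)"
proof -
  let ?M = "in_mat v i x" and ?N = "out_mat v i x"
  let ?d = "det (P * ?M * T)"
  note dims = carrier_matD[OF P] carrier_matD[OF T] width1
  have PMT: "P * ?M * T \<in> carrier_mat (v1 i) (v1 i)" using P T by auto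
  define D where "D = inverse ?d \<cdot>\<^sub>m adj_mat (P * ?M * T)"
  note adj = adj_mat[OF PMT]
  have D: "D \<in> carrier_mat (v1 i) (v1 i)" using adj(1) by (simp add: D_def)
  have Di: "D * (P * ?M * T) = 1\<^sub>m (v1 i)"
    unfolding D_def using smult_mult_dim(1)[of "adj_mat (P * ?M * T)" "P * ?M * T" "inverse ?d"] adj det
      carrier_matD[OF adj(1)] dims
    by (simp add: smult_twice smult_one del: index_mult_mat(1))
  note fac = factor_through_chart[OF in_mat_carrier(1) rank P T D Di]
  have \<phi>: "?M * T * D \<in> carrier_mat (v i) (v1 i)"
    by (intro mult_carrier_mat[OF mult_carrier_mat[OF in_mat_carrier(1) T] D])
  define z where "z = glue v1 i (P * ?M) (?N * (?M * T * D)) x"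
  note R = restriction_exists[OF i x v \<phi> P fac(2,1), folded z_def]
  have "scaled_restriction i v v1 P T x = scale v1 ?d z"
    by (rule scaled_restriction_eq(2)[OF x R(1) \<phi> fac(2) R(2)])
  moreover have "rank_ge (v1 i) (in_mat v1 i z)"
    unfolding rank_ge_def R(3) using D T Di dims
    by (intro exI[of _ D] exI[of _ T]) (auto simp: mult_assoc_dim)
  ultimately show ?thesis using that \<phi> fac(2) R by blast
qed

end

lemma eps_rep_zero_iff: "z \<in> reps Q v1 \<Longrightarrow> eps_rep Q v1 i z = 0 \<longleftrightarrow> rank_ge (v1 i) (in_mat v1 i z)"
  using eps_rep_le_iff[of z v1 "v1 i" i] by simp

text \<open>The incoming matrix of a lift is an injective matrix times a surjective one.\<close>

lemma eps_rep_lift: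
  assumes x: "x \<in> lifts i v v1 U" and U: "\<And>z. z \<in> U \<Longrightarrow> z \<in> Lam Q \<Omega> v1 \<and> eps_rep Q v1 i z = 0"
  shows "eps_rep Q v i x = v i - v1 i"
proof -
  obtain \<phi> P z where z: "x \<in> Lam Q \<Omega> v" "\<phi> \<in> carrier_mat (v i) (v1 i)" "P \<in> carrier_mat (v1 i) (v i)"
    "P * \<phi> = 1\<^sub>m (v1 i)" "z \<in> U" "restricts i \<phi> x z"
    using x unfolding lifts_def by blast
  note xr = Lam_reps[OF z(1)] and zr = Lam_reps[OF conjunct1[OF U[OF z(5)]]]
  have M: "in_mat v i x = \<phi> * in_mat v1 i z" using in_mat_restriction[OF i xr zr v z(2-4,6)] .
  obtain P' T where PT: "P' \<in> carrier_mat (v1 i) (v1 i)" "T \<in> carrier_mat (width v i) (v1 i)"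
    "P' * in_mat v1 i z * T = 1\<^sub>m (v1 i)"
    using eps_rep_zero_iff[OF zr] U[OF z(5)] width1 unfolding rank_ge_def by auto
  note dims = carrier_matD[OF z(2)] carrier_matD[OF z(3)] carrier_matD[OF PT(1)] carrier_matD[OF PT(2)] width1
  have "(P' * P) * in_mat v i x * T = 1\<^sub>m (v1 i)"
  proof -
    have "(P' * P) * in_mat v i x * T = P' * ((P * \<phi>) * in_mat v1 i z) * T"
      unfolding M using dims by (simp add: mult_assoc_dim)
    then show ?thesis unfolding z(4) using PT(3) by simp
  qed
  then have "rank_ge (v1 i) (in_mat v i x)"
    unfolding rank_ge_def using dims by (intro exI[of _ "P' * P"] exI[of _ T]) auto
  moreover have "rank_le (v1 i) (in_mat v i x)"
    unfolding rank_le_def using M z(2) dims by (intro exI[of _ \<phi>] exI[of _ "in_mat v1 i z"]) auto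
  ultimately show ?thesis using eps_rep_eq[OF xr] by simp
qed

definition lift_closure :: "('i, 'e) rep set \<Rightarrow> ('i, 'e) rep set" where
  "lift_closure Z = zariski Q v closure_of lifts i v v1 (eps_stratum v1 i Z)"

context
  fixes Z
  assumes Z: "Z \<in> components v1" and eps0: "eps Q i (v1, Z) = 0"
begin

lemma stratum:
  shows "irreducible_in (zariski Q v1) (eps_stratum v1 i Z)" "eps_stratum v1 i Z \<subseteq> Lam Q \<Omega> v1"
    "eps_stratum v1 i Z \<subseteq> Z" "z \<in> eps_stratum v1 i Z \<Longrightarrow> rank_ge (v1 i) (in_mat v1 i z)"
    "eps_stratum v1 i Z = {z \<in> Z. eps_rep Q v1 i z = 0}" "eps_stratum v1 i Z \<noteq> {}"
proof -
  show "irreducible_in (zariski Q v1) (eps_stratum v1 i Z)"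
    using eps_stratum(1)[OF componentD(2)[OF Z]] .
  then show "eps_stratum v1 i Z \<noteq> {}" unfolding irreducible_in_def by simp
  show eq: "eps_stratum v1 i Z = {z \<in> Z. eps_rep Q v1 i z = 0}"
    unfolding eps_stratum_def eps0 ..
  then show sub: "eps_stratum v1 i Z \<subseteq> Z" by auto
  then show "eps_stratum v1 i Z \<subseteq> Lam Q \<Omega> v1" using componentD(1)[OF Z] by auto
  then show "z \<in> eps_stratum v1 i Z \<Longrightarrow> rank_ge (v1 i) (in_mat v1 i z)"
    using eps_rep_zero_iff[of z] Lam_reps unfolding eq by blast
qed

lemma lift_closure:
  shows lift_closure_irreducible: "irreducible_in (zariski Q v) (lift_closure Z)"
    and lift_closure_Lam: "lift_closure Z \<subseteq> Lam Q \<Omega> v"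
    and lifts_subset_closure: "lifts i v v1 (eps_stratum v1 i Z) \<subseteq> lift_closure Z"
    and eps_lift_closure: "eps Q i (v, lift_closure Z) = v i - v1 i"
proof -
  have irr: "irreducible_in (zariski Q v) (lifts i v v1 (eps_stratum v1 i Z))"
    by (rule irreducible_lifts[OF i v le stratum(1,2)]) (simp add: stratum(4))
  show cl: "irreducible_in (zariski Q v) (lift_closure Z)"
    unfolding lift_closure_def by (rule irreducible_in_closure[OF irr])
  show "lift_closure Z \<subseteq> Lam Q \<Omega> v"
    unfolding lift_closure_def using lifts_Lam[OF i v le] by (intro closure_of_minimal closed_Lam)
  have R: "lifts i v v1 (eps_stratum v1 i Z) \<subseteq> reps Q v" using lifts_Lam[OF i v le] Lam_reps by blast
  show sub: "lifts i v v1 (eps_stratum v1 i Z) \<subseteq> lift_closure Z"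
    unfolding lift_closure_def using R by (intro closure_of_subset) simp
  have e: "eps_rep Q v i x = v i - v1 i" if "x \<in> lifts i v v1 (eps_stratum v1 i Z)" for x
    by (rule eps_rep_lift[OF that]) (use stratum(2,5) in blast)
  obtain x where x: "x \<in> lifts i v v1 (eps_stratum v1 i Z)"
    using irr unfolding irreducible_in_def by blast
  show "eps Q i (v, lift_closure Z) = v i - v1 i"
  proof (rule eps_eqI[OF cl])
    show "x \<in> lift_closure Z" using x sub by blast
    show "eps_rep Q v i x = v i - v1 i" by (rule e[OF x])
    have "lift_closure Z \<subseteq> {x \<in> reps Q v. v i - v1 i \<le> eps_rep Q v i x}"
      unfolding lift_closure_def using R e by (intro closure_of_minimal closedin_eps_rep_ge) auto
    then show "v i - v1 i \<le> eps_rep Q v i y" if "y \<in> lift_closure Z" for y using that by auto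
  qed
qed

text \<open>Any two representations of which \<open>x\<close> is a lift and which are surjective at \<open>i\<close> differ by a
  change of basis at \<open>i\<close>, so they lie in the same components.\<close>

lemma scaled_restriction_in_component:
  assumes x: "x \<in> lifts i v v1 (eps_stratum v1 i Z)"
    and P: "P \<in> carrier_mat (v1 i) (v i)" and T: "T \<in> carrier_mat (width v i) (v1 i)"
    and det: "det (P * in_mat v i x * T) \<noteq> 0"
  shows "scaled_restriction i v v1 P T x \<in> Z"
proof -
  obtain \<psi> R y where y: "x \<in> Lam Q \<Omega> v" "\<psi> \<in> carrier_mat (v i) (v1 i)" "R \<in> carrier_mat (v1 i) (v i)"
    "R * \<psi> = 1\<^sub>m (v1 i)" "y \<in> eps_stratum v1 i Z" "restricts i \<psi> x y"
    using x unfolding lifts_def by blast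
  have yL: "y \<in> Lam Q \<Omega> v1" and yZ: "y \<in> Z" using y(5) stratum(2,3) by auto
  note xr = Lam_reps[OF y(1)] and yr = Lam_reps[OF yL]
  have My: "in_mat v i x = \<psi> * in_mat v1 i y" and Ny: "out_mat v1 i y = out_mat v i x * \<psi>"
    and ay: "agree_away i x y"
    using in_mat_restriction[OF i xr yr v y(2-4,6)] out_mat_restriction[OF i xr yr v y(2-4,6)]
      agree_away_restriction[OF i xr yr v y(2-4,6)] by auto
  have rank: "rank_le (v1 i) (in_mat v i x)"
    unfolding rank_le_def using My y(2) width1 by (intro exI[of _ \<psi>] exI[of _ "in_mat v1 i y"]) auto
  obtain \<phi> z where z: "\<phi> \<in> carrier_mat (v i) (v1 i)" "P * \<phi> = 1\<^sub>m (v1 i)" "z \<in> Lam Q \<Omega> v1"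
    "restricts i \<phi> x z" "in_mat v1 i z = P * in_mat v i x"
    "scaled_restriction i v v1 P T x = scale v1 (det (P * in_mat v i x * T)) z"
    "rank_ge (v1 i) (in_mat v1 i z)"
    by (rule scaled_restriction[OF P T y(1) rank det])
  note zr = Lam_reps[OF z(3)]
  have Mz: "in_mat v i x = \<phi> * in_mat v1 i z" and Nz: "out_mat v1 i z = out_mat v i x * \<phi>"
    and az: "agree_away i x z"
    using in_mat_restriction[OF i xr zr v z(1) P z(2,4)] out_mat_restriction[OF i xr zr v z(1) P z(2,4)]
      agree_away_restriction[OF i xr zr v z(1) P z(2,4)] by auto
  note dims = carrier_matD[OF y(2)] carrier_matD[OF y(3)] carrier_matD[OF z(1)] carrier_matD[OF P] width1
  have "in_mat v1 i y \<in> carrier_mat (v1 i) (width v i)" using width1 in_mat_carrier(1)[of v1 i y] by simp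
  from rank_ge_right_inverse[OF this stratum(4)[OF y(5)]] obtain T' where
    T': "T' \<in> carrier_mat (width v i) (v1 i)" and right: "in_mat v1 i y * T' = 1\<^sub>m (v1 i)" by blast
  note dims = dims carrier_matD[OF T']
  have "\<phi> * (P * in_mat v i x) = in_mat v i x" using Mz z(5) by simp
  then have "\<phi> * (P * (\<psi> * in_mat v1 i y)) * T' = \<psi> * in_mat v1 i y * T'"
    unfolding My by simp
  then have \<psi>: "\<phi> * (P * \<psi>) = \<psi>" using dims by (simp add: mult_assoc_dim right)
  have inv: "(R * \<phi>) * (P * \<psi>) = 1\<^sub>m (v1 i)" using y(4) \<psi> dims by (simp add: mult_assoc_dim)
  have g: "P * \<psi> \<in> carrier_mat (v1 i) (v1 i)" "R * \<phi> \<in> carrier_mat (v1 i) (v1 i)" using dims by auto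
  have "restricts i (P * \<psi>) z y"
    unfolding restricts_iff[OF zr yr agree_off_refl g(1)]
  proof (intro conjI)
    show "in_mat v1 i z = P * \<psi> * in_mat v1 i y"
      unfolding z(5) My using dims by (simp add: mult_assoc_dim)
    show "out_mat v1 i y = out_mat v1 i z * (P * \<psi>)"
      unfolding Nz Ny using dims \<psi> by (simp add: mult_assoc_dim)
    show "agree_away i z y" using ay az unfolding agree_away_def by simp
  qed
  then have "z \<in> lifts i v1 v1 Z" unfolding lifts_def using z(3) g inv yZ by blast
  then have "z \<in> Z" using lifts_component[OF Z i] by simp
  then show ?thesis unfolding z(6) by (rule component_scale[OF Z _ det])
qed

end

text \<open>The condition that the scaled restriction lies in \<open>Z'\<close> is closed. It holds for the lifts of \<open>Z'\<close>, hence on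
the common closure, and for the trivial lift of a point \<open>z\<close> of \<open>Z\<close> the restriction is \<open>z\<close> itself. So
\<open>Z\<close> is contained in \<open>Z'\<close>.\<close>

lemma lift_closure_inj:
  assumes Z: "Z \<in> components v1" "eps Q i (v1, Z) = 0"
    and Z': "Z' \<in> components v1" "eps Q i (v1, Z') = 0"
    and eq: "lift_closure Z = lift_closure Z'"
  shows "Z = Z'"
proof -
  have "eps_stratum v1 i Z \<subseteq> Z'"
  proof
    fix z assume z: "z \<in> eps_stratum v1 i Z"
    have zL: "z \<in> Lam Q \<Omega> v1" using z stratum(2)[OF Z] by auto
    note zr = Lam_reps[OF zL]
    show "z \<in> Z'"
    proof (rule ccontr)
      assume nz: "z \<notin> Z'"
      have Z'R: "Z' \<subseteq> reps Q v1" using componentD(1)[OF Z'(1)] Lam_reps by auto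
      obtain p where p: "p \<in> polynomial_functions Q v1" "\<And>y. y \<in> Z' \<Longrightarrow> p y = 0" "p z \<noteq> 0"
        using nz component_closed[OF Z'(1) closed_Lam] in_closure_zariski[OF Z'R, of z] zr by auto
      define x where "x = frame_lift i v v1 (1\<^sub>m (v i)) (1\<^sub>m (v i)) (0\<^sub>m (width v i) (v i - v1 i)) z"
      have xl: "x \<in> lifts i v v1 (eps_stratum v1 i Z)"
        unfolding x_def by (rule lifts_nonempty(1)[OF i v le zL z])
      have "in_mat v1 i z \<in> carrier_mat (v1 i) (width v i)" using width1 in_mat_carrier(1)[of v1 i z] by simp
      from rank_ge_right_inverse[OF this stratum(4)[OF Z z]] obtain T where
        T: "T \<in> carrier_mat (width v i) (v1 i)" and AT: "in_mat v1 i z * T = 1\<^sub>m (v1 i)" by blast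
      note dims = carrier_matD[OF T] width1 le
      define P where "P = incl (v1 i) (v i)"
      have P: "P \<in> carrier_mat (v1 i) (v i)" by (simp add: P_def)
      have M: "in_mat v i x = incl (v i) (v1 i) * in_mat v1 i z"
        unfolding x_def frame_lift_def using dims by (subst in_mat_glue) auto
      have PM: "P * in_mat v i x = in_mat v1 i z"
        unfolding P_def M using dims by (simp add: incl_cancel)
      have PMT: "P * in_mat v i x * T = 1\<^sub>m (v1 i)" unfolding PM AT ..
      let ?q = "\<lambda>x. p (scaled_restriction i v v1 P T x) * det (P * in_mat v i x * T)"
      have q: "?q \<in> polynomial_functions Q v"
        by (intro function_ringD(3)[OF pf_ring] chart_det_polynomial[OF P T]
            polynomial_functions_comp[OF pf_ring rep_fun_scaled_restriction[OF P T] p(1)])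
      have zero: "?q y = 0" if "y \<in> lifts i v v1 (eps_stratum v1 i Z')" for y
        using scaled_restriction_in_component[OF Z' that P T] p(2) by auto
      have "x \<in> lift_closure Z'" using xl lifts_subset_closure[OF Z] eq by auto
      moreover have R: "lifts i v v1 (eps_stratum v1 i Z') \<subseteq> reps Q v"
        using lifts_Lam[OF i v le, of "eps_stratum v1 i Z'"] Lam_reps by blast
      ultimately have "?q x = 0"
        unfolding lift_closure_def using zero_on_closure[OF R _ q zero] by simp
      then have q0: "p (scaled_restriction i v v1 P T x) = 0" unfolding PMT by simp
      have xL: "x \<in> Lam Q \<Omega> v" using xl lifts_Lam[OF i v le] by blast
      have restr: "restricts i (incl (v i) (v1 i)) x z"
        using frame_lift_restricts[OF i v le zL, of "1\<^sub>m (v i)" "1\<^sub>m (v i)" "0\<^sub>m (width v i) (v i - v1 i)"]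
          width1 unfolding x_def by simp
      have \<iota>: "incl (v i) (v1 i) \<in> carrier_mat (v i) (v1 i)" "P * incl (v i) (v1 i) = 1\<^sub>m (v1 i)"
        using le by (auto simp: P_def)
      have "scaled_restriction i v v1 P T x = z"
        using scaled_restriction_eq(2)[OF P T xL zL \<iota> restr] scale_one[OF zr] unfolding PMT by simp
      with q0 p(3) show False by simp
    qed
  qed
  then have "Z \<subseteq> Z'"
    using closure_of_mono[of "eps_stratum v1 i Z" Z' "zariski Q v1"] eps_stratum(2)[OF componentD(2)[OF Z(1)], of i]
      component_closed[OF Z'(1) closed_Lam] by auto
  from component_maximal[OF Z(1) componentD(2)[OF Z'(1)] this componentD(1)[OF Z'(1)]]
  show ?thesis by simp
qed

end

subsection \<open>Every component is a lift closure\<close>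

text \<open>On a chart the scaled restriction maps a dense open subset of \<open>X\<close> onto an irreducible set, which
  lies in one component \<open>Z\<close>. As \<open>Z\<close> is a cone, it contains the restrictions themselves, so almost
  all of \<open>X\<close> consists of lifts of points of \<open>Z\<close>.\<close>

lemma generic_lift:
  assumes i: "i \<in> verts Q" and v: "agree_off i v v1" and le: "v1 i \<le> v i"
    and X: "irreducible_in (zariski Q v) X" "X \<subseteq> Lam Q \<Omega> v" and eps: "eps Q i (v, X) = v i - v1 i"
  shows "\<exists>P T Z D x0. P \<in> carrier_mat (v1 i) (v i) \<and> T \<in> carrier_mat (width v i) (v1 i) \<and>
    Z \<in> components v1 \<and> eps Q i (v1, Z) = 0 \<and>
    D \<subseteq> X \<and> X \<subseteq> zariski Q v closure_of D \<and> x0 \<in> D \<and> P * in_mat v i x0 * T = 1\<^sub>m (v1 i) \<and>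
    (\<forall>x\<in>D. \<exists>\<phi> z. \<phi> \<in> carrier_mat (v i) (v1 i) \<and> P * \<phi> = 1\<^sub>m (v1 i) \<and>
       z \<in> eps_stratum v1 i Z \<and> restricts i \<phi> x z \<and> in_mat v1 i z = P * in_mat v i x \<and>
       det (P * in_mat v i x * T) \<noteq> 0)"
proof -
  have XR: "X \<subseteq> reps Q v" using X(2) Lam_reps by auto
  obtain x0 where x0: "x0 \<in> X" "eps_rep Q v i x0 = v i - v1 i"
    using eps_attained(1)[OF X(1), of i] eps by auto
  have x0r: "x0 \<in> reps Q v" using x0(1) XR by auto
  obtain P T where PT: "P \<in> carrier_mat (v1 i) (v i)" "T \<in> carrier_mat (width v i) (v1 i)"
    "P * in_mat v i x0 * T = 1\<^sub>m (v1 i)"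
    using eps_rep_rank(1)[OF x0r x0(2) le] unfolding rank_ge_def by auto
  let ?d = "\<lambda>x. det (P * in_mat v i x * T)"
  let ?S = "eps_stratum v i X"
  define D where "D = {x \<in> ?S. ?d x \<noteq> 0}"
  note S = eps_stratum[OF X(1), of i]
  have x0S: "x0 \<in> ?S" using x0 eps unfolding eps_stratum_def by simp
  have d0: "?d x0 \<noteq> 0" unfolding PT(3) by simp
  note dp = chart_det_polynomial[OF i v le PT(1,2)]
  note Dirr = irreducible_nonzero_locus[OF S(1) dp x0S d0, folded D_def]
  have DX: "D \<subseteq> X" unfolding D_def eps_stratum_def by auto
  have "zariski Q v closure_of ?S \<subseteq> zariski Q v closure_of D"
    using Dirr(2) by (intro closure_of_minimal) auto
  then have dense: "X \<subseteq> zariski Q v closure_of D" using S(2) by auto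
  have restr: "\<exists>\<phi> z. \<phi> \<in> carrier_mat (v i) (v1 i) \<and> P * \<phi> = 1\<^sub>m (v1 i) \<and> z \<in> Lam Q \<Omega> v1 \<and>
      restricts i \<phi> x z \<and> in_mat v1 i z = P * in_mat v i x \<and>
      scaled_restriction i v v1 P T x = scale v1 (?d x) z \<and> rank_ge (v1 i) (in_mat v1 i z)"
    if x: "x \<in> D" for x
  proof -
    have xL: "x \<in> Lam Q \<Omega> v" using x DX X(2) by auto
    have d: "?d x \<noteq> 0" using x unfolding D_def by simp
    have "eps_rep Q v i x = v i - v1 i" using x eps unfolding D_def eps_stratum_def by simp
    from eps_rep_rank(2)[OF Lam_reps[OF xL] this le]
    have "rank_le (v1 i) (in_mat v i x)" .
    from scaled_restriction[OF i v le PT(1,2) xL this d] show ?thesis by metis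
  qed
  have sub: "scaled_restriction i v v1 P T ` D \<subseteq> Lam Q \<Omega> v1"
  proof
    fix y assume "y \<in> scaled_restriction i v v1 P T ` D"
    then obtain x z where "z \<in> Lam Q \<Omega> v1" "y = scale v1 (?d x) z" using restr by blast
    then show "y \<in> Lam Q \<Omega> v1" using Lam_scale by simp
  qed
  have "irreducible_in (zariski Q v1) (scaled_restriction i v v1 P T ` D)"
    by (rule irreducible_polynomial_image[OF Dirr(1) rep_fun_scaled_restriction[OF i v le PT(1,2)]])
      (use sub Lam_reps in blast)
  from irreducible_subset_component[OF this sub]
  obtain Z where Z: "Z \<in> components v1"
    "scaled_restriction i v v1 P T ` D \<subseteq> Z" by blast
  have lift: "\<exists>\<phi> z. \<phi> \<in> carrier_mat (v i) (v1 i) \<and> P * \<phi> = 1\<^sub>m (v1 i) \<and>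
       z \<in> Z \<and> eps_rep Q v1 i z = 0 \<and> restricts i \<phi> x z \<and> in_mat v1 i z = P * in_mat v i x \<and>
       ?d x \<noteq> 0" if x: "x \<in> D" for x
  proof -
    have d: "?d x \<noteq> 0" using x unfolding D_def by simp
    obtain \<phi> z where z: "\<phi> \<in> carrier_mat (v i) (v1 i)" "P * \<phi> = 1\<^sub>m (v1 i)" "z \<in> Lam Q \<Omega> v1"
      "restricts i \<phi> x z" "in_mat v1 i z = P * in_mat v i x"
      "scaled_restriction i v v1 P T x = scale v1 (?d x) z" "rank_ge (v1 i) (in_mat v1 i z)"
      using restr[OF x] by blast
    note zr = Lam_reps[OF z(3)]
    have "scale v1 (inverse (?d x)) (scale v1 (?d x) z) = scale v1 1 z"
      unfolding scale_def using d by (intro restrict_ext eq_matI) auto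
    moreover have "scale v1 (?d x) z \<in> Z" using Z(2) x z(6) by auto
    ultimately have "z \<in> Z"
      using component_scale[OF Z(1), of _ "inverse (?d x)"] d scale_one[OF zr] by fastforce
    moreover have "eps_rep Q v1 i z = 0" using eps_rep_zero_iff[OF i v le zr] z(7) by simp
    ultimately show ?thesis using z d by blast
  qed
  have x0D: "x0 \<in> D" using x0S d0 unfolding D_def by simp
  from lift[OF x0D] obtain z where "z \<in> Z" "eps_rep Q v1 i z = 0" by blast
  then have eps0: "eps Q i (v1, Z) = 0" using eps_attained(2)[OF componentD(2)[OF Z(1)], of z i] by simp
  have "\<forall>x\<in>D. \<exists>\<phi> z. \<phi> \<in> carrier_mat (v i) (v1 i) \<and> P * \<phi> = 1\<^sub>m (v1 i) \<and>
       z \<in> eps_stratum v1 i Z \<and> restricts i \<phi> x z \<and> in_mat v1 i z = P * in_mat v i x \<and> ?d x \<noteq> 0"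
  proof
    fix x assume "x \<in> D"
    from lift[OF this] show "\<exists>\<phi> z. \<phi> \<in> carrier_mat (v i) (v1 i) \<and> P * \<phi> = 1\<^sub>m (v1 i) \<and>
       z \<in> eps_stratum v1 i Z \<and> restricts i \<phi> x z \<and> in_mat v1 i z = P * in_mat v i x \<and> ?d x \<noteq> 0"
      unfolding eps_stratum_def eps0 by blast
  qed
  then show ?thesis using PT Z(1) eps0 DX dense x0D by blast
qed

text \<open>By maximality it suffices that \<open>X\<close> is contained in the closure of the lifts of one component, as such
closures are irreducible.\<close>

lemma component_is_lift_closure:
  assumes i: "i \<in> verts Q" and v: "agree_off i v v1" and le: "v1 i \<le> v i"
    and X: "X \<in> components v" and eps: "eps Q i (v, X) = v i - v1 i"
  shows "\<exists>Z\<in>components v1. eps Q i (v1, Z) = 0 \<and>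
    X = lift_closure i v v1 Z"
proof -
  from generic_lift[OF i v le componentD(2,1)[OF X] eps] obtain P T Z D where
    Z: "P \<in> carrier_mat (v1 i) (v i)" "Z \<in> components v1"
    "eps Q i (v1, Z) = 0" "D \<subseteq> X" "X \<subseteq> zariski Q v closure_of D" and
    D: "\<forall>x\<in>D. \<exists>\<phi> z. \<phi> \<in> carrier_mat (v i) (v1 i) \<and> P * \<phi> = 1\<^sub>m (v1 i) \<and>
       z \<in> eps_stratum v1 i Z \<and> restricts i \<phi> x z \<and> in_mat v1 i z = P * in_mat v i x \<and>
       det (P * in_mat v i x * T) \<noteq> 0" by blast
  have "D \<subseteq> lifts i v v1 (eps_stratum v1 i Z)"
    unfolding lifts_def using D Z(1,4) componentD(1)[OF X] by blast
  then have "zariski Q v closure_of D \<subseteq> lift_closure i v v1 Z"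
    unfolding lift_closure_def[OF i v le] by (rule closure_of_mono)
  then have "X \<subseteq> lift_closure i v v1 Z" using Z(5) by auto
  from component_maximal[OF X lift_closure_irreducible[OF i v le Z(2,3)] this lift_closure_Lam[OF i v le Z(2,3)]]
  show ?thesis using Z(2,3) by auto
qed

section \<open>The dimension of the varieties\<close>

text \<open>The dimension of the space of representations of the oriented quiver \<open>\<Omega>\<close>, which is half the dimension
of the space of all representations.\<close>

definition expected_dim :: "('i \<Rightarrow> nat) \<Rightarrow> nat" where
  "expected_dim v = (\<Sum>h\<in>\<Omega>. v (in_vertex h) * v (out_vertex h))"

lemma expected_dim_agree:
  assumes i: "i \<in> verts Q" and v: "agree_off i v v1" and le: "v1 i \<le> v i"
  shows "expected_dim v = expected_dim v1 + (v i - v1 i) * width v i"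
proof -
  have \<Omega>: "\<Omega> \<subseteq> arrows Q" and ex: "\<And>h. h \<in> arrows Q \<Longrightarrow> h \<in> \<Omega> \<or> rev_arrow h \<in> \<Omega>"
    and un: "\<And>h. h \<in> \<Omega> \<Longrightarrow> rev_arrow h \<notin> \<Omega>"
  proof -
    have o: "\<Omega> \<inter> rev_arrow ` \<Omega> = {}" "\<Omega> \<union> rev_arrow ` \<Omega> = arrows Q"
      using orientation unfolding orientation_def by auto
    show "\<Omega> \<subseteq> arrows Q" using o(2) by auto
    show "h \<in> \<Omega> \<or> rev_arrow h \<in> \<Omega>" if "h \<in> arrows Q" for h using o(2) that rev_rev by force
    show "rev_arrow h \<notin> \<Omega>" if "h \<in> \<Omega>" for h using o(1) that rev_rev by blast
  qed
  have fin: "finite \<Omega>" using \<Omega> finite_arrows[OF graph] finite_subset by blast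
  define A where "A = {h \<in> \<Omega>. in_vertex h = i \<or> out_vertex h = i}"
  let ?f = "\<lambda>h. if in_vertex h = i then h else rev_arrow h"
  have bij: "bij_betw ?f A (arrows_into Q i)"
  proof (rule bij_betw_imageI)
    show "inj_on ?f A"
    proof (rule inj_onI)
      fix h h' assume h: "h \<in> A" "h' \<in> A" "?f h = ?f h'"
      show "h = h'"
      proof (cases "in_vertex h = i"; cases "in_vertex h' = i")
        assume "in_vertex h = i" "in_vertex h' \<noteq> i"
        then have "h = rev_arrow h'" using h(3) by simp
        then show ?thesis using un[of h'] h(1,2) unfolding A_def by auto
      next
        assume "in_vertex h \<noteq> i" "in_vertex h' = i"
        then have "rev_arrow h = h'" using h(3) by simp
        then show ?thesis using un[of h] h(1,2) unfolding A_def by auto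
      next
        assume "in_vertex h \<noteq> i" "in_vertex h' \<noteq> i"
        then have "rev_arrow (rev_arrow h) = rev_arrow (rev_arrow h')" using h(3) by simp
        then show ?thesis by simp
      qed (use h(3) in simp)
    qed
    show "?f ` A = arrows_into Q i"
    proof (intro equalityI subsetI)
      fix h assume "h \<in> ?f ` A"
      then obtain k where k: "k \<in> A" "h = ?f k" by blast
      then have "k \<in> arrows Q" "in_vertex k = i \<or> out_vertex k = i" using \<Omega> unfolding A_def by auto
      then show "h \<in> arrows_into Q i" unfolding k(2) arrows_into_def by (simp, blast)
    next
      fix h assume h: "h \<in> arrows_into Q i"
      note hD = arrows_intoD[OF h]
      show "h \<in> ?f ` A"
      proof (cases "h \<in> \<Omega>")
        case True
        then show ?thesis using hD unfolding A_def by (intro image_eqI[of _ _ h]) auto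
      next
        case False
        then have "rev_arrow h \<in> \<Omega>" using ex[OF hD(1)] by simp
        then show ?thesis using hD unfolding A_def by (intro image_eqI[of _ _ "rev_arrow h"]) auto
      qed
    qed
  qed
  have sumA: "(\<Sum>h\<in>A. u (in_vertex h) * u (out_vertex h)) = u i * (\<Sum>h\<in>arrows_into Q i. u (out_vertex h))"
    for u :: "'i \<Rightarrow> nat"
  proof -
    have "(\<Sum>h\<in>A. u (in_vertex h) * u (out_vertex h)) = (\<Sum>h\<in>A. u i * u (out_vertex (?f h)))"
      by (intro sum.cong) (auto simp: A_def)
    also have "\<dots> = (\<Sum>h\<in>arrows_into Q i. u i * u (out_vertex h))"
      by (rule sum.reindex_bij_betw[OF bij])
    finally show ?thesis by (simp add: sum_distrib_left)
  qed
  have split: "expected_dim u = (\<Sum>h\<in>\<Omega> - A. u (in_vertex h) * u (out_vertex h)) + u i * width u i" for u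
    unfolding expected_dim_def width_eq sumA[symmetric]
    by (rule sum.subset_diff) (use fin in \<open>auto simp: A_def\<close>)
  have "(\<Sum>h\<in>\<Omega> - A. v (in_vertex h) * v (out_vertex h)) = (\<Sum>h\<in>\<Omega> - A. v1 (in_vertex h) * v1 (out_vertex h))"
  proof (intro sum.cong refl)
    fix h assume h: "h \<in> \<Omega> - A"
    then have "h \<in> arrows Q" using \<Omega> by auto
    from arrowsD[OF this] h v show "v (in_vertex h) * v (out_vertex h) = v1 (in_vertex h) * v1 (out_vertex h)"
      unfolding A_def agree_off_def by auto
  qed
  then show ?thesis
  proof -
    have "v i * width v1 i = v1 i * width v1 i + (v i - v1 i) * width v1 i"
      using le by (metis add_mult_distrib le_add_diff_inverse)
    with \<open>sum _ _ = sum _ _\<close> show ?thesis unfolding split in_index_cong(2)[OF v] by simp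
  qed
qed

lemma zariski_dense_all_polys:
  assumes "D \<subseteq> reps Q v" "X \<subseteq> zariski Q v closure_of D"
    and "f \<in> all_polys (coords Q v)" "\<forall>x\<in>D. f x = 0"
  shows "\<forall>x\<in>X. f x = 0"
proof
  fix x assume "x \<in> X"
  with assms(2) have "x \<in> zariski Q v closure_of D" by auto
  then show "f x = 0"
    by (rule zero_on_closure[OF assms(1)]) (use assms(3,4) in \<open>auto simp: polynomial_functions_eq\<close>)
qed

lemma rep_fun_all_polys_gens:
  assumes "rep_fun (all_polys G) Q v \<Phi>" "g \<in> coords Q v"
  shows "(\<lambda>y. g (\<Phi> y)) \<in> all_polys G"
  using assms unfolding rep_fun_def coords_def by blast

subsection \<open>Lifts in coordinates\<close>

text \<open>The \<open>(v i - v1 i) * width v i\<close> parameters of a lift of \<open>z\<close>: the matrix \<open>B\<close> moves the image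
  inside a chart of the Grassmannian, and \<open>u\<close> gives the outgoing map on the complement in a basis
  of the kernel of the incoming matrix.\<close>

context
  fixes i :: 'i and v v1 :: "'i \<Rightarrow> nat"
  assumes i: "i \<in> verts Q" and v: "agree_off i v v1" and le: "v1 i \<le> v i" and lew: "v1 i \<le> width v i"
begin

definition chart_index :: "(nat \<times> nat \<times> nat) set" where
  "chart_index = ({0} \<times> {..<v i - v1 i} \<times> {..<v1 i}) \<union> ({1} \<times> {..<width v i - v1 i} \<times> {..<v i - v1 i})"

definition chart_B :: "(nat \<times> nat \<times> nat \<Rightarrow> complex) \<Rightarrow> complex mat" where
  "chart_B f = mat (v i - v1 i) (v1 i) (\<lambda>(a, b). f (0, a, b))"

definition chart_u :: "(nat \<times> nat \<times> nat \<Rightarrow> complex) \<Rightarrow> complex mat" where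
  "chart_u f = mat (width v i - v1 i) (v i - v1 i) (\<lambda>(a, b). f (1, a, b))"

lemma card_chart_index: "card chart_index = (v i - v1 i) * width v i"
proof -
  have "card chart_index = (v i - v1 i) * v1 i + (width v i - v1 i) * (v i - v1 i)"
    unfolding chart_index_def by (subst card_Un_disjoint) auto
  also have "\<dots> = (v i - v1 i) * (v1 i + (width v i - v1 i))" by (simp add: algebra_simps)
  finally show ?thesis using lew by simp
qed

lemma finite_chart_index: "finite chart_index"
  unfolding chart_index_def by simp

lemma chart_surj:
  assumes "B \<in> carrier_mat (v i - v1 i) (v1 i)" "u \<in> carrier_mat (width v i - v1 i) (v i - v1 i)"
  shows "\<exists>f. chart_B f = B \<and> chart_u f = u"
proof -
  let ?f = "\<lambda>(k, a, b). if k = 0 then B $$ (a, b) else u $$ (a, b)"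
  have "chart_B ?f = B" "chart_u ?f = u"
    using assms by (auto simp: chart_B_def chart_u_def intro!: eq_matI)
  then show ?thesis by blast
qed

text \<open>The unipotent matrices \<open>1 + shear B\<close> move the span of the first \<open>v1 i\<close> basis vectors through all
complements of the span of the others.\<close>

definition shear :: "complex mat \<Rightarrow> complex mat" where
  "shear B = coincl (v i) (v1 i) * B * incl (v1 i) (v i)"

lemma shear:
  assumes "B \<in> carrier_mat (v i - v1 i) (v1 i)"
  shows "shear B \<in> carrier_mat (v i) (v i)" "shear B * shear B = 0\<^sub>m (v i) (v i)"
    "shear B * incl (v i) (v1 i) = coincl (v i) (v1 i) * B"
    "shear B * coincl (v i) (v1 i) = 0\<^sub>m (v i) (v i - v1 i)"
    "coproj (v i) (v1 i) * shear B = B * incl (v1 i) (v i)"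
    "incl (v1 i) (v i) * shear B = 0\<^sub>m (v1 i) (v i)"
    "(1\<^sub>m (v i) + shear B) * (1\<^sub>m (v i) - shear B) = 1\<^sub>m (v i)"
    "(1\<^sub>m (v i) - shear B) * (1\<^sub>m (v i) + shear B) = 1\<^sub>m (v i)"
proof -
  note dims = carrier_matD[OF assms] le
  show s: "shear B \<in> carrier_mat (v i) (v i)" using dims by (auto simp: shear_def)
  show sq: "shear B * shear B = 0\<^sub>m (v i) (v i)"
    unfolding shear_def using dims by (simp add: mat_algebra incl_cancel)
  show "shear B * incl (v i) (v1 i) = coincl (v i) (v1 i) * B"
    "shear B * coincl (v i) (v1 i) = 0\<^sub>m (v i) (v i - v1 i)"
    "coproj (v i) (v1 i) * shear B = B * incl (v1 i) (v i)"
    "incl (v1 i) (v i) * shear B = 0\<^sub>m (v1 i) (v i)"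
    unfolding shear_def using dims by (simp_all add: mat_algebra incl_cancel)
  show "(1\<^sub>m (v i) + shear B) * (1\<^sub>m (v i) - shear B) = 1\<^sub>m (v i)"
    "(1\<^sub>m (v i) - shear B) * (1\<^sub>m (v i) + shear B) = 1\<^sub>m (v i)"
    using carrier_matD[OF s] sq by (auto simp: mat_algebra intro!: eq_matI)
qed

context
  fixes g g' N N' :: "complex mat"
  assumes g: "g \<in> carrier_mat (v i) (v i)" "g' \<in> carrier_mat (v i) (v i)"
      "g * g' = 1\<^sub>m (v i)" "g' * g = 1\<^sub>m (v i)"
    and N: "N \<in> carrier_mat (width v i) (width v i)" "N' \<in> carrier_mat (width v i) (width v i)"
      "N * N' = 1\<^sub>m (width v i)" "N' * N = 1\<^sub>m (width v i)"
begin

definition chart_lift :: "('i, 'e) rep \<times> (nat \<times> nat \<times> nat \<Rightarrow> complex) \<Rightarrow> ('i, 'e) rep" where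
  "chart_lift p = frame_lift i v v1 (g * (1\<^sub>m (v i) + shear (chart_B (snd p))))
     ((1\<^sub>m (v i) - shear (chart_B (snd p))) * g')
     (ker_op (in_mat v1 i (fst p)) (N * incl (width v i) (v1 i)) *
       (N * coincl (width v i) (v1 i) * chart_u (snd p))) (fst p)"

lemma chart_frame:
  assumes "B \<in> carrier_mat (v i - v1 i) (v1 i)"
  shows "g * (1\<^sub>m (v i) + shear B) \<in> carrier_mat (v i) (v i)"
    "(1\<^sub>m (v i) - shear B) * g' \<in> carrier_mat (v i) (v i)"
    "(g * (1\<^sub>m (v i) + shear B)) * ((1\<^sub>m (v i) - shear B) * g') = 1\<^sub>m (v i)"
    "((1\<^sub>m (v i) - shear B) * g') * (g * (1\<^sub>m (v i) + shear B)) = 1\<^sub>m (v i)"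
proof -
  note s = shear[OF assms]
  note dims = carrier_matD[OF g(1)] carrier_matD[OF g(2)] carrier_matD[OF s(1)]
  show "g * (1\<^sub>m (v i) + shear B) \<in> carrier_mat (v i) (v i)"
    "(1\<^sub>m (v i) - shear B) * g' \<in> carrier_mat (v i) (v i)" using dims by auto
  have "(g * (1\<^sub>m (v i) + shear B)) * ((1\<^sub>m (v i) - shear B) * g') =
      g * (((1\<^sub>m (v i) + shear B) * (1\<^sub>m (v i) - shear B)) * g')"
    using dims by (simp add: mult_assoc_dim)
  then show "(g * (1\<^sub>m (v i) + shear B)) * ((1\<^sub>m (v i) - shear B) * g') = 1\<^sub>m (v i)"
    unfolding s(7) using g(3) dims by simp
  have "((1\<^sub>m (v i) - shear B) * g') * (g * (1\<^sub>m (v i) + shear B)) =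
      (1\<^sub>m (v i) - shear B) * ((g' * g) * (1\<^sub>m (v i) + shear B))"
    using dims by (simp add: mult_assoc_dim)
  then show "((1\<^sub>m (v i) - shear B) * g') * (g * (1\<^sub>m (v i) + shear B)) = 1\<^sub>m (v i)"
    unfolding g(4) using s(8) dims by simp
qed

lemma chart_carriers:
  "chart_B f \<in> carrier_mat (v i - v1 i) (v1 i)" "chart_u f \<in> carrier_mat (width v i - v1 i) (v i - v1 i)"
  "N * incl (width v i) (v1 i) \<in> carrier_mat (width v i) (v1 i)"
  "N * coincl (width v i) (v1 i) * chart_u f \<in> carrier_mat (width v i) (v i - v1 i)"
  using N(1) by (auto simp: chart_B_def chart_u_def)

lemma chart_lift_lifts:
  assumes "z \<in> Lam Q \<Omega> v1" "z \<in> U"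
  shows "chart_lift (z, f) \<in> lifts i v v1 U" "chart_lift (z, f) \<in> Lam Q \<Omega> v"
proof -
  note c = chart_frame[OF chart_carriers(1)[of f]]
  note k = in_mat_ker_op_zero[OF i v le chart_carriers(3) chart_carriers(4)[of f]]
  show "chart_lift (z, f) \<in> lifts i v v1 U"
    unfolding chart_lift_def using frame_lift_lifts[OF i v le assms(1) c(1,2,4) k assms(2)] by simp
  then show "chart_lift (z, f) \<in> Lam Q \<Omega> v" using lifts_Lam[OF i v le] by blast
qed

lemma rep_fun_chart_lift:
  "rep_fun (all_polys (product_gens (coords Q v1) chart_index)) Q v chart_lift"
proof -
  let ?F = "all_polys (product_gens (coords Q v1) chart_index)"
  note F = function_ring_all_polys[of "product_gens (coords Q v1) chart_index"]
  have fst: "rep_fun ?F Q v1 fst"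
    unfolding rep_fun_def
  proof (intro ballI allI impI)
    fix h r s assume "h \<in> arrows Q" "r < v1 (in_vertex h)" "s < v1 (out_vertex h)"
    then have c: "(\<lambda>x. x h $$ (r, s)) \<in> coords Q v1" unfolding coords_def by blast
    have "(\<lambda>p. fst p h $$ (r, s)) \<in> product_gens (coords Q v1) chart_index"
      unfolding product_gens_def by (rule UnI1, rule image_eqI[OF _ c]) simp
    then show "(\<lambda>p. fst p h $$ (r, s)) \<in> ?F" by (intro all_polys_gen)
  qed
  have coord: "(\<lambda>p. snd p j) \<in> ?F" if "j \<in> chart_index" for j
    using that by (intro all_polys_gen) (auto simp: product_gens_def)
  have B: "mat_fun ?F (v i - v1 i) (v1 i) (\<lambda>p. chart_B (snd p))"
  proof -
    have "(\<lambda>p. snd p (0, a, b)) \<in> ?F" if "a < v i - v1 i" "b < v1 i" for a b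
      by (intro coord) (use that in \<open>simp add: chart_index_def\<close>)
    then show ?thesis unfolding mat_fun_def chart_B_def by simp
  qed
  have u: "mat_fun ?F (width v i - v1 i) (v i - v1 i) (\<lambda>p. chart_u (snd p))"
  proof -
    have "(\<lambda>p. snd p (1, a, b)) \<in> ?F" if "a < width v i - v1 i" "b < v i - v1 i" for a b
      by (intro coord) (use that in \<open>simp add: chart_index_def\<close>)
    then show ?thesis unfolding mat_fun_def chart_u_def by simp
  qed
  note cst = mat_fun_const[OF F]
  have s: "mat_fun ?F (v i) (v i) (\<lambda>p. shear (chart_B (snd p)))"
    unfolding shear_def by (rule mat_fun_mult[OF F mat_fun_mult[OF F cst B] cst]) simp_all
  have one: "1\<^sub>m (v i) \<in> carrier_mat (v i) (v i)" by simp
  have A: "mat_fun ?F (v1 i) (width v i) (\<lambda>p. in_mat v1 i (fst p))"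
    using mat_fun_in_mat[OF F fst, of i] in_index_cong(2)[OF v] by simp
  have Y: "mat_fun ?F (width v i) (v i - v1 i) (\<lambda>p. ker_op (in_mat v1 i (fst p)) (N * incl (width v i) (v1 i)) *
       (N * coincl (width v i) (v1 i) * chart_u (snd p)))"
    by (rule mat_fun_mult[OF F mat_fun_ker_op[OF F A chart_carriers(3)] mat_fun_mult[OF F cst u]])
      (use N(1) in auto)
  have "rep_fun ?F Q v (\<lambda>p. chart_lift p)"
    unfolding chart_lift_def
    by (rule rep_fun_frame_lift[OF i v le F fst mat_fun_mult[OF F cst[OF g(1)] mat_fun_add[OF F cst[OF one] s]]
          mat_fun_mult[OF F mat_fun_minus[OF F cst[OF one] s] cst[OF g(2)]] Y])
  then show ?thesis .
qed

text \<open>The image of the lift has a unique basis normalised by the chart, which determines \<open>B\<close>. The outgoing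
map on the complement lies in the kernel of the incoming matrix of \<open>z\<close>, which has the
images of the last columns of \<open>N\<close> under the kernel operator as a basis; \<open>u\<close> gives the coordinates.\<close>

lemma chart_lift_surj:
  assumes x: "x \<in> Lam Q \<Omega> v" and z: "z \<in> Lam Q \<Omega> v1"
    and \<phi>: "\<phi> \<in> carrier_mat (v i) (v1 i)" "incl (v1 i) (v i) * g' * \<phi> = 1\<^sub>m (v1 i)" "restricts i \<phi> x z"
    and det: "det (in_mat v1 i z * (N * incl (width v i) (v1 i))) \<noteq> 0"
  shows "\<exists>f. x = chart_lift (z, f)"
proof -
  let ?\<iota> = "incl (v i) (v1 i)" and ?\<kappa> = "coincl (v i) (v1 i)" and ?W = "width v i"
  let ?T = "N * incl ?W (v1 i)" and ?A = "in_mat v1 i z"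
  let ?d = "det (?A * ?T)"
  define B where "B = coproj (v i) (v1 i) * (g' * \<phi>)"
  note dims = carrier_matD[OF g(1)] carrier_matD[OF g(2)] carrier_matD[OF N(1)] carrier_matD[OF N(2)]
    carrier_matD[OF \<phi>(1)] le lew in_index_cong(2)[OF v]
  have Bc: "B \<in> carrier_mat (v i - v1 i) (v1 i)" using dims by (auto simp: B_def)
  note s = shear[OF Bc] and c = chart_frame[OF Bc]
  have "g' * \<phi> = (?\<iota> * incl (v1 i) (v i) + ?\<kappa> * coproj (v i) (v1 i)) * (g' * \<phi>)"
    unfolding incl_coincl_sum[OF le] using dims by simp
  also have "\<dots> = ?\<iota> * (incl (v1 i) (v i) * g' * \<phi>) + ?\<kappa> * B"
    unfolding B_def using dims by (simp add: mat_algebra del: incl_coincl_sum)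
  also have "\<dots> = ?\<iota> + ?\<kappa> * B" unfolding \<phi>(2) using dims by simp
  finally have g'\<phi>: "g' * \<phi> = ?\<iota> + ?\<kappa> * B" .
  have "\<phi> = g * (g' * \<phi>)" using mult_assoc_left[OF g(3), of \<phi>] dims by simp
  also have "\<dots> = g * (1\<^sub>m (v i) + shear B) * ?\<iota>"
    unfolding g'\<phi> using dims carrier_matD[OF s(1)] carrier_matD[OF Bc] s(3) by (simp add: mat_algebra)
  finally have \<phi>g: "\<phi> = g * (1\<^sub>m (v i) + shear B) * ?\<iota>" .
  note eq = eq_frame_lift[OF i v le x z c \<phi>(3)[unfolded \<phi>g]]
  define Y where "Y = out_mat v i x * (g * (1\<^sub>m (v i) + shear B) * ?\<kappa>)"
  note Y = eq[folded Y_def]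
  have Ac: "?A \<in> carrier_mat (v1 i) ?W" using dims by auto
  have Tc: "?T \<in> carrier_mat ?W (v1 i)" using N(1) by auto
  note K = ker_op_carrier[OF Ac Tc] ker_op_mult[OF Ac Tc] ker_op_kernel[OF Ac Tc Y(1,2)]
  define u where "u = inverse ?d \<cdot>\<^sub>m (coproj ?W (v1 i) * (N' * Y))"
  have uc: "u \<in> carrier_mat (?W - v1 i) (v i - v1 i)"
    using dims carrier_matD[OF Y(1)] by (auto simp: u_def)
  have N'Y: "coincl ?W (v1 i) * (coproj ?W (v1 i) * (N' * Y)) =
      N' * Y - incl ?W (v1 i) * (incl (v1 i) ?W * (N' * Y))"
  proof -
    have "N' * Y = (incl ?W (v1 i) * incl (v1 i) ?W + coincl ?W (v1 i) * coproj ?W (v1 i)) * (N' * Y)"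
      unfolding incl_coincl_sum[OF lew] using dims carrier_matD[OF Y(1)] by simp
    also have "\<dots> = incl ?W (v1 i) * (incl (v1 i) ?W * (N' * Y)) + coincl ?W (v1 i) * (coproj ?W (v1 i) * (N' * Y))"
      using dims carrier_matD[OF Y(1)] by (simp add: mat_algebra del: incl_coincl_sum)
    finally show ?thesis by (rule mat_eq_minusI) (use dims carrier_matD[OF Y(1)] in auto)
  qed
  have "ker_op ?A ?T * (N * coincl ?W (v1 i) * u) =
      inverse ?d \<cdot>\<^sub>m (ker_op ?A ?T * (N * (coincl ?W (v1 i) * (coproj ?W (v1 i) * (N' * Y)))))"
    unfolding u_def using dims carrier_matD[OF Y(1)] carrier_matD[OF K(1)] by (simp add: mat_algebra)
  also have "\<dots> = inverse ?d \<cdot>\<^sub>m (ker_op ?A ?T * ((N * N') * Y) -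
      (ker_op ?A ?T * ?T) * (incl (v1 i) ?W * (N' * Y)))"
    unfolding N'Y using dims carrier_matD[OF Y(1)] carrier_matD[OF K(1)] by (simp add: mat_algebra)
  also have "\<dots> = inverse ?d \<cdot>\<^sub>m (?d \<cdot>\<^sub>m Y)"
    unfolding K(2) N(3) using K(3) dims carrier_matD[OF Y(1)] carrier_matD[OF K(1)] by simp
  also have "\<dots> = Y" using det by (simp add: smult_twice smult_one)
  finally have Yu: "ker_op ?A ?T * (N * coincl ?W (v1 i) * u) = Y" .
  obtain f where "chart_B f = B" "chart_u f = u" using chart_surj[OF Bc uc] by blast
  then have "x = chart_lift (z, f)" unfolding chart_lift_def using Y(3) Yu by simp
  then show ?thesis by blast
qed

end

end

lemma scale_scale: "scale v a (scale v b x) = scale v (a * b) x"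
  unfolding scale_def by (intro restrict_ext eq_matI) auto

subsection \<open>Upper bound\<close>

text \<open>\<open>X\<close> is covered by the finitely many closed sets on which some \<open>\<epsilon>\<^sub>i\<close> is positive, hence contained in one.\<close>

lemma irreducible_eps_positive:
  assumes X: "irreducible_in (zariski Q v) X" "X \<subseteq> Lam Q \<Omega> v" and j: "total_dim v \<noteq> 0"
  shows "\<exists>i\<in>verts Q. 0 < eps Q i (v, X)"
proof -
  let ?C = "\<lambda>i. {x \<in> reps Q v. 1 \<le> eps_rep Q v i x}"
  obtain j where j: "j \<in> verts Q" "v j > 0" using assms(3) total_dim_zero by auto
  have "X \<subseteq> \<Union>(?C ` verts Q)"
  proof
    fix x assume "x \<in> X"
    then have x: "x \<in> Lam Q \<Omega> v" using X(2) by auto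
    from exists_eps_rep_positive[OF this j] obtain i where "i \<in> verts Q" "eps_rep Q v i x > 0" by blast
    then show "x \<in> \<Union>(?C ` verts Q)" using Lam_reps[OF x] by (intro UnionI[OF imageI, of i]) auto
  qed
  from irreducible_in_finite_union[OF X(1) _ _ this] finite_verts closedin_eps_rep_ge
  obtain i where i: "i \<in> verts Q" "X \<subseteq> ?C i" by auto
  obtain x where "x \<in> X" "eps_rep Q v i x = eps Q i (v, X)" using eps_attained(1)[OF X(1), of i] by auto
  with i show ?thesis by force
qed

definition lower :: "'i \<Rightarrow> nat \<Rightarrow> ('i \<Rightarrow> nat) \<Rightarrow> 'i \<Rightarrow> nat" where
  "lower i c v = v(i := v i - c)"

lemma lower:
  assumes "i \<in> verts Q" "0 < c" "c \<le> v i"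
  shows "agree_off i v (lower i c v)" "lower i c v i \<le> v i" "v i - lower i c v i = c"
    "total_dim (lower i c v) < total_dim v"
proof -
  show v: "agree_off i v (lower i c v)" by (simp add: lower_def agree_off_def)
  show "lower i c v i \<le> v i" "v i - lower i c v i = c" using assms by (auto simp: lower_def)
  then show "total_dim (lower i c v) < total_dim v" using total_dim_agree[OF v assms(1)] assms by simp
qed

lemma eps_le_dim:
  assumes "irreducible_in (zariski Q v) X"
  shows "eps Q i (v, X) \<le> v i"
proof -
  obtain x where "eps_rep Q v i x = eps Q i (v, X)" using eps_attained(1)[OF assms, of i] by blast
  then show ?thesis using eps_rep_le[of v i x] by simp
qed

lemma reps_zero:
  assumes "total_dim v = 0" "x \<in> reps Q v" "y \<in> reps Q v"
  shows "x = y"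
proof (rule extensionalityI)
  show "x \<in> extensional (arrows Q)" "y \<in> extensional (arrows Q)"
    using assms(2,3) unfolding reps_def by (auto simp: PiE_iff)
  fix h assume h: "h \<in> arrows Q"
  have "v (in_vertex h) = 0" using assms(1) arrowsD(1)[OF h] total_dim_zero by auto
  then show "x h = y h" using repsD[OF assms(2) h] repsD[OF assms(3) h] by (intro eq_matI) auto
qed

lemma expected_dim_zero:
  assumes "total_dim v = 0"
  shows "expected_dim v = 0"
proof -
  have "v (in_vertex h) * v (out_vertex h) = 0" if "h \<in> \<Omega>" for h
  proof -
    have "h \<in> arrows Q" using that orientation unfolding orientation_def by auto
    then show ?thesis using arrowsD(1) assms total_dim_zero by auto
  qed
  then show ?thesis unfolding expected_dim_def by simp
qed

text \<open>A dense subset of \<open>X\<close> is covered by the charted lifts of a component of smaller dimension vector, that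
is, by the image of its product with an affine space.\<close>

lemma growth_le_Lam:
  assumes "irreducible_in (zariski Q v) X" "X \<subseteq> Lam Q \<Omega> v"
  shows "growth_le X (coords Q v) (expected_dim v)"
  using assms
proof (induction "total_dim v" arbitrary: v X rule: less_induct)
  case less
  note X = less.prems
  have XR: "X \<subseteq> reps Q v" using X(2) Lam_reps by auto
  show ?case
  proof (cases "total_dim v = 0")
    case True
    obtain x where x: "x \<in> X" using X(1) unfolding irreducible_in_def by auto
    then have "X \<subseteq> {x}" using reps_zero[OF True] XR by auto
    then show ?thesis
      using growth_le_mono[OF growth_le_point] expected_dim_zero[OF True] by simp
  next
    case False
    from irreducible_eps_positive[OF X False] obtain i
      where i: "i \<in> verts Q" "0 < eps Q i (v, X)" by blast
    define v1 where "v1 = lower i (eps Q i (v, X)) v"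
    note low = lower[where v = v, OF i(1,2) eps_le_dim[OF X(1)], folded v1_def]
    note v = low(1) and le = low(2)
    from generic_lift[OF i(1) v le X low(3)[symmetric]] obtain P T Z D x0 where
      PT: "P \<in> carrier_mat (v1 i) (v i)" "T \<in> carrier_mat (width v i) (v1 i)" and
      Z: "Z \<in> components v1" "eps Q i (v1, Z) = 0" and
      D: "D \<subseteq> X" "X \<subseteq> zariski Q v closure_of D" "x0 \<in> D" "P * in_mat v i x0 * T = 1\<^sub>m (v1 i)" and
      lift: "\<And>x. x \<in> D \<Longrightarrow> \<exists>\<phi> z. \<phi> \<in> carrier_mat (v i) (v1 i) \<and> P * \<phi> = 1\<^sub>m (v1 i) \<and>
        z \<in> eps_stratum v1 i Z \<and> restricts i \<phi> x z \<and> in_mat v1 i z = P * in_mat v i x \<and>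
        det (P * in_mat v i x * T) \<noteq> 0" by blast
    have IH: "growth_le Z (coords Q v1) (expected_dim v1)"
      using less.hyps[OF low(4) componentD(2,1)[OF Z(1)]] .
    have M0: "in_mat v i x0 * T \<in> carrier_mat (v i) (v1 i)"
      by (rule mult_carrier_mat[OF in_mat_carrier(1) PT(2)])
    have PM0: "P * in_mat v i x0 \<in> carrier_mat (v1 i) (width v i)"
      using carrier_matD[OF PT(1)] by (intro carrier_matI) auto
    have "P * (in_mat v i x0 * T) = 1\<^sub>m (v1 i)"
      using D(4) carrier_matD[OF PT(1)] carrier_matD[OF PT(2)] by (simp add: mult_assoc_dim)
    from complete_to_invertible[OF PT(1) M0 this] obtain g g' where
      g: "g \<in> carrier_mat (v i) (v i)" "g' \<in> carrier_mat (v i) (v i)" "g * g' = 1\<^sub>m (v i)"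
      "g' * g = 1\<^sub>m (v i)" "incl (v1 i) (v i) * g' = P" by blast
    from complete_to_invertible[OF PM0 PT(2) D(4)] obtain N N' where
      N: "N \<in> carrier_mat (width v i) (width v i)" "N' \<in> carrier_mat (width v i) (width v i)"
      "N * N' = 1\<^sub>m (width v i)" "N' * N = 1\<^sub>m (width v i)" "N * incl (width v i) (v1 i) = T" by blast
    have lew: "v1 i \<le> width v i" by (rule left_inverse_imp_le[OF PM0 PT(2) D(4)])
    let ?J = "chart_index i v v1" and ?\<Psi> = "chart_lift i v v1 g g' N"
    have Dim: "growth_le D (coords Q v) (expected_dim v1 + card ?J)"
    proof (rule growth_le_pullback)
      show "growth_le (Z \<times> UNIV) (product_gens (coords Q v1) ?J) (expected_dim v1 + card ?J)"
        by (rule growth_le_product[OF finite_chart_index[OF i(1) v le lew] finite_coords[OF graph] IH])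
      show "(\<lambda>y. f (?\<Psi> y)) \<in> all_polys (product_gens (coords Q v1) ?J)" if "f \<in> coords Q v" for f
        by (rule rep_fun_all_polys_gens[OF rep_fun_chart_lift[OF i(1) v le lew g(1-4) N(1-4)] that])
      show "D \<subseteq> ?\<Psi> ` (Z \<times> UNIV)"
      proof
        fix x assume x: "x \<in> D"
        from lift[OF x] obtain \<phi> z where z: "\<phi> \<in> carrier_mat (v i) (v1 i)" "P * \<phi> = 1\<^sub>m (v1 i)"
          "z \<in> eps_stratum v1 i Z" "restricts i \<phi> x z" "in_mat v1 i z = P * in_mat v i x"
          "det (P * in_mat v i x * T) \<noteq> 0" by blast
        have xL: "x \<in> Lam Q \<Omega> v" using x D(1) X(2) by auto
        have zZ: "z \<in> Z" "z \<in> Lam Q \<Omega> v1" using z(3) stratum(2,3)[OF i(1) v le Z] by auto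
        from chart_lift_surj[OF i(1) v le lew g(1-4) N(1-4) xL zZ(2) z(1) _ z(4)] z(2,5,6)
        obtain f where "x = ?\<Psi> (z, f)" unfolding g(5) N(5) by auto
        then show "x \<in> ?\<Psi> ` (Z \<times> UNIV)" using zZ(1) by auto
      qed
    qed (rule finite_coords[OF graph])
    have DR: "D \<subseteq> reps Q v" using D(1) XR by auto
    have "expected_dim v1 + card ?J = expected_dim v"
      using card_chart_index[OF i(1) v le lew] expected_dim_agree[OF i(1) v le] by simp
    with growth_le_dense[OF zariski_dense_all_polys[OF DR D(2)] Dim] show ?thesis by simp
  qed
qed

subsection \<open>Lower bound\<close>

lemma exists_root:
  fixes c :: complex
  assumes "c \<noteq> 0"
  shows "\<exists>t. t ^ Suc k * c = 1"
proof -
  define d where "d = inverse c"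
  define t where "t = rcis (root (Suc k) (cmod d)) (Arg d / real (Suc k))"
  have "t ^ Suc k = rcis (root (Suc k) (cmod d) ^ Suc k) (real (Suc k) * (Arg d / real (Suc k)))"
    unfolding t_def by (rule DeMoivre2)
  also have "\<dots> = rcis (cmod d) (Arg d)"
    using real_root_pow_pos2[of "Suc k" "cmod d"] by (simp del: power_Suc)
  also have "\<dots> = d" by (rule rcis_cmod_Arg)
  finally show ?thesis using assms unfolding d_def by (intro exI[of _ t]) (simp del: power_Suc)
qed

lemma det_smult_dim: "A \<in> carrier_mat k k \<Longrightarrow> det (t \<cdot>\<^sub>m A) = t ^ k * det (A :: complex mat)"
  by simp

text \<open>On a chart, a lift \<open>x\<close> determines the restriction \<open>z\<close> and the parameters \<open>B\<close> and \<open>u\<close>, and after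
multiplication by the determinant they are polynomial functions of \<open>x\<close>. Together they define a
polynomial map on the lifts whose image contains the product of a nonempty open subset of \<open>Z\<close> with an
affine space.\<close>

lemma growth_ge_lifts:
  assumes i: "i \<in> verts Q" and v: "agree_off i v v1" and le: "v1 i \<le> v i"
    and Z: "Z \<in> components v1" "eps Q i (v1, Z) = 0"
    and ge: "growth_ge Z (coords Q v1) (expected_dim v1)"
  shows "growth_ge (lifts i v v1 (eps_stratum v1 i Z)) (coords Q v) (expected_dim v)"
proof -
  let ?W = "width v i" and ?F = "polynomial_functions Q v" and ?S = "eps_stratum v1 i Z"
  note W1 = in_index_cong(2)[OF v]
  note st = stratum[OF i v le Z]
  have ZR: "Z \<subseteq> reps Q v1" using componentD(1)[OF Z(1)] Lam_reps by auto
  obtain z0 where z0: "z0 \<in> ?S" using st(6) by auto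
  have A0: "in_mat v1 i z0 \<in> carrier_mat (v1 i) ?W" using W1 in_mat_carrier(1)[of v1 i] by simp
  from rank_ge_right_inverse[OF this st(4)[OF z0]] obtain T0 where
    T0: "T0 \<in> carrier_mat ?W (v1 i)" and AT: "in_mat v1 i z0 * T0 = 1\<^sub>m (v1 i)" by blast
  have lew: "v1 i \<le> ?W" by (rule left_inverse_imp_le[OF A0 T0 AT])
  from complete_to_invertible[OF A0 T0 AT] obtain N N' where
    N: "N \<in> carrier_mat ?W ?W" "N' \<in> carrier_mat ?W ?W" "N * N' = 1\<^sub>m ?W" "N' * N = 1\<^sub>m ?W"
    "N * incl ?W (v1 i) = T0" by blast
  define T where "T = N * incl ?W (v1 i)"
  have T: "T \<in> carrier_mat ?W (v1 i)" using N(1) by (auto simp: T_def)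
  define P where "P = incl (v1 i) (v i)"
  have P: "P \<in> carrier_mat (v1 i) (v i)" by (simp add: P_def)
  let ?one = "1\<^sub>m (v i) :: complex mat"
  have one: "?one \<in> carrier_mat (v i) (v i)" "?one * ?one = ?one" by auto
  let ?J = "chart_index i v v1" and ?\<Psi> = "chart_lift i v v1 ?one ?one N"
  have A: "in_mat v1 i z \<in> carrier_mat (v1 i) ?W" for z using W1 in_mat_carrier(1)[of v1 i z] by simp
  let ?p = "\<lambda>z. det (in_mat v1 i z * T)"
  have p: "?p \<in> polynomial_functions Q v1"
  proof -
    have "mat_fun (polynomial_functions Q v1) (v1 i) ?W (in_mat v1 i)"
      using mat_fun_in_mat_id[of v1 i] W1 by simp
    from function_ring_det[OF pf_ring mat_fun_mult[OF pf_ring this mat_fun_const[OF pf_ring T]]]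
    show ?thesis .
  qed
  have p0: "?p z0 \<noteq> 0" unfolding T_def N(5) AT by simp
  have z0Z: "z0 \<in> Z" using z0 st(3) by auto
  define E where "E = {z \<in> Z. ?p z \<noteq> 0}"
  have ER: "E \<subseteq> reps Q v1" unfolding E_def using ZR by auto
  have "Z \<subseteq> zariski Q v1 closure_of E"
    using irreducible_nonzero_locus(2)[OF componentD(2)[OF Z(1)] p z0Z p0] unfolding E_def .
  from growth_ge_dense[OF zariski_dense_all_polys[OF ER this] ge]
  have "growth_ge E (coords Q v1) (expected_dim v1)" by simp
  from growth_ge_product[OF finite_chart_index[OF i v le lew] finite_coords[OF graph] this]
  have geE: "growth_ge (E \<times> UNIV) (product_gens (coords Q v1) ?J) (expected_dim v1 + card ?J)" .
  \<comment> \<open>The parameters of a lift, multiplied by the determinant, are polynomial functions of it.\<close>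
  define bB where "bB x = coproj (v i) (v1 i) * (in_mat v i x * T) * adj_mat (P * in_mat v i x * T)" for x
  define bu where "bu x = coproj ?W (v1 i) * N' * (out_mat v i x * coincl (v i) (v1 i))" for x
  define \<Phi> where "\<Phi> x = (scaled_restriction i v v1 P T x,
    \<lambda>(k, a, b). if k = (0 :: nat) then bB x $$ (a, b) else bu x $$ (a, b))" for x
  have "growth_ge (lifts i v v1 ?S) (coords Q v) (expected_dim v1 + card ?J)"
  proof (rule growth_ge_pullback[OF _ _ _ geE, where \<Phi> = \<Phi>])
    show "finite (product_gens (coords Q v1) ?J)"
      unfolding product_gens_def using finite_chart_index[OF i v le lew] finite_coords[OF graph] by simp
    have MT: "mat_fun ?F (v i) (v1 i) (\<lambda>x. in_mat v i x * T)"
      by (rule mat_fun_mult[OF pf_ring mat_fun_in_mat_id mat_fun_const[OF pf_ring T]])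
    have bB: "mat_fun ?F (v i - v1 i) (v1 i) bB"
      unfolding bB_def
      by (rule mat_fun_mult[OF pf_ring mat_fun_mult[OF pf_ring mat_fun_const[OF pf_ring] MT]
            mat_fun_adj[OF pf_ring mat_fun_chart(1)[OF i v le P T]]]) simp
    have Nc: "coproj ?W (v1 i) * N' \<in> carrier_mat (?W - v1 i) ?W" using N(2) by auto
    have NO: "mat_fun ?F ?W (v i - v1 i) (\<lambda>x. out_mat v i x * coincl (v i) (v1 i))"
      by (rule mat_fun_mult[OF pf_ring mat_fun_out_mat_id mat_fun_const[OF pf_ring]]) simp
    have bu: "mat_fun ?F (?W - v1 i) (v i - v1 i) bu"
      unfolding bu_def by (rule mat_fun_mult[OF pf_ring mat_fun_const[OF pf_ring Nc] NO])
    show "(\<lambda>x. f (\<Phi> x)) \<in> all_polys (coords Q v)" if f: "f \<in> product_gens (coords Q v1) ?J" for f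
      using f unfolding product_gens_def
    proof
      assume "f \<in> (\<lambda>c p. c (fst p)) ` coords Q v1"
      then obtain c where c: "c \<in> coords Q v1" "f = (\<lambda>p. c (fst p))" by blast
      have "rep_fun (all_polys (coords Q v)) Q v1 (scaled_restriction i v v1 P T)"
        using rep_fun_scaled_restriction[OF i v le P T] unfolding polynomial_functions_eq .
      from rep_fun_all_polys_gens[OF this c(1)] show ?thesis unfolding c(2) \<Phi>_def by simp
    next
      assume "f \<in> (\<lambda>j p. snd p j) ` ?J"
      then obtain k a b where kab: "(k, a, b) \<in> ?J" "f = (\<lambda>p. snd p (k, a, b))" by auto
      show ?thesis
      proof (cases "k = 0")
        case True
        then have "(\<lambda>x. bB x $$ (a, b)) \<in> ?F"
          using kab(1) mat_funD(4)[OF bB, of a b] unfolding chart_index_def[OF i v le lew] by simp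
        then show ?thesis unfolding kab(2) \<Phi>_def using True by (simp add: polynomial_functions_eq)
      next
        case False
        then have "(\<lambda>x. bu x $$ (a, b)) \<in> ?F"
          using kab(1) mat_funD(4)[OF bu, of a b] unfolding chart_index_def[OF i v le lew] by simp
        then show ?thesis unfolding kab(2) \<Phi>_def using False by (simp add: polynomial_functions_eq)
      qed
    qed
    fix e assume "e \<in> E \<times> (UNIV :: (nat \<times> nat \<times> nat \<Rightarrow> complex) set)"
    then obtain z' f' where e: "e = (z', f')" "z' \<in> E" by auto
    have z'Z: "z' \<in> Z" and pz': "?p z' \<noteq> 0" using e(2) unfolding E_def by auto
    have z'r: "z' \<in> reps Q v1" using z'Z ZR by auto
    \<comment> \<open>The scaling is undone by extracting a root of the determinant.\<close>
    obtain t where t: "t ^ Suc (v1 i) * ?p z' = 1" using exists_root[OF pz'] by blast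
    then have t0: "t \<noteq> 0" by auto
    define z where "z = scale v1 t z'"
    have zZ: "z \<in> Z" unfolding z_def by (rule component_scale[OF Z(1) z'Z t0])
    have zL: "z \<in> Lam Q \<Omega> v1" using zZ componentD(1)[OF Z(1)] by auto
    note zr = Lam_reps[OF zL]
    let ?d = "?p z"
    have "in_mat v1 i z * T = t \<cdot>\<^sub>m (in_mat v1 i z' * T)"
      unfolding z_def scale_mats using carrier_matD[OF T] W1 by (simp add: smult_mult_dim)
    moreover have "in_mat v1 i z' * T \<in> carrier_mat (v1 i) (v1 i)" using A T by auto
    ultimately have "?d = t ^ v1 i * ?p z'" by (simp add: det_smult_dim del: det_smult)
    then have dt: "?d * t = 1" using t by (simp add: algebra_simps)
    then have d0: "?d \<noteq> 0" by auto
    have "scale v1 ?d z = scale v1 1 z'"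
      using scale_scale[of v1 ?d t z'] unfolding dt z_def[symmetric] .
    then have sz: "scale v1 ?d z = z'" using scale_one[OF z'r] by simp
    have "rank_ge (v1 i) (in_mat v1 i z)"
      unfolding rank_ge_iff_det using T d0 W1 carrier_matD[OF A, of z]
      by (intro exI[of _ "1\<^sub>m (v1 i)"] exI[of _ T]) auto
    then have zS: "z \<in> ?S" unfolding st(5) using zZ eps_rep_zero_iff[OF i v le zr] by simp
    define B where "B = inverse ?d \<cdot>\<^sub>m chart_B i v v1 f'"
    define u where "u = inverse ?d \<cdot>\<^sub>m chart_u i v v1 f'"
    note cc = chart_carriers[OF i v le lew one(1,1,2,2) N(1-4)]
    have Bc: "B \<in> carrier_mat (v i - v1 i) (v1 i)" and uc: "u \<in> carrier_mat (?W - v1 i) (v i - v1 i)"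
      using cc(1)[of f'] cc(2)[of f'] by (auto simp: B_def u_def)
    obtain f where f: "chart_B i v v1 f = B" "chart_u i v v1 f = u"
      using chart_surj[OF i v le lew Bc uc] by blast
    define x where "x = ?\<Psi> (z, f)"
    have xl: "x \<in> lifts i v v1 ?S"
      unfolding x_def by (rule chart_lift_lifts(1)[OF i v le lew one(1,1,2,2) N(1-4) zL zS])
    then have xL: "x \<in> Lam Q \<Omega> v" using lifts_Lam[OF i v le] by blast
    note s = shear[OF i v le lew Bc]
    define Y where "Y = ker_op (in_mat v1 i z) T * (N * coincl ?W (v1 i) * u)"
    have Kc: "ker_op (in_mat v1 i z) T \<in> carrier_mat ?W ?W" by (rule ker_op_carrier[OF A T])
    note dims = carrier_matD[OF N(1)] carrier_matD[OF N(2)] carrier_matD[OF T] carrier_matD[OF Bc]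
      carrier_matD[OF uc] carrier_matD[OF Kc] carrier_matD[OF s(1)] W1 le lew
    have Nu: "N * coincl ?W (v1 i) * u \<in> carrier_mat ?W (v i - v1 i)" using dims by auto
    have Yc: "dim_row Y = ?W" "dim_col Y = v i - v1 i" using dims by (auto simp: Y_def)
    have xf: "x = frame_lift i v v1 (?one + shear i v v1 B) (?one - shear i v v1 B) Y z"
      unfolding x_def chart_lift_def[OF i v le lew one(1,1,2,2) N(1-4)] using dims
      by (simp add: f Y_def T_def)
    have M: "in_mat v i x = (incl (v i) (v1 i) + coincl (v i) (v1 i) * B) * in_mat v1 i z"
      unfolding xf frame_lift_def using dims
      by (subst in_mat_glue) (auto simp: mat_algebra s(3))
    have O: "out_mat v i x = (out_mat v1 i z * incl (v1 i) (v i) + Y * coproj (v i) (v1 i)) * (?one - shear i v v1 B)"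
      unfolding xf frame_lift_def using dims Yc by (subst out_mat_glue) auto
    have PM: "P * in_mat v i x = in_mat v1 i z"
      unfolding M P_def using dims by (simp add: mat_algebra incl_cancel)
    have adjc: "adj_mat (in_mat v1 i z * T) \<in> carrier_mat (v1 i) (v1 i)"
      by (rule adj_mat(1)) (use A T in auto)
    note adj = adj_mat[OF mult_carrier_mat[OF A[of z] T]]
    note adims = carrier_matD[OF adjc]
    have "scaled_restriction i v v1 P T x = z'"
    proof -
      have restr: "restricts i ((?one + shear i v v1 B) * incl (v i) (v1 i)) x z"
        unfolding xf
        by (rule frame_lift_restricts[OF i v le zL _ _ s(8)])
          (use s(1) in_mat_ker_op_zero[OF i v le T Nu] in \<open>auto simp: Y_def\<close>)
      define \<psi> where "\<psi> = (?one + shear i v v1 B) * incl (v i) (v1 i)"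
      have \<psi>: "\<psi> \<in> carrier_mat (v i) (v1 i)" "P * \<psi> = 1\<^sub>m (v1 i)" "restricts i \<psi> x z"
        unfolding \<psi>_def using restr dims s(3) by (auto simp: P_def mat_algebra incl_cancel)
      show ?thesis using scaled_restriction_eq(2)[OF i v le P T xL zL \<psi>] sz unfolding PM by simp
    qed
    moreover have "bB x = chart_B i v v1 f'"
    proof -
      have "bB x = B * ((in_mat v1 i z * T) * adj_mat (in_mat v1 i z * T))"
        unfolding bB_def PM unfolding M using dims adims by (simp add: mat_algebra incl_cancel)
      also have "\<dots> = ?d \<cdot>\<^sub>m B" unfolding adj(2) using dims by (simp add: smult_mult_dim)
      finally show ?thesis unfolding B_def using d0 by (simp add: smult_twice smult_one)
    qed
    moreover have "bu x = chart_u i v v1 f'"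
    proof -
      have OY: "out_mat v i x * coincl (v i) (v1 i) = Y"
        unfolding O using dims Yc s(4) by (simp add: mat_algebra)
      have N'X: "N' * (N * X) = X" if "dim_row X = ?W" for X
        using mult_assoc_left[OF N(4), of X] that dims by simp
      have "N' * (T * X) = incl ?W (v1 i) * X" if "dim_row X = v1 i" for X
        unfolding T_def using dims that by (simp add: mult_assoc_dim N'X)
      then have "bu x = ?d \<cdot>\<^sub>m u"
        unfolding bu_def OY Y_def ker_op_def using dims adims
        by (simp add: mat_algebra N'X incl_cancel)
      then show ?thesis unfolding u_def using d0 by (simp add: smult_twice smult_one)
    qed
    ultimately have "\<forall>f\<in>product_gens (coords Q v1) ?J. f (\<Phi> x) = f e"
      unfolding product_gens_def \<Phi>_def e(1) chart_index_def[OF i v le lew]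
      by (auto simp: chart_B_def[OF i v le lew] chart_u_def[OF i v le lew])
    then show "\<exists>y\<in>lifts i v v1 ?S. \<forall>g\<in>product_gens (coords Q v1) ?J. g (\<Phi> y) = g e"
      using xl by blast
  qed
  moreover have "expected_dim v1 + card ?J = expected_dim v"
    using card_chart_index[OF i v le lew] expected_dim_agree[OF i v le] by simp
  ultimately show ?thesis by simp
qed

lemma growth_ge_component:
  assumes "X \<in> components v"
  shows "growth_ge X (coords Q v) (expected_dim v)"
  using assms
proof (induction "total_dim v" arbitrary: v X rule: less_induct)
  case less
  note X = less.prems
  note XD = componentD[OF X]
  show ?case
  proof (cases "total_dim v = 0")
    case True
    obtain x where "x \<in> X" using XD(3) by auto
    then show ?thesis
      using growth_ge_mono[OF growth_ge_point, of x X] expected_dim_zero[OF True] by simp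
  next
    case False
    from irreducible_eps_positive[OF XD(2,1) False] obtain i
      where i: "i \<in> verts Q" "0 < eps Q i (v, X)" by blast
    define v1 where "v1 = lower i (eps Q i (v, X)) v"
    note low = lower[where v = v, OF i(1,2) eps_le_dim[OF XD(2)], folded v1_def]
    from component_is_lift_closure[OF i(1) low(1,2) X low(3)[symmetric]] obtain Z where
      Z: "Z \<in> components v1" "eps Q i (v1, Z) = 0"
      "X = lift_closure i v v1 Z" by blast
    from growth_ge_lifts[OF i(1) low(1,2) Z(1,2) less.hyps[OF low(4) Z(1)]]
    show ?thesis
      using growth_ge_mono lifts_subset_closure[OF i(1) low(1,2) Z(1,2)] unfolding Z(3) by metis
  qed
qed

text \<open>The closure of the lifts has the dimension of the whole variety, hence cannot be contained
  properly in a larger irreducible subset.\<close>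

lemma lift_closure_component:
  assumes i: "i \<in> verts Q" and v: "agree_off i v v1" and le: "v1 i \<le> v i"
    and Z: "Z \<in> components v1" "eps Q i (v1, Z) = 0"
  shows "lift_closure i v v1 Z \<in> components v"
proof -
  let ?X = "lift_closure i v v1 Z"
  obtain W where W: "W \<in> components v" "?X \<subseteq> W"
    using irreducible_subset_component[OF lift_closure_irreducible[OF i v le Z] lift_closure_Lam[OF i v le Z]] by blast
  note WD = componentD[OF W(1)]
  have "?X = W"
  proof (rule ccontr)
    assume "?X \<noteq> W"
    then obtain w where w: "w \<in> W" "w \<notin> ?X" using W(2) by auto
    have R: "lifts i v v1 (eps_stratum v1 i Z) \<subseteq> reps Q v"
      using lifts_Lam[OF i v le, of "eps_stratum v1 i Z"] Lam_reps by blast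
    have "w \<in> reps Q v" using w(1) WD(1) Lam_reps by auto
    then obtain p where p: "p \<in> polynomial_functions Q v"
      "\<forall>x\<in>lifts i v v1 (eps_stratum v1 i Z). p x = 0" "p w \<noteq> 0"
      using w(2) unfolding lift_closure_def[OF i v le] in_closure_zariski[OF R] by blast
    have "growth_ge W (coords Q v) (Suc (expected_dim v))"
    proof (rule growth_ge_hypersurface[OF growth_ge_lifts[OF i v le Z growth_ge_component[OF Z(1)]]])
      show "lifts i v v1 (eps_stratum v1 i Z) \<subseteq> W" using lifts_subset_closure[OF i v le Z] W(2) by auto
      show "p \<in> all_polys (coords Q v)" using p(1) unfolding polynomial_functions_eq .
      show "p z = 0" if "z \<in> lifts i v v1 (eps_stratum v1 i Z)" for z using p(2) that by blast
      show "w \<in> W" "p w \<noteq> 0" by (fact w(1), fact p(3))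
      fix f q assume fq: "f \<in> all_polys (coords Q v)" "q \<in> all_polys (coords Q v)" "\<forall>x\<in>W. f x * q x = 0"
      show "(\<forall>x\<in>W. f x = 0) \<or> (\<forall>x\<in>W. q x = 0)"
        using irreducible_zariskiD[OF WD(2), of f q] fq by (auto simp: polynomial_functions_eq)
    qed
    then show False using growth_contradiction growth_le_Lam[OF WD(2,1)] by blast
  qed
  with W(1) show ?thesis by simp
qed

section \<open>The crystal operators\<close>

subsection \<open>Base change\<close>

lemma eps_rep_cong:
  assumes "incoming_image Q v i x = incoming_image Q v1 i z" "v i = v1 i"
  shows "eps_rep Q v i x = eps_rep Q v1 i z"
  unfolding eps_rep_def using assms by simp

lemma base_change_component:
  assumes X: "X \<in> components v" and j: "j \<in> verts Q"
    and g: "g \<in> carrier_mat (v j) (v j)" "g' \<in> carrier_mat (v j) (v j)" "g' * g = 1\<^sub>m (v j)"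
    and z: "z \<in> X" and x: "x \<in> reps Q v" and restr: "restricts j g x z"
  shows "x \<in> X"
proof -
  have zL: "z \<in> Lam Q \<Omega> v" using z componentD(1)[OF X] by auto
  note zr = Lam_reps[OF zL]
  note dims = carrier_matD[OF g(1)] carrier_matD[OF g(2)]
  have gg': "g * g' = 1\<^sub>m (v j)" by (rule mat_mult_left_right_inverse[OF g(2,1,3)])
  have O: "out_mat v j z = out_mat v j x * g"
    using out_mat_restriction[OF j x zr agree_off_refl g(1,2,3) restr] .
  have "out_mat v j x = out_mat v j z * g'"
    unfolding O using gg' dims by (simp add: mult_assoc_dim)
  moreover have "in_mat v j z * out_mat v j z = 0\<^sub>m (v j) (v j)"
    using zL j unfolding preproj_at_iff[OF zr, symmetric] Lam_def preprojective_iff by simp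
  ultimately have "in_mat v j z * out_mat v j x = 0\<^sub>m (v j) (v j)"
    using mult_assoc_left[of "in_mat v j z" "out_mat v j z" "0\<^sub>m (v j) (v j)" g'] dims by simp
  then have "x \<in> Lam Q \<Omega> v"
    using Lam_restriction_iff[OF j x zr agree_off_refl g(1,2,3) restr] zL by simp
  then have "x \<in> lifts j v v X" unfolding lifts_def using g z restr by blast
  then show ?thesis using lifts_component[OF X j] by simp
qed

text \<open>Base change at another vertex only changes the coordinates in the source of the map whose cokernel is
measured.\<close>

lemma base_change_eps_rep:
  assumes j: "j \<noteq> i"
    and g: "g \<in> carrier_mat (v j) (v j)" "g' \<in> carrier_mat (v j) (v j)" "g * g' = 1\<^sub>m (v j)"
      "g' * g = 1\<^sub>m (v j)"
    and z: "z \<in> reps Q v" and x: "x \<in> reps Q v" and restr: "restricts j g x z"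
  shows "eps_rep Q v i x = eps_rep Q v i z"
proof -
  have same: "x h = z h" if "h \<in> arrows_into Q i" "out_vertex h \<noteq> j" for h
    using restr arrows_intoD[OF that(1)] that(2) j unfolding restricts_def by auto
  have zx: "z h = x h * g" if "h \<in> arrows_into Q i" "out_vertex h = j" for h
    using restr arrows_intoD[OF that(1)] that(2) unfolding restricts_def by auto
  have xc: "x h \<in> carrier_mat (v i) (v (out_vertex h))" if "h \<in> arrows_into Q i" for h
    using repsD[OF x, of h] arrows_intoD[OF that] by simp
  have sub: "incoming_image Q v i y \<subseteq> incoming_image Q v i y'"
    if A: "A \<in> carrier_mat (v j) (v j)"
      and yy: "\<And>h w. \<lbrakk>h \<in> arrows_into Q i; out_vertex h = j; w \<in> carrier_vec (v j)\<rbrakk> \<Longrightarrow> y h *\<^sub>v w = y' h *\<^sub>v (A *\<^sub>v w)"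
      and same': "\<And>h. \<lbrakk>h \<in> arrows_into Q i; out_vertex h \<noteq> j\<rbrakk> \<Longrightarrow> y h = y' h" for A y y'
  proof
    fix e assume "e \<in> incoming_image Q v i y"
    then obtain w where w: "w \<in> (\<Pi>\<^sub>E h\<in>arrows_into Q i. carrier_vec (v (out_vertex h)))"
      "e = vec (v i) (\<lambda>r. \<Sum>h\<in>arrows_into Q i. (y h *\<^sub>v w h) $ r)"
      unfolding incoming_image_def by auto
    define w' where "w' = (\<lambda>h\<in>arrows_into Q i. if out_vertex h = j then A *\<^sub>v w h else w h)"
    have wc: "w h \<in> carrier_vec (v (out_vertex h))" if "h \<in> arrows_into Q i" for h using w(1) that by auto
    have "y h *\<^sub>v w h = y' h *\<^sub>v w' h" if h: "h \<in> arrows_into Q i" for h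
    proof (cases "out_vertex h = j")
      case True
      then have "w h \<in> carrier_vec (v j)" using wc[OF h] by simp
      from yy[OF h True this] show ?thesis using h True by (simp add: w'_def)
    next
      case False
      then show ?thesis using same'[OF h False] h by (simp add: w'_def)
    qed
    then have "e = vec (v i) (\<lambda>r. \<Sum>h\<in>arrows_into Q i. (y' h *\<^sub>v w' h) $ r)"
      unfolding w(2) by (intro eq_vecI) (auto intro!: sum.cong)
    moreover have "w' \<in> (\<Pi>\<^sub>E h\<in>arrows_into Q i. carrier_vec (v (out_vertex h)))"
      using wc A mult_mat_vec_carrier[OF A] unfolding w'_def by auto
    ultimately show "e \<in> incoming_image Q v i y'" unfolding incoming_image_def by blast
  qed
  have "incoming_image Q v i z \<subseteq> incoming_image Q v i x"
  proof (rule sub[OF g(1)])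
    fix h and w :: "complex vec" assume h: "h \<in> arrows_into Q i" "out_vertex h = j" "w \<in> carrier_vec (v j)"
    show "z h *\<^sub>v w = x h *\<^sub>v (g *\<^sub>v w)"
      unfolding zx[OF h(1,2)] using xc[OF h(1)] h(2,3) g(1) by (intro assoc_mult_mat_vec) auto
  qed (simp add: same)
  moreover have "incoming_image Q v i x \<subseteq> incoming_image Q v i z"
  proof (rule sub[OF g(2)])
    fix h and w :: "complex vec" assume h: "h \<in> arrows_into Q i" "out_vertex h = j" "w \<in> carrier_vec (v j)"
    have xc': "x h \<in> carrier_mat (v i) (v j)" using xc[OF h(1)] h(2) by simp
    have "z h *\<^sub>v (g' *\<^sub>v w) = (x h * g * g') *\<^sub>v w"
      unfolding zx[OF h(1,2)] using xc' h(3) g(1,2) by (intro assoc_mult_mat_vec[symmetric]) auto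
    also have "x h * g * g' = x h" using g(1-3) carrier_matD[OF xc'] by (simp add: mult_assoc_dim)
    finally show "x h *\<^sub>v w = z h *\<^sub>v (g' *\<^sub>v w)" by simp
  qed (simp add: same)
  ultimately show ?thesis by (intro eps_rep_cong) auto
qed

text \<open>The base change at a set of vertices is performed one vertex at a time, since components are
  known to be invariant under base change at a single vertex.\<close>

lemma base_change_stratum:
  assumes X: "X \<in> components v"
    and g: "\<And>j. j \<in> verts Q \<Longrightarrow> g j \<in> carrier_mat (v j) (v j) \<and> g' j \<in> carrier_mat (v j) (v j) \<and>
      g j * g' j = 1\<^sub>m (v j) \<and> g' j * g j = 1\<^sub>m (v j)"
    and y: "y \<in> X" "eps_rep Q v i y = 0" and J: "finite J" "J \<subseteq> verts Q - {i}"
  defines "bc \<equiv> \<lambda>J. \<lambda>h\<in>arrows Q. (if in_vertex h \<in> J then g (in_vertex h) else 1\<^sub>m (v (in_vertex h))) * y h *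
    (if out_vertex h \<in> J then g' (out_vertex h) else 1\<^sub>m (v (out_vertex h)))"
  shows "bc J \<in> X \<and> eps_rep Q v i (bc J) = 0"
  using J
proof (induction J rule: finite_induct)
  have yr: "y \<in> reps Q v" using y(1) componentD(1)[OF X] Lam_reps by auto
  {
    case empty
    have "bc {} = y"
    proof (rule extensionalityI)
      show "bc {} \<in> extensional (arrows Q)" "y \<in> extensional (arrows Q)"
        using yr unfolding reps_def bc_def by (auto simp: PiE_iff)
      show "bc {} h = y h" if "h \<in> arrows Q" for h
        using that carrier_matD[OF repsD[OF yr that]] by (simp add: bc_def)
    qed
    then show ?case using y by simp
  next
    case (insert j J)
    have j: "j \<in> verts Q" "j \<noteq> i" and Jv: "J \<subseteq> verts Q - {i}" using insert.prems by auto
    have IH: "bc J \<in> X" "eps_rep Q v i (bc J) = 0" using insert.IH[OF Jv] by auto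
    have zr: "bc J \<in> reps Q v" using IH(1) componentD(1)[OF X] Lam_reps by auto
    have car: "bc K h \<in> carrier_mat (v (in_vertex h)) (v (out_vertex h))"
      if "h \<in> arrows Q" "K \<subseteq> verts Q" for K h
      using carrier_matD[OF repsD[OF yr that(1)]] g[OF arrowsD(1)[OF that(1)]] g[OF arrowsD(2)[OF that(1)]] that
      by (auto simp: bc_def)
    have xr: "bc (insert j J) \<in> reps Q v"
    proof (rule repsI)
      show "bc (insert j J) h \<in> carrier_mat (v (in_vertex h)) (v (out_vertex h))" if "h \<in> arrows Q" for h
        by (rule car[OF that]) (use insert.prems in auto)
    qed (simp add: bc_def)
    note gj = g[OF j(1)]
    note gd = carrier_matD[OF conjunct1[OF gj]] carrier_matD[OF conjunct1[OF conjunct2[OF gj]]]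
    have "restricts j (g j) (bc (insert j J)) (bc J)"
      unfolding restricts_def
    proof (intro ballI conjI impI)
      fix h assume h: "h \<in> arrows Q"
      note yc = carrier_matD[OF repsD[OF yr h]]
      note gi = g[OF arrowsD(1)[OF h]] and go = g[OF arrowsD(2)[OF h]]
      define r where "r = (if out_vertex h \<in> J then g' (out_vertex h) else 1\<^sub>m (v (out_vertex h)))"
      define l where "l = (if in_vertex h \<in> J then g (in_vertex h) else 1\<^sub>m (v (in_vertex h)))"
      have rd: "dim_row r = v (out_vertex h)" "dim_col r = v (out_vertex h)" using go by (auto simp: r_def)
      have ld: "dim_row l = v (in_vertex h)" "dim_col l = v (in_vertex h)" using gi by (auto simp: l_def)
      show "bc (insert j J) h = g j * bc J h" if "in_vertex h = j"
      proof -
        have o: "out_vertex h \<noteq> j" using arrowsD(3)[OF h] that by simp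
        have "bc (insert j J) h = g j * y h * r" using h that o by (simp add: bc_def r_def)
        moreover have "bc J h = y h * r" using h that insert.hyps(2) yc by (simp add: bc_def r_def)
        ultimately show ?thesis using rd yc gd that by (simp add: mult_assoc_dim)
      qed
      show "bc J h = bc (insert j J) h * g j" if "out_vertex h = j"
      proof -
        have o: "in_vertex h \<noteq> j" using arrowsD(3)[OF h] that by simp
        have "bc (insert j J) h = l * y h * g' j" using h that o by (simp add: bc_def l_def)
        moreover have "bc J h = l * y h" using h that insert.hyps(2) yc ld by (simp add: bc_def l_def)
        ultimately show ?thesis using ld yc gd gj that by (simp add: mult_assoc_dim)
      qed
      show "bc (insert j J) h = bc J h" if "in_vertex h \<noteq> j" "out_vertex h \<noteq> j"
        using h that by (simp add: bc_def)
    qed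
    from base_change_component[OF X j(1) _ _ _ IH(1) xr this, of "g' j"]
      base_change_eps_rep[OF j(2) _ _ _ _ zr xr this, of "g' j"] gj IH(2)
    show ?case by simp
  }
qed

subsection \<open>The correspondence in terms of lifts\<close>

lemma mult_mat_zero_vec:
  assumes A: "(A :: complex mat) \<in> carrier_mat r c" shows "A *\<^sub>v 0\<^sub>v c = 0\<^sub>v r"
proof (intro eq_vecI)
  fix k assume "k < dim_vec (0\<^sub>v r :: complex vec)"
  then have k: "k < dim_row A" "row A k \<in> carrier_vec c" using A by auto
  then show "(A *\<^sub>v 0\<^sub>v c) $ k = 0\<^sub>v r $ k" using A scalar_prod_right_zero[OF k(2)] by simp
qed (use A in auto)

lemma mat_eq_by_vec:
  fixes A B :: "complex mat"
  assumes "A \<in> carrier_mat l k" "B \<in> carrier_mat l k"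
    and "\<And>u. u \<in> carrier_vec k \<Longrightarrow> A *\<^sub>v u = B *\<^sub>v u"
  shows "A = B"
proof (intro eq_matI)
  fix r s assume rs: "r < dim_row B" "s < dim_col B"
  have c: "C *\<^sub>v unit_vec k s = col C s" if "C \<in> carrier_mat l k" for C :: "complex mat"
    using that rs assms(2) by (intro eq_vecI) auto
  have "col A s = col B s" using assms(3)[of "unit_vec k s"] c[OF assms(1)] c[OF assms(2)] by simp
  then have "col A s $ r = col B s $ r" by simp
  then show "A $$ (r, s) = B $$ (r, s)" using rs assms(1,2) by (simp add: col_def)
qed (use assms in auto)

text \<open>A rank factorisation \<open>A = (A T)(P A)\<close> of an injective matrix gives \<open>T P A = 1\<close>.\<close>

lemma injective_imp_left_inverse:
  fixes A :: "complex mat"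
  assumes A: "A \<in> carrier_mat l k" and inj: "inj_on (\<lambda>u. A *\<^sub>v u) (carrier_vec k)"
  shows "\<exists>P. P \<in> carrier_mat k l \<and> P * A = 1\<^sub>m k"
proof -
  obtain r P T where PT: "P \<in> carrier_mat r l" "T \<in> carrier_mat k r" "P * A * T = 1\<^sub>m r" "A = A * T * (P * A)"
    using rank_factorization[OF A] by blast
  note dims = carrier_matD[OF A] carrier_matD[OF PT(1)] carrier_matD[OF PT(2)]
  have TPA: "T * P * A \<in> carrier_mat k k" using dims by auto
  have "T * P * A = 1\<^sub>m k"
  proof (rule mat_eq_by_vec[OF TPA])
    fix u :: "complex vec" assume u: "u \<in> carrier_vec k"
    have "A *\<^sub>v ((T * P * A) *\<^sub>v u) = (A * (T * P * A)) *\<^sub>v u"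
      by (rule assoc_mult_mat_vec[symmetric, OF A TPA u])
    also have "A * (T * P * A) = A" using PT(4) dims by (simp add: mult_assoc_dim)
    finally have "(T * P * A) *\<^sub>v u = u"
      by (rule inj_onD[OF inj]) (use u TPA in auto)
    then show "(T * P * A) *\<^sub>v u = 1\<^sub>m k *\<^sub>v u" using u by simp
  qed simp
  then show ?thesis using PT by (intro exI[of _ "T * P"]) auto
qed

context
  fixes i :: 'i and c :: nat and v1 v :: "'i \<Rightarrow> nat"
  assumes i: "i \<in> verts Q" and v_def: "v = add_dim Q v1 (mult_root Q c i)"
begin

lemma add_root: "agree_off i v v1" "v i = v1 i + c" "v1 i \<le> v i" "v i - v1 i = c"
  using i unfolding v_def by (auto simp: agree_off_def add_dim_def mult_root_def)

text \<open>At the vertices other than \<open>i\<close> the injection of a short exact sequence is an isomorphism. Base change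
turns it into the identity there, without leaving the component or changing \<open>\<epsilon>\<^sub>i\<close>.\<close>

lemma correspondence_subset_lifts:
  assumes X: "X \<in> components v1"
    and t: "(x, \<phi>, \<psi>) \<in> Lam' Q \<Omega> i c v1" "varpi1 Q v1 (x, \<phi>, \<psi>) \<in> X \<inter> {y. eps_rep Q v1 i y = 0}"
  shows "x \<in> lifts i v v1 (X \<inter> {y. eps_rep Q v1 i y = 0})"
proof -
  have t': "x \<in> Lam Q \<Omega> v" "short_exact Q v1 v (mult_root Q c i) \<phi> \<psi>" "stable_image Q x \<phi>"
    using t(1) unfolding Lam'_def Let_def v_def[symmetric] by auto
  note xr = Lam_reps[OF t'(1)]
  have \<phi>c: "\<phi> j \<in> carrier_mat (v j) (v1 j)" if "j \<in> verts Q" for j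
    using t'(2) that unfolding short_exact_def by auto
  have "\<exists>P. P \<in> carrier_mat (v1 j) (v j) \<and> P * \<phi> j = 1\<^sub>m (v1 j)" if "j \<in> verts Q" for j
    using injective_imp_left_inverse[OF \<phi>c[OF that]] t'(2) that unfolding short_exact_def by auto
  then obtain P where P: "\<And>j. j \<in> verts Q \<Longrightarrow> P j \<in> carrier_mat (v1 j) (v j)"
    "\<And>j. j \<in> verts Q \<Longrightarrow> P j * \<phi> j = 1\<^sub>m (v1 j)" by metis
  have vj: "v j = v1 j" if "j \<in> verts Q" "j \<noteq> i" for j
    using add_root(1) that unfolding agree_off_def by simp
  \<comment> \<open>The restriction exists and is unique, so the definite description denotes it.\<close>
  define y where "y = (\<lambda>h\<in>arrows Q. P (in_vertex h) * (x h * \<phi> (out_vertex h)))"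
  have yr: "y \<in> reps Q v1"
    using P(1)[OF arrowsD(1)] \<phi>c[OF arrowsD(2)] repsD[OF xr]
    by (intro repsI) (force simp: y_def)+
  have y: "\<phi> (in_vertex h) * y h = x h * \<phi> (out_vertex h)" if h: "h \<in> arrows Q" for h
  proof -
    note hi = arrowsD(1)[OF h] and ho = arrowsD(2)[OF h]
    have xc: "x h \<in> carrier_mat (v (in_vertex h)) (v (out_vertex h))" using repsD[OF xr h] .
    have xp: "x h * \<phi> (out_vertex h) \<in> carrier_mat (v (in_vertex h)) (v1 (out_vertex h))"
      using xc \<phi>c[OF ho] by auto
    have yc: "y h \<in> carrier_mat (v1 (in_vertex h)) (v1 (out_vertex h))" by (rule repsD[OF yr h])
    show ?thesis
    proof (rule mat_eq_by_vec[OF _ xp])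
      show "\<phi> (in_vertex h) * y h \<in> carrier_mat (v (in_vertex h)) (v1 (out_vertex h))"
        using yc \<phi>c[OF hi] by auto
      fix u :: "complex vec" assume u: "u \<in> carrier_vec (v1 (out_vertex h))"
      have "\<phi> (out_vertex h) *\<^sub>v u \<in> mat_image (\<phi> (out_vertex h))"
        using u carrier_matD[OF \<phi>c[OF ho]] unfolding mat_image_def by auto
      then have "x h *\<^sub>v (\<phi> (out_vertex h) *\<^sub>v u) \<in> mat_image (\<phi> (in_vertex h))"
        using t'(3) h unfolding stable_image_def by blast
      then obtain w where w: "w \<in> carrier_vec (v1 (in_vertex h))"
        "x h *\<^sub>v (\<phi> (out_vertex h) *\<^sub>v u) = \<phi> (in_vertex h) *\<^sub>v w"
        using carrier_matD[OF \<phi>c[OF hi]] unfolding mat_image_def by auto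
      have xpu: "(x h * \<phi> (out_vertex h)) *\<^sub>v u = \<phi> (in_vertex h) *\<^sub>v w"
        using assoc_mult_mat_vec[OF xc \<phi>c[OF ho] u] w(2) by simp
      have "y h *\<^sub>v u = P (in_vertex h) *\<^sub>v ((x h * \<phi> (out_vertex h)) *\<^sub>v u)"
        using assoc_mult_mat_vec[OF P(1)[OF hi] xp u] h by (simp add: y_def)
      also have "\<dots> = (P (in_vertex h) * \<phi> (in_vertex h)) *\<^sub>v w"
        unfolding xpu using assoc_mult_mat_vec[OF P(1)[OF hi] \<phi>c[OF hi] w(1)] by simp
      also have "\<dots> = w" unfolding P(2)[OF hi] using w(1) by simp
      finally have "y h *\<^sub>v u = w" .
      then show "(\<phi> (in_vertex h) * y h) *\<^sub>v u = (x h * \<phi> (out_vertex h)) *\<^sub>v u"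
        using assoc_mult_mat_vec[OF \<phi>c[OF hi] yc u] xpu by simp
    qed
  qed
  have uniq: "y' = y" if y': "y' \<in> reps Q v1" "\<forall>h\<in>arrows Q. \<phi> (in_vertex h) * y' h = x h * \<phi> (out_vertex h)" for y'
  proof (rule extensionalityI)
    show "y' \<in> extensional (arrows Q)" "y \<in> extensional (arrows Q)"
      using y'(1) yr unfolding reps_def by (auto simp: PiE_iff)
    fix h assume h: "h \<in> arrows Q"
    note hi = arrowsD(1)[OF h]
    note d = carrier_matD[OF P(1)[OF hi]] carrier_matD[OF \<phi>c[OF hi]] carrier_matD[OF repsD[OF y'(1) h]]
    have "y' h = P (in_vertex h) * (\<phi> (in_vertex h) * y' h)"
      using mult_assoc_left[OF P(2)[OF hi], of "y' h"] d by simp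
    also have "\<dots> = y h" using y'(2) h by (simp add: y_def)
    finally show "y' h = y h" .
  qed
  have "varpi1 Q v1 (x, \<phi>, \<psi>) = y"
    unfolding varpi1_def prod.case
  proof (rule the_equality)
    show "y \<in> reps Q v1 \<and> (\<forall>h\<in>arrows Q. \<phi> (in_vertex h) * y h = x h * \<phi> (out_vertex h))"
      using yr y by simp
  qed (rule uniq, simp_all)
  then have yX: "y \<in> X" "eps_rep Q v1 i y = 0" using t(2) by auto
  define g where "g j = (if j = i then 1\<^sub>m (v1 j) else \<phi> j)" for j
  define g' where "g' j = (if j = i then 1\<^sub>m (v1 j) else P j)" for j
  have gg: "g j \<in> carrier_mat (v1 j) (v1 j) \<and> g' j \<in> carrier_mat (v1 j) (v1 j) \<and>
      g j * g' j = 1\<^sub>m (v1 j) \<and> g' j * g j = 1\<^sub>m (v1 j)" if j: "j \<in> verts Q" for j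
  proof (cases "j = i")
    case False
    have c: "\<phi> j \<in> carrier_mat (v1 j) (v1 j)" "P j \<in> carrier_mat (v1 j) (v1 j)"
      using \<phi>c[OF j] P(1)[OF j] vj[OF j False] by auto
    from mat_mult_left_right_inverse[OF c(2,1) P(2)[OF j]] c P(2)[OF j] False
    show ?thesis by (simp add: g_def g'_def)
  qed (simp add: g_def g'_def)
  define z where "z = (\<lambda>h\<in>arrows Q. (if in_vertex h \<in> verts Q - {i} then g (in_vertex h) else 1\<^sub>m (v1 (in_vertex h))) * y h *
    (if out_vertex h \<in> verts Q - {i} then g' (out_vertex h) else 1\<^sub>m (v1 (out_vertex h))))"
  have z: "z \<in> X" "eps_rep Q v1 i z = 0"
    using base_change_stratum[OF X gg yX, of "verts Q - {i}"] finite_verts unfolding z_def by auto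
  have "restricts i (\<phi> i) x z"
    unfolding restricts_def
  proof (intro ballI conjI impI)
    fix h assume h: "h \<in> arrows Q"
    note hi = arrowsD(1)[OF h] and ho = arrowsD(2)[OF h]
    note d = carrier_matD[OF repsD[OF yr h]] carrier_matD[OF repsD[OF xr h]] carrier_matD[OF \<phi>c[OF hi]]
      carrier_matD[OF \<phi>c[OF ho]] carrier_matD[OF P(1)[OF ho]]
    have \<phi>P: "\<phi> (out_vertex h) * P (out_vertex h) = 1\<^sub>m (v (out_vertex h))" if "out_vertex h \<noteq> i"
      using gg[OF ho] that vj[OF ho that] by (simp add: g_def g'_def)
    have xb: "x h * \<phi> (out_vertex h) * P (out_vertex h) = x h" if "out_vertex h \<noteq> i"
      using \<phi>P[OF that] d by (simp add: mult_assoc_dim)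
    show "x h = \<phi> i * z h" if "in_vertex h = i"
    proof -
      have o: "out_vertex h \<noteq> i" using arrowsD(3)[OF h] that by simp
      have "z h = y h * P (out_vertex h)" using h that o ho d by (simp add: z_def g'_def)
      then have "\<phi> i * z h = (\<phi> (in_vertex h) * y h) * P (out_vertex h)"
        using that d vj[OF ho o] by (simp add: mult_assoc_dim)
      then show ?thesis unfolding y[OF h] xb[OF o] by simp
    qed
    show "z h = x h * \<phi> i" if "out_vertex h = i"
    proof -
      have o: "in_vertex h \<noteq> i" using arrowsD(3)[OF h] that by simp
      have "z h = \<phi> (in_vertex h) * y h" using h that o hi d by (simp add: z_def g_def)
      then show ?thesis unfolding y[OF h] that .
    qed
    show "x h = z h" if o: "in_vertex h \<noteq> i" "out_vertex h \<noteq> i"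
    proof -
      have "z h = \<phi> (in_vertex h) * y h * P (out_vertex h)" using h o hi ho by (simp add: z_def g_def g'_def)
      then show ?thesis unfolding y[OF h] xb[OF o(2)] by simp
    qed
  qed
  then show ?thesis
    unfolding lifts_def using t'(1) \<phi>c[OF i] P(1)[OF i] P(2)[OF i] z by blast
qed

text \<open>A left inverse of the inclusion at \<open>i\<close> provides the complement, hence the quotient map; at the other
vertices the quotient is zero.\<close>

lemma lifts_subset_correspondence:
  assumes U: "U \<subseteq> Lam Q \<Omega> v1" and x: "x \<in> lifts i v v1 U"
  shows "\<exists>\<phi> \<psi>. (x, \<phi>, \<psi>) \<in> Lam' Q \<Omega> i c v1 \<and> varpi1 Q v1 (x, \<phi>, \<psi>) \<in> U"
proof -
  obtain f P z where z: "x \<in> Lam Q \<Omega> v" "f \<in> carrier_mat (v i) (v1 i)" "P \<in> carrier_mat (v1 i) (v i)"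
    "P * f = 1\<^sub>m (v1 i)" "z \<in> U" "restricts i f x z"
    using x unfolding lifts_def by blast
  have zL: "z \<in> Lam Q \<Omega> v1" using z(5) U by auto
  note xr = Lam_reps[OF z(1)] and zr = Lam_reps[OF zL]
  obtain g g' where g: "g \<in> carrier_mat (v i) (v i)" "g' \<in> carrier_mat (v i) (v i)" "g * g' = 1\<^sub>m (v i)"
    "g' * g = 1\<^sub>m (v i)" "g * incl (v i) (v1 i) = f" "incl (v1 i) (v i) * g' = P"
    using complete_to_invertible[OF z(3,2,4)] by blast
  have vj: "v j = v1 j" if "j \<in> verts Q" "j \<noteq> i" for j
    using add_root(1) that unfolding agree_off_def by simp
  let ?q = "coproj (v i) (v1 i) * g'"
  have q: "?q \<in> carrier_mat c (v i)" using g(2) add_root(4) by (intro carrier_matI) auto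
  note dims = carrier_matD[OF g(1)] carrier_matD[OF g(2)] carrier_matD[OF z(2)] carrier_matD[OF z(3)]
    carrier_matD[OF q] add_root(2,3,4)
  define \<phi> where "\<phi> = (\<lambda>j\<in>verts Q. if j = i then f else 1\<^sub>m (v j))"
  define \<psi> where "\<psi> = (\<lambda>j\<in>verts Q. if j = i then ?q else 0\<^sub>m 0 (v j))"
  have \<phi>i: "\<phi> i = f" "\<psi> i = ?q" and \<phi>j: "\<And>j. j \<in> verts Q \<Longrightarrow> j \<noteq> i \<Longrightarrow> \<phi> j = 1\<^sub>m (v j) \<and> \<psi> j = 0\<^sub>m 0 (v j)"
    using i by (auto simp: \<phi>_def \<psi>_def)
  have full: "mat_image (1\<^sub>m k :: complex mat) = carrier_vec k" for k
    unfolding mat_image_def by (auto intro!: image_eqI)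
  have se: "short_exact Q v1 v (mult_root Q c i) \<phi> \<psi>"
    unfolding short_exact_def
  proof (intro conjI ballI)
    show "\<phi> \<in> (\<Pi>\<^sub>E j\<in>verts Q. carrier_mat (v j) (v1 j))"
      using z(2) vj by (auto simp: \<phi>_def)
    show "\<psi> \<in> (\<Pi>\<^sub>E j\<in>verts Q. carrier_mat (mult_root Q c i j) (v j))"
      using q by (auto simp: \<psi>_def mult_root_def)
    fix j assume j: "j \<in> verts Q"
    show "inj_on (\<lambda>u. \<phi> j *\<^sub>v u) (carrier_vec (v1 j))"
    proof (cases "j = i")
      case True
      show ?thesis
      proof (rule inj_onI)
        fix u u' assume u: "u \<in> carrier_vec (v1 j)" "u' \<in> carrier_vec (v1 j)" "\<phi> j *\<^sub>v u = \<phi> j *\<^sub>v u'"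
        have "P *\<^sub>v (f *\<^sub>v w) = w" if "w \<in> carrier_vec (v1 i)" for w
          using assoc_mult_mat_vec[OF z(3,2) that] z(4) that by simp
        then show "u = u'" using u True \<phi>i(1) by metis
      qed
    next
      case False
      then show ?thesis using \<phi>j[OF j] vj[OF j False] by (auto intro!: inj_onI)
    qed
    show "mat_image (\<phi> j) = mat_kernel (\<psi> j)"
    proof (cases "j = i")
      case False
      then show ?thesis using \<phi>j[OF j] full[of "v j"] by (auto simp: mat_kernel_def)
    next
      case True
      have qf: "?q * f = 0\<^sub>m c (v1 i)"
      proof -
        have "?q * f = coproj (v i) (v1 i) * ((g' * g) * incl (v i) (v1 i))"
          unfolding g(5)[symmetric] using dims by (simp add: mult_assoc_dim)
        then show ?thesis unfolding g(4) using dims by simp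
      qed
      have split: "f * P + g * coincl (v i) (v1 i) * ?q = 1\<^sub>m (v i)"
      proof -
        have "f * P + g * coincl (v i) (v1 i) * ?q =
            g * ((incl (v i) (v1 i) * incl (v1 i) (v i) + coincl (v i) (v1 i) * coproj (v i) (v1 i)) * g')"
          unfolding g(5)[symmetric] g(6)[symmetric] using dims by (simp add: mat_algebra del: incl_coincl_sum)
        then show ?thesis unfolding incl_coincl_sum[OF add_root(3)] using g(3) dims by simp
      qed
      have "mat_image f = mat_kernel ?q"
      proof (intro equalityI subsetI)
        fix e assume "e \<in> mat_image f"
        then obtain u where u: "u \<in> carrier_vec (v1 i)" "e = f *\<^sub>v u" using dims unfolding mat_image_def by auto
        have "?q *\<^sub>v e = 0\<^sub>v c"
          unfolding u(2) assoc_mult_mat_vec[OF q z(2) u(1), symmetric] qf using u(1) by (intro eq_vecI) auto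
        then show "e \<in> mat_kernel ?q"
          unfolding mat_kernel_def using dims u z(2) by auto
      next
        fix e assume "e \<in> mat_kernel ?q"
        then have e: "e \<in> carrier_vec (v i)" "?q *\<^sub>v e = 0\<^sub>v c" unfolding mat_kernel_def using dims by auto
        have gc: "g * coincl (v i) (v1 i) \<in> carrier_mat (v i) c" using g(1) add_root(4) by (intro carrier_matI) auto
        have "e = (f * P + g * coincl (v i) (v1 i) * ?q) *\<^sub>v e" unfolding split using e(1) by simp
        also have "\<dots> = (f * P) *\<^sub>v e + (g * coincl (v i) (v1 i) * ?q) *\<^sub>v e"
          by (rule add_mult_distrib_mat_vec) (use z(2,3) q gc e in auto)
        also have "(g * coincl (v i) (v1 i) * ?q) *\<^sub>v e = 0\<^sub>v (v i)"
          unfolding assoc_mult_mat_vec[OF gc q e(1)] e(2) by (rule mult_mat_zero_vec[OF gc])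
        also have "(f * P) *\<^sub>v e = f *\<^sub>v (P *\<^sub>v e)" by (rule assoc_mult_mat_vec[OF z(2,3) e(1)])
        finally have "e = f *\<^sub>v (P *\<^sub>v e)" using z(2,3) e(1) by simp
        moreover have "P *\<^sub>v e \<in> carrier_vec (dim_col f)" using z(2,3) e(1) by auto
        ultimately show "e \<in> mat_image f" unfolding mat_image_def by blast
      qed
      then show ?thesis using True \<phi>i by simp
    qed
    show "mat_image (\<psi> j) = carrier_vec (mult_root Q c i j)"
    proof (cases "j = i")
      case False
      then have "\<psi> j = 0\<^sub>m 0 (v j)" "mult_root Q c i j = 0" using \<phi>j[OF j] j by (auto simp: mult_root_def)
      moreover have "mat_image (0\<^sub>m 0 (v j) :: complex mat) = carrier_vec 0"
        unfolding mat_image_def by (auto intro!: image_eqI[of _ _ "0\<^sub>v (v j)"] mult_mat_vec_carrier[OF zero_carrier_mat])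
      ultimately show ?thesis by simp
    next
      case True
      have gc: "g * coincl (v i) (v1 i) \<in> carrier_mat (v i) c" using g(1) add_root(4) by (intro carrier_matI) auto
      have "?q * (g * coincl (v i) (v1 i)) = coproj (v i) (v1 i) * ((g' * g) * coincl (v i) (v1 i))"
        using dims by (simp add: mult_assoc_dim)
      then have one: "?q * (g * coincl (v i) (v1 i)) = 1\<^sub>m c" unfolding g(4) using dims by simp
      have "mat_image ?q = carrier_vec c"
      proof (intro equalityI subsetI)
        fix e assume "e \<in> mat_image ?q"
        then obtain u where u: "u \<in> carrier_vec (v i)" "e = ?q *\<^sub>v u" using carrier_matD(2)[OF q] unfolding mat_image_def by auto
        then show "e \<in> carrier_vec c" using mult_mat_vec_carrier[OF q u(1)] by simp
      next
        fix e :: "complex vec" assume e: "e \<in> carrier_vec c"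
        have "e = ?q *\<^sub>v ((g * coincl (v i) (v1 i)) *\<^sub>v e)"
          using assoc_mult_mat_vec[OF q gc e] one e by simp
        moreover have "(g * coincl (v i) (v1 i)) *\<^sub>v e \<in> carrier_vec (dim_col ?q)" using gc e dims by auto
        ultimately show "e \<in> mat_image ?q" unfolding mat_image_def by blast
      qed
      then show ?thesis using True \<phi>i i by (simp add: mult_root_def)
    qed
  qed
  have eq: "\<phi> (in_vertex h) * z h = x h * \<phi> (out_vertex h)" if h: "h \<in> arrows Q" for h
  proof -
    note hi = arrowsD(1)[OF h] and ho = arrowsD(2)[OF h]
    note d = carrier_matD[OF repsD[OF xr h]] carrier_matD[OF repsD[OF zr h]]
    note r = bspec[OF z(6)[unfolded restricts_def] h]
    consider "in_vertex h = i" "out_vertex h \<noteq> i" | "in_vertex h \<noteq> i" "out_vertex h = i"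
      | "in_vertex h \<noteq> i" "out_vertex h \<noteq> i" using arrowsD(3)[OF h] by metis
    then show ?thesis
    proof cases
      case 1
      have "\<phi> (out_vertex h) = 1\<^sub>m (v (out_vertex h))" using \<phi>j[OF ho 1(2)] by simp
      then show ?thesis using r 1(1) \<phi>i(1) d by simp
    next
      case 2
      have "\<phi> (in_vertex h) = 1\<^sub>m (v (in_vertex h))" using \<phi>j[OF hi 2(1)] by simp
      then have "\<phi> (in_vertex h) * z h = z h" using d vj[OF hi 2(1)] by simp
      then show ?thesis using r 2(2) \<phi>i(1) by simp
    next
      case 3
      have "\<phi> (in_vertex h) = 1\<^sub>m (v (in_vertex h))" "\<phi> (out_vertex h) = 1\<^sub>m (v (out_vertex h))"
        using \<phi>j[OF hi 3(1)] \<phi>j[OF ho 3(2)] by auto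
      then show ?thesis using r 3 d by simp
    qed
  qed
  have stable: "stable_image Q x \<phi>"
    unfolding stable_image_def
  proof (intro ballI)
    fix h e assume h: "h \<in> arrows Q" and e: "e \<in> mat_image (\<phi> (out_vertex h))"
    note hi = arrowsD(1)[OF h] and ho = arrowsD(2)[OF h]
    have c: "\<phi> j \<in> carrier_mat (v j) (v1 j)" if "j \<in> verts Q" for j
      using se that unfolding short_exact_def by auto
    obtain u where u: "u \<in> carrier_vec (v1 (out_vertex h))" "e = \<phi> (out_vertex h) *\<^sub>v u"
      using e carrier_matD[OF c[OF ho]] unfolding mat_image_def by auto
    have "x h *\<^sub>v e = (\<phi> (in_vertex h) * z h) *\<^sub>v u"
      unfolding eq[OF h] u(2) using assoc_mult_mat_vec[OF repsD[OF xr h] c[OF ho] u(1)] by simp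
    also have "\<dots> = \<phi> (in_vertex h) *\<^sub>v (z h *\<^sub>v u)"
      by (rule assoc_mult_mat_vec[OF c[OF hi] repsD[OF zr h] u(1)])
    finally show "x h *\<^sub>v e \<in> mat_image (\<phi> (in_vertex h))"
      unfolding mat_image_def using repsD[OF zr h] u(1) carrier_matD[OF c[OF hi]]
      by (auto intro!: image_eqI[of _ _ "z h *\<^sub>v u"] mult_mat_vec_carrier)
  qed
  have "varpi1 Q v1 (x, \<phi>, \<psi>) = z"
    unfolding varpi1_def prod.case
  proof (rule the_equality)
    show "z \<in> reps Q v1 \<and> (\<forall>h\<in>arrows Q. \<phi> (in_vertex h) * z h = x h * \<phi> (out_vertex h))"
      using zr eq by simp
    fix y assume y: "y \<in> reps Q v1 \<and> (\<forall>h\<in>arrows Q. \<phi> (in_vertex h) * y h = x h * \<phi> (out_vertex h))"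
    show "y = z"
    proof (rule extensionalityI)
      show "y \<in> extensional (arrows Q)" "z \<in> extensional (arrows Q)"
        using y zr unfolding reps_def by (auto simp: PiE_iff)
      fix h assume h: "h \<in> arrows Q"
      note hi = arrowsD(1)[OF h]
      have yr: "y \<in> reps Q v1" using y by simp
      note d = carrier_matD[OF repsD[OF yr h]] carrier_matD[OF repsD[OF zr h]]
      have e: "\<phi> (in_vertex h) * y h = \<phi> (in_vertex h) * z h" using y eq h by simp
      show "y h = z h"
      proof (cases "in_vertex h = i")
        case True
        have "P * (f * y h) = P * (f * z h)" using e True \<phi>i(1) by simp
        then show ?thesis using mult_assoc_left[OF z(4)] d True dims by simp
      next
        case False
        then show ?thesis using e \<phi>j[OF hi False] vj[OF hi False] d by simp
      qed
    qed
  qed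
  moreover have "(x, \<phi>, \<psi>) \<in> Lam' Q \<Omega> i c v1"
    unfolding Lam'_def Let_def v_def[symmetric] using z(1) se stable by simp
  ultimately show ?thesis using z(5) by auto
qed

lemma f_pow_eq_lift_closure:
  assumes X: "X \<in> components v1" and e: "eps Q i (v1, X) = 0"
  shows "f_pow Q \<Omega> i c (v1, X) = (v, lift_closure i v v1 X)"
proof -
  let ?U = "X \<inter> {y. eps_rep Q v1 i y = 0}"
  have U: "?U \<subseteq> Lam Q \<Omega> v1" using componentD(1)[OF X] by auto
  have "varpi2 ` {t \<in> Lam' Q \<Omega> i c v1. varpi1 Q v1 t \<in> ?U} = lifts i v v1 ?U"
  proof (intro equalityI subsetI)
    fix x assume "x \<in> varpi2 ` {t \<in> Lam' Q \<Omega> i c v1. varpi1 Q v1 t \<in> ?U}"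
    then obtain \<phi> \<psi> where "(x, \<phi>, \<psi>) \<in> Lam' Q \<Omega> i c v1" "varpi1 Q v1 (x, \<phi>, \<psi>) \<in> ?U"
      unfolding varpi2_def by force
    then show "x \<in> lifts i v v1 ?U" by (rule correspondence_subset_lifts[OF X])
  next
    fix x assume "x \<in> lifts i v v1 ?U"
    from lifts_subset_correspondence[OF U this] obtain \<phi> \<psi> where
      "(x, \<phi>, \<psi>) \<in> Lam' Q \<Omega> i c v1" "varpi1 Q v1 (x, \<phi>, \<psi>) \<in> ?U" by blast
    then show "x \<in> varpi2 ` {t \<in> Lam' Q \<Omega> i c v1. varpi1 Q v1 t \<in> ?U}"
      by (intro image_eqI[of _ _ "(x, \<phi>, \<psi>)"]) (simp_all add: varpi2_def)
  qed
  moreover have "?U = eps_stratum v1 i X" unfolding eps_stratum_def e by auto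
  ultimately show ?thesis
    unfolding f_pow_def prod.case Let_def v_def[symmetric] lift_closure_def[OF i add_root(1,3)] by simp
qed

end

subsection \<open>Bijectivity\<close>

lemma B_infinity_iff:
  "(v, X) \<in> B_infinity Q \<Omega> \<longleftrightarrow> v \<in> dim_vectors Q \<and> X \<in> components v"
  unfolding B_infinity_def by auto

lemma B_eps_iff: "C \<in> B_infinity_eps Q \<Omega> i p \<longleftrightarrow> C \<in> B_infinity Q \<Omega> \<and> eps Q i C = p"
  unfolding B_infinity_eps_def by simp

lemma add_root_dim: "add_dim Q v (mult_root Q c i) \<in> dim_vectors Q"
  unfolding add_dim_def dim_vectors_def by auto

lemma add_root_lower:
  assumes "v \<in> dim_vectors Q" "c \<le> v i"
  shows "\<exists>v1\<in>dim_vectors Q. v = add_dim Q v1 (mult_root Q c i)"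
proof -
  let ?v1 = "\<lambda>j\<in>verts Q. if j = i then v i - c else v j"
  have "v = add_dim Q ?v1 (mult_root Q c i)"
    using assms unfolding dim_vectors_def
    by (intro extensionalityI[of _ "verts Q"]) (auto simp: add_dim_def mult_root_def PiE_iff)
  moreover have "?v1 \<in> dim_vectors Q" unfolding dim_vectors_def by auto
  ultimately show ?thesis by blast
qed

lemma add_root_inj:
  assumes "v \<in> dim_vectors Q" "u \<in> dim_vectors Q"
    and "add_dim Q v (mult_root Q c i) = add_dim Q u (mult_root Q c i)"
  shows "v = u"
proof (rule extensionalityI)
  show "v \<in> extensional (verts Q)" "u \<in> extensional (verts Q)"
    using assms(1,2) unfolding dim_vectors_def by (auto simp: PiE_iff)
  fix j assume "j \<in> verts Q"
  then show "v j = u j" using fun_cong[OF assms(3), of j] by (simp add: add_dim_def)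
qed

lemma f_pow_B_eps:
  assumes i: "i \<in> verts Q" and C: "C \<in> B_infinity_eps Q \<Omega> i 0"
  shows "f_pow Q \<Omega> i c C \<in> B_infinity_eps Q \<Omega> i c"
proof -
  obtain v1 X where X: "C = (v1, X)" by (cases C)
  then have X': "X \<in> components v1" "eps Q i (v1, X) = 0"
    using C unfolding B_eps_iff by (auto simp: B_infinity_iff)
  define v where "v = add_dim Q v1 (mult_root Q c i)"
  note r = add_root[OF i v_def]
  have "f_pow Q \<Omega> i c C = (v, lift_closure i v v1 X)"
    unfolding X by (rule f_pow_eq_lift_closure[OF i v_def X'])
  then show ?thesis
    using lift_closure_component[OF i r(1,3) X'] eps_lift_closure[OF i r(1,3) X'] r(4) add_root_dim
    unfolding B_eps_iff by (simp add: B_infinity_iff v_def)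
qed

text \<open>The theorem of Kashiwara and Saito.\<close>

lemma f_pow_bij:
  assumes i: "i \<in> verts Q"
  shows "bij_betw (f_pow Q \<Omega> i c) (B_infinity_eps Q \<Omega> i 0) (B_infinity_eps Q \<Omega> i c)"
proof (rule bij_betw_imageI)
  show "inj_on (f_pow Q \<Omega> i c) (B_infinity_eps Q \<Omega> i 0)"
  proof (rule inj_onI)
    fix C C' assume C: "C \<in> B_infinity_eps Q \<Omega> i 0" "C' \<in> B_infinity_eps Q \<Omega> i 0"
      and eq: "f_pow Q \<Omega> i c C = f_pow Q \<Omega> i c C'"
    obtain v1 X u1 Y where XY: "C = (v1, X)" "C' = (u1, Y)" by (cases C; cases C')
    have X: "X \<in> components v1" "eps Q i (v1, X) = 0"
      and Y: "Y \<in> components u1" "eps Q i (u1, Y) = 0"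
      and d: "v1 \<in> dim_vectors Q" "u1 \<in> dim_vectors Q"
      using C unfolding XY B_eps_iff by (auto simp: B_infinity_iff)
    have vu: "v1 = u1"
      using eq add_root_inj[OF d] unfolding XY f_pow_eq_lift_closure[OF i refl X]
        f_pow_eq_lift_closure[OF i refl Y] by blast
    note X' = X[unfolded vu] and r = add_root[OF i refl, of u1 c]
    have "lift_closure i (add_dim Q u1 (mult_root Q c i)) u1 X = lift_closure i (add_dim Q u1 (mult_root Q c i)) u1 Y"
      using eq unfolding XY vu f_pow_eq_lift_closure[OF i refl X'] f_pow_eq_lift_closure[OF i refl Y] by simp
    from lift_closure_inj[OF i r(1,3) X' Y this] show "C = C'" unfolding XY vu by simp
  qed
  show "f_pow Q \<Omega> i c ` B_infinity_eps Q \<Omega> i 0 = B_infinity_eps Q \<Omega> i c"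
  proof (intro equalityI subsetI)
    fix C assume "C \<in> f_pow Q \<Omega> i c ` B_infinity_eps Q \<Omega> i 0"
    then show "C \<in> B_infinity_eps Q \<Omega> i c" using f_pow_B_eps[OF i] by blast
  next
    fix C assume C: "C \<in> B_infinity_eps Q \<Omega> i c"
    obtain v X where X: "C = (v, X)" by (cases C)
    have X': "X \<in> components v" "eps Q i (v, X) = c" "v \<in> dim_vectors Q"
      using C unfolding X B_eps_iff by (auto simp: B_infinity_iff)
    have "c \<le> v i" using eps_le_dim[OF componentD(2)[OF X'(1)], of i] X'(2) by simp
    from add_root_lower[OF X'(3) this] obtain v1 where
      v1: "v1 \<in> dim_vectors Q" "v = add_dim Q v1 (mult_root Q c i)" by blast
    note r = add_root[OF i v1(2)]
    have "eps Q i (v, X) = v i - v1 i" using X'(2) r(4) by simp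
    from component_is_lift_closure[OF i r(1,3) X'(1) this] obtain Z where
      Z: "Z \<in> components v1" "eps Q i (v1, Z) = 0"
      "X = lift_closure i v v1 Z" by blast
    have "C = f_pow Q \<Omega> i c (v1, Z)"
      unfolding X Z(3) by (rule f_pow_eq_lift_closure[OF i v1(2) Z(1,2), symmetric])
    moreover have "(v1, Z) \<in> B_infinity_eps Q \<Omega> i 0"
      using Z v1(1) unfolding B_eps_iff by (simp add: B_infinity_iff)
    ultimately show "C \<in> f_pow Q \<Omega> i c ` B_infinity_eps Q \<Omega> i 0" by blast
  qed
qed

lemma e_pow:
  assumes i: "i \<in> verts Q" and C: "C \<in> B_infinity_eps Q \<Omega> i c"
  shows "e_pow Q \<Omega> i c C \<in> B_infinity_eps Q \<Omega> i 0" "f_pow Q \<Omega> i c (e_pow Q \<Omega> i c C) = C"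
proof -
  have "C \<in> f_pow Q \<Omega> i c ` B_infinity_eps Q \<Omega> i 0" using f_pow_bij[OF i, of c] C by (auto simp: bij_betw_def)
  then show "e_pow Q \<Omega> i c C \<in> B_infinity_eps Q \<Omega> i 0" "f_pow Q \<Omega> i c (e_pow Q \<Omega> i c C) = C"
    unfolding e_pow_def by (auto intro: inv_into_into f_inv_into_f)
qed

lemma e_pow_f_pow:
  assumes i: "i \<in> verts Q" and C: "C \<in> B_infinity_eps Q \<Omega> i 0"
  shows "e_pow Q \<Omega> i c (f_pow Q \<Omega> i c C) = C"
  unfolding e_pow_def using f_pow_bij[OF i, of c] C by (auto simp: bij_betw_def inv_into_f_f)

lemma f_tilde_f_pow:
  assumes i: "i \<in> verts Q" and C: "C \<in> B_infinity_eps Q \<Omega> i 0"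
  shows "f_tilde Q \<Omega> i (f_pow Q \<Omega> i c C) = f_pow Q \<Omega> i (Suc c) C"
  unfolding f_tilde_def using f_pow_B_eps[OF i C, of c] e_pow_f_pow[OF i C, of c] by (simp add: B_eps_iff)

lemma f_pow_cases:
  assumes i: "i \<in> verts Q" and C: "C \<in> B_infinity Q \<Omega>"
  obtains D where "D \<in> B_infinity_eps Q \<Omega> i 0" "C = f_pow Q \<Omega> i (eps Q i C) D"
  using e_pow[OF i, of C "eps Q i C"] C by (auto simp: B_eps_iff)

lemma f_tilde_B:
  assumes i: "i \<in> verts Q" and C: "C \<in> B_infinity Q \<Omega>"
  shows "f_tilde Q \<Omega> i C \<in> B_infinity Q \<Omega>" "eps Q i (f_tilde Q \<Omega> i C) = Suc (eps Q i C)"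
proof -
  obtain D where D: "D \<in> B_infinity_eps Q \<Omega> i 0" "C = f_pow Q \<Omega> i (eps Q i C) D"
    by (rule f_pow_cases[OF i C])
  have "f_tilde Q \<Omega> i C = f_pow Q \<Omega> i (Suc (eps Q i C)) D"
    by (subst D(2)) (rule f_tilde_f_pow[OF i D(1)])
  then show "f_tilde Q \<Omega> i C \<in> B_infinity Q \<Omega>" "eps Q i (f_tilde Q \<Omega> i C) = Suc (eps Q i C)"
    using f_pow_B_eps[OF i D(1), of "Suc (eps Q i C)"] by (auto simp: B_eps_iff)
qed

lemma f_tilde_inj:
  assumes i: "i \<in> verts Q" and C: "C \<in> B_infinity Q \<Omega>" "C' \<in> B_infinity Q \<Omega>"
    and eq: "f_tilde Q \<Omega> i C = f_tilde Q \<Omega> i C'"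
  shows "C = C'"
proof -
  have e: "eps Q i C = eps Q i C'" using f_tilde_B(2)[OF i C(1)] f_tilde_B(2)[OF i C(2)] eq by simp
  obtain D where D: "D \<in> B_infinity_eps Q \<Omega> i 0" "C = f_pow Q \<Omega> i (eps Q i C) D"
    by (rule f_pow_cases[OF i C(1)])
  obtain D' where D': "D' \<in> B_infinity_eps Q \<Omega> i 0" "C' = f_pow Q \<Omega> i (eps Q i C') D'"
    by (rule f_pow_cases[OF i C(2)])
  have "f_tilde Q \<Omega> i C = f_pow Q \<Omega> i (Suc (eps Q i C)) D"
    by (subst D(2)) (rule f_tilde_f_pow[OF i D(1)])
  moreover have "f_tilde Q \<Omega> i C' = f_pow Q \<Omega> i (Suc (eps Q i C')) D'"
    by (subst D'(2)) (rule f_tilde_f_pow[OF i D'(1)])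
  ultimately have "D = D'"
    using eq e f_pow_bij[OF i, of "Suc (eps Q i C)"] D(1) D'(1) by (auto simp: bij_betw_def dest: inj_onD)
  then show ?thesis using D(2) D'(2) e by simp
qed

lemma f_tilde_surj:
  assumes i: "i \<in> verts Q" and C: "C \<in> B_infinity Q \<Omega>" "0 < eps Q i C"
  shows "\<exists>D\<in>B_infinity Q \<Omega>. f_tilde Q \<Omega> i D = C"
proof -
  obtain D where D: "D \<in> B_infinity_eps Q \<Omega> i 0" "C = f_pow Q \<Omega> i (eps Q i C) D"
    by (rule f_pow_cases[OF i C(1)])
  have "f_tilde Q \<Omega> i (f_pow Q \<Omega> i (eps Q i C - 1) D) = C"
    using f_tilde_f_pow[OF i D(1), of "eps Q i C - 1"] D(2) C(2) by simp
  moreover have "f_pow Q \<Omega> i (eps Q i C - 1) D \<in> B_infinity Q \<Omega>"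
    using f_pow_B_eps[OF i D(1), of "eps Q i C - 1"] by (simp add: B_eps_iff)
  ultimately show ?thesis by blast
qed

lemma total_dim_f_tilde:
  assumes i: "i \<in> verts Q" and C: "C \<in> B_infinity Q \<Omega>"
  shows "total_dim (fst (f_tilde Q \<Omega> i C)) = Suc (total_dim (fst C))"
proof -
  obtain D where D: "D \<in> B_infinity_eps Q \<Omega> i 0" "C = f_pow Q \<Omega> i (eps Q i C) D"
    by (rule f_pow_cases[OF i C])
  have dim: "total_dim (fst (f_pow Q \<Omega> i c D)) = total_dim (fst D) + c" for c
  proof -
    have "fst (f_pow Q \<Omega> i c D) = add_dim Q (fst D) (mult_root Q c i)"
      by (cases D) (simp add: f_pow_def Let_def)
    then show ?thesis
      using total_dim_agree[OF add_root(1)[OF i refl] i, of "fst D" c] add_root(2)[OF i refl, of "fst D" c] by simp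
  qed
  have "f_tilde Q \<Omega> i C = f_pow Q \<Omega> i (Suc (eps Q i C)) D"
    by (subst D(2)) (rule f_tilde_f_pow[OF i D(1)])
  then have "total_dim (fst (f_tilde Q \<Omega> i C)) = total_dim (fst D) + Suc (eps Q i C)" using dim by simp
  moreover have "total_dim (fst C) = total_dim (fst D) + eps Q i C" by (subst D(2)) (rule dim)
  ultimately show ?thesis by simp
qed

subsection \<open>Commutation at vertices that are not joined by an edge\<close>

definition unjoined :: "'i \<Rightarrow> 'i \<Rightarrow> bool" where
  "unjoined i j \<longleftrightarrow> i \<noteq> j \<and> (\<forall>h\<in>arrows Q. \<not> (in_vertex h = i \<and> out_vertex h = j))"

lemma unjoined_sym: "unjoined i j \<Longrightarrow> unjoined j i"
  unfolding unjoined_def by (metis in_rev out_rev rev_arrows)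

lemma unjoinedD:
  assumes "unjoined i j" "h \<in> arrows Q" "in_vertex h = j \<or> out_vertex h = j"
  shows "in_vertex h \<noteq> i" "out_vertex h \<noteq> i"
proof -
  have *: "\<And>h. h \<in> arrows Q \<Longrightarrow> \<not> (in_vertex h = i \<and> out_vertex h = j)"
    "\<And>h. h \<in> arrows Q \<Longrightarrow> \<not> (in_vertex h = j \<and> out_vertex h = i)" "i \<noteq> j"
    using assms(1) unjoined_sym[OF assms(1)] unfolding unjoined_def by auto
  show "in_vertex h \<noteq> i" "out_vertex h \<noteq> i" using *(1)[OF assms(2)] *(2)[OF assms(2)] *(3) assms(3) by auto
qed

text \<open>The arrows into \<open>j\<close> do not start or end at \<open>i\<close>, so they are the same for \<open>x\<close> and for its restriction.\<close>

lemma eps_rep_other: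
  assumes ij: "unjoined i j" and j: "j \<in> verts Q" and v: "agree_off i v v1" and restr: "restricts i \<phi> x z"
  shows "eps_rep Q v j x = eps_rep Q v1 j z"
proof (rule eps_rep_cong)
  have h: "x h = z h \<and> v (out_vertex h) = v1 (out_vertex h)" if "h \<in> arrows_into Q j" for h
    using restr v unjoinedD[OF ij arrows_intoD(1)[OF that]] arrows_intoD[OF that]
    unfolding restricts_def agree_off_def by auto
  show vj: "v j = v1 j" using v j ij unfolding agree_off_def unjoined_def by auto
  have P: "(\<Pi>\<^sub>E h\<in>arrows_into Q j. carrier_vec (v (out_vertex h))) =
      (\<Pi>\<^sub>E h\<in>arrows_into Q j. carrier_vec (v1 (out_vertex h)))"
    using h by (intro PiE_cong) simp
  show "incoming_image Q v j x = incoming_image Q v1 j z"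
    unfolding incoming_image_def P vj using h by (intro image_cong refl eq_vecI) (auto intro!: sum.cong)
qed

text \<open>The locus in a component where two of the cokernels have their generic dimensions.\<close>

lemma double_stratum_dense:
  assumes X: "irreducible_in (zariski Q v) X"
  shows "eps_stratum v i X \<subseteq> zariski Q v closure_of (eps_stratum v i X \<inter> eps_stratum v j X)"
    and "eps_stratum v i X \<inter> eps_stratum v j X \<noteq> {}"
proof -
  have XR: "X \<subseteq> reps Q v" using X unfolding irreducible_zariski by simp
  let ?U = "{x \<in> reps Q v. eps_rep Q v j x \<le> eps Q j (v, X)}"
  have eq: "?U \<inter> eps_stratum v i X = eps_stratum v i X \<inter> eps_stratum v j X"
    using XR eps_attained(2)[OF X, of _ j] unfolding eps_stratum_def by (auto intro: antisym)
  obtain x where x: "x \<in> X" "eps_rep Q v j x = eps Q j (v, X)" using eps_attained(1)[OF X] by blast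
  have "x \<in> zariski Q v closure_of eps_stratum v i X" using eps_stratum(2)[OF X] x(1) by blast
  moreover have "x \<in> ?U" using x XR by auto
  ultimately obtain y where "y \<in> eps_stratum v i X" "y \<in> ?U"
    using openin_eps_rep_le[of v j "eps Q j (v, X)"] unfolding in_closure_of by meson
  then have ne: "?U \<inter> eps_stratum v i X \<noteq> {}" by (intro notI) (simp only: disjoint_iff)
  then show "eps_stratum v i X \<inter> eps_stratum v j X \<noteq> {}" unfolding eq .
  from irreducible_in_open_subset(2)[OF eps_stratum(1)[OF X] openin_eps_rep_le ne]
  show "eps_stratum v i X \<subseteq> zariski Q v closure_of (eps_stratum v i X \<inter> eps_stratum v j X)"
    unfolding eq .
qed

text \<open>All lifts of a point have the same cokernel at \<open>j\<close> as this point, so the minimal values agree.\<close>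

lemma eps_f_pow_other:
  assumes i: "i \<in> verts Q" and j: "j \<in> verts Q" and ij: "unjoined i j" and C: "C \<in> B_infinity_eps Q \<Omega> i 0"
  shows "eps Q j (f_pow Q \<Omega> i c C) = eps Q j C"
proof -
  obtain v1 X where X: "C = (v1, X)" by (cases C)
  then have X': "X \<in> components v1" "eps Q i (v1, X) = 0"
    using C unfolding B_eps_iff by (auto simp: B_infinity_iff)
  define v where "v = add_dim Q v1 (mult_root Q c i)"
  note r = add_root[OF i v_def]
  note irr = componentD(2)[OF X'(1)]
  note st = stratum[OF i r(1,3) X']
  obtain z where z: "z \<in> eps_stratum v1 i X" "z \<in> eps_stratum v1 j X"
    using double_stratum_dense(2)[OF irr, of i j] by blast
  have zL: "z \<in> Lam Q \<Omega> v1" using z(1) st(2) by auto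
  have el: "\<exists>y\<in>eps_stratum v1 i X. eps_rep Q v j x = eps_rep Q v1 j y"
    if x: "x \<in> lifts i v v1 (eps_stratum v1 i X)" for x
  proof -
    obtain \<phi> y where "y \<in> eps_stratum v1 i X" "restricts i \<phi> x y" using x unfolding lifts_def by blast
    then show ?thesis using eps_rep_other[OF ij j r(1)] by blast
  qed
  let ?x = "frame_lift i v v1 (1\<^sub>m (v i)) (1\<^sub>m (v i)) (0\<^sub>m (width v i) (v i - v1 i)) z"
  have xr: "restricts i (1\<^sub>m (v i) * incl (v i) (v1 i)) ?x z"
    by (rule frame_lift_restricts[OF i r(1,3) zL]) (use in_index_cong(2)[OF r(1)] in auto)
  have R: "lifts i v v1 (eps_stratum v1 i X) \<subseteq> reps Q v"
    using lifts_Lam[OF i r(1,3), of "eps_stratum v1 i X"] Lam_reps by blast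
  have "eps Q j (v, lift_closure i v v1 X) = eps Q j (v1, X)"
  proof (rule eps_eqI[OF lift_closure_irreducible[OF i r(1,3) X']])
    show "?x \<in> lift_closure i v v1 X"
      using lifts_nonempty(1)[OF i r(1,3) zL z(1)] lifts_subset_closure[OF i r(1,3) X'] by blast
    show "eps_rep Q v j ?x = eps Q j (v1, X)"
      using eps_rep_other[OF ij j r(1) xr] z(2) unfolding eps_stratum_def by simp
    have "lifts i v v1 (eps_stratum v1 i X) \<subseteq> {x \<in> reps Q v. eps Q j (v1, X) \<le> eps_rep Q v j x}"
    proof
      fix x assume x: "x \<in> lifts i v v1 (eps_stratum v1 i X)"
      from el[OF x] obtain y where "y \<in> X" "eps_rep Q v j x = eps_rep Q v1 j y" using st(3) by blast
      then show "x \<in> {x \<in> reps Q v. eps Q j (v1, X) \<le> eps_rep Q v j x}"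
        using eps_attained(2)[OF irr, of y j] x R by auto
    qed
    then have "lift_closure i v v1 X \<subseteq> {x \<in> reps Q v. eps Q j (v1, X) \<le> eps_rep Q v j x}"
      unfolding lift_closure_def[OF i r(1,3)] by (intro closure_of_minimal closedin_eps_rep_ge)
    then show "eps Q j (v1, X) \<le> eps_rep Q v j x" if "x \<in> lift_closure i v v1 X" for x using that by auto
  qed
  then show ?thesis unfolding X f_pow_eq_lift_closure[OF i v_def X'] by simp
qed

text \<open>The arrows at \<open>i\<close> and the arrows at \<open>j\<close> are disjoint, so the two restrictions do not interfere and can
be performed in either order. The representation restricted only at \<open>j\<close> takes the arrows at \<open>i\<close> from
\<open>x\<close> and all others from \<open>z\<close>.\<close>

lemma lifts_commute_subset:
  assumes i: "i \<in> verts Q" and j: "j \<in> verts Q" and ij: "unjoined i j"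
    and u: "u = add_dim Q v1 (mult_root Q d j)" and u': "u' = add_dim Q v1 (mult_root Q c i)"
    and v: "v = add_dim Q u (mult_root Q c i)" "v = add_dim Q u' (mult_root Q d j)"
    and U: "U \<subseteq> Lam Q \<Omega> v1"
  shows "lifts i v u (lifts j u v1 U) \<subseteq> lifts j v u' (lifts i u' v1 U)"
proof
  note ru = add_root[OF j u] and ru' = add_root[OF i u'] and rv = add_root[OF i v(1)] and rv' = add_root[OF j v(2)]
  have ne: "i \<noteq> j" using ij unfolding unjoined_def by simp
  have dims: "u i = v1 i" "v j = u j" "u' j = v1 j" "v i = u' i"
    using ru(1) rv(1) ru'(1) rv'(1) i j ne unfolding agree_off_def by auto
  fix x assume "x \<in> lifts i v u (lifts j u v1 U)"
  then obtain \<phi> P y where y: "x \<in> Lam Q \<Omega> v" "\<phi> \<in> carrier_mat (v i) (u i)" "P \<in> carrier_mat (u i) (v i)"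
    "P * \<phi> = 1\<^sub>m (u i)" "y \<in> lifts j u v1 U" "restricts i \<phi> x y"
    unfolding lifts_def by blast
  then obtain \<psi> R z where z: "y \<in> Lam Q \<Omega> u" "\<psi> \<in> carrier_mat (u j) (v1 j)" "R \<in> carrier_mat (v1 j) (u j)"
    "R * \<psi> = 1\<^sub>m (v1 j)" "z \<in> U" "restricts j \<psi> y z"
    unfolding lifts_def by blast
  have zL: "z \<in> Lam Q \<Omega> v1" using z(5) U by auto
  note xr = Lam_reps[OF y(1)] and yr = Lam_reps[OF z(1)] and zr = Lam_reps[OF zL]
  define t where "t = (\<lambda>h\<in>arrows Q. if in_vertex h = i \<or> out_vertex h = i then x h else z h)"
  have tr: "t \<in> reps Q u'"
  proof (rule repsI)
    fix h assume h: "h \<in> arrows Q"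
    note hD = arrowsD[OF h]
    show "t h \<in> carrier_mat (u' (in_vertex h)) (u' (out_vertex h))"
    proof (cases "in_vertex h = i \<or> out_vertex h = i")
      case True
      then have "in_vertex h \<noteq> j" "out_vertex h \<noteq> j" using unjoinedD[OF unjoined_sym[OF ij] h] by auto
      then have "v (in_vertex h) = u' (in_vertex h)" "v (out_vertex h) = u' (out_vertex h)"
        using rv'(1) hD unfolding agree_off_def by auto
      then show ?thesis using repsD[OF xr h] True h by (simp add: t_def)
    next
      case False
      then have "u' (in_vertex h) = v1 (in_vertex h)" "u' (out_vertex h) = v1 (out_vertex h)"
        using ru'(1) hD unfolding agree_off_def by auto
      then show ?thesis using repsD[OF zr h] False h by (simp add: t_def)
    qed
  qed (simp add: t_def)
  have xt: "restricts j \<psi> x t"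
    unfolding restricts_def
  proof (intro ballI conjI impI)
    fix h assume h: "h \<in> arrows Q"
    note rx = bspec[OF y(6)[unfolded restricts_def] h] and ry = bspec[OF z(6)[unfolded restricts_def] h]
    show "x h = \<psi> * t h" if hj: "in_vertex h = j"
    proof -
      note ni = unjoinedD[OF ij h disjI1[OF hj]]
      have "x h = y h" "y h = \<psi> * z h" using rx ry ni hj by blast+
      then show ?thesis using h ni by (simp add: t_def)
    qed
    show "t h = x h * \<psi>" if hj: "out_vertex h = j"
    proof -
      note ni = unjoinedD[OF ij h disjI2[OF hj]]
      have "x h = y h" "z h = y h * \<psi>" using rx ry ni hj by blast+
      then show ?thesis using h ni by (simp add: t_def)
    qed
    show "x h = t h" if "in_vertex h \<noteq> j" "out_vertex h \<noteq> j"
    proof (cases "in_vertex h = i \<or> out_vertex h = i")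
      case True
      then show ?thesis using h by (simp add: t_def)
    next
      case False
      then have "x h = y h" "y h = z h" using rx ry that by blast+
      then show ?thesis using h False by (simp add: t_def)
    qed
  qed
  have tz: "restricts i \<phi> t z"
    unfolding restricts_def
  proof (intro ballI conjI impI)
    fix h assume h: "h \<in> arrows Q"
    note rx = bspec[OF y(6)[unfolded restricts_def] h] and ry = bspec[OF z(6)[unfolded restricts_def] h]
    show "t h = \<phi> * z h" if hi: "in_vertex h = i"
    proof -
      note nj = unjoinedD[OF unjoined_sym[OF ij] h disjI1[OF hi]]
      have "x h = \<phi> * y h" "y h = z h" using rx ry nj hi by blast+
      then show ?thesis using h hi by (simp add: t_def)
    qed
    show "z h = t h * \<phi>" if hi: "out_vertex h = i"
    proof -
      note nj = unjoinedD[OF unjoined_sym[OF ij] h disjI2[OF hi]]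
      have "y h = x h * \<phi>" "y h = z h" using rx ry nj hi by blast+
      then show ?thesis using h hi by (simp add: t_def)
    qed
    show "t h = z h" if "in_vertex h \<noteq> i" "out_vertex h \<noteq> i"
      using that h by (simp add: t_def)
  qed
  have \<psi>: "\<psi> \<in> carrier_mat (v j) (u' j)" "R \<in> carrier_mat (u' j) (v j)" "R * \<psi> = 1\<^sub>m (u' j)"
    using z(2-4) dims by auto
  have \<phi>: "\<phi> \<in> carrier_mat (u' i) (v1 i)" "P \<in> carrier_mat (v1 i) (u' i)" "P * \<phi> = 1\<^sub>m (v1 i)"
    using y(2-4) dims by auto
  have tL: "t \<in> Lam Q \<Omega> u'"
    using Lam_restriction_iff[OF j xr tr rv'(1) \<psi> xt] y(1) by simp
  then have "t \<in> lifts i u' v1 U" unfolding lifts_def using \<phi> z(5) tz by blast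
  then show "x \<in> lifts j v u' (lifts i u' v1 U)" unfolding lifts_def using y(1) \<psi> xt by blast
qed

text \<open>Lifting twice from the points where both cokernels are generic suffices, because these points are dense
in the locus from which each single lift is taken. In this form the two operators enter symmetrically.\<close>

lemma f_pow_f_pow:
  assumes i: "i \<in> verts Q" and j: "j \<in> verts Q" and ij: "unjoined i j"
    and X: "X \<in> components v1" "eps Q i (v1, X) = 0" "eps Q j (v1, X) = 0"
    and u: "u = add_dim Q v1 (mult_root Q d j)" and v: "v = add_dim Q u (mult_root Q c i)"
    and d: "v1 \<in> dim_vectors Q"
  shows "f_pow Q \<Omega> i c (f_pow Q \<Omega> j d (v1, X)) =
    (v, zariski Q v closure_of lifts i v u (lifts j u v1 (eps_stratum v1 i X \<inter> eps_stratum v1 j X)))"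
proof -
  note ru = add_root[OF j u] and rv = add_root[OF i v]
  let ?U = "eps_stratum v1 i X \<inter> eps_stratum v1 j X" and ?Y = "lift_closure j u v1 X"
  have f: "f_pow Q \<Omega> j d (v1, X) = (u, ?Y)" by (rule f_pow_eq_lift_closure[OF j u X(1,3)])
  have Y: "?Y \<in> components u"
    by (rule lift_closure_component[OF j ru(1,3) X(1,3)])
  have CB: "(v1, X) \<in> B_infinity_eps Q \<Omega> j 0" using X(1,3) d unfolding B_eps_iff by (simp add: B_infinity_iff)
  have eY: "eps Q i (u, ?Y) = 0"
    using eps_f_pow_other[OF j i unjoined_sym[OF ij] CB, of d] X(2) unfolding f by simp
  have ff: "f_pow Q \<Omega> i c (u, ?Y) = (v, lift_closure i v u ?Y)"
    by (rule f_pow_eq_lift_closure[OF i v Y eY])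
  note irr = componentD(2)[OF X(1)]
  have sX: "eps_stratum v1 j X \<subseteq> Lam Q \<Omega> v1" using stratum(2)[OF j ru(1,3) X(1,3)] .
  have UL: "?U \<subseteq> Lam Q \<Omega> v1" using sX by auto
  let ?D = "lifts j u v1 ?U"
  have D1: "lifts j u v1 (eps_stratum v1 j X) \<subseteq> zariski Q u closure_of ?D"
  proof (rule lifts_dense[OF j ru(1,3) sX])
    show "rank_ge (v1 j) (in_mat v1 j z) \<or> u j = v1 j" if "z \<in> eps_stratum v1 j X" for z
      using stratum(4)[OF j ru(1,3) X(1,3) that] by simp
    show "?U \<subseteq> eps_stratum v1 j X" by auto
    show "eps_stratum v1 j X \<subseteq> zariski Q v1 closure_of ?U"
      using double_stratum_dense(1)[OF irr, of j i] by (simp add: Int_commute)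
  qed
  have YD: "?Y \<subseteq> zariski Q u closure_of ?D"
    unfolding lift_closure_def[OF j ru(1,3)] using D1 by (intro closure_of_minimal) auto
  have DY: "?D \<subseteq> eps_stratum u i ?Y"
  proof
    fix y assume y: "y \<in> ?D"
    then obtain \<psi> z where z: "z \<in> ?U" "restricts j \<psi> y z" unfolding lifts_def by blast
    have "eps_rep Q u i y = eps_rep Q v1 i z"
      by (rule eps_rep_other[OF unjoined_sym[OF ij] i ru(1) z(2)])
    then have "eps_rep Q u i y = 0" using z(1) X(2) unfolding eps_stratum_def by simp
    moreover have "y \<in> ?Y"
      using y lifts_mono[OF j ru(1,3), of ?U "eps_stratum v1 j X"] lifts_subset_closure[OF j ru(1,3) X(1,3)] by blast
    ultimately show "y \<in> eps_stratum u i ?Y" unfolding eps_stratum_def eY by simp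
  qed
  have dense: "lifts i v u (eps_stratum u i ?Y) \<subseteq> zariski Q v closure_of (lifts i v u ?D)"
  proof (rule lifts_dense[OF i rv(1,3) stratum(2)[OF i rv(1,3) Y eY] _ DY])
    show "rank_ge (u i) (in_mat u i z) \<or> v i = u i" if "z \<in> eps_stratum u i ?Y" for z
      using stratum(4)[OF i rv(1,3) Y eY that] by simp
    show "eps_stratum u i ?Y \<subseteq> zariski Q u closure_of ?D"
      using YD stratum(3)[OF i rv(1,3) Y eY] by auto
  qed
  have "lift_closure i v u ?Y = zariski Q v closure_of (lifts i v u ?D)"
  proof (intro equalityI)
    show "lift_closure i v u ?Y \<subseteq> zariski Q v closure_of (lifts i v u ?D)"
      unfolding lift_closure_def[OF i rv(1,3)] using dense by (intro closure_of_minimal) auto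
    show "zariski Q v closure_of (lifts i v u ?D) \<subseteq> lift_closure i v u ?Y"
      unfolding lift_closure_def[OF i rv(1,3)]
      by (intro closure_of_mono lifts_mono[OF i rv(1,3)] DY)
  qed
  then show ?thesis unfolding f ff by simp
qed

lemma f_pow_commute:
  assumes i: "i \<in> verts Q" and j: "j \<in> verts Q" and ij: "unjoined i j"
    and C: "C \<in> B_infinity_eps Q \<Omega> i 0" "C \<in> B_infinity_eps Q \<Omega> j 0"
  shows "f_pow Q \<Omega> i c (f_pow Q \<Omega> j d C) = f_pow Q \<Omega> j d (f_pow Q \<Omega> i c C)"
proof -
  obtain v1 X where XC: "C = (v1, X)" by (cases C)
  have X: "X \<in> components v1" "eps Q i (v1, X) = 0" "eps Q j (v1, X) = 0"
    and dv: "v1 \<in> dim_vectors Q"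
    using C unfolding XC B_eps_iff by (auto simp: B_infinity_iff)
  define u where "u = add_dim Q v1 (mult_root Q d j)"
  define u' where "u' = add_dim Q v1 (mult_root Q c i)"
  define v where "v = add_dim Q u (mult_root Q c i)"
  have v': "v = add_dim Q u' (mult_root Q d j)"
    unfolding v_def u_def u'_def add_dim_def by (intro restrict_ext) auto
  let ?U = "eps_stratum v1 i X \<inter> eps_stratum v1 j X"
  have U: "?U \<subseteq> Lam Q \<Omega> v1" using componentD(1)[OF X(1)] unfolding eps_stratum_def by auto
  have "lifts i v u (lifts j u v1 ?U) = lifts j v u' (lifts i u' v1 ?U)"
    using lifts_commute_subset[OF i j ij u_def u'_def v_def v' U]
      lifts_commute_subset[OF j i unjoined_sym[OF ij] u'_def u_def v' v_def U] by auto
  then show ?thesis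
    unfolding XC f_pow_f_pow[OF i j ij X u_def v_def dv]
      f_pow_f_pow[OF j i unjoined_sym[OF ij] X(1,3,2) u'_def v' dv]
    by (simp add: Int_commute)
qed

lemma double_f_pow_cases:
  assumes i: "i \<in> verts Q" and j: "j \<in> verts Q" and ij: "unjoined i j" and C: "C \<in> B_infinity Q \<Omega>"
  obtains D where "D \<in> B_infinity_eps Q \<Omega> i 0" "D \<in> B_infinity_eps Q \<Omega> j 0"
    "C = f_pow Q \<Omega> i (eps Q i C) (f_pow Q \<Omega> j (eps Q j C) D)"
proof -
  obtain D1 where D1: "D1 \<in> B_infinity_eps Q \<Omega> i 0" "C = f_pow Q \<Omega> i (eps Q i C) D1"
    by (rule f_pow_cases[OF i C])
  have D1B: "D1 \<in> B_infinity Q \<Omega>" using D1(1) by (simp add: B_eps_iff)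
  obtain D where D: "D \<in> B_infinity_eps Q \<Omega> j 0" "D1 = f_pow Q \<Omega> j (eps Q j D1) D"
    by (rule f_pow_cases[OF j D1B])
  have "eps Q j C = eps Q j D1" by (subst D1(2)) (rule eps_f_pow_other[OF i j ij D1(1)])
  moreover have "eps Q i D1 = eps Q i D" by (subst D(2)) (rule eps_f_pow_other[OF j i unjoined_sym[OF ij] D(1)])
  ultimately show ?thesis using that[of D] D1 D by (simp add: B_eps_iff)
qed

text \<open>Both statements reduce to the operators \<^const>\<open>f_pow\<close>, as every component arises from one with
\<open>\<epsilon>\<^sub>i = \<epsilon>\<^sub>j = 0\<close>.\<close>

lemma f_tilde_commute:
  assumes i: "i \<in> verts Q" and j: "j \<in> verts Q" and ij: "unjoined i j" and C: "C \<in> B_infinity Q \<Omega>"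
  shows "f_tilde Q \<Omega> i (f_tilde Q \<Omega> j C) = f_tilde Q \<Omega> j (f_tilde Q \<Omega> i C)"
    and "eps Q j (f_tilde Q \<Omega> i C) = eps Q j C"
proof -
  let ?a = "eps Q i C" and ?b = "eps Q j C"
  obtain D where D: "D \<in> B_infinity_eps Q \<Omega> i 0" "D \<in> B_infinity_eps Q \<Omega> j 0"
    "C = f_pow Q \<Omega> i ?a (f_pow Q \<Omega> j ?b D)"
    by (rule double_f_pow_cases[OF i j ij C])
  have comm: "f_pow Q \<Omega> i a (f_pow Q \<Omega> j b D) = f_pow Q \<Omega> j b (f_pow Q \<Omega> i a D)" for a b
    by (rule f_pow_commute[OF i j ij D(1,2)])
  have fi: "f_pow Q \<Omega> i a D \<in> B_infinity_eps Q \<Omega> j 0" for a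
    using f_pow_B_eps[OF i D(1), of a] eps_f_pow_other[OF i j ij D(1), of a] D(2) by (simp add: B_eps_iff)
  have fj: "f_pow Q \<Omega> j b D \<in> B_infinity_eps Q \<Omega> i 0" for b
    using f_pow_B_eps[OF j D(2), of b] eps_f_pow_other[OF j i unjoined_sym[OF ij] D(2), of b] D(1)
    by (simp add: B_eps_iff)
  have ti: "f_tilde Q \<Omega> i (f_pow Q \<Omega> i a (f_pow Q \<Omega> j b D)) = f_pow Q \<Omega> i (Suc a) (f_pow Q \<Omega> j b D)" for a b
    by (rule f_tilde_f_pow[OF i fj])
  have tj: "f_tilde Q \<Omega> j (f_pow Q \<Omega> i a (f_pow Q \<Omega> j b D)) = f_pow Q \<Omega> i a (f_pow Q \<Omega> j (Suc b) D)" for a b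
    unfolding comm by (rule f_tilde_f_pow[OF j fi])
  have "f_tilde Q \<Omega> i (f_tilde Q \<Omega> j (f_pow Q \<Omega> i ?a (f_pow Q \<Omega> j ?b D))) =
      f_tilde Q \<Omega> j (f_tilde Q \<Omega> i (f_pow Q \<Omega> i ?a (f_pow Q \<Omega> j ?b D)))"
    unfolding ti tj ..
  then show "f_tilde Q \<Omega> i (f_tilde Q \<Omega> j C) = f_tilde Q \<Omega> j (f_tilde Q \<Omega> i C)"
    unfolding D(3)[symmetric] .
  have "eps Q j (f_tilde Q \<Omega> i (f_pow Q \<Omega> i ?a (f_pow Q \<Omega> j ?b D))) = eps Q j (f_pow Q \<Omega> i ?a (f_pow Q \<Omega> j ?b D))"
    unfolding ti eps_f_pow_other[OF i j ij fj] ..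
  then show "eps Q j (f_tilde Q \<Omega> i C) = eps Q j C" unfolding D(3)[symmetric] .
qed

end

section \<open>The action of the automorphism\<close>

lemma rep_fun_closure:
  assumes \<Phi>: "rep_fun (polynomial_functions Q v) Q u \<Phi>" "\<And>x. x \<in> reps Q v \<Longrightarrow> \<Phi> x \<in> reps Q u"
    and S: "S \<subseteq> reps Q v" and x: "x \<in> zariski Q v closure_of S"
  shows "\<Phi> x \<in> zariski Q u closure_of \<Phi> ` S"
proof -
  have SR: "\<Phi> ` S \<subseteq> reps Q u" using S \<Phi>(2) by auto
  have "p (\<Phi> x) = 0" if p: "p \<in> polynomial_functions Q u" "\<forall>s\<in>\<Phi> ` S. p s = 0" for p
  proof -
    have "(\<lambda>y. p (\<Phi> y)) \<in> polynomial_functions Q v"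
      by (rule polynomial_functions_comp[OF function_ring_polynomial_functions \<Phi>(1) p(1)])
    moreover have "\<forall>s\<in>S. p (\<Phi> s) = 0" using p(2) by simp
    ultimately show ?thesis using x unfolding in_closure_zariski[OF S] by (elim conjE) (drule bspec, assumption, simp)
  qed
  moreover have "\<Phi> x \<in> reps Q u" using x \<Phi>(2) unfolding in_closure_zariski[OF S] by simp
  ultimately show ?thesis unfolding in_closure_zariski[OF SR] by simp
qed

lemma rep_fun_irreducible:
  assumes \<Phi>: "rep_fun (polynomial_functions Q v) Q u \<Phi>" "\<And>x. x \<in> reps Q v \<Longrightarrow> \<Phi> x \<in> reps Q u"
    and S: "irreducible_in (zariski Q v) S"
  shows "irreducible_in (zariski Q u) (\<Phi> ` S)"
proof (rule irreducible_polynomial_image[OF S \<Phi>(1)])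
  show "\<Phi> x \<in> reps Q u" if "x \<in> S" for x using that S \<Phi>(2) unfolding irreducible_zariski by blast
qed

locale quiver_automorphism = quiver Q \<Omega>
  for Q :: "('i, 'e) graph" and \<Omega> :: "('i, 'e) arrow set" +
  fixes a :: "'i \<Rightarrow> 'i" and b :: "'e \<Rightarrow> 'e"
  assumes admissible: "admissible_automorphism Q a b" and orientation_invariant: "act_arrow a b ` \<Omega> = \<Omega>"
begin

lemma automorphism:
  "bij_betw a (verts Q) (verts Q)" "bij_betw b (edges Q) (edges Q)"
  "e \<in> edges Q \<Longrightarrow> ends Q (b e) = a ` ends Q e"
  using admissible unfolding admissible_automorphism_def graph_automorphism_def by auto

lemma act_vertex: "i \<in> verts Q \<Longrightarrow> a i \<in> verts Q" "a ` verts Q = verts Q" "inj_on a (verts Q)"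
  using automorphism(1) by (auto simp: bij_betw_def)

lemma vertex_eq_iff: "i \<in> verts Q \<Longrightarrow> j \<in> verts Q \<Longrightarrow> a i = a j \<longleftrightarrow> i = j"
  using act_vertex(3) by (auto dest: inj_onD)

abbreviation "act_h \<equiv> act_arrow a b"

lemma act_arrow_ends [simp]:
  "in_vertex (act_h h) = a (in_vertex h)" "out_vertex (act_h h) = a (out_vertex h)"
  "rev_arrow (act_h h) = act_h (rev_arrow h)"
  by (cases h; simp)+

lemma act_arrow_bij: "bij_betw act_h (arrows Q) (arrows Q)"
proof -
  have "act_h ` arrows Q \<subseteq> arrows Q"
    using automorphism(2,3) unfolding arrows_def by (auto simp: bij_betw_def)
  moreover have inj: "inj_on act_h (arrows Q)"
  proof (rule inj_onI)
    fix h h' assume h: "h \<in> arrows Q" "h' \<in> arrows Q" "act_h h = act_h h'"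
    have "in_vertex h = in_vertex h'" "out_vertex h = out_vertex h'"
      using arg_cong[OF h(3), of in_vertex] arg_cong[OF h(3), of out_vertex]
        arrowsD(1,2)[OF h(1)] arrowsD(1,2)[OF h(2)] by (simp_all add: vertex_eq_iff)
    moreover have "fst h = fst h'"
    proof -
      have "b (fst h) = b (fst h')" using h(3) by (cases h; cases h') auto
      moreover have "fst h \<in> edges Q" "fst h' \<in> edges Q" using h(1,2) unfolding arrows_def by auto
      ultimately show ?thesis using automorphism(2) by (auto simp: bij_betw_def dest: inj_onD)
    qed
    ultimately show "h = h'" by (cases h; cases h') simp
  qed
  ultimately show ?thesis
    using endo_inj_surj[OF finite_arrows[OF graph]] by (auto simp: bij_betw_def)
qed

lemma act_arrow_in: "h \<in> arrows Q \<Longrightarrow> act_h h \<in> arrows Q"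
  using act_arrow_bij by (auto simp: bij_betw_def)

lemma arrow_cases:
  assumes "h \<in> arrows Q"
  obtains k where "k \<in> arrows Q" "h = act_h k"
  using assms that bij_betw_imp_surj_on[OF act_arrow_bij] by (metis imageE)

lemma vertex_cases:
  assumes "i \<in> verts Q"
  obtains j where "j \<in> verts Q" "i = a j"
  using assms act_vertex(2) by (metis imageE)

lemma act_arrows_into:
  assumes i: "i \<in> verts Q"
  shows "arrows_into Q (a i) = act_h ` arrows_into Q i"
proof (intro equalityI subsetI)
  fix h assume h: "h \<in> arrows_into Q (a i)"
  obtain k where k: "k \<in> arrows Q" "h = act_h k" using arrow_cases arrows_intoD(1)[OF h] by blast
  then have "in_vertex k = i" using arrows_intoD(2)[OF h] vertex_eq_iff[OF arrowsD(1)[OF k(1)] i] by simp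
  then show "h \<in> act_h ` arrows_into Q i" using k unfolding arrows_into_def by auto
next
  fix h assume "h \<in> act_h ` arrows_into Q i"
  then obtain k where k: "k \<in> arrows_into Q i" "h = act_h k" by blast
  show "h \<in> arrows_into Q (a i)"
    using act_arrow_in[OF arrows_intoD(1)[OF k(1)]] arrows_intoD(2)[OF k(1)]
    unfolding k(2) by (subst arrows_into_def) simp
qed

lemma act_arrow_inj_into: "inj_on act_h (arrows_into Q i)"
  by (rule inj_on_subset[OF bij_betw_imp_inj_on[OF act_arrow_bij]]) (auto simp: arrows_into_def)

lemma act_arrow_sign: "h \<in> arrows Q \<Longrightarrow> arrow_sign \<Omega> (act_h h) = arrow_sign \<Omega> h"
proof -
  assume h: "h \<in> arrows Q"
  have \<Omega>: "\<Omega> \<subseteq> arrows Q" using orientation unfolding orientation_def by auto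
  have "h \<in> \<Omega>" if "act_h h \<in> \<Omega>"
  proof -
    have "act_h h \<in> act_h ` \<Omega>" unfolding orientation_invariant by (rule that)
    then obtain k where k: "k \<in> \<Omega>" "act_h h = act_h k" by (rule imageE) simp
    then have "h = k" using inj_onD[OF bij_betw_imp_inj_on[OF act_arrow_bij]] h \<Omega> by blast
    then show ?thesis using k by simp
  qed
  moreover have "act_h h \<in> \<Omega>" if "h \<in> \<Omega>" using imageI[OF that, of "act_h"] orientation_invariant by simp
  ultimately show ?thesis unfolding arrow_sign_def by (simp only: split: if_split) blast
qed

abbreviation "act_v \<equiv> act_dim Q a"
abbreviation "act_x \<equiv> act_rep Q a b"
abbreviation "act_C \<equiv> act_component Q a b"

lemma act_v_at: "i \<in> verts Q \<Longrightarrow> act_v v (a i) = v i"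
  unfolding act_dim_def using act_vertex by (simp add: inv_into_f_f)

lemma act_x_at: "h \<in> arrows Q \<Longrightarrow> act_x x (act_h h) = x h"
  unfolding act_rep_def using act_arrow_in act_arrow_bij by (simp add: bij_betw_def inv_into_f_f)

text \<open>The inverse of the action on representations, in a form in which it is visibly polynomial.\<close>

definition unact :: "('i, 'e) rep \<Rightarrow> ('i, 'e) rep" where
  "unact y = (\<lambda>h\<in>arrows Q. y (act_h h))"

lemma act_reps: "x \<in> reps Q v \<Longrightarrow> act_x x \<in> reps Q (act_v v)"
proof (rule repsI)
  fix h assume x: "x \<in> reps Q v" and "h \<in> arrows Q"
  then obtain k where k: "k \<in> arrows Q" "h = act_h k" using arrow_cases by blast
  show "act_x x h \<in> carrier_mat (act_v v (in_vertex h)) (act_v v (out_vertex h))"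
    using repsD[OF x k(1)] arrowsD(1,2)[OF k(1)] k by (simp add: act_x_at act_v_at)
qed (simp add: act_rep_def)

lemma unact_reps: "y \<in> reps Q (act_v v) \<Longrightarrow> unact y \<in> reps Q v"
proof (rule repsI)
  fix h assume y: "y \<in> reps Q (act_v v)" and h: "h \<in> arrows Q"
  show "unact y h \<in> carrier_mat (v (in_vertex h)) (v (out_vertex h))"
    using repsD[OF y act_arrow_in[OF h]] arrowsD(1,2)[OF h] h by (simp add: unact_def act_v_at)
qed (simp add: unact_def)

lemma unact_act: "x \<in> reps Q v \<Longrightarrow> unact (act_x x) = x"
proof (rule extensionalityI)
  assume x: "x \<in> reps Q v"
  show "unact (act_x x) \<in> extensional (arrows Q)" "x \<in> extensional (arrows Q)"
    using x by (auto simp: unact_def reps_def PiE_iff)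
qed (simp add: unact_def act_x_at)

lemma act_unact: "y \<in> reps Q u \<Longrightarrow> act_x (unact y) = y"
proof (rule extensionalityI)
  assume y: "y \<in> reps Q u"
  show "act_x (unact y) \<in> extensional (arrows Q)" "y \<in> extensional (arrows Q)"
    using y by (auto simp: act_rep_def reps_def PiE_iff)
  fix h assume "h \<in> arrows Q"
  then obtain k where "k \<in> arrows Q" "h = act_h k" using arrow_cases by blast
  then show "act_x (unact y) h = y h" by (simp add: act_x_at unact_def)
qed

lemma rep_fun_act: "rep_fun (polynomial_functions Q v) Q (act_v v) act_x"
  unfolding rep_fun_def
proof (intro ballI allI impI)
  fix h r s assume h: "h \<in> arrows Q" "r < act_v v (in_vertex h)" "s < act_v v (out_vertex h)"
  then obtain k where k: "k \<in> arrows Q" "h = act_h k" using arrow_cases by blast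
  show "(\<lambda>x. act_x x h $$ (r, s)) \<in> polynomial_functions Q v"
    unfolding k(2) act_x_at[OF k(1)]
    by (rule polynomial_functions.coord[OF k(1)]) (use h k arrowsD(1,2)[OF k(1)] in \<open>simp_all add: act_v_at\<close>)
qed

lemma rep_fun_unact: "rep_fun (polynomial_functions Q (act_v v)) Q v unact"
  unfolding rep_fun_def
proof (intro ballI allI impI)
  fix h r s assume h: "h \<in> arrows Q" "r < v (in_vertex h)" "s < v (out_vertex h)"
  have "(\<lambda>y. y (act_h h) $$ (r, s)) \<in> polynomial_functions Q (act_v v)"
    by (rule polynomial_functions.coord[OF act_arrow_in[OF h(1)]])
      (use h arrowsD(1,2)[OF h(1)] in \<open>simp_all add: act_v_at\<close>)
  then show "(\<lambda>y. unact y h $$ (r, s)) \<in> polynomial_functions Q (act_v v)" using h(1) by (simp add: unact_def)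
qed

lemma act_unact_image: "S \<subseteq> reps Q (act_v v) \<Longrightarrow> act_x ` unact ` S = S"
  unfolding image_image using act_unact by (intro trans[OF image_cong[OF refl] image_ident]) blast

lemma unact_act_image: "S \<subseteq> reps Q v \<Longrightarrow> unact ` act_x ` S = S"
  unfolding image_image using unact_act by (intro trans[OF image_cong[OF refl] image_ident]) blast

lemma act_closure:
  assumes S: "S \<subseteq> reps Q v"
  shows "act_x ` (zariski Q v closure_of S) = zariski Q (act_v v) closure_of (act_x ` S)"
proof (intro equalityI subsetI)
  fix y assume "y \<in> act_x ` (zariski Q v closure_of S)"
  then show "y \<in> zariski Q (act_v v) closure_of (act_x ` S)"
    using rep_fun_closure[OF rep_fun_act act_reps S] by blast
next
  fix y assume y: "y \<in> zariski Q (act_v v) closure_of (act_x ` S)"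
  have SR: "act_x ` S \<subseteq> reps Q (act_v v)" using S act_reps by auto
  have "unact y \<in> zariski Q v closure_of (unact ` act_x ` S)"
    by (rule rep_fun_closure[OF rep_fun_unact unact_reps SR y])
  moreover have "act_x (unact y) = y" using y act_unact unfolding in_closure_zariski[OF SR] by blast
  ultimately show "y \<in> act_x ` (zariski Q v closure_of S)" unfolding unact_act_image[OF S] by force
qed

subsection \<open>Equivariance of the nilpotent varieties and their components\<close>

lemma act_preproj_at:
  assumes i: "i \<in> verts Q"
  shows "preproj_at (act_v v) (a i) (act_x x) \<longleftrightarrow> preproj_at v i x"
proof -
  have "(\<Sum>h\<in>arrows_into Q (a i). arrow_sign \<Omega> h * (act_x x h * act_x x (rev_arrow h)) $$ (r, s)) =
      (\<Sum>h\<in>arrows_into Q i. arrow_sign \<Omega> h * (x h * x (rev_arrow h)) $$ (r, s))" for r s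
    unfolding act_arrows_into[OF i] sum.reindex[OF act_arrow_inj_into] comp_def
    by (intro sum.cong refl) (simp add: arrows_intoD(1) act_arrow_sign act_x_at)
  then show ?thesis unfolding preproj_at_def act_v_at[OF i] by simp
qed

lemma act_path:
  assumes "set hs \<subseteq> arrows Q"
  shows "is_path (map act_h hs) \<longleftrightarrow> is_path hs"
proof -
  have "successively (\<lambda>h h'. out_vertex h = in_vertex h') (map act_h hs) \<longleftrightarrow>
      successively (\<lambda>h h'. out_vertex h = in_vertex h') hs"
    unfolding successively_map
  proof (rule successively_cong[OF _ refl])
    fix h k assume "h \<in> set hs" "k \<in> set hs"
    then have "out_vertex h \<in> verts Q" "in_vertex k \<in> verts Q" using assms arrowsD(1,2) by blast+
    then show "out_vertex (act_h h) = in_vertex (act_h k) \<longleftrightarrow> out_vertex h = in_vertex k"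
      using vertex_eq_iff by simp
  qed
  then show ?thesis unfolding is_path_def using assms act_arrow_in by auto
qed

lemma act_path_mat: "set hs \<subseteq> arrows Q \<Longrightarrow> hs \<noteq> [] \<Longrightarrow> path_mat (act_x x) (map act_h hs) = path_mat x hs"
  by (induction x hs rule: path_mat.induct) (auto simp: act_x_at)

lemma act_nilp_bound: "nilp_bound (act_v v) N (act_x x) \<longleftrightarrow> nilp_bound v N x"
proof -
  have eq: "(path_mat (act_x x) (map act_h hs) = 0\<^sub>m (act_v v (in_vertex (hd (map act_h hs))))
      (act_v v (out_vertex (last (map act_h hs))))) \<longleftrightarrow>
      (path_mat x hs = 0\<^sub>m (v (in_vertex (hd hs))) (v (out_vertex (last hs))))" if p: "is_path hs" for hs
  proof -
    have "hs \<noteq> []" "set hs \<subseteq> arrows Q" using p unfolding is_path_def by auto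
    then show ?thesis using is_path_ends(3,4)[OF p] by (simp add: act_path_mat act_v_at hd_map last_map)
  qed
  have sub: "set hs \<subseteq> arrows Q" if "is_path hs" for hs using that unfolding is_path_def by simp
  show ?thesis
  proof
    assume L: "nilp_bound (act_v v) N (act_x x)"
    show "nilp_bound v N x"
      unfolding nilp_bound_def
    proof (intro allI impI)
      fix hs assume hs: "is_path hs \<and> length hs = N"
      then have p: "is_path hs" by simp
      have "is_path (map act_h hs) \<and> length (map act_h hs) = N"
        using hs act_path[OF sub[OF p]] by simp
      from L[unfolded nilp_bound_def, THEN spec, THEN mp, OF this]
      show "path_mat x hs = 0\<^sub>m (v (in_vertex (hd hs))) (v (out_vertex (last hs)))" unfolding eq[OF p] .
    qed
  next
    assume R: "nilp_bound v N x"
    show "nilp_bound (act_v v) N (act_x x)"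
      unfolding nilp_bound_def
    proof (intro allI impI)
      fix ks assume ks: "is_path ks \<and> length ks = N"
      define hs where "hs = map (inv_into (arrows Q) act_h) ks"
      have im: "arrows Q = act_h ` arrows Q" using act_arrow_bij by (simp add: bij_betw_def)
      have "set ks \<subseteq> act_h ` arrows Q" using sub[OF conjunct1[OF ks]] im by simp
      then have hs: "set hs \<subseteq> arrows Q" "map act_h hs = ks" "length hs = N"
        unfolding hs_def using ks by (auto simp: subset_iff inv_into_into f_inv_into_f intro!: map_idI)
      have p: "is_path hs" using act_path[OF hs(1)] hs(2) ks by simp
      from R[unfolded nilp_bound_def, THEN spec, THEN mp, OF conjI[OF p hs(3)]]
      show "path_mat (act_x x) ks = 0\<^sub>m (act_v v (in_vertex (hd ks))) (act_v v (out_vertex (last ks)))"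
        unfolding eq[OF p, symmetric] hs(2) .
    qed
  qed
qed

lemma act_Lam_iff: "x \<in> reps Q v \<Longrightarrow> act_x x \<in> Lam Q \<Omega> (act_v v) \<longleftrightarrow> x \<in> Lam Q \<Omega> v"
proof -
  assume x: "x \<in> reps Q v"
  have "preprojective Q \<Omega> (act_v v) (act_x x) \<longleftrightarrow> (\<forall>i\<in>a ` verts Q. preproj_at (act_v v) i (act_x x))"
    unfolding preprojective_iff act_vertex(2) ..
  also have "\<dots> \<longleftrightarrow> preprojective Q \<Omega> v x" unfolding preprojective_iff using act_preproj_at by simp
  finally show ?thesis
    unfolding Lam_def using x act_reps[OF x] by (simp add: nilpotent_iff act_nilp_bound)
qed

lemma act_Lam: "act_x ` Lam Q \<Omega> v = Lam Q \<Omega> (act_v v)"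
proof (intro equalityI subsetI)
  fix y assume "y \<in> act_x ` Lam Q \<Omega> v"
  then show "y \<in> Lam Q \<Omega> (act_v v)" using act_Lam_iff Lam_reps by blast
next
  fix y assume y: "y \<in> Lam Q \<Omega> (act_v v)"
  note yr = Lam_reps[OF y]
  have "unact y \<in> Lam Q \<Omega> v" using act_Lam_iff[OF unact_reps[OF yr]] y act_unact[OF yr] by simp
  then show "y \<in> act_x ` Lam Q \<Omega> v" using act_unact[OF yr] by force
qed

lemma act_irreducible_components:
  assumes X: "X \<in> components v"
  shows "act_x ` X \<in> components (act_v v)"
proof -
  have XR: "X \<subseteq> reps Q v" using componentD(1)[OF X] Lam_reps by blast
  have "Z = act_x ` X" if Z: "Z \<subseteq> Lam Q \<Omega> (act_v v)" "irreducible_in (zariski Q (act_v v)) Z" "act_x ` X \<subseteq> Z" for Z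
  proof -
    have ZR: "Z \<subseteq> reps Q (act_v v)" using Z(1) Lam_reps by blast
    have "unact ` Z = X"
    proof (rule component_maximal[OF X])
      show "irreducible_in (zariski Q v) (unact ` Z)" by (rule rep_fun_irreducible[OF rep_fun_unact unact_reps Z(2)])
      show "X \<subseteq> unact ` Z" using image_mono[OF Z(3), of unact] unact_act_image[OF XR] by simp
      have "unact ` Z \<subseteq> unact ` act_x ` Lam Q \<Omega> v" unfolding act_Lam by (rule image_mono[OF Z(1)])
      moreover have "Lam Q \<Omega> v \<subseteq> reps Q v" using Lam_reps by blast
      ultimately show "unact ` Z \<subseteq> Lam Q \<Omega> v" using unact_act_image by metis
    qed
    then show ?thesis using act_unact_image[OF ZR] by metis
  qed
  moreover have "act_x ` X \<subseteq> Lam Q \<Omega> (act_v v)"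
    unfolding act_Lam[symmetric] by (rule image_mono[OF componentD(1)[OF X]])
  moreover have "irreducible_in (zariski Q (act_v v)) (act_x ` X)"
    by (rule rep_fun_irreducible[OF rep_fun_act act_reps componentD(2)[OF X]])
  ultimately show ?thesis unfolding irreducible_components_def by simp
qed

lemma act_incoming_image:
  assumes i: "i \<in> verts Q"
  shows "incoming_image Q (act_v v) (a i) (act_x x) = incoming_image Q v i x"
proof -
  let ?s = "inv_into (arrows_into Q i) act_h"
  have s: "?s (act_h h) = h" if "h \<in> arrows_into Q i" for h
    using that inv_into_f_f[OF act_arrow_inj_into] by simp
  have dim: "act_v v (out_vertex (act_h h)) = v (out_vertex h)" if "h \<in> arrows_into Q i" for h
    using arrows_intoD(4)[OF that] by (simp add: act_v_at)
  have sum: "(\<Sum>h\<in>arrows_into Q (a i). (act_x x h *\<^sub>v w h) $ r) =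
      (\<Sum>h\<in>arrows_into Q i. (x h *\<^sub>v w (act_h h)) $ r)" for w :: "('i, 'e) arrow \<Rightarrow> complex vec" and r
    unfolding act_arrows_into[OF i] sum.reindex[OF act_arrow_inj_into] comp_def
    by (intro sum.cong refl) (simp add: arrows_intoD(1) act_x_at)
  show ?thesis
  proof (intro equalityI subsetI)
    fix e assume "e \<in> incoming_image Q (act_v v) (a i) (act_x x)"
    then obtain w where w: "w \<in> (\<Pi>\<^sub>E h\<in>arrows_into Q (a i). carrier_vec (act_v v (out_vertex h)))"
      "e = vec (v i) (\<lambda>r. \<Sum>h\<in>arrows_into Q i. (x h *\<^sub>v w (act_h h)) $ r)"
      unfolding incoming_image_def act_v_at[OF i] sum by blast
    let ?w = "\<lambda>h\<in>arrows_into Q i. w (act_h h)"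
    have "?w \<in> (\<Pi>\<^sub>E h\<in>arrows_into Q i. carrier_vec (v (out_vertex h)))"
    proof (rule restrict_PiE_iff[THEN iffD2], rule ballI)
      fix h assume h: "h \<in> arrows_into Q i"
      then have "act_h h \<in> arrows_into Q (a i)" unfolding act_arrows_into[OF i] by simp
      then show "w (act_h h) \<in> carrier_vec (v (out_vertex h))" using PiE_mem[OF w(1)] dim[OF h] by metis
    qed
    moreover have "e = vec (v i) (\<lambda>r. \<Sum>h\<in>arrows_into Q i. (x h *\<^sub>v ?w h) $ r)" unfolding w(2) by simp
    ultimately show "e \<in> incoming_image Q v i x" unfolding incoming_image_def by blast
  next
    fix e assume "e \<in> incoming_image Q v i x"
    then obtain w where w: "w \<in> (\<Pi>\<^sub>E h\<in>arrows_into Q i. carrier_vec (v (out_vertex h)))"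
      "e = vec (v i) (\<lambda>r. \<Sum>h\<in>arrows_into Q i. (x h *\<^sub>v w h) $ r)"
      unfolding incoming_image_def by blast
    let ?w = "\<lambda>h\<in>arrows_into Q (a i). w (?s h)"
    have "?w \<in> (\<Pi>\<^sub>E h\<in>arrows_into Q (a i). carrier_vec (act_v v (out_vertex h)))"
    proof (rule restrict_PiE_iff[THEN iffD2], rule ballI)
      fix h assume "h \<in> arrows_into Q (a i)"
      then obtain k where k: "k \<in> arrows_into Q i" "h = act_h k" unfolding act_arrows_into[OF i] by blast
      show "w (?s h) \<in> carrier_vec (act_v v (out_vertex h))"
        unfolding k(2) s[OF k(1)] dim[OF k(1)] by (rule PiE_mem[OF w(1) k(1)])
    qed
    moreover have "e = vec (v i) (\<lambda>r. \<Sum>h\<in>arrows_into Q (a i). (act_x x h *\<^sub>v ?w h) $ r)"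
      unfolding w(2) sum using s act_arrows_into[OF i] by simp
    ultimately show "e \<in> incoming_image Q (act_v v) (a i) (act_x x)"
      unfolding incoming_image_def act_v_at[OF i] by blast
  qed
qed

lemma act_eps_rep: "i \<in> verts Q \<Longrightarrow> eps_rep Q (act_v v) (a i) (act_x x) = eps_rep Q v i x"
  unfolding eps_rep_def by (simp add: act_incoming_image act_v_at)

lemma act_eps:
  assumes i: "i \<in> verts Q" and X: "irreducible_in (zariski Q v) X"
  shows "eps Q (a i) (act_v v, act_x ` X) = eps Q i (v, X)"
proof -
  obtain x where x: "x \<in> X" "eps_rep Q v i x = eps Q i (v, X)" using eps_attained(1)[OF X] by blast
  show ?thesis
  proof (rule eps_eqI[OF rep_fun_irreducible[OF rep_fun_act act_reps X]])
    show "act_x x \<in> act_x ` X" "eps_rep Q (act_v v) (a i) (act_x x) = eps Q i (v, X)"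
      using x i by (auto simp: act_eps_rep)
    show "eps Q i (v, X) \<le> eps_rep Q (act_v v) (a i) y" if "y \<in> act_x ` X" for y
      using that i eps_attained(2)[OF X] by (auto simp: act_eps_rep)
  qed
qed

subsection \<open>Equivariance of the operators\<close>

lemma act_C_eq: "act_C (v, X) = (act_v v, act_x ` X)"
  by (simp add: act_component_def)

lemma act_C_B: "C \<in> B_infinity Q \<Omega> \<Longrightarrow> act_C C \<in> B_infinity Q \<Omega>"
proof (cases C)
  case (Pair v X)
  moreover have "act_v v \<in> dim_vectors Q" unfolding act_dim_def dim_vectors_def by simp
  moreover assume "C \<in> B_infinity Q \<Omega>"
  ultimately show ?thesis using act_irreducible_components by (simp add: act_C_eq B_infinity_iff)
qed

lemma act_C_eps: "i \<in> verts Q \<Longrightarrow> C \<in> B_infinity Q \<Omega> \<Longrightarrow> eps Q (a i) (act_C C) = eps Q i C"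
  by (cases C) (auto simp: act_C_eq B_infinity_iff act_eps componentD(2))

lemma act_restricts:
  assumes i: "i \<in> verts Q"
  shows "restricts (a i) \<phi> (act_x x) (act_x z) \<longleftrightarrow> restricts i \<phi> x z"
proof -
  let ?P = "\<lambda>j x z h. (in_vertex h = j \<longrightarrow> x h = \<phi> * z h) \<and> (out_vertex h = j \<longrightarrow> z h = x h * \<phi>) \<and>
     (in_vertex h \<noteq> j \<longrightarrow> out_vertex h \<noteq> j \<longrightarrow> x h = z h)"
  have "?P (a i) (act_x x) (act_x z) (act_h h) \<longleftrightarrow> ?P i x z h" if h: "h \<in> arrows Q" for h
    using vertex_eq_iff[OF arrowsD(1)[OF h] i] vertex_eq_iff[OF arrowsD(2)[OF h] i] h by (simp add: act_x_at)
  then have "(\<forall>h\<in>act_h ` arrows Q. ?P (a i) (act_x x) (act_x z) h) \<longleftrightarrow> (\<forall>h\<in>arrows Q. ?P i x z h)"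
    by simp
  then show ?thesis unfolding restricts_def bij_betw_imp_surj_on[OF act_arrow_bij] .
qed

lemma act_lifts:
  assumes i: "i \<in> verts Q" and U: "U \<subseteq> reps Q v1"
  shows "act_x ` lifts i v v1 U = lifts (a i) (act_v v) (act_v v1) (act_x ` U)"
proof (intro equalityI subsetI)
  fix y assume "y \<in> act_x ` lifts i v v1 U"
  then obtain x \<phi> P z where *: "y = act_x x" "x \<in> Lam Q \<Omega> v" "\<phi> \<in> carrier_mat (v i) (v1 i)"
    "P \<in> carrier_mat (v1 i) (v i)" "P * \<phi> = 1\<^sub>m (v1 i)" "z \<in> U" "restricts i \<phi> x z"
    unfolding lifts_def by blast
  have "act_x x \<in> Lam Q \<Omega> (act_v v)" using act_Lam *(2) by blast
  then show "y \<in> lifts (a i) (act_v v) (act_v v1) (act_x ` U)"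
    unfolding lifts_def *(1) act_v_at[OF i] using *(3-6) act_restricts[OF i] *(7) by blast
next
  fix y assume "y \<in> lifts (a i) (act_v v) (act_v v1) (act_x ` U)"
  then obtain \<phi> P z where *: "y \<in> Lam Q \<Omega> (act_v v)" "\<phi> \<in> carrier_mat (v i) (v1 i)"
    "P \<in> carrier_mat (v1 i) (v i)" "P * \<phi> = 1\<^sub>m (v1 i)" "z \<in> U" "restricts (a i) \<phi> y (act_x z)"
    unfolding lifts_def act_v_at[OF i] by blast
  obtain x where x: "x \<in> Lam Q \<Omega> v" "y = act_x x" using *(1) unfolding act_Lam[symmetric] by blast
  have "x \<in> lifts i v v1 U"
    unfolding lifts_def using x(1) *(2-5) *(6)[unfolded x(2) act_restricts[OF i]] by blast
  then show "y \<in> act_x ` lifts i v v1 U" using x(2) by blast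
qed

lemma act_add_root:
  assumes i: "i \<in> verts Q"
  shows "act_v (add_dim Q v (mult_root Q c i)) = add_dim Q (act_v v) (mult_root Q c (a i))"
proof (rule extensionalityI)
  fix k assume "k \<in> verts Q"
  then obtain j where j: "j \<in> verts Q" "k = a j" using vertex_cases by blast
  then show "act_v (add_dim Q v (mult_root Q c i)) k = add_dim Q (act_v v) (mult_root Q c (a i)) k"
    using i act_vertex(1)[OF j(1)] by (simp add: act_v_at add_dim_def mult_root_def vertex_eq_iff)
qed (auto simp: act_dim_def add_dim_def)

text \<open>Every ingredient of the closure of lifts is transported by the automorphism: the generic locus, the
relation between a representation and its restriction, and the Zariski closure.\<close>

lemma act_f_pow:
  assumes i: "i \<in> verts Q" and C: "C \<in> B_infinity_eps Q \<Omega> i 0"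
  shows "f_pow Q \<Omega> (a i) c (act_C C) = act_C (f_pow Q \<Omega> i c C)"
proof -
  obtain v1 X where XC: "C = (v1, X)" by (cases C)
  have X: "X \<in> components v1" "eps Q i (v1, X) = 0"
    using C unfolding XC B_eps_iff by (auto simp: B_infinity_iff)
  have X': "act_x ` X \<in> components (act_v v1)"
    "eps Q (a i) (act_v v1, act_x ` X) = 0"
    using act_irreducible_components[OF X(1)] act_eps[OF i componentD(2)[OF X(1)]] X(2) by auto
  define v where "v = add_dim Q v1 (mult_root Q c i)"
  have v': "act_v v = add_dim Q (act_v v1) (mult_root Q c (a i))" unfolding v_def by (rule act_add_root[OF i])
  note ai = act_vertex(1)[OF i]
  note r = add_root[OF i v_def] and r' = add_root[OF ai v']
  have str: "eps_stratum (act_v v1) (a i) (act_x ` X) = act_x ` eps_stratum v1 i X"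
    unfolding eps_stratum_def X(2) X'(2) using act_eps_rep[OF i] by auto
  have SR: "eps_stratum v1 i X \<subseteq> reps Q v1" using stratum(2)[OF i r(1,3) X] Lam_reps by blast
  have LR: "lifts i v v1 (eps_stratum v1 i X) \<subseteq> reps Q v" using Lam_reps unfolding lifts_def by blast
  have "lift_closure (a i) (act_v v) (act_v v1) (act_x ` X) = act_x ` lift_closure i v v1 X"
    unfolding lift_closure_def[OF ai r'(1,3)] lift_closure_def[OF i r(1,3)] str act_closure[OF LR]
      act_lifts[OF i SR] ..
  then show ?thesis
    unfolding XC act_C_eq f_pow_eq_lift_closure[OF i v_def X] f_pow_eq_lift_closure[OF ai v' X'] by simp
qed

lemma act_f_tilde:
  assumes i: "i \<in> verts Q" and C: "C \<in> B_infinity Q \<Omega>"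
  shows "f_tilde Q \<Omega> (a i) (act_C C) = act_C (f_tilde Q \<Omega> i C)"
proof -
  obtain D where D: "D \<in> B_infinity_eps Q \<Omega> i 0" "C = f_pow Q \<Omega> i (eps Q i C) D"
    by (rule f_pow_cases[OF i C])
  have D': "act_C D \<in> B_infinity_eps Q \<Omega> (a i) 0"
    using D(1) i by (simp add: B_eps_iff act_C_B act_C_eps)
  have "f_tilde Q \<Omega> (a i) (act_C (f_pow Q \<Omega> i c D)) = act_C (f_tilde Q \<Omega> i (f_pow Q \<Omega> i c D))" for c
    unfolding act_f_pow[OF i D(1), symmetric] f_tilde_f_pow[OF i D(1)] f_tilde_f_pow[OF act_vertex(1)[OF i] D'] ..
  then show ?thesis using D(2) by metis
qed

section \<open>Components generated from the highest weight component\<close>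

lemma zero_dim: "zero_dim Q \<in> dim_vectors Q" "total_dim (zero_dim Q) = 0"
  unfolding zero_dim_def dim_vectors_def total_dim_zero by auto

text \<open>The only representation on the zero space is the zero representation.\<close>

lemma components_zero_dim:
  "components (zero_dim Q) = {Lam Q \<Omega> (zero_dim Q)}"
proof -
  let ?v = "zero_dim Q"
  have z: "?v j = 0" if "j \<in> verts Q" for j using that by (simp add: zero_dim_def)
  define x :: "('i, 'e) rep" where "x = (\<lambda>h\<in>arrows Q. 0\<^sub>m 0 0)"
  have xr: "x \<in> reps Q ?v" by (rule repsI) (auto simp: x_def z arrowsD(1,2))
  have "nilp_bound ?v 1 x"
    unfolding nilp_bound_def
  proof (intro allI impI)
    fix hs assume "is_path hs \<and> length hs = 1"
    then obtain h where h: "hs = [h]" "h \<in> arrows Q" unfolding is_path_def by (auto simp: length_Suc_conv)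
    then show "path_mat x hs = 0\<^sub>m (?v (in_vertex (hd hs))) (?v (out_vertex (last hs)))"
      using arrowsD(1,2)[OF h(2)] by (simp add: x_def z)
  qed
  then have xL: "x \<in> Lam Q \<Omega> ?v" unfolding Lam_def nilpotent_iff preprojective_def using xr z by auto
  have L: "Lam Q \<Omega> ?v = {x}" using xL reps_zero[OF zero_dim(2) _ xr] Lam_reps by blast
  have irr: "irreducible_in (zariski Q ?v) {x}" unfolding irreducible_zariski using xr by auto
  show ?thesis
    unfolding L
  proof (intro equalityI subsetI)
    fix X assume "X \<in> irreducible_components (zariski Q ?v) {x}"
    then show "X \<in> {{x}}" using componentD(1,3) by blast
  next
    fix X assume "X \<in> {{x}}"
    then show "X \<in> irreducible_components (zariski Q ?v) {x}" unfolding irreducible_components_def using irr by auto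
  qed
qed

lemma X_infinity: "X_infinity Q \<Omega> = (zero_dim Q, Lam Q \<Omega> (zero_dim Q))"
  unfolding X_infinity_def components_zero_dim by simp

lemma X_infinity_B: "X_infinity Q \<Omega> \<in> B_infinity Q \<Omega>"
  unfolding X_infinity B_infinity_iff using zero_dim(1) components_zero_dim by simp

lemma X_infinity_invariant: "act_C (X_infinity Q \<Omega>) = X_infinity Q \<Omega>"
proof -
  have "act_v (zero_dim Q) = zero_dim Q"
  proof (rule extensionalityI)
    fix k assume k: "k \<in> verts Q"
    then obtain j where "j \<in> verts Q" "k = a j" using vertex_cases by blast
    then show "act_v (zero_dim Q) k = zero_dim Q k" using k by (simp add: act_v_at) (simp add: zero_dim_def)
  qed (auto simp: act_dim_def zero_dim_def)
  then show ?thesis unfolding X_infinity act_C_eq act_Lam by simp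
qed

lemma X_infinity_unique:
  assumes C: "C \<in> B_infinity Q \<Omega>" and d: "total_dim (fst C) = 0"
  shows "C = X_infinity Q \<Omega>"
proof -
  obtain v X where X: "C = (v, X)" by (cases C)
  have v: "v \<in> dim_vectors Q" "X \<in> components v"
    using C unfolding X B_infinity_iff by auto
  have "v = zero_dim Q"
  proof (rule extensionalityI)
    show "v \<in> extensional (verts Q)" using v(1) unfolding dim_vectors_def by (simp add: PiE_iff)
  qed (use d in \<open>auto simp: X zero_dim_def total_dim_zero\<close>)
  then show ?thesis using v(2) components_zero_dim unfolding X X_infinity by simp
qed

subsection \<open>Products of operators over an orbit\<close>

text \<open>Outside the set of components \<^const>\<open>f_tilde\<close> takes irrelevant values, and the operators need
  not commute there. Cutting them off makes the general theory of folds applicable.\<close>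

definition f_cut :: "'i \<Rightarrow> ('i, 'e) component \<Rightarrow> ('i, 'e) component" where
  "f_cut i C = (if C \<in> B_infinity Q \<Omega> then f_tilde Q \<Omega> i C else C)"

lemma orbit_subset:
  assumes "i \<in> verts Q" shows "(a ^^ k) i \<in> verts Q"
  by (induction k) (use assms act_vertex(1) in auto)

context
  fixes orb assumes orb: "orb \<in> vertex_orbits Q a"
begin

lemma orb_verts: "orb \<subseteq> verts Q"
  using orb orbit_subset unfolding vertex_orbits_def by auto

lemma finite_orb: "finite orb"
  using orb_verts finite_verts by (rule finite_subset)

lemma act_orb: "a ` orb = orb"
proof (rule endo_inj_surj[OF finite_orb])
  obtain i where i: "orb = range (\<lambda>k. (a ^^ k) i)" using orb unfolding vertex_orbits_def by blast
  have "a ((a ^^ k) i) = (a ^^ Suc k) i" for k by simp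
  then show "a ` orb \<subseteq> orb" unfolding i by blast
  show "inj_on a orb" by (rule inj_on_subset[OF act_vertex(3) orb_verts])
qed

lemma orb_unjoined:
  assumes "i \<in> orb" "j \<in> orb" "i \<noteq> j"
  shows "unjoined i j"
  unfolding unjoined_def
proof (intro conjI ballI notI)
  fix h assume h: "h \<in> arrows Q" "in_vertex h = i \<and> out_vertex h = j"
  obtain e k l where e: "h = (e, k, l)" "e \<in> edges Q" "ends Q e = {k, l}" using h(1) unfolding arrows_def by blast
  then have "ends Q e \<subseteq> orb" using h(2) assms by auto
  then show False using e(2) orb admissible unfolding admissible_automorphism_def by blast
qed (use assms in simp)

lemma f_cut_commute: "Finite_Set.comp_fun_commute_on orb f_cut"
proof
  fix i j assume ij: "i \<in> orb" "j \<in> orb"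
  show "f_cut j \<circ> f_cut i = f_cut i \<circ> f_cut j"
  proof (cases "i = j")
    case False
    have v: "i \<in> verts Q" "j \<in> verts Q" using ij orb_verts by auto
    show ?thesis
    proof
      fix C
      show "(f_cut j \<circ> f_cut i) C = (f_cut i \<circ> f_cut j) C"
        using f_tilde_commute(1)[OF v orb_unjoined[OF ij False]] f_tilde_B(1)[OF v(1)] f_tilde_B(1)[OF v(2)]
        by (simp add: f_cut_def)
    qed
  qed simp
qed

lemma fold_f_cut_insert:
  assumes "insert i A \<subseteq> orb" "i \<notin> A"
  shows "Finite_Set.fold f_cut C (insert i A) = f_cut i (Finite_Set.fold f_cut C A)"
  by (rule Finite_Set.comp_fun_commute_on.fold_insert[OF f_cut_commute])
    (use assms finite_subset[OF _ finite_orb] in auto)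

lemma fold_f_cut_B:
  assumes "C \<in> B_infinity Q \<Omega>" "finite A" "A \<subseteq> orb"
  shows "Finite_Set.fold f_cut C A \<in> B_infinity Q \<Omega>"
  using assms(2,3)
proof (induction A rule: finite_induct)
  case (insert i A)
  have "i \<in> verts Q" using insert.prems orb_verts by auto
  then show ?case
    unfolding fold_f_cut_insert[OF insert.prems insert.hyps(2)] f_cut_def[of i]
    using insert.IH insert.prems f_tilde_B(1) by simp
qed (use assms(1) in simp)

lemma fold_f_cut_Suc:
  assumes C: "C \<in> B_infinity Q \<Omega>" and A: "finite A" "insert i A \<subseteq> orb" "i \<notin> A"
  shows "Finite_Set.fold f_cut C (insert i A) = f_tilde Q \<Omega> i (Finite_Set.fold f_cut C A)"
  unfolding fold_f_cut_insert[OF A(2,3)] using fold_f_cut_B[OF C A(1)] A(2) by (simp add: f_cut_def)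

lemma f_tilde_orbit_eq_fold:
  assumes C: "C \<in> B_infinity Q \<Omega>"
  shows "f_tilde_orbit Q \<Omega> orb C = Finite_Set.fold f_cut C orb"
  unfolding f_tilde_orbit_def
proof (rule fold_closed_eq[where B = "B_infinity Q \<Omega>"])
  fix i D assume "i \<in> orb" "D \<in> B_infinity Q \<Omega>"
  then show "f_tilde Q \<Omega> i D = f_cut i D" "f_cut i D \<in> B_infinity Q \<Omega>"
    using f_tilde_B(1)[of i D] orb_verts by (auto simp: f_cut_def)
qed (rule C)

lemma act_fold_f_cut:
  assumes C: "C \<in> B_infinity Q \<Omega>" and A: "finite A" "A \<subseteq> orb"
  shows "Finite_Set.fold f_cut (act_C C) (a ` A) = act_C (Finite_Set.fold f_cut C A)"
  using A
proof (induction A rule: finite_induct)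
  case (insert i A)
  have i: "i \<in> verts Q" and A: "A \<subseteq> orb" using insert.prems orb_verts by auto
  have im: "insert (a i) (a ` A) \<subseteq> orb" using insert.prems act_orb by blast
  have "a i \<notin> a ` A"
    using insert.hyps(2) vertex_eq_iff[OF i] A orb_verts by (metis imageE subsetD)
  then have "Finite_Set.fold f_cut (act_C C) (a ` insert i A) =
      f_tilde Q \<Omega> (a i) (Finite_Set.fold f_cut (act_C C) (a ` A))"
    using fold_f_cut_Suc[OF act_C_B[OF C] finite_imageI[OF insert.hyps(1)] im] by simp
  also have "\<dots> = act_C (f_tilde Q \<Omega> i (Finite_Set.fold f_cut C A))"
    unfolding insert.IH[OF A] by (rule act_f_tilde[OF i fold_f_cut_B[OF C insert.hyps(1) A]])
  finally show ?case unfolding fold_f_cut_Suc[OF C insert.hyps(1) insert.prems insert.hyps(2)] .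
qed simp

lemma fold_f_cut_inj:
  assumes C: "C \<in> B_infinity Q \<Omega>" "D \<in> B_infinity Q \<Omega>" and A: "finite A" "A \<subseteq> orb"
    and eq: "Finite_Set.fold f_cut C A = Finite_Set.fold f_cut D A"
  shows "C = D"
  using A eq
proof (induction A rule: finite_induct)
  case (insert i A)
  have i: "i \<in> verts Q" and A: "A \<subseteq> orb" using insert.prems(1) orb_verts by auto
  note B = fold_f_cut_B[OF C(1) insert.hyps(1) A] fold_f_cut_B[OF C(2) insert.hyps(1) A]
  have "Finite_Set.fold f_cut C A = Finite_Set.fold f_cut D A"
    by (rule f_tilde_inj[OF i B])
      (use insert.prems(2) fold_f_cut_Suc[OF C(1) insert.hyps(1) insert.prems(1) insert.hyps(2)]
        fold_f_cut_Suc[OF C(2) insert.hyps(1) insert.prems(1) insert.hyps(2)] in simp)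
  then show ?case by (rule insert.IH[OF A])
qed simp

text \<open>Removing the operator at one vertex of the orbit leaves the values \<open>\<epsilon>\<^sub>j\<close> at the remaining ones
unchanged, so they stay positive and can be removed in turn.\<close>

lemma fold_f_cut_surj:
  assumes A: "finite A" "A \<subseteq> orb" and C: "C \<in> B_infinity Q \<Omega>" "\<And>i. i \<in> A \<Longrightarrow> 0 < eps Q i C"
  shows "\<exists>D\<in>B_infinity Q \<Omega>. Finite_Set.fold f_cut D A = C \<and> total_dim (fst C) = total_dim (fst D) + card A"
  using A C
proof (induction A arbitrary: C rule: finite_induct)
  case empty
  then show ?case by auto
next
  case (insert i A)
  have i: "i \<in> verts Q" "i \<in> orb" and A: "A \<subseteq> orb" using insert.prems(1) orb_verts by auto
  obtain C' where C': "C' \<in> B_infinity Q \<Omega>" "f_tilde Q \<Omega> i C' = C"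
    using f_tilde_surj[OF i(1) insert.prems(2) insert.prems(3)[OF insertI1]] by blast
  have "0 < eps Q j C'" if j: "j \<in> A" for j
  proof -
    have jo: "j \<in> orb" "j \<in> verts Q" "i \<noteq> j" using j A orb_verts insert.hyps(2) by auto
    have "eps Q j C = eps Q j C'"
      using f_tilde_commute(2)[OF i(1) jo(2) orb_unjoined[OF i(2) jo(1,3)] C'(1)] C'(2) by simp
    then show ?thesis using insert.prems(3)[of j] j by simp
  qed
  from insert.IH[OF A C'(1) this] obtain D where D: "D \<in> B_infinity Q \<Omega>" "Finite_Set.fold f_cut D A = C'"
    "total_dim (fst C') = total_dim (fst D) + card A" by blast
  have "Finite_Set.fold f_cut D (insert i A) = C"
    unfolding fold_f_cut_Suc[OF D(1) insert.hyps(1) insert.prems(1) insert.hyps(2)] D(2) C'(2) ..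
  moreover have "total_dim (fst C) = total_dim (fst D) + card (insert i A)"
    using total_dim_f_tilde[OF i(1) C'(1)] C'(2) D(3) insert.hyps by simp
  ultimately show ?case using D(1) by blast
qed

end

lemma eps_on_orbit:
  assumes C: "C \<in> B_infinity Q \<Omega>" "act_C C = C" and i: "i \<in> verts Q"
  shows "eps Q ((a ^^ k) i) C = eps Q i C"
proof (induction k)
  case (Suc k)
  have "eps Q (a ((a ^^ k) i)) (act_C C) = eps Q ((a ^^ k) i) C"
    by (rule act_C_eps[OF orbit_subset[OF i] C(1)])
  then show ?case using Suc C(2) by simp
qed simp

lemma B_Gamma_invariant:
  assumes "C \<in> B_Gamma Q \<Omega> a"
  shows "C \<in> B_infinity Q \<Omega> \<and> act_C C = C"
  using assms
proof (induction rule: B_Gamma.induct)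
  case highest
  show ?case using X_infinity_B X_infinity_invariant by simp
next
  case (step C orb)
  then have C: "C \<in> B_infinity Q \<Omega>" "act_C C = C" and orb: "orb \<in> vertex_orbits Q a" by auto
  show ?case
    unfolding f_tilde_orbit_eq_fold[OF orb C(1)]
    using fold_f_cut_B[OF orb C(1) finite_orb[OF orb] subset_refl]
      act_fold_f_cut[OF orb C(1) finite_orb[OF orb] subset_refl] C(2) act_orb[OF orb] by simp
qed

text \<open>A positive \<open>\<epsilon>\<^sub>i\<close> is positive on the whole orbit, so the component is an orbit product applied to
some \<open>D\<close>. Applying the automorphism shows that the same product maps its translate to the same component;
by injectivity \<open>D\<close> is invariant.\<close>

lemma invariant_B_Gamma:
  assumes "C \<in> B_infinity Q \<Omega>" "act_C C = C"
  shows "C \<in> B_Gamma Q \<Omega> a"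
  using assms
proof (induction "total_dim (fst C)" arbitrary: C rule: less_induct)
  case less
  note C = less.prems
  show ?case
  proof (cases "total_dim (fst C) = 0")
    case True
    show ?thesis unfolding X_infinity_unique[OF C(1) True] by (rule B_Gamma.highest)
  next
    case False
    obtain v X where X: "C = (v, X)" by (cases C)
    have "X \<in> components v" using C(1) unfolding X B_infinity_iff by simp
    from irreducible_eps_positive[OF componentD(2,1)[OF this]] False
    obtain i where i: "i \<in> verts Q" "0 < eps Q i C" unfolding X by auto
    define orb where "orb = range (\<lambda>k. (a ^^ k) i)"
    have orb: "orb \<in> vertex_orbits Q a" unfolding orb_def vertex_orbits_def using i(1) by blast
    have pos: "0 < eps Q j C" if "j \<in> orb" for j using that eps_on_orbit[OF C i(1)] i(2) unfolding orb_def by auto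
    from fold_f_cut_surj[OF orb finite_orb[OF orb] subset_refl C(1) pos]
    obtain D where D: "D \<in> B_infinity Q \<Omega>" "Finite_Set.fold f_cut D orb = C"
      "total_dim (fst C) = total_dim (fst D) + card orb" by blast
    have "card orb > 0" using finite_orb[OF orb] unfolding orb_def by (simp add: card_gt_0_iff)
    then have less: "total_dim (fst D) < total_dim (fst C)" using D(3) by simp
    have "Finite_Set.fold f_cut (act_C D) orb = Finite_Set.fold f_cut D orb"
      using act_fold_f_cut[OF orb D(1) finite_orb[OF orb] subset_refl] act_orb[OF orb] D(2) C(2) by simp
    then have "act_C D = D"
      by (rule fold_f_cut_inj[OF orb act_C_B[OF D(1)] D(1) finite_orb[OF orb] subset_refl])
    then have "D \<in> B_Gamma Q \<Omega> a" by (rule less.hyps[OF less D(1)])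
    then have "f_tilde_orbit Q \<Omega> orb D \<in> B_Gamma Q \<Omega> a" by (rule B_Gamma.step[OF _ orb])
    then show ?thesis unfolding f_tilde_orbit_eq_fold[OF orb D(1)] D(2) .
  qed
qed

end

theorem proposition6p1:
  fixes Q :: "('i, 'e) graph"
    and a :: "'i \<Rightarrow> 'i" and b :: "'e \<Rightarrow> 'e"
    and \<Omega> :: "('i, 'e) arrow set"
  assumes "graph Q"
    and "admissible_automorphism Q a b"
    and "orientation Q \<Omega>"
    and "act_arrow a b ` \<Omega> = \<Omega>"
  shows "B_Gamma Q \<Omega> a = {C \<in> B_infinity Q \<Omega>. act_component Q a b C = C}"
proof -
  interpret quiver_automorphism Q \<Omega> a b
    by unfold_locales (rule assms)+
  show ?thesis using B_Gamma_invariant invariant_B_Gamma by blast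
qed

end
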